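(* Let $\Omega\subset\mathbb{R}^d$ be a bounded Lipschitz domain and let $\Phi:\mathbb{R}^d\to\mathbb{R}$ be a continuous strictly positive definite kernel such that, for some $\sigma>d/2$ and constants $0<c_\Phi\le C_\Phi<\infty$, $$c_\Phi(1+\|\omega\|_2^2)^{-\sigma}\le\widehat\Phi(\omega)\le C_\Phi(1+\|\omega\|_2^2)^{-\sigma},\qquad \omega\in\mathbb{R}^d.$$ Assume that $0\le\alpha\le\tau\le\sigma$ and fix $c_0>0$. Then there exists a constant $C>0$, depending only on $c_0,\alpha,\tau,\sigma,d,\Phi,\Omega$ (in particular independent of $\delta$ and $X$), such that for every $0<\delta\le 1$, every finite set $X\subset\overline\Omega$ satisfying $q_X\le c_0\delta$, and every $v\in V_{\Phi_\delta,X}$, $$\|v\|_{H_\delta^\tau(\Omega)}\le C\left(\frac{\delta}{q_X}\right)^{\tau-\alpha}\|v\|_{H_\delta^\alpha(\Omega)}.$$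
   Context: The Fourier transform is $\widehat f(\omega)=(2\pi)^{-d/2}\int_{\mathbb{R}^d}f(x)e^{-ix^T\omega}\,dx$, extended to $L^2(\mathbb{R}^d)$ in the usual way; $\Phi$ is integrable so that $\widehat\Phi$ is given by this integral. $\|\cdot\|_2$ is the Euclidean norm on $\mathbb{R}^d$. For $0<\delta\le1$, the scaled kernel is $\Phi_\delta(x)=\delta^{-d}\Phi(x/\delta)$. For a finite set $X=\{x_1,\dots,x_N\}$ of (at least two) distinct points, the separation distance is $q_X=\frac12\min_{j\ne k}\|x_j-x_k\|_2$, and $V_{\Phi_\delta,X}=\operatorname{span}\{\Phi_\delta(\cdot-x_j):x_j\in X\}$. For $s\ge0$, the scaled Sobolev space $H_\delta^s(\mathbb{R}^d)$ consists of all $w\in L^2(\mathbb{R}^d)$ with finite norm $$\|w\|_{H_\delta^s(\mathbb{R}^d)}^2=(2\pi)^{-d/2}\int_{\mathbb{R}^d}(1+\delta^2\|\omega\|_2^2)^s|\widehat w(\omega)|^2\,d\omega.$$ The space $H_\delta^s(\Omega)=\{w|_\Omega: w\in H_\delta^s(\mathbb{R}^d)\}$ carries the quotient norm $\|v\|_{H_\delta^s(\Omega)}=\inf\{\|w\|_{H_\delta^s(\mathbb{R}^d)}: w\in H_\delta^s(\mathbb{R}^d),\ w|_\Omega=v\}$. For $v\in V_{\Phi_\delta,X}$, norms over $\Omega$ are those of the restriction $v|_\Omega$. *)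

theory Defs
  imports "HOL-Analysis.Analysis"
begin

definition fourier :: "('a::euclidean_space \<Rightarrow> complex) \<Rightarrow> 'a \<Rightarrow> complex" where
  "fourier f \<omega> = of_real ((2 * pi) powr (- real DIM('a) / 2)) *
     (LINT x|lborel. f x * exp (- \<i> * of_real (x \<bullet> \<omega>)))"

definition square_integrable :: "('a::euclidean_space \<Rightarrow> complex) \<Rightarrow> bool" where
  "square_integrable f \<longleftrightarrow>
     f \<in> borel_measurable lborel \<and> integrable lborel (\<lambda>x. (cmod (f x))\<^sup>2)"

text \<open>
  Extension of the Fourier transform to square-integrable functions, by continuity from the
  functions that are both integrable and square integrable. The distances are taken in
  \<^typ>\<open>ennreal\<close>, since the Bochner integral of a non-integrable function is 0.
\<close>

definition has_fourier_L2 ::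
    "('a::euclidean_space \<Rightarrow> complex) \<Rightarrow> ('a \<Rightarrow> complex) \<Rightarrow> bool" where
  "has_fourier_L2 f g \<longleftrightarrow> square_integrable g \<and>
     (\<exists>u :: nat \<Rightarrow> 'a \<Rightarrow> complex.
        (\<forall>n. integrable lborel (u n) \<and> square_integrable (u n)) \<and>
        (\<lambda>n. \<integral>\<^sup>+x. ennreal ((cmod (u n x - f x))\<^sup>2) \<partial>lborel) \<longlonglongrightarrow> 0 \<and>
        (\<lambda>n. \<integral>\<^sup>+\<omega>. ennreal ((cmod (fourier (u n) \<omega> - g \<omega>))\<^sup>2) \<partial>lborel) \<longlonglongrightarrow> 0)"

text \<open>
  For square-integrable \<open>f\<close>, such a \<open>g\<close> exists and is unique up to a null set (Plancherel); the
  integrals below do not depend on the representative.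
\<close>

definition fourier_L2 :: "('a::euclidean_space \<Rightarrow> complex) \<Rightarrow> 'a \<Rightarrow> complex" where
  "fourier_L2 f = (SOME g. has_fourier_L2 f g)"

definition scaled_sobolev_space :: "real \<Rightarrow> real \<Rightarrow> ('a::euclidean_space \<Rightarrow> complex) set" where
  "scaled_sobolev_space \<delta> s = {w. square_integrable w \<and>
     integrable lborel (\<lambda>\<omega>. (1 + \<delta>\<^sup>2 * (norm \<omega>)\<^sup>2) powr s * (cmod (fourier_L2 w \<omega>))\<^sup>2)}"

definition scaled_sobolev_norm :: "real \<Rightarrow> real \<Rightarrow> ('a::euclidean_space \<Rightarrow> complex) \<Rightarrow> real" where
  "scaled_sobolev_norm \<delta> s w = sqrt ((2 * pi) powr (- real DIM('a) / 2) *
     (LINT \<omega>|lborel. (1 + \<delta>\<^sup>2 * (norm \<omega>)\<^sup>2) powr s * (cmod (fourier_L2 w \<omega>))\<^sup>2))"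

text \<open>
  Elements of the Sobolev spaces are classes modulo null sets, so \<open>w\<close> restricts to \<open>v\<close> on \<open>\<Omega>\<close> if
  the two agree almost everywhere there. The value is meaningful only if \<open>v\<close> has an extension in
  \<^term>\<open>scaled_sobolev_space \<delta> s\<close>.
\<close>

definition scaled_sobolev_norm_on ::
    "'a::euclidean_space set \<Rightarrow> real \<Rightarrow> real \<Rightarrow> ('a \<Rightarrow> complex) \<Rightarrow> real" where
  "scaled_sobolev_norm_on \<Omega> \<delta> s v =
     Inf {scaled_sobolev_norm \<delta> s w | w.
            w \<in> scaled_sobolev_space \<delta> s \<and> (AE x in lborel. x \<in> \<Omega> \<longrightarrow> w x = v x)}"

text \<open>
  Near each boundary point, after choosing a direction \<open>e\<close> as the last coordinate axis, \<open>\<Omega>\<close> is the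
  region above the graph of a Lipschitz function \<open>\<gamma>\<close> on the hyperplane orthogonal to \<open>e\<close>.
\<close>

definition bounded_lipschitz_domain :: "'a::euclidean_space set \<Rightarrow> bool" where
  "bounded_lipschitz_domain \<Omega> \<longleftrightarrow>
     open \<Omega> \<and> connected \<Omega> \<and> \<Omega> \<noteq> {} \<and> bounded \<Omega> \<and>
     (\<forall>p \<in> frontier \<Omega>. \<exists>r > 0. \<exists>e. norm e = 1 \<and>
        (\<exists>\<gamma> L. L-lipschitz_on {y. y \<bullet> e = 0} \<gamma> \<and>
           \<Omega> \<inter> ball p r = {x \<in> ball p r. \<gamma> (x - (x \<bullet> e) *\<^sub>R e) < x \<bullet> e}))"

definition strictly_positive_definite :: "('a::euclidean_space \<Rightarrow> real) \<Rightarrow> bool" where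
  "strictly_positive_definite \<Phi> \<longleftrightarrow>
     (\<forall>X a. finite X \<and> (\<exists>x\<in>X. a x \<noteq> 0) \<longrightarrow>
        0 < (\<Sum>x\<in>X. \<Sum>y\<in>X. a x * a y * \<Phi> (x - y)))"

definition scaled_kernel :: "('a::euclidean_space \<Rightarrow> real) \<Rightarrow> real \<Rightarrow> 'a \<Rightarrow> real" where
  "scaled_kernel \<Phi> \<delta> x = \<Phi> (x /\<^sub>R \<delta>) / \<delta> ^ DIM('a)"

definition separation_distance :: "'a::euclidean_space set \<Rightarrow> real" where
  "separation_distance X = Min {norm (x - y) | x y. x \<in> X \<and> y \<in> X \<and> x \<noteq> y} / 2"

text \<open>The span, with complex coefficients, of the translates of a real-valued \<open>\<Psi>\<close>.\<close>

definition translate_span :: "('a::euclidean_space \<Rightarrow> real) \<Rightarrow> 'a set \<Rightarrow> ('a \<Rightarrow> complex) set" where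
  "translate_span \<Psi> X = {\<lambda>x. \<Sum>y\<in>X. a y * of_real (\<Psi> (x - y)) | a. True}"

end

theory Submission
  imports Defs "HOL-Probability.Characteristic_Functions"
begin

text \<open>
  An element of the span is \<open>v = \<Sum>\<^sub>y a y * \<Phi>\<^sub>\<delta> (x - y)\<close>; its transform is \<open>P \<omega> * \<Phi>hat (\<delta> \<omega>)\<close> with the
  exponential sum \<open>P \<omega> = \<Sum>\<^sub>y a y * exp (- i y \<bullet> \<omega>)\<close>. Put \<open>W\<^sub>s \<omega> = (1 + \<delta>\<^sup>2 |\<omega>|\<^sup>2)\<^sup>s\<close>. By the two-sided
  bound on the transform of \<open>\<Phi>\<close>, the energy \<open>E = \<integral> W\<^sub>-\<^sub>\<sigma> |P|\<^sup>2\<close> is comparable to the square of the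
  norm of \<open>v\<close> of order \<open>\<sigma>\<close> over the whole space. Let \<open>u\<close> be any function of order \<open>\<alpha>\<close>
  that agrees with \<open>v\<close> on \<open>\<Omega>\<close>, let \<open>B\<close> be its norm and \<open>q\<close> the separation distance. The theorem
  is the infimum over \<open>u\<close> of the second of the following two statements.

  \<^item> \<open>energy_estimate\<close>: \<open>E \<le> K (\<delta>/q)\<^bsup>2(\<sigma> - \<alpha>)\<^esup> B\<^sup>2\<close>.

  \<^item> \<open>extension_exists\<close>: some \<open>w\<close> of order \<open>\<tau>\<close> agrees with \<open>v\<close> on \<open>\<Omega>\<close> and has norm at most
    \<open>K (\<delta>/q)\<^bsup>\<tau> - \<alpha>\<^esup> B\<close>.

  Both use smoothing operators that read a function only inside \<open>\<Omega>\<close>. The closure of a Lipschitz domain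
  is covered by finitely many pieces \<open>A\<^sub>i\<close> such that for \<open>x\<close> in the closure and near \<open>A\<^sub>i\<close> the cone
  of the points \<open>x + r (e\<^sub>i + s\<^sub>i z)\<close>, \<open>0 < r < t\<close>, \<open>|z| \<le> 1\<close>, lies in \<open>\<Omega>\<close> (\<open>cone_cover\<close>). For a
  mollifier \<open>\<rho>\<close> on the unit ball, put
  \<open>T\<^sub>i f x = \<Sum>\<^sub>1\<^sub>\<le>\<^sub>l\<^sub>\<le>\<^sub>k (-1)\<^bsup>l+1\<^esup> (k choose l) \<integral> \<rho> z f (x + h l (e\<^sub>i + s\<^sub>i z)) dz\<close>. At such a point \<open>T\<^sub>i u x\<close> and \<open>T\<^sub>i v x\<close>
  are equal. On the Fourier side \<open>T\<^sub>i\<close> multiplies by \<open>\<mu>\<^sub>i (h \<omega>)\<close>, where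
  \<open>1 - \<mu>\<^sub>i \<omega> = \<integral> \<rho> z (1 - exp (i (e\<^sub>i + s\<^sub>i z) \<bullet> \<omega>))\<^sup>k dz\<close>. So \<open>\<mu>\<^sub>i\<close> decays at infinity because \<open>\<rho>\<close> is smooth,
  and \<open>1 - \<mu>\<^sub>i\<close> vanishes to order \<open>k \<ge> \<sigma>\<close> at the origin (\<open>cone_multiplier_bounds\<close>): the operator gains
  \<open>r\<close> orders of smoothness at the price \<open>(\<delta>/h)\<^sup>r\<close>, and its error gains \<open>(h/\<delta>)\<^sup>r\<close> for \<open>r\<close> orders.

  For the energy estimate, a smooth partition of unity \<open>\<zeta>\<^sub>i\<close> subordinate to the pieces splits
  \<open>P\<close> into the sums \<open>P\<^sub>i\<close> with coefficients \<open>\<zeta>\<^sub>i y * a y\<close>, and, \<open>V\<close> being the transform of \<open>v\<close>,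
  \<open>c E \<le> \<integral> V cnj P = \<Sum>\<^sub>i \<integral> V (1 - \<mu>\<^sub>i (h \<omega>)) cnj P\<^sub>i + \<Sum>\<^sub>i \<integral> V \<mu>\<^sub>i (h \<omega>) cnj P\<^sub>i\<close>.
  Each integral of the last sum is a pairing of \<open>v\<close> with a function supported in \<open>\<Omega>\<close>. Hence \<open>V\<close> may be replaced there
  by the transform of \<open>u\<close>, and Cauchy-Schwarz bounds the integral by a multiple of
  \<open>(\<delta>/h)\<^bsup>\<sigma> - \<alpha>\<^esup> B E\<^bsup>1/2\<^esup>\<close>. For the other sum the separation of the points enters: on an \<open>h\<close>-separated
  set the integral of \<open>|P|\<^sup>2\<close> against \<open>(1 + h\<^sup>2 |\<omega>|\<^sup>2)\<^bsup>-\<sigma>\<^esup>\<close> is comparable to \<open>h\<^bsup>-d\<^esup> \<Sum>\<^sub>y |a y|\<^sup>2\<close>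
  (\<open>exp_sum_lower\<close>, \<open>exp_sum_upper\<close>). Using the lower bound at the scale \<open>q\<close> and the upper bound at the
  scale \<open>h = \<epsilon> q\<close>, that sum is at most a multiple of \<open>\<epsilon>\<^bsup>\<sigma> - d/2\<^esup> E\<close>; a small \<open>\<epsilon>\<close> absorbs it on
  the left. This is where \<open>\<sigma> > d/2\<close> is decisive.

  The extension is \<open>w = \<Sum>\<^sub>i \<zeta>\<^sub>i (T\<^sub>i u + v - T\<^sub>i v)\<close>. On \<open>\<Omega>\<close> it equals \<open>\<Sum>\<^sub>i \<zeta>\<^sub>i v = v\<close>. The norm
  of \<open>T\<^sub>i u\<close> of order \<open>\<tau>\<close> costs \<open>(\<delta>/h)\<^bsup>\<tau> - \<alpha>\<^esup> B\<close>, the norm of \<open>v - T\<^sub>i v\<close> costs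
  \<open>(h/\<delta>)\<^bsup>\<sigma> - \<tau>\<^esup> E\<^bsup>1/2\<^esup>\<close>, which the energy estimate turns into \<open>(\<delta>/q)\<^bsup>\<tau> - \<alpha>\<^esup> B\<close>, and multiplication by \<open>\<zeta>\<^sub>i\<close>
  is bounded in every norm that occurs, by Young's and Peetre's inequalities.
\<close>

section \<open>Integrals of products, dilations and the Gaussian\<close>

text \<open>
  The dimension is a property of the type, which is therefore the only argument.
\<close>

definition fourier_factor :: "'a::euclidean_space itself \<Rightarrow> real" where
  "fourier_factor _ = (2 * pi) powr (- real DIM('a) / 2)"

lemma fourier_factor_pos [simp]: "0 < fourier_factor TYPE('a::euclidean_space)"
  by (simp add: fourier_factor_def)

lemma fourier_factor_nonneg [simp]: "0 \<le> fourier_factor TYPE('a::euclidean_space)"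
  by (simp add: less_imp_le)

lemma fourier_factor_neq_0 [simp]: "fourier_factor TYPE('a::euclidean_space) \<noteq> 0"
  using fourier_factor_pos[where 'a='a] by linarith

lemma fourier_cis:
  "fourier f \<omega> = of_real (fourier_factor TYPE('a)) * (LINT x|lborel. f x * cis (- (x \<bullet> \<omega>)))"
  for f :: "'a::euclidean_space \<Rightarrow> complex"
  by (simp add: fourier_def fourier_factor_def cis_conv_exp)

lemma borel_measurable_cis [measurable]: "cis \<in> borel_measurable borel"
  by (intro borel_measurable_continuous_onI continuous_intros)

lemma borel_measurable_cnj [measurable]: "cnj \<in> borel_measurable borel"
  by (intro borel_measurable_continuous_onI continuous_intros)

lemma integrable_mult_bounded:
  fixes f k :: "'a \<Rightarrow> complex"
  assumes "integrable M f" and [measurable]: "k \<in> borel_measurable M" and "\<And>x. cmod (k x) \<le> B"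
  shows "integrable M (\<lambda>x. f x * k x)"
proof (rule Bochner_Integration.integrable_bound)
  show "integrable M (\<lambda>x. of_real B * f x)" using assms(1) by simp
  show "(\<lambda>x. f x * k x) \<in> borel_measurable M" using assms(1) by measurable
  have "cmod (f x * k x) \<le> cmod (of_real B * f x)" for x
    using mult_left_mono[OF order_trans[OF assms(3)[of x] abs_ge_self], of "cmod (f x)"]
    by (simp add: norm_mult mult.commute)
  then show "AE x in M. cmod (f x * k x) \<le> cmod (of_real B * f x)" by simp
qed

lemma integrable_kernel:
  fixes f :: "'a::euclidean_space \<Rightarrow> complex" and g :: "'b::euclidean_space \<Rightarrow> complex"
  assumes f: "integrable lborel f" and g: "integrable lborel g"
    and [measurable]: "case_prod k \<in> borel_measurable (borel \<Otimes>\<^sub>M borel)" and B: "\<And>x y. cmod (k x y) \<le> B"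
  shows "integrable (lborel \<Otimes>\<^sub>M lborel) (\<lambda>(x, y). f x * (g y * k x y))"
proof (rule lborel_pair.Fubini_integrable)
  note [measurable] = borel_measurable_integrable[OF f] borel_measurable_integrable[OF g]
  show "(\<lambda>(x, y). f x * (g y * k x y)) \<in> borel_measurable (lborel \<Otimes>\<^sub>M lborel)"
    by measurable
  have gk: "integrable lborel (\<lambda>y. g y * k x y)" for x
    by (rule integrable_mult_bounded[OF g _ B]) measurable
  then show "AE x in lborel. integrable lborel (\<lambda>y. case (x, y) of (x, y) \<Rightarrow> f x * (g y * k x y))"
    by auto
  show "integrable lborel (\<lambda>x. LINT y|lborel. cmod (case (x, y) of (x, y) \<Rightarrow> f x * (g y * k x y)))"
  proof (rule Bochner_Integration.integrable_bound)
    show "integrable lborel (\<lambda>x. (B * (LINT y|lborel. cmod (g y))) * cmod (f x))"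
      using f by simp
    show "(\<lambda>x. LINT y|lborel. cmod (case (x, y) of (x, y) \<Rightarrow> f x * (g y * k x y))) \<in> borel_measurable lborel"
      by measurable
    have "(LINT y|lborel. cmod (f x * (g y * k x y))) \<le> \<bar>B * (LINT y|lborel. cmod (g y))\<bar> * cmod (f x)" for x
    proof -
      have "(LINT y|lborel. cmod (f x * (g y * k x y))) \<le> (LINT y|lborel. (cmod (f x) * B) * cmod (g y))"
      proof (rule integral_mono)
        show "integrable lborel (\<lambda>y. cmod (f x * (g y * k x y)))"
          by (intro integrable_norm integrable_mult_right gk)
        show "integrable lborel (\<lambda>y. (cmod (f x) * B) * cmod (g y))"
          by (intro integrable_norm integrable_mult_right g)
        show "cmod (f x * (g y * k x y)) \<le> (cmod (f x) * B) * cmod (g y)" for y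
          using mult_left_mono[OF B[of x y], of "cmod (f x) * cmod (g y)"] by (simp add: norm_mult mult_ac)
      qed
      also have "\<dots> = B * (LINT y|lborel. cmod (g y)) * cmod (f x)" by simp
      also have "\<dots> \<le> \<bar>B * (LINT y|lborel. cmod (g y))\<bar> * cmod (f x)" by (intro mult_right_mono) auto
      finally show ?thesis .
    qed
    then show "AE x in lborel. norm (LINT y|lborel. cmod (case (x, y) of (x, y) \<Rightarrow> f x * (g y * k x y)))
        \<le> norm ((B * (LINT y|lborel. cmod (g y))) * cmod (f x))"
      by (auto simp: abs_mult)
  qed
qed

text \<open>
  Every exchange of integrals between the space side and the Fourier side is an instance:
  the kernel is a character \<open>cis (x \<bullet> y)\<close>, bounded by one.
\<close>

lemma Fubini_kernel:
  fixes f :: "'a::euclidean_space \<Rightarrow> complex" and g :: "'b::euclidean_space \<Rightarrow> complex"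
  assumes f: "integrable lborel f" and g: "integrable lborel g"
    and k: "case_prod k \<in> borel_measurable (borel \<Otimes>\<^sub>M borel)" and B: "\<And>x y. cmod (k x y) \<le> B"
  shows "(LINT x|lborel. f x * (LINT y|lborel. g y * k x y)) = (LINT y|lborel. g y * (LINT x|lborel. f x * k x y))"
proof -
  have "(LINT x|lborel. f x * (LINT y|lborel. g y * k x y)) = (LINT x|lborel. LINT y|lborel. f x * (g y * k x y))"
    by (simp only: integral_mult_right_zero)
  also have "\<dots> = (LINT y|lborel. LINT x|lborel. f x * (g y * k x y))"
    by (rule lborel_pair.Fubini_integral[OF integrable_kernel[OF assms], symmetric])
  also have "\<dots> = (LINT y|lborel. g y * (LINT x|lborel. f x * k x y))"
    by (simp only: mult.left_commute[of "f _" "g _"] integral_mult_right_zero)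
  finally show ?thesis .
qed

lemma nn_integral_affine:
  fixes f :: "'a::euclidean_space \<Rightarrow> ennreal"
  assumes [measurable]: "f \<in> borel_measurable borel" and "c \<noteq> 0"
  shows "(\<integral>\<^sup>+x. f x \<partial>lborel) = ennreal (\<bar>c\<bar> ^ DIM('a)) * (\<integral>\<^sup>+x. f (t + c *\<^sub>R x) \<partial>lborel)"
  by (subst lborel_affine[OF \<open>c \<noteq> 0\<close>, of t]) (simp add: nn_integral_density nn_integral_distr nn_integral_cmult)

lemma
  fixes f :: "'a::euclidean_space \<Rightarrow> 'b::{banach, second_countable_topology}"
  assumes f: "integrable lborel f" and "c \<noteq> 0"
  shows integrable_affine: "integrable lborel (\<lambda>x. f (t + c *\<^sub>R x))"
    and integral_affine: "(LINT x|lborel. f x) = \<bar>c\<bar> ^ DIM('a) *\<^sub>R (LINT x|lborel. f (t + c *\<^sub>R x))"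
proof -
  note [measurable] = borel_measurable_integrable[OF f]
  have "integrable (density (distr lborel borel (\<lambda>x. t + c *\<^sub>R x)) (\<lambda>_. ennreal (\<bar>c\<bar> ^ DIM('a)))) f"
    using f by (simp only: lborel_affine[OF \<open>c \<noteq> 0\<close>, of t, symmetric])
  then have "integrable lborel (\<lambda>x. \<bar>c\<bar> ^ DIM('a) *\<^sub>R f (t + c *\<^sub>R x))"
    by (simp add: integrable_density integrable_distr_eq)
  then show "integrable lborel (\<lambda>x. f (t + c *\<^sub>R x))"
    using \<open>c \<noteq> 0\<close> integrable_scaleR_right[of "1 / \<bar>c\<bar> ^ DIM('a)" lborel "\<lambda>x. \<bar>c\<bar> ^ DIM('a) *\<^sub>R f (t + c *\<^sub>R x)"]
    by simp
  show "(LINT x|lborel. f x) = \<bar>c\<bar> ^ DIM('a) *\<^sub>R (LINT x|lborel. f (t + c *\<^sub>R x))"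
    by (subst lborel_affine[OF \<open>c \<noteq> 0\<close>, of t]) (simp add: integral_density integral_distr ennreal_power)
qed

lemma integrable_affine_iff:
  fixes f :: "'a::euclidean_space \<Rightarrow> 'b::{banach, second_countable_topology}"
  assumes "c \<noteq> 0"
  shows "integrable lborel (\<lambda>x. f (t + c *\<^sub>R x)) \<longleftrightarrow> integrable lborel f"
proof
  assume "integrable lborel (\<lambda>x. f (t + c *\<^sub>R x))"
  from integrable_affine[OF this, of "1/c" "- t /\<^sub>R c"] assms
  show "integrable lborel f" by (simp add: algebra_simps divide_inverse)
qed (rule integrable_affine[OF _ assms])

lemma integral_affine':
  fixes f :: "'a::euclidean_space \<Rightarrow> 'b::{banach, second_countable_topology}"
  assumes "c \<noteq> 0"
  shows "(LINT x|lborel. f (t + c *\<^sub>R x)) = (1 / \<bar>c\<bar> ^ DIM('a)) *\<^sub>R (LINT x|lborel. f x)"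
proof (cases "integrable lborel f")
  case True
  from integral_affine[OF this assms, of t] assms show ?thesis by simp
next
  case False
  then show ?thesis using integrable_affine_iff[OF assms, of f t] by (simp add: not_integrable_integral_eq)
qed

lemma
  fixes f :: "'a::euclidean_space \<Rightarrow> real \<Rightarrow> complex"
  assumes f: "\<And>b. b \<in> Basis \<Longrightarrow> integrable lborel (f b)"
  shows integrable_lborel_tensor: "integrable lborel (\<lambda>x::'a. \<Prod>b\<in>Basis. f b (x \<bullet> b))"
    and integral_lborel_tensor: "(LINT x|lborel. (\<Prod>b\<in>Basis. f b (x \<bullet> b))) = (\<Prod>b\<in>Basis. LINT t|lborel. f b t)"
proof -
  interpret product_sigma_finite "\<lambda>_::'a. lborel :: real measure" by standard
  note [measurable] = borel_measurable_integrable[OF f]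
  have m: "(\<lambda>x::'a. \<Prod>b\<in>Basis. f b (x \<bullet> b)) \<in> borel_measurable borel"
    by (intro borel_measurable_prod) (use f in measurable)
  have m2: "(\<lambda>f. \<Sum>b\<in>Basis. f b *\<^sub>R b) \<in> measurable (\<Pi>\<^sub>M b\<in>(Basis::'a set). lborel) (borel :: 'a measure)"
    by measurable
  have "integrable (\<Pi>\<^sub>M b\<in>(Basis::'a set). lborel) (\<lambda>x. \<Prod>b\<in>Basis. f b (x b))"
    by (rule product_integrable_prod) (use f in auto)
  then show "integrable lborel (\<lambda>x::'a. \<Prod>b\<in>Basis. f b (x \<bullet> b))"
    unfolding lborel_eq[where 'a='a] by (subst integrable_distr_eq[OF m2 m]) simp
  show "(LINT x|lborel. (\<Prod>b\<in>Basis. f b (x \<bullet> b))) = (\<Prod>b\<in>Basis. LINT t|lborel. f b t)"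
    unfolding lborel_eq[where 'a='a]
    apply (subst integral_distr[OF m2 m])
    using product_integral_prod[of Basis f] f by simp
qed

definition gauss :: "'a::euclidean_space \<Rightarrow> real" where
  "gauss x = exp (- (norm x)\<^sup>2 / 2)"

lemma gauss_pos: "0 < gauss x" and gauss_nonneg [simp]: "0 \<le> gauss x" and gauss_le_1: "gauss x \<le> 1"
  and gauss_0 [simp]: "gauss 0 = 1" and gauss_minus [simp]: "gauss (- x) = gauss x"
  by (auto simp: gauss_def)

lemma continuous_on_gauss [continuous_intros]:
  "continuous_on A f \<Longrightarrow> continuous_on A (\<lambda>x. gauss (f x))"
  unfolding gauss_def by (intro continuous_intros) auto

lemma borel_measurable_gauss [measurable]: "gauss \<in> borel_measurable borel"
  by (intro borel_measurable_continuous_onI continuous_intros)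

text \<open>
  The one-dimensional transform is the characteristic function of the standard normal distribution.
\<close>

lemma gauss_1D:
  "integrable lborel (\<lambda>t::real. complex_of_real (exp (- t\<^sup>2 / 2)) * cis (t * s))"
  "(LINT t|lborel. complex_of_real (exp (- t\<^sup>2 / 2)) * cis (t * s)) = of_real (sqrt (2 * pi) * exp (- s\<^sup>2 / 2))"
proof -
  have i: "integrable lborel (\<lambda>t::real. exp (- t\<^sup>2 / 2))"
    using integrable_mult_right[OF integrable_std_normal_moment[of 0], of "sqrt (2 * pi)"]
    by (simp add: std_normal_density_def)
  have "integrable lborel (\<lambda>t::real. complex_of_real (exp (- t\<^sup>2 / 2)))"
    using i by (rule integrable_of_real)
  then show 1: "integrable lborel (\<lambda>t::real. complex_of_real (exp (- t\<^sup>2 / 2)) * cis (t * s))"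
    by (rule integrable_mult_bounded[where B=1]) auto
  have "char std_normal_distribution s = (LINT t|std_normal_distribution. cis (s * t))"
    by (simp add: char_def cis_conv_exp)
  also have "\<dots> = (LINT t|lborel. std_normal_density t *\<^sub>R cis (s * t))"
    by (rule integral_density) (auto simp: normal_density_nonneg)
  also have "\<dots> = (LINT t|lborel. of_real (1 / sqrt (2 * pi)) * (complex_of_real (exp (- t\<^sup>2 / 2)) * cis (t * s)))"
    by (simp add: std_normal_density_def scaleR_conv_of_real mult_ac)
  also have "\<dots> = of_real (1 / sqrt (2 * pi)) * (LINT t|lborel. complex_of_real (exp (- t\<^sup>2 / 2)) * cis (t * s))"
    by simp
  finally show "(LINT t|lborel. complex_of_real (exp (- t\<^sup>2 / 2)) * cis (t * s)) = of_real (sqrt (2 * pi) * exp (- s\<^sup>2 / 2))"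
    by (simp add: char_std_normal_distribution field_simps)
qed

text \<open>
  The Gaussian and the character both factor over the coordinates, so that its transform is a product of one-dimensional ones.
\<close>

lemma gauss_tensor:
  "complex_of_real (gauss x) * cis (x \<bullet> y) = (\<Prod>b\<in>Basis. complex_of_real (exp (- (x \<bullet> b)\<^sup>2 / 2)) * cis ((x \<bullet> b) * (y \<bullet> b)))"
  for x y :: "'a::euclidean_space"
proof -
  have "(norm x)\<^sup>2 = (\<Sum>b\<in>Basis. (x \<bullet> b)\<^sup>2)"
    using euclidean_inner[of x x] by (simp add: power2_norm_eq_inner) (simp add: power2_eq_square)
  then have "gauss x = (\<Prod>b\<in>Basis. exp (- (x \<bullet> b)\<^sup>2 / 2))"
    unfolding gauss_def by (simp add: exp_sum[symmetric] sum_negf sum_divide_distrib)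
  moreover have "cis (x \<bullet> y) = (\<Prod>b\<in>Basis. cis ((x \<bullet> b) * (y \<bullet> b)))"
    by (simp add: cis_conv_exp euclidean_inner[of x y] exp_sum[symmetric] sum_distrib_left)
  ultimately show ?thesis by (simp add: prod.distrib)
qed

lemma fourier_factor_inverse: "sqrt (2 * pi) ^ DIM('a::euclidean_space) = 1 / fourier_factor TYPE('a)"
proof -
  have "sqrt (2 * pi) ^ DIM('a) = (2 * pi) powr (real DIM('a) / 2)"
    by (simp add: powr_half_sqrt[symmetric] powr_realpow[symmetric] powr_powr)
  then show ?thesis by (simp add: fourier_factor_def powr_minus field_simps)
qed

lemma integrable_gauss_cis:
  "integrable lborel (\<lambda>x::'a::euclidean_space. complex_of_real (gauss x) * cis (x \<bullet> y))"
  unfolding gauss_tensor by (rule integrable_lborel_tensor) (rule gauss_1D)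

lemma integral_gauss_cis:
  "(LINT x|lborel. complex_of_real (gauss (x::'a::euclidean_space)) * cis (x \<bullet> y)) = of_real (gauss y / fourier_factor TYPE('a))"
proof -
  have "(LINT x|lborel. complex_of_real (gauss (x::'a)) * cis (x \<bullet> y)) =
    (\<Prod>b\<in>Basis. of_real (sqrt (2 * pi)) * (of_real (exp (- (y \<bullet> b)\<^sup>2 / 2)) * cis ((y \<bullet> b) * (0 \<bullet> b))))"
    unfolding gauss_tensor integral_lborel_tensor[OF gauss_1D(1)] by (simp add: gauss_1D(2)[simplified])
  also have "\<dots> = of_real (sqrt (2 * pi) ^ DIM('a)) * (of_real (gauss y) * cis (y \<bullet> 0))"
    unfolding gauss_tensor by (simp add: prod.distrib)
  finally show ?thesis unfolding fourier_factor_inverse by simp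
qed

lemma integrable_gauss: "integrable lborel (gauss :: 'a::euclidean_space \<Rightarrow> real)"
  using integrable_Re[OF integrable_gauss_cis[of "0::'a"]] by simp

lemma integral_gauss: "(LINT x|lborel. gauss (x::'a::euclidean_space)) = 1 / fourier_factor TYPE('a)"
proof -
  have "complex_of_real (LINT x|lborel. gauss (x::'a)) = of_real (1 / fourier_factor TYPE('a))"
    using integral_gauss_cis[of "0::'a"] by simp
  then show ?thesis unfolding of_real_eq_iff .
qed

lemma integrable_gauss_scale: "\<epsilon> \<noteq> 0 \<Longrightarrow> integrable lborel (\<lambda>x::'a::euclidean_space. gauss (\<epsilon> *\<^sub>R x))"
  using integrable_affine[OF integrable_gauss, of \<epsilon> 0] by simp

section \<open>The Fourier transform of integrable functions\<close>

lemma cmod_fourier_le: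
  fixes f :: "'a::euclidean_space \<Rightarrow> complex"
  shows "cmod (fourier f \<omega>) \<le> fourier_factor TYPE('a) * (LINT x|lborel. cmod (f x))"
proof -
  have "cmod (LINT x|lborel. f x * cis (- (x \<bullet> \<omega>))) \<le> (LINT x|lborel. cmod (f x * cis (- (x \<bullet> \<omega>))))"
    by (rule integral_norm_bound)
  then show ?thesis
    by (simp add: fourier_cis norm_mult)
qed

lemma borel_measurable_fourier [measurable]:
  fixes f :: "'a::euclidean_space \<Rightarrow> complex"
  assumes [measurable]: "f \<in> borel_measurable borel"
  shows "fourier f \<in> borel_measurable borel"
  unfolding fourier_cis[abs_def] by measurable

lemma integrable_mult_cis:
  fixes f :: "'a::euclidean_space \<Rightarrow> complex"
  assumes "integrable lborel f" and [measurable]: "g \<in> borel_measurable borel"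
  shows "integrable lborel (\<lambda>x. f x * cis (g x))"
  by (rule integrable_mult_bounded[OF assms(1), where B=1]) auto

lemma fourier_diff:
  fixes f :: "'a::euclidean_space \<Rightarrow> complex"
  assumes "integrable lborel f" "integrable lborel g"
  shows "fourier (\<lambda>x. f x - g x) \<omega> = fourier f \<omega> - fourier g \<omega>"
  using assms by (simp add: fourier_cis left_diff_distrib integrable_mult_cis right_diff_distrib)

lemma fourier_add:
  fixes f :: "'a::euclidean_space \<Rightarrow> complex"
  assumes "integrable lborel f" "integrable lborel g"
  shows "fourier (\<lambda>x. f x + g x) \<omega> = fourier f \<omega> + fourier g \<omega>"
  using assms by (simp add: fourier_cis distrib_right integrable_mult_cis distrib_left)

lemma fourier_sum_cmult:
  fixes f :: "'i \<Rightarrow> 'a::euclidean_space \<Rightarrow> complex"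
  assumes "\<And>i. i \<in> I \<Longrightarrow> integrable lborel (f i)"
  shows "fourier (\<lambda>x. \<Sum>i\<in>I. a i * f i x) \<omega> = (\<Sum>i\<in>I. a i * fourier (f i) \<omega>)"
proof -
  have "(LINT x|lborel. (\<Sum>i\<in>I. a i * f i x) * cis (- (x \<bullet> \<omega>))) = (LINT x|lborel. (\<Sum>i\<in>I. a i * (f i x * cis (- (x \<bullet> \<omega>)))))"
    by (simp add: sum_distrib_right mult.assoc)
  also have "\<dots> = (\<Sum>i\<in>I. a i * (LINT x|lborel. f i x * cis (- (x \<bullet> \<omega>))))"
    using assms by (simp add: integrable_mult_cis)
  finally show ?thesis by (simp add: fourier_cis sum_distrib_left mult.left_commute)
qed

lemma integral_gauss_scaled_cis:
  fixes y :: "'a::euclidean_space"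
  assumes "0 < \<epsilon>"
  shows "(LINT \<omega>|lborel. complex_of_real (gauss (\<epsilon> *\<^sub>R \<omega>)) * cis (\<omega> \<bullet> y)) =
    of_real (gauss (y /\<^sub>R \<epsilon>) / (\<epsilon> ^ DIM('a) * fourier_factor TYPE('a)))"
proof -
  have "(LINT \<omega>|lborel. complex_of_real (gauss (\<epsilon> *\<^sub>R \<omega>)) * cis (\<omega> \<bullet> y)) =
    (LINT \<omega>|lborel. (\<lambda>\<omega>. complex_of_real (gauss \<omega>) * cis (\<omega> \<bullet> (y /\<^sub>R \<epsilon>))) (0 + \<epsilon> *\<^sub>R \<omega>))"
    using assms by (simp add: mult.assoc[symmetric])
  also have "\<dots> = (1 / \<epsilon> ^ DIM('a)) *\<^sub>R of_real (gauss (y /\<^sub>R \<epsilon>) / fourier_factor TYPE('a))"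
    using assms by (subst integral_affine') (simp_all add: integral_gauss_cis del: inner_scaleR_right)
  finally show ?thesis by (simp add: scaleR_conv_of_real)
qed

text \<open>
  Cutting off a transform by a wide Gaussian and inverting it averages the function against a narrow Gaussian;
  the parameter is the width of the average. Inversion and Bessel's inequality both follow as it tends to zero.
\<close>

lemma gauss_smoothing:
  fixes f :: "'a::euclidean_space \<Rightarrow> complex"
  assumes f: "integrable lborel f" and "0 < \<epsilon>"
  shows "(LINT \<omega>|lborel. (fourier f \<omega> * of_real (gauss (\<epsilon> *\<^sub>R \<omega>))) * cis (x \<bullet> \<omega>)) = (LINT z|lborel. of_real (gauss z) * f (x + \<epsilon> *\<^sub>R z))"
proof -
  note [measurable] = borel_measurable_integrable[OF f]
  let ?\<kappa> = "complex_of_real (fourier_factor TYPE('a))"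
  let ?G = "\<lambda>\<omega>::'a. complex_of_real (gauss (\<epsilon> *\<^sub>R \<omega>))"
  have G: "integrable lborel ?G"
    using integrable_gauss_scale[of \<epsilon>] assms(2) by (intro integrable_of_real) simp
  have "(LINT \<omega>|lborel. (fourier f \<omega> * ?G \<omega>) * cis (x \<bullet> \<omega>)) = (LINT \<omega>|lborel. ?\<kappa> * (?G \<omega> * (LINT y|lborel. f y * cis ((x - y) \<bullet> \<omega>))))"
  proof (rule Bochner_Integration.integral_cong[OF refl])
    fix \<omega> :: 'a
    have "(LINT y|lborel. f y * cis ((x - y) \<bullet> \<omega>)) = (LINT y|lborel. cis (x \<bullet> \<omega>) * (f y * cis (- (y \<bullet> \<omega>))))"
      by (simp add: inner_diff_left cis_divide[symmetric] cis_mult mult.left_commute)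
    also have "\<dots> = cis (x \<bullet> \<omega>) * (LINT y|lborel. f y * cis (- (y \<bullet> \<omega>)))" by (rule integral_mult_right_zero)
    finally show "(fourier f \<omega> * ?G \<omega>) * cis (x \<bullet> \<omega>) = ?\<kappa> * (?G \<omega> * (LINT y|lborel. f y * cis ((x - y) \<bullet> \<omega>)))"
      by (simp add: fourier_cis mult_ac)
  qed
  also have "\<dots> = ?\<kappa> * (LINT \<omega>|lborel. ?G \<omega> * (LINT y|lborel. f y * cis ((x - y) \<bullet> \<omega>)))"
    by (rule integral_mult_right_zero)
  also have "(LINT \<omega>|lborel. ?G \<omega> * (LINT y|lborel. f y * cis ((x - y) \<bullet> \<omega>))) = (LINT y|lborel. f y * (LINT \<omega>|lborel. ?G \<omega> * cis ((x - y) \<bullet> \<omega>)))"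
    by (rule Fubini_kernel[OF G f, where B=1]) auto
  also have "\<dots> = (LINT y|lborel. f y * of_real (gauss ((x - y) /\<^sub>R \<epsilon>) / (\<epsilon> ^ DIM('a) * fourier_factor TYPE('a))))"
    by (subst inner_commute) (simp only: integral_gauss_scaled_cis[OF assms(2)])
  also have "\<dots> = \<epsilon> ^ DIM('a) *\<^sub>R (LINT z|lborel. f (x + \<epsilon> *\<^sub>R z) * of_real (gauss ((x - (x + \<epsilon> *\<^sub>R z)) /\<^sub>R \<epsilon>) / (\<epsilon> ^ DIM('a) * fourier_factor TYPE('a))))"
  proof -
    have "integrable lborel (\<lambda>y. f y * complex_of_real (gauss ((x - y) /\<^sub>R \<epsilon>) / (\<epsilon> ^ DIM('a) * fourier_factor TYPE('a))))"
      by (rule integrable_mult_bounded[OF f, where B="1 / (\<epsilon> ^ DIM('a) * fourier_factor TYPE('a))"])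
        (use assms(2) in \<open>auto simp: norm_mult norm_divide gauss_le_1 norm_power divide_simps\<close>)
    from integral_affine[OF this, of \<epsilon> x] assms(2) show ?thesis by simp
  qed
  also have "\<dots> = (LINT z|lborel. (1 / ?\<kappa>) * (of_real (gauss z) * f (x + \<epsilon> *\<^sub>R z)))"
    unfolding integral_scaleR_right[symmetric] using assms(2)
    by (intro Bochner_Integration.integral_cong refl) (simp add: scaleR_conv_of_real)
  also have "\<dots> = (1 / ?\<kappa>) * (LINT z|lborel. of_real (gauss z) * f (x + \<epsilon> *\<^sub>R z))"
    by (rule integral_mult_right_zero)
  finally show ?thesis by simp
qed

text \<open>
  Let the width in \<open>gauss_smoothing\<close> tend to zero: the left side is dominated by the integrable
  transform, the right side by a multiple of the Gaussian, since the function is bounded.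
\<close>

lemma fourier_inversion_bounded:
  fixes f :: "'a::euclidean_space \<Rightarrow> complex"
  assumes f: "integrable lborel f" and F: "integrable lborel (fourier f)"
    and cont: "continuous_on UNIV f" and B: "\<And>x. cmod (f x) \<le> B"
  shows "f x = of_real (fourier_factor TYPE('a)) * (LINT \<omega>|lborel. fourier f \<omega> * cis (x \<bullet> \<omega>))"
proof -
  define e where "e n = inverse (real (Suc n))" for n
  have e: "e \<longlonglongrightarrow> 0" "0 < e n" for n
    unfolding e_def using LIMSEQ_inverse_real_of_nat by auto
  note [measurable] = borel_measurable_integrable[OF f] borel_measurable_integrable[OF F]
  have "B \<ge> 0" using B[of 0] norm_ge_zero order_trans by blast
  have lim_gauss: "(\<lambda>n. gauss (e n *\<^sub>R \<omega>)) \<longlonglongrightarrow> 1" for \<omega> :: 'a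
  proof -
    have "(\<lambda>n. gauss (e n *\<^sub>R \<omega>)) \<longlonglongrightarrow> gauss (0 *\<^sub>R \<omega>)"
      unfolding gauss_def by (intro tendsto_intros e) auto
    then show ?thesis by simp
  qed
  have 1: "(\<lambda>n. LINT \<omega>|lborel. (fourier f \<omega> * of_real (gauss (e n *\<^sub>R \<omega>))) * cis (x \<bullet> \<omega>)) \<longlonglongrightarrow> (LINT \<omega>|lborel. (fourier f \<omega> * of_real 1) * cis (x \<bullet> \<omega>))"
  proof (rule integral_dominated_convergence[where w="\<lambda>\<omega>. cmod (fourier f \<omega>)"])
    show "AE \<omega> in lborel. (\<lambda>n. (fourier f \<omega> * of_real (gauss (e n *\<^sub>R \<omega>))) * cis (x \<bullet> \<omega>)) \<longlonglongrightarrow> (fourier f \<omega> * of_real 1) * cis (x \<bullet> \<omega>)"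
      by (intro always_eventually allI tendsto_intros lim_gauss)
    show "AE \<omega> in lborel. cmod (fourier f \<omega> * of_real (gauss (e n *\<^sub>R \<omega>)) * cis (x \<bullet> \<omega>)) \<le> cmod (fourier f \<omega>)" for n
      by (intro always_eventually allI) (simp add: norm_mult mult_left_le gauss_le_1)
    show "integrable lborel (\<lambda>\<omega>. cmod (fourier f \<omega>))" using F by (rule integrable_norm)
  qed measurable
  have 2: "(\<lambda>n. LINT z|lborel. of_real (gauss z) * f (x + e n *\<^sub>R z)) \<longlonglongrightarrow> (LINT z|lborel. of_real (gauss (z::'a)) * f x)"
  proof (rule integral_dominated_convergence[where w="\<lambda>z::'a. gauss z * B"])
    have "(\<lambda>n. x + e n *\<^sub>R z) \<longlonglongrightarrow> x + 0 *\<^sub>R z" for z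
      by (intro tendsto_intros e)
    then have "(\<lambda>n. f (x + e n *\<^sub>R z)) \<longlonglongrightarrow> f (x + 0 *\<^sub>R z)" for z
      by (rule continuous_on_tendsto_compose[OF cont]) auto
    then show "AE z in lborel. (\<lambda>n. of_real (gauss z) * f (x + e n *\<^sub>R z)) \<longlonglongrightarrow> of_real (gauss z) * f x"
      by (intro always_eventually allI tendsto_intros) simp
    show "AE z in lborel. cmod (of_real (gauss z) * f (x + e n *\<^sub>R z)) \<le> gauss z * B" for n
      by (intro always_eventually allI) (simp add: norm_mult mult_left_mono B)
    show "integrable lborel (\<lambda>z::'a. gauss z * B)" by (intro integrable_mult_left integrable_gauss)
  qed measurable
  have "(LINT \<omega>|lborel. fourier f \<omega> * cis (x \<bullet> \<omega>)) = (LINT z|lborel. complex_of_real (gauss (z::'a)) * f x)"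
    using LIMSEQ_unique[OF 1 2[folded gauss_smoothing[OF f e(2)]]] by simp
  also have "\<dots> = f x / of_real (fourier_factor TYPE('a))"
    using integral_gauss[where 'a='a] integrable_gauss[where 'a='a] by (simp add: integral_mult_left_zero)
  finally show ?thesis by simp
qed

text \<open>
  Values in \<^typ>\<open>ennreal\<close> make the estimates free of integrability conditions; finiteness is
  concluded at the end.
\<close>

definition weighted_sq :: "('a::euclidean_space \<Rightarrow> real) \<Rightarrow> ('a \<Rightarrow> complex) \<Rightarrow> ennreal" where
  "weighted_sq W f = (\<integral>\<^sup>+x. ennreal (W x * (cmod (f x))\<^sup>2) \<partial>lborel)"

abbreviation "L2_sq f \<equiv> weighted_sq (\<lambda>_. 1) f"

lemma square_integrable_iff:
  "square_integrable f \<longleftrightarrow> f \<in> borel_measurable borel \<and> L2_sq f < \<infinity>"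
  unfolding square_integrable_def weighted_sq_def integrable_iff_bounded by auto

lemma square_integrableD [measurable_dest]: "square_integrable f \<Longrightarrow> f \<in> borel_measurable borel"
  by (simp add: square_integrable_def)

lemma has_fourier_L2_iff:
  "has_fourier_L2 f g \<longleftrightarrow> square_integrable g \<and>
     (\<exists>u. (\<forall>n. integrable lborel (u n) \<and> square_integrable (u n)) \<and>
        (\<lambda>n. L2_sq (\<lambda>x. u n x - f x)) \<longlonglongrightarrow> 0 \<and>
        (\<lambda>n. L2_sq (\<lambda>\<omega>. fourier (u n) \<omega> - g \<omega>)) \<longlonglongrightarrow> 0)"
  by (simp add: has_fourier_L2_def weighted_sq_def)

lemma norm_sum_sq_le: "(norm (a + b))\<^sup>2 \<le> 2 * (norm a)\<^sup>2 + 2 * (norm b)\<^sup>2"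
  for a b :: "'a::real_normed_vector"
proof -
  have "(norm (a + b))\<^sup>2 \<le> (norm a + norm b)\<^sup>2" by (intro power_mono norm_triangle_ineq) auto
  also have "\<dots> \<le> 2 * (norm a)\<^sup>2 + 2 * (norm b)\<^sup>2"
    using sum_squares_bound[of "norm a" "norm b"] by (simp add: power2_sum)
  finally show ?thesis .
qed

lemma weighted_sq_add:
  fixes f g :: "'a::euclidean_space \<Rightarrow> complex"
  assumes [measurable]: "f \<in> borel_measurable borel" "g \<in> borel_measurable borel" "W \<in> borel_measurable borel"
    and W: "\<And>x. 0 \<le> W x"
  shows "weighted_sq W (\<lambda>x. f x + g x) \<le> 2 * weighted_sq W f + 2 * weighted_sq W g"
proof -
  have "W x * (cmod (f x + g x))\<^sup>2 \<le> 2 * (W x * (cmod (f x))\<^sup>2) + 2 * (W x * (cmod (g x))\<^sup>2)" for x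
    using mult_left_mono[OF norm_sum_sq_le[of "f x" "g x"] W[of x]] by (simp add: algebra_simps)
  then have "weighted_sq W (\<lambda>x. f x + g x) \<le> (\<integral>\<^sup>+x. ennreal (2 * (W x * (cmod (f x))\<^sup>2)) + ennreal (2 * (W x * (cmod (g x))\<^sup>2)) \<partial>lborel)"
    unfolding weighted_sq_def by (intro nn_integral_mono) (simp add: W flip: ennreal_plus)
  also have "\<dots> = 2 * weighted_sq W f + 2 * weighted_sq W g"
    unfolding weighted_sq_def by (simp add: nn_integral_add ennreal_mult W nn_integral_cmult)
  finally show ?thesis .
qed

lemma weighted_sq_uminus: "weighted_sq W (\<lambda>x. - f x) = weighted_sq W f"
  by (simp add: weighted_sq_def)

lemma weighted_sq_diff_commute: "weighted_sq W (\<lambda>x. f x - g x) = weighted_sq W (\<lambda>x. g x - f x)"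
  by (simp add: weighted_sq_def norm_minus_commute)

lemma weighted_sq_triangle:
  fixes f g h :: "'a::euclidean_space \<Rightarrow> complex"
  assumes "f \<in> borel_measurable borel" "g \<in> borel_measurable borel" "h \<in> borel_measurable borel" "W \<in> borel_measurable borel"
    and W: "\<And>x. 0 \<le> W x"
  shows "weighted_sq W (\<lambda>x. f x - h x) \<le> 2 * weighted_sq W (\<lambda>x. f x - g x) + 2 * weighted_sq W (\<lambda>x. g x - h x)"
  using weighted_sq_add[of "\<lambda>x. f x - g x" "\<lambda>x. g x - h x" W] assms by simp

lemma weighted_sq_mono:
  "(\<And>x. W x * (cmod (f x))\<^sup>2 \<le> W' x * (cmod (g x))\<^sup>2) \<Longrightarrow> weighted_sq W f \<le> weighted_sq W' g"
  unfolding weighted_sq_def by (intro nn_integral_mono ennreal_leI)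

lemma norm_integral_le_nn: "ennreal (norm (integral\<^sup>L M f)) \<le> (\<integral>\<^sup>+x. norm (f x) \<partial>M)"
  for f :: "_ \<Rightarrow> 'b::{banach, second_countable_topology}"
  by (cases "integrable M f") (auto simp: integral_norm_bound_ennreal not_integrable_integral_eq)

text \<open>
  The weight is split as \<open>sqrt (W x) * sqrt (inverse (W x)) = 1\<close>: this is the duality between Sobolev norms of
  opposite order.
\<close>

lemma Cauchy_Schwarz_integral:
  fixes f g :: "'a::euclidean_space \<Rightarrow> complex"
  assumes [measurable]: "f \<in> borel_measurable borel" "g \<in> borel_measurable borel" "W \<in> borel_measurable borel"
    and W: "\<And>x. 0 < W x"
  shows "ennreal ((cmod (LINT x|lborel. f x * g x))\<^sup>2) \<le> weighted_sq W f * weighted_sq (\<lambda>x. inverse (W x)) g"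
proof -
  have W0: "0 \<le> W x" for x using W[of x] by simp
  have "ennreal ((cmod (LINT x|lborel. f x * g x))\<^sup>2) = (ennreal (cmod (LINT x|lborel. f x * g x)))\<^sup>2"
    by (simp add: ennreal_power)
  also have "\<dots> \<le> (\<integral>\<^sup>+x. norm (f x * g x) \<partial>lborel)\<^sup>2"
    by (intro power_mono norm_integral_le_nn) auto
  also have "(\<integral>\<^sup>+x. norm (f x * g x) \<partial>lborel) = (\<integral>\<^sup>+x. ennreal (sqrt (W x) * cmod (f x)) * ennreal (sqrt (inverse (W x)) * cmod (g x)) \<partial>lborel)"
  proof (rule nn_integral_cong)
    fix x
    have "sqrt (W x) * sqrt (inverse (W x)) = 1" using W[of x] by (simp add: real_sqrt_inverse)
    then have "norm (f x * g x) = (sqrt (W x) * cmod (f x)) * (sqrt (inverse (W x)) * cmod (g x))"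
      by (simp add: norm_mult mult_ac)
    then show "ennreal (norm (f x * g x)) = ennreal (sqrt (W x) * cmod (f x)) * ennreal (sqrt (inverse (W x)) * cmod (g x))"
      using W0 by (simp add: ennreal_mult[symmetric])
  qed
  also have "\<dots>\<^sup>2 \<le> (\<integral>\<^sup>+x. (ennreal (sqrt (W x) * cmod (f x)))\<^sup>2 \<partial>lborel) * (\<integral>\<^sup>+x. (ennreal (sqrt (inverse (W x)) * cmod (g x)))\<^sup>2 \<partial>lborel)"
    by (rule Cauchy_Schwarz_nn_integral) auto
  also have "\<dots> = weighted_sq W f * weighted_sq (\<lambda>x. inverse (W x)) g"
    unfolding weighted_sq_def by (simp add: ennreal_power power_mult_distrib W0)
  finally show ?thesis .
qed

lemma integrable_mult_L2:
  fixes f g :: "'a::euclidean_space \<Rightarrow> complex"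
  assumes "square_integrable f" "square_integrable g"
  shows "integrable lborel (\<lambda>x. f x * g x)"
proof (rule Bochner_Integration.integrable_bound)
  have [measurable]: "f \<in> borel_measurable borel" "g \<in> borel_measurable borel"
    using assms by auto
  show "integrable lborel (\<lambda>x. (cmod (f x))\<^sup>2 + (cmod (g x))\<^sup>2)"
    using assms by (simp add: square_integrable_def)
  show "(\<lambda>x. f x * g x) \<in> borel_measurable lborel" by measurable
  have "cmod (f x) * cmod (g x) \<le> (cmod (f x))\<^sup>2 + (cmod (g x))\<^sup>2" for x
  proof -
    have "2 * (cmod (f x) * cmod (g x)) \<le> (cmod (f x))\<^sup>2 + (cmod (g x))\<^sup>2"
      using sum_squares_bound[of "cmod (f x)" "cmod (g x)"] by (simp add: mult.assoc)
    moreover have "0 \<le> cmod (f x) * cmod (g x)" by simp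
    ultimately show ?thesis by linarith
  qed
  then show "AE x in lborel. cmod (f x * g x) \<le> norm ((cmod (f x))\<^sup>2 + (cmod (g x))\<^sup>2)"
    by (simp add: norm_mult)
qed

lemma nn_integral_translate:
  fixes f :: "'a::euclidean_space \<Rightarrow> ennreal"
  assumes "f \<in> borel_measurable borel"
  shows "(\<integral>\<^sup>+x. f (x + t) \<partial>lborel) = (\<integral>\<^sup>+x. f x \<partial>lborel)"
  using nn_integral_affine[OF assms, of 1 t] by (simp add: add.commute)

text \<open>
  With a Gaussian cut-off, \<open>gauss_smoothing\<close> turns the integral of the squared transform into a correlation
  of \<open>f\<close> with its translates, averaged over a probability density; each correlation is at most
  the integral of \<open>|f|\<^sup>2\<close>. Fatou's lemma removes the cut-off.
\<close>

theorem Bessel_inequality: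
  fixes f :: "'a::euclidean_space \<Rightarrow> complex"
  assumes f: "integrable lborel f" and f2: "square_integrable f"
  shows "L2_sq (fourier f) \<le> L2_sq f"
proof -
  note [measurable] = borel_measurable_integrable[OF f]
  have meas [measurable]: "fourier f \<in> borel_measurable borel" by measurable
  define \<kappa> where "\<kappa> = fourier_factor TYPE('a)"
  have \<kappa>: "\<kappa> > 0" by (simp add: \<kappa>_def)
  \<comment> \<open>The Gaussian has total mass \<open>1 / \<kappa>\<close>, which cancels the factor \<open>\<kappa>\<close> of the transform.\<close>
  have smoothed: "(\<integral>\<^sup>+\<omega>. ennreal (gauss (\<epsilon> *\<^sub>R \<omega>) * (cmod (fourier f \<omega>))\<^sup>2) \<partial>lborel) \<le> L2_sq f" if "0 < \<epsilon>" for \<epsilon> :: real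
  proof -
    let ?H = "\<lambda>\<omega>. fourier f \<omega> * complex_of_real (gauss (\<epsilon> *\<^sub>R \<omega>))"
    have "integrable lborel (\<lambda>\<omega>::'a. complex_of_real (gauss (\<epsilon> *\<^sub>R \<omega>)))"
      using integrable_gauss_scale[of \<epsilon>] that by (intro integrable_of_real) simp
    from integrable_mult_bounded[OF this _ cmod_fourier_le[of f]] have H: "integrable lborel ?H"
      by (simp add: mult.commute)
    have fc: "integrable lborel (\<lambda>x. cnj (f x))" using f by simp
    have eq: "?H \<omega> * cnj (fourier f \<omega>) = complex_of_real (gauss (\<epsilon> *\<^sub>R \<omega>) * (cmod (fourier f \<omega>))\<^sup>2)" for \<omega>
      using complex_norm_square[of "fourier f \<omega>"] by (simp add: mult_ac)
    have "integrable lborel (\<lambda>\<omega>. ?H \<omega> * cnj (fourier f \<omega>))"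
      by (rule integrable_mult_bounded[OF H]) (use cmod_fourier_le[of f] in auto)
    from integrable_Re[OF this] have int: "integrable lborel (\<lambda>\<omega>. gauss (\<epsilon> *\<^sub>R \<omega>) * (cmod (fourier f \<omega>))\<^sup>2)"
      by (simp only: eq Re_complex_of_real)
    have "complex_of_real (LINT \<omega>|lborel. gauss (\<epsilon> *\<^sub>R \<omega>) * (cmod (fourier f \<omega>))\<^sup>2) = (LINT \<omega>|lborel. ?H \<omega> * cnj (fourier f \<omega>))"
      unfolding eq by (rule integral_of_real[OF int, symmetric])
    also have "\<dots> = (LINT \<omega>|lborel. of_real \<kappa> * (?H \<omega> * (LINT x|lborel. cnj (f x) * cis (x \<bullet> \<omega>))))"
    proof (rule Bochner_Integration.integral_cong[OF refl])
      fix \<omega>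
      have "cnj (LINT x|lborel. f x * cis (- (x \<bullet> \<omega>))) = (LINT x|lborel. cnj (f x * cis (- (x \<bullet> \<omega>))))"
        by (rule Bochner_Integration.integral_cnj[symmetric])
      then have "cnj (fourier f \<omega>) = of_real \<kappa> * (LINT x|lborel. cnj (f x) * cis (x \<bullet> \<omega>))"
        by (simp add: fourier_cis \<kappa>_def cis_cnj)
      then show "?H \<omega> * cnj (fourier f \<omega>) = of_real \<kappa> * (?H \<omega> * (LINT x|lborel. cnj (f x) * cis (x \<bullet> \<omega>)))"
        by simp
    qed
    also have "\<dots> = of_real \<kappa> * (LINT \<omega>|lborel. ?H \<omega> * (LINT x|lborel. cnj (f x) * cis (x \<bullet> \<omega>)))"
      by (rule integral_mult_right_zero)
    also have "(LINT \<omega>|lborel. ?H \<omega> * (LINT x|lborel. cnj (f x) * cis (x \<bullet> \<omega>))) = (LINT x|lborel. cnj (f x) * (LINT \<omega>|lborel. ?H \<omega> * cis (x \<bullet> \<omega>)))"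
      by (rule Fubini_kernel[OF H fc, where B=1]) auto
    also have "\<dots> = (LINT x|lborel. cnj (f x) * (LINT z|lborel. of_real (gauss z) * f (x + \<epsilon> *\<^sub>R z)))"
      unfolding gauss_smoothing[OF f that] ..
    finally have "norm (complex_of_real (LINT \<omega>|lborel. gauss (\<epsilon> *\<^sub>R \<omega>) * (cmod (fourier f \<omega>))\<^sup>2))
        = norm (of_real \<kappa> * (LINT x|lborel. cnj (f x) * (LINT z|lborel. of_real (gauss z) * f (x + \<epsilon> *\<^sub>R z))))"
      by (rule arg_cong)
    then have "(LINT \<omega>|lborel. gauss (\<epsilon> *\<^sub>R \<omega>) * (cmod (fourier f \<omega>))\<^sup>2)
        \<le> \<kappa> * cmod (LINT x|lborel. cnj (f x) * (LINT z|lborel. of_real (gauss z) * f (x + \<epsilon> *\<^sub>R z)))"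
      unfolding norm_mult norm_of_real abs_of_pos[OF \<kappa>] by (rule ord_le_eq_trans[OF abs_ge_self])
    then have "(\<integral>\<^sup>+\<omega>. ennreal (gauss (\<epsilon> *\<^sub>R \<omega>) * (cmod (fourier f \<omega>))\<^sup>2) \<partial>lborel)
       \<le> ennreal \<kappa> * ennreal (cmod (LINT x|lborel. cnj (f x) * (LINT z|lborel. of_real (gauss z) * f (x + \<epsilon> *\<^sub>R z))))"
      using \<kappa> by (subst nn_integral_eq_integral[OF int]) (auto simp: ennreal_mult[symmetric] intro!: ennreal_leI)
    also have "\<dots> \<le> ennreal \<kappa> * (\<integral>\<^sup>+x. \<integral>\<^sup>+z. ennreal (cmod (f x) * (gauss z * cmod (f (x + \<epsilon> *\<^sub>R z)))) \<partial>lborel \<partial>lborel)"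
    proof (rule mult_left_mono)
      have "ennreal (cmod (LINT x|lborel. cnj (f x) * (LINT z|lborel. of_real (gauss z) * f (x + \<epsilon> *\<^sub>R z))))
         \<le> (\<integral>\<^sup>+x. norm (cnj (f x) * (LINT z|lborel. of_real (gauss z) * f (x + \<epsilon> *\<^sub>R z))) \<partial>lborel)"
        by (rule norm_integral_le_nn)
      also have "\<dots> \<le> (\<integral>\<^sup>+x. \<integral>\<^sup>+z. ennreal (cmod (f x) * (gauss z * cmod (f (x + \<epsilon> *\<^sub>R z)))) \<partial>lborel \<partial>lborel)"
      proof (rule nn_integral_mono)
        fix x
        have "ennreal (norm (cnj (f x) * (LINT z|lborel. of_real (gauss z) * f (x + \<epsilon> *\<^sub>R z))))
          = ennreal (norm (LINT z|lborel. f x * (of_real (gauss z) * f (x + \<epsilon> *\<^sub>R z))))"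
          by (simp only: integral_mult_right_zero norm_mult complex_mod_cnj)
        also have "\<dots> \<le> (\<integral>\<^sup>+z. norm (f x * (of_real (gauss z) * f (x + \<epsilon> *\<^sub>R z))) \<partial>lborel)"
          by (rule norm_integral_le_nn)
        finally show "ennreal (norm (cnj (f x) * (LINT z|lborel. of_real (gauss z) * f (x + \<epsilon> *\<^sub>R z))))
          \<le> (\<integral>\<^sup>+z. ennreal (cmod (f x) * (gauss z * cmod (f (x + \<epsilon> *\<^sub>R z)))) \<partial>lborel)"
          by (simp add: norm_mult)
      qed
      finally show "ennreal (cmod (LINT x|lborel. cnj (f x) * (LINT z|lborel. of_real (gauss z) * f (x + \<epsilon> *\<^sub>R z))))
        \<le> (\<integral>\<^sup>+x. \<integral>\<^sup>+z. ennreal (cmod (f x) * (gauss z * cmod (f (x + \<epsilon> *\<^sub>R z)))) \<partial>lborel \<partial>lborel)" .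
    qed simp
    also have "(\<integral>\<^sup>+x. \<integral>\<^sup>+z. ennreal (cmod (f x) * (gauss z * cmod (f (x + \<epsilon> *\<^sub>R z)))) \<partial>lborel \<partial>lborel)
       = (\<integral>\<^sup>+z. \<integral>\<^sup>+x. ennreal (cmod (f x) * (gauss z * cmod (f (x + \<epsilon> *\<^sub>R z)))) \<partial>lborel \<partial>lborel)"
      by (rule lborel_pair.Fubini') measurable
    also have "\<dots> \<le> (\<integral>\<^sup>+z. ennreal (gauss (z::'a)) * L2_sq f \<partial>lborel)"
    proof (rule nn_integral_mono)
      fix z :: 'a
      have "cmod (f x) * (gauss z * cmod (f (x + \<epsilon> *\<^sub>R z))) \<le> gauss z / 2 * (cmod (f x))\<^sup>2 + gauss z / 2 * (cmod (f (x + \<epsilon> *\<^sub>R z)))\<^sup>2" for x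
        using mult_left_mono[OF sum_squares_bound[of "cmod (f x)" "cmod (f (x + \<epsilon> *\<^sub>R z))"], of "gauss z / 2"] by (simp add: algebra_simps)
      then have "(\<integral>\<^sup>+x. ennreal (cmod (f x) * (gauss z * cmod (f (x + \<epsilon> *\<^sub>R z)))) \<partial>lborel)
        \<le> (\<integral>\<^sup>+x. ennreal (gauss z / 2) * ennreal ((cmod (f x))\<^sup>2) + ennreal (gauss z / 2) * ennreal ((cmod (f (x + \<epsilon> *\<^sub>R z)))\<^sup>2) \<partial>lborel)"
        by (intro nn_integral_mono) (simp add: ennreal_mult[symmetric] ennreal_plus[symmetric] del: ennreal_plus)
      also have "\<dots> = ennreal (gauss z / 2) * L2_sq f + ennreal (gauss z / 2) * (\<integral>\<^sup>+x. ennreal ((cmod (f (x + \<epsilon> *\<^sub>R z)))\<^sup>2) \<partial>lborel)"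
        by (simp add: nn_integral_add nn_integral_cmult weighted_sq_def)
      also have "(\<integral>\<^sup>+x. ennreal ((cmod (f (x + \<epsilon> *\<^sub>R z)))\<^sup>2) \<partial>lborel) = L2_sq f"
        using nn_integral_translate[of "\<lambda>x. ennreal ((cmod (f x))\<^sup>2)" "\<epsilon> *\<^sub>R z"] by (simp add: weighted_sq_def)
      also have "ennreal (gauss z / 2) * L2_sq f + ennreal (gauss z / 2) * L2_sq f = ennreal (gauss z) * L2_sq f"
        by (simp add: distrib_right[symmetric] ennreal_plus[symmetric] del: ennreal_plus)
      finally show "(\<integral>\<^sup>+x. ennreal (cmod (f x) * (gauss z * cmod (f (x + \<epsilon> *\<^sub>R z)))) \<partial>lborel) \<le> ennreal (gauss z) * L2_sq f" .
    qed
    also have "(\<integral>\<^sup>+z. ennreal (gauss (z::'a)) * L2_sq f \<partial>lborel) = ennreal (1 / \<kappa>) * L2_sq f"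
      by (simp add: nn_integral_multc nn_integral_eq_integral integrable_gauss integral_gauss \<kappa>_def)
    finally have "(\<integral>\<^sup>+\<omega>. ennreal (gauss (\<epsilon> *\<^sub>R \<omega>) * (cmod (fourier f \<omega>))\<^sup>2) \<partial>lborel) \<le> ennreal \<kappa> * (ennreal (1 / \<kappa>) * L2_sq f)"
      by (simp add: mult_left_mono)
    also have "\<dots> = L2_sq f"
      using \<kappa> by (simp add: mult.assoc[symmetric] ennreal_mult[symmetric])
    finally show ?thesis .
  qed
  define e where "e n = inverse (real (Suc n))" for n
  have e: "e \<longlonglongrightarrow> 0" "0 < e n" for n
    unfolding e_def using LIMSEQ_inverse_real_of_nat by auto
  have "L2_sq (fourier f) = (\<integral>\<^sup>+\<omega>. liminf (\<lambda>n. ennreal (gauss (e n *\<^sub>R \<omega>) * (cmod (fourier f \<omega>))\<^sup>2)) \<partial>lborel)"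
    unfolding weighted_sq_def
  proof (rule nn_integral_cong)
    fix \<omega> :: 'a
    have "(\<lambda>n. ennreal (gauss (e n *\<^sub>R \<omega>) * (cmod (fourier f \<omega>))\<^sup>2)) \<longlonglongrightarrow> ennreal (gauss (0 *\<^sub>R \<omega>) * (cmod (fourier f \<omega>))\<^sup>2)"
      unfolding gauss_def by (intro tendsto_intros tendsto_ennrealI e) auto
    from lim_imp_Liminf[OF _ this] show "ennreal (1 * (cmod (fourier f \<omega>))\<^sup>2) = liminf (\<lambda>n. ennreal (gauss (e n *\<^sub>R \<omega>) * (cmod (fourier f \<omega>))\<^sup>2))"
      by simp
  qed
  also have "\<dots> \<le> liminf (\<lambda>n. \<integral>\<^sup>+\<omega>. ennreal (gauss (e n *\<^sub>R \<omega>) * (cmod (fourier f \<omega>))\<^sup>2) \<partial>lborel)"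
    by (rule nn_integral_liminf) measurable
  also have "\<dots> \<le> L2_sq f"
    by (rule order_trans[OF Liminf_mono[OF always_eventually, of _ "\<lambda>_. L2_sq f"]]) (auto intro: smoothed e simp: Liminf_const)
  finally show ?thesis .
qed

section \<open>The Fourier transform of square-integrable functions\<close>

lemma ennreal_squeeze_0:
  fixes f g :: "nat \<Rightarrow> ennreal"
  assumes "g \<longlonglongrightarrow> 0" "\<And>n. f n \<le> g n"
  shows "f \<longlonglongrightarrow> 0"
  by (rule tendsto_sandwich[OF _ _ tendsto_const assms(1)]) (use assms(2) in auto)

lemma weighted_sq_cong_AE:
  "(AE x in lborel. f x = g x) \<Longrightarrow> weighted_sq W f = weighted_sq W g"
  unfolding weighted_sq_def by (rule nn_integral_cong_AE) auto

lemma sum_half_powers_le: "(\<Sum>k=n..<m. (1/2::real) ^ k) \<le> 2 / 2 ^ n" if "n \<le> m"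
proof -
  have "(\<Sum>k=n..<m. (1/2::real) ^ k) = 2 / 2 ^ n - 2 / 2 ^ m"
    using that by (induction m rule: dec_induct) (simp_all add: power_divide)
  then show ?thesis by simp
qed

text \<open>
  The theorem of Riesz and Fischer for a sequence whose increments decay geometrically. The weighted sum
  \<open>S\<close> of the squared increments has a finite integral, hence is finite almost everywhere; it
  controls the tails pointwise, so that the sequence converges pointwise and in the mean.
\<close>

lemma L2_Cauchy_limit:
  fixes g :: "nat \<Rightarrow> 'a::euclidean_space \<Rightarrow> complex"
  assumes [measurable]: "\<And>n. g n \<in> borel_measurable borel"
    and d: "\<And>n. L2_sq (\<lambda>x. g (Suc n) x - g n x) \<le> ennreal (C / 4 ^ n)"
    and g0: "L2_sq (g 0) < \<infinity>" and C: "0 \<le> C"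
  shows "\<exists>h. square_integrable h \<and> (\<lambda>n. L2_sq (\<lambda>x. g n x - h x)) \<longlonglongrightarrow> 0"
proof -
  \<comment> \<open>The weights \<open>2\<^sup>k\<close> still leave a convergent series, and by Cauchy-Schwarz turn a bound for the sum into one for the tails.\<close>
  define S where "S x = (\<Sum>k. ennreal (2 ^ k * (cmod (g (Suc k) x - g k x))\<^sup>2))" for x
  define h where "h x = lim (\<lambda>n. g n x)" for x
  have [measurable]: "S \<in> borel_measurable borel" "h \<in> borel_measurable borel"
    unfolding S_def h_def by measurable
  have "(\<integral>\<^sup>+x. S x \<partial>lborel) = (\<Sum>k. \<integral>\<^sup>+x. ennreal (2 ^ k * (cmod (g (Suc k) x - g k x))\<^sup>2) \<partial>lborel)"
    unfolding S_def by (rule nn_integral_suminf) measurable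
  also have "\<dots> \<le> (\<Sum>k. ennreal (C * (1/2) ^ k))"
  proof (intro suminf_le summableI)
    fix k
    have "(\<integral>\<^sup>+x. ennreal (2 ^ k * (cmod (g (Suc k) x - g k x))\<^sup>2) \<partial>lborel) = ennreal (2 ^ k) * L2_sq (\<lambda>x. g (Suc k) x - g k x)"
      by (simp add: weighted_sq_def ennreal_mult nn_integral_cmult)
    also have "\<dots> \<le> ennreal (2 ^ k) * ennreal (C / 4 ^ k)" by (intro mult_left_mono d) simp
    also have "\<dots> = ennreal (C * (1/2) ^ k)"
      using C by (simp add: ennreal_mult[symmetric] power_divide) (simp add: field_simps flip: power_mult_distrib)
    finally show "(\<integral>\<^sup>+x. ennreal (2 ^ k * (cmod (g (Suc k) x - g k x))\<^sup>2) \<partial>lborel) \<le> ennreal (C * (1/2) ^ k)" .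
  qed
  also have "\<dots> = ennreal (C * 2)"
  proof (rule sums_unique[symmetric], subst sums_ennreal)
    show "(\<lambda>k. C * (1/2) ^ k) sums (C * 2)"
      using sums_mult[OF geometric_sums[of "1/2::real"], of C] by simp
  qed (use C in auto)
  finally have int_S: "(\<integral>\<^sup>+x. S x \<partial>lborel) \<le> ennreal (C * 2)" .
  then have "AE x in lborel. S x \<noteq> \<infinity>"
    by (intro nn_integral_PInf_AE) (auto simp: top_unique)
  then have AE: "AE x in lborel. \<forall>n. ennreal ((cmod (g n x - h x))\<^sup>2) \<le> ennreal (2 / 2 ^ n) * S x"
  proof eventually_elim
    fix x assume "S x \<noteq> \<infinity>"
    then obtain s where s: "S x = ennreal s" "0 \<le> s" by (cases "S x") auto
    have bound: "(cmod (g m x - g n x))\<^sup>2 \<le> 2 / 2 ^ n * s" if "n \<le> m" for n m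
    proof -
      let ?d = "\<lambda>k. cmod (g (Suc k) x - g k x)"
      have "ennreal (\<Sum>k=n..<m. 2 ^ k * (?d k)\<^sup>2) = (\<Sum>k=n..<m. ennreal (2 ^ k * (?d k)\<^sup>2))"
        by (rule sum_ennreal[symmetric]) simp
      also have "\<dots> \<le> S x" unfolding S_def by (rule sum_le_suminf) auto
      finally have le: "(\<Sum>k=n..<m. 2 ^ k * (?d k)\<^sup>2) \<le> s" using s by simp
      have "cmod (g m x - g n x) = cmod (\<Sum>k=n..<m. g (Suc k) x - g k x)"
        using sum_Suc_diff'[OF that, of "\<lambda>k. g k x"] by simp
      also have "\<dots> \<le> (\<Sum>k=n..<m. ?d k)" by (rule norm_sum)
      finally have "(cmod (g m x - g n x))\<^sup>2 \<le> (\<Sum>k=n..<m. ?d k)\<^sup>2" by (intro power_mono) auto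
      also have "(\<Sum>k=n..<m. ?d k) = (\<Sum>k=n..<m. sqrt ((1/2) ^ k) * (sqrt (2 ^ k) * ?d k))"
        by (intro sum.cong refl) (simp add: mult.assoc[symmetric] real_sqrt_mult[symmetric] power_mult_distrib[symmetric])
      also have "\<dots>\<^sup>2 \<le> (\<Sum>k=n..<m. (sqrt ((1/2) ^ k))\<^sup>2) * (\<Sum>k=n..<m. (sqrt (2 ^ k) * ?d k)\<^sup>2)"
        by (rule Cauchy_Schwarz_ineq_sum)
      also have "\<dots> = (\<Sum>k=n..<m. (1/2) ^ k) * (\<Sum>k=n..<m. 2 ^ k * (?d k)\<^sup>2)"
        by (simp add: power_mult_distrib)
      also have "\<dots> \<le> 2 / 2 ^ n * s"
        by (intro mult_mono sum_half_powers_le that le sum_nonneg) auto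
      finally show ?thesis .
    qed
    have "Cauchy (\<lambda>n. g n x)"
    proof (rule metric_CauchyI)
      fix e :: real assume "0 < e"
      have "(\<lambda>n. 2 * s * (1/2) ^ n) \<longlonglongrightarrow> 2 * s * 0" by (intro tendsto_intros LIMSEQ_realpow_zero) auto
      then have "\<forall>\<^sub>F n in sequentially. 2 * s * (1/2) ^ n < (e/2)\<^sup>2"
        by (rule order_tendstoD) (use \<open>0 < e\<close> in auto)
      then obtain N where N: "2 * s * (1/2) ^ N < (e/2)\<^sup>2" by (auto simp: eventually_sequentially)
      have lt: "dist (g m x) (g N x) < e / 2" if "N \<le> m" for m
      proof -
        have "(cmod (g m x - g N x))\<^sup>2 \<le> 2 * s * (1/2) ^ N" using bound[OF that] by (simp add: power_divide field_simps)
        then have "(cmod (g m x - g N x))\<^sup>2 < (e/2)\<^sup>2" using N by linarith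
        then have "cmod (g m x - g N x) < e / 2"
          by (rule power2_less_imp_less) (use \<open>0 < e\<close> in simp)
        then show ?thesis unfolding dist_norm .
      qed
      show "\<exists>M. \<forall>m\<ge>M. \<forall>n\<ge>M. dist (g m x) (g n x) < e"
        using dist_triangle_half_l[OF lt lt] by blast
    qed
    then have lim: "(\<lambda>n. g n x) \<longlonglongrightarrow> h x"
      unfolding h_def by (simp add: Cauchy_convergent convergent_LIMSEQ_iff[symmetric])
    show "\<forall>n. ennreal ((cmod (g n x - h x))\<^sup>2) \<le> ennreal (2 / 2 ^ n) * S x"
    proof
      fix n
      have "(\<lambda>m. (cmod (g m x - g n x))\<^sup>2) \<longlonglongrightarrow> (cmod (h x - g n x))\<^sup>2"
        by (intro tendsto_intros lim)
      then have "(cmod (h x - g n x))\<^sup>2 \<le> 2 / 2 ^ n * s"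
        by (rule LIMSEQ_le_const2) (use bound in auto)
      then show "ennreal ((cmod (g n x - h x))\<^sup>2) \<le> ennreal (2 / 2 ^ n) * S x"
        using s by (simp add: ennreal_mult[symmetric] norm_minus_commute)
    qed
  qed
  have le: "L2_sq (\<lambda>x. g n x - h x) \<le> ennreal (4 * C * (1/2) ^ n)" for n
  proof -
    have "L2_sq (\<lambda>x. g n x - h x) \<le> (\<integral>\<^sup>+x. ennreal (2 / 2 ^ n) * S x \<partial>lborel)"
      unfolding weighted_sq_def by (rule nn_integral_mono_AE) (use AE in auto)
    also have "\<dots> = ennreal (2 / 2 ^ n) * (\<integral>\<^sup>+x. S x \<partial>lborel)" by (rule nn_integral_cmult) simp
    also have "\<dots> \<le> ennreal (2 / 2 ^ n) * ennreal (C * 2)" by (intro mult_left_mono int_S) simp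
    also have "\<dots> = ennreal (4 * C * (1/2) ^ n)"
      using C by (simp add: ennreal_mult[symmetric] power_divide)
    finally show ?thesis .
  qed
  have "(\<lambda>n. ennreal (4 * C * (1/2) ^ n)) \<longlonglongrightarrow> ennreal (4 * C * 0)"
    by (intro tendsto_intros tendsto_ennrealI LIMSEQ_realpow_zero) auto
  then have "(\<lambda>n. ennreal (4 * C * (1/2) ^ n)) \<longlonglongrightarrow> 0" by simp
  from ennreal_squeeze_0[OF this le] have "(\<lambda>n. L2_sq (\<lambda>x. g n x - h x)) \<longlonglongrightarrow> 0" .
  moreover have "square_integrable h"
  proof -
    have "L2_sq h = L2_sq (\<lambda>x. g 0 x - (g 0 x - h x))" by simp
    also have "\<dots> \<le> 2 * L2_sq (\<lambda>x. g 0 x - 0) + 2 * L2_sq (\<lambda>x. 0 - (g 0 x - h x))"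
      by (rule weighted_sq_triangle) auto
    also have "L2_sq (\<lambda>x. 0 - (g 0 x - h x)) = L2_sq (\<lambda>x. (g 0 x - h x))"
      using weighted_sq_uminus[of "\<lambda>_. 1" "\<lambda>x. (g 0 x - h x)"] by simp
    also have "2 * L2_sq (\<lambda>x. g 0 x - 0) + 2 * L2_sq (\<lambda>x. g 0 x - h x) < \<infinity>"
      using g0 order_le_less_trans[OF le[of 0] ennreal_less_top] by (simp add: ennreal_mult_less_top)
    finally show ?thesis by (simp add: square_integrable_iff)
  qed
  ultimately show ?thesis by blast
qed

lemma square_integrable_diff:
  assumes "square_integrable f" "square_integrable g"
  shows "square_integrable (\<lambda>x. f x - g x)"
proof -
  have [measurable]: "f \<in> borel_measurable borel" "g \<in> borel_measurable borel" using assms by auto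
  have "L2_sq (\<lambda>x. f x - g x) \<le> 2 * L2_sq (\<lambda>x. f x - 0) + 2 * L2_sq (\<lambda>x. 0 - g x)"
    by (rule weighted_sq_triangle) auto
  also have "\<dots> < \<infinity>" using assms weighted_sq_uminus[of "\<lambda>_. 1" g]
    by (simp add: square_integrable_iff ennreal_mult_less_top)
  finally show ?thesis by (simp add: square_integrable_iff)
qed

lemma square_integrable_add:
  assumes "square_integrable f" "square_integrable g"
  shows "square_integrable (\<lambda>x. f x + g x)"
proof -
  have [measurable]: "f \<in> borel_measurable borel" "g \<in> borel_measurable borel" using assms by auto
  have "L2_sq (\<lambda>x. f x + g x) \<le> 2 * L2_sq f + 2 * L2_sq g"
    by (rule weighted_sq_add) auto
  also have "\<dots> < \<infinity>" using assms
    by (simp add: square_integrable_iff ennreal_mult_less_top)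
  finally show ?thesis by (simp add: square_integrable_iff)
qed

lemma square_integrable_mult_bounded:
  assumes "square_integrable f" and [measurable]: "k \<in> borel_measurable borel" and B: "\<And>x. cmod (k x) \<le> B"
  shows "square_integrable (\<lambda>x. k x * f x)"
proof -
  have [measurable]: "f \<in> borel_measurable borel" using assms(1) by auto
  have "L2_sq (\<lambda>x. k x * f x) \<le> weighted_sq (\<lambda>_. B\<^sup>2) f"
  proof (rule weighted_sq_mono)
    fix x show "1 * (cmod (k x * f x))\<^sup>2 \<le> B\<^sup>2 * (cmod (f x))\<^sup>2"
      using power_mono[OF B[of x] norm_ge_zero, of 2] by (simp add: norm_mult power_mult_distrib mult_right_mono)
  qed
  also have "\<dots> = ennreal (B\<^sup>2) * L2_sq f"
    by (simp add: weighted_sq_def ennreal_mult nn_integral_cmult)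
  also have "\<dots> < \<infinity>" using assms(1) by (simp add: square_integrable_iff ennreal_mult_less_top)
  finally show ?thesis by (simp add: square_integrable_iff)
qed

lemma square_integrable_bounded:
  fixes f :: "'a::euclidean_space \<Rightarrow> complex"
  assumes f: "integrable lborel f" and B: "\<And>x. cmod (f x) \<le> B"
  shows "square_integrable f"
proof -
  have [measurable]: "f \<in> borel_measurable borel" using borel_measurable_integrable[OF f] by simp
  have "integrable lborel (\<lambda>x. (cmod (f x))\<^sup>2)"
  proof (rule Bochner_Integration.integrable_bound)
    show "integrable lborel (\<lambda>x. B * cmod (f x))" using f by simp
    have "(cmod (f x))\<^sup>2 \<le> B * cmod (f x)" for x
      unfolding power2_eq_square by (intro mult_right_mono B) simp
    then show "AE x in lborel. norm ((cmod (f x))\<^sup>2) \<le> norm (B * cmod (f x))"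
      by (auto intro: order_trans[OF _ abs_ge_self])
  qed simp
  then show ?thesis by (simp add: square_integrable_def)
qed

lemma square_integrable_fourier:
  "integrable lborel f \<Longrightarrow> square_integrable f \<Longrightarrow> square_integrable (fourier f)"
  using order_le_less_trans[OF Bessel_inequality, of f "\<infinity>"] by (auto simp: square_integrable_iff)

lemma has_fourier_L2_fourier:
  assumes "integrable lborel f" "square_integrable f"
  shows "has_fourier_L2 f (fourier f)"
  unfolding has_fourier_L2_iff
  using assms square_integrable_fourier[OF assms]
  by (intro conjI exI[of _ "\<lambda>_. f"]) (auto simp: weighted_sq_def)

lemma cball_measurable [measurable]: "cball a r \<in> sets borel"
  by (intro borel_closed closed_cball)

lemma integrable_indicator_cball: "integrable lborel (indicator (cball a r) :: 'a::euclidean_space \<Rightarrow> complex)"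
proof -
  have "integrable lborel (\<lambda>x. complex_of_real (indicator (cball a r) x))"
    by (intro integrable_of_real integrable_real_indicator emeasure_bounded_finite bounded_cball) simp
  also have "(\<lambda>x. complex_of_real (indicator (cball a r) x)) = indicator (cball a r)"
    by (auto split: split_indicator)
  finally show ?thesis .
qed

lemma truncation_L2:
  fixes f :: "'a::euclidean_space \<Rightarrow> complex"
  assumes f: "square_integrable f"
  shows "(\<lambda>n. L2_sq (\<lambda>x. indicator (cball 0 (real n)) x * f x - f x)) \<longlonglongrightarrow> 0"
proof -
  have [measurable]: "f \<in> borel_measurable borel" using f by auto
  have "(\<lambda>n. \<integral>\<^sup>+x. ennreal ((cmod (indicator (cball 0 (real n)) x * f x - f x))\<^sup>2) \<partial>lborel) \<longlonglongrightarrow> (\<integral>\<^sup>+x. 0 \<partial>(lborel :: 'a measure))"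
  proof (rule nn_integral_dominated_convergence[where w="\<lambda>x. ennreal ((cmod (f x))\<^sup>2)"])
    show "(\<integral>\<^sup>+x. ennreal ((cmod (f x))\<^sup>2) \<partial>lborel) < \<infinity>"
      using f by (simp add: square_integrable_iff weighted_sq_def)
    show "AE x in lborel. ennreal ((cmod (indicator (cball 0 (real n)) x * f x - f x))\<^sup>2) \<le> ennreal ((cmod (f x))\<^sup>2)" for n
      by (intro always_eventually allI) (auto split: split_indicator)
    show "AE x in lborel. (\<lambda>n. ennreal ((cmod (indicator (cball 0 (real n)) x * f x - f x))\<^sup>2)) \<longlonglongrightarrow> 0"
    proof (rule AE_I2, rule tendsto_eventually)
      fix x :: 'a
      show "\<forall>\<^sub>F n in sequentially. ennreal ((cmod (indicator (cball 0 (real n)) x * f x - f x))\<^sup>2) = 0"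
        using eventually_ge_at_top[of "nat \<lceil>norm x\<rceil>"]
        by eventually_elim (auto split: split_indicator simp: nat_le_iff ceiling_le_iff)
    qed
  qed measurable
  then show ?thesis by (simp add: weighted_sq_def)
qed

text \<open>
  Truncations to balls are integrable and converge in the mean; by Bessel's inequality their
  transforms form a Cauchy sequence.
\<close>

lemma has_fourier_L2_exists:
  fixes f :: "'a::euclidean_space \<Rightarrow> complex"
  assumes f: "square_integrable f"
  shows "\<exists>g. has_fourier_L2 f g"
proof -
  have [measurable]: "f \<in> borel_measurable borel" using f by auto
  have "\<exists>n. L2_sq (\<lambda>x. indicator (cball 0 (real n)) x * f x - f x) < ennreal (1 / 4 ^ k)" for k
    using order_tendstoD(2)[OF truncation_L2[OF f], of "ennreal (1 / 4 ^ k)"]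
    by (auto simp: eventually_sequentially)
  then obtain r where r: "\<And>k. L2_sq (\<lambda>x. indicator (cball 0 (real (r k))) x * f x - f x) < ennreal (1 / 4 ^ k)"
    by metis
  define u where "u k x = indicator (cball 0 (real (r k))) x * f x" for k x
  have [measurable]: "u k \<in> borel_measurable borel" for k
    unfolding u_def by (intro borel_measurable_times borel_measurable_indicator) (use f in auto)
  have u2: "square_integrable (u k)" for k
    unfolding u_def
  proof (rule square_integrable_mult_bounded[OF f, where B=1])
    show "(\<lambda>x. indicator (cball 0 (real (r k))) x :: complex) \<in> borel_measurable borel"
      by (intro borel_measurable_indicator) simp
  qed (auto split: split_indicator)
  have ind2: "square_integrable (indicator (cball 0 (real (r k))) :: 'a \<Rightarrow> complex)" for k
    by (rule square_integrable_bounded[OF integrable_indicator_cball, where B=1]) (auto split: split_indicator)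
  have u1: "integrable lborel (u k)" for k
    unfolding u_def by (rule integrable_mult_L2[OF ind2 f])
  have uf: "L2_sq (\<lambda>x. u k x - f x) \<le> ennreal (1 / 4 ^ k)" for k
    using r[of k] by (simp add: u_def)
  have lim: "(\<lambda>k. L2_sq (\<lambda>x. u k x - f x)) \<longlonglongrightarrow> 0"
  proof (rule ennreal_squeeze_0[OF _ uf])
    have "(\<lambda>k. ennreal ((1 / 4) ^ k)) \<longlonglongrightarrow> ennreal 0"
      by (intro tendsto_ennrealI LIMSEQ_realpow_zero) auto
    then show "(\<lambda>k. ennreal (1 / 4 ^ k)) \<longlonglongrightarrow> 0" by (simp add: power_divide)
  qed
  have "\<exists>h. square_integrable h \<and> (\<lambda>n. L2_sq (\<lambda>x. fourier (u n) x - h x)) \<longlonglongrightarrow> 0"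
  proof (rule L2_Cauchy_limit)
    show "fourier (u n) \<in> borel_measurable borel" for n by measurable
    show "L2_sq (fourier (u 0)) < \<infinity>" using square_integrable_fourier[OF u1 u2] by (simp add: square_integrable_iff)
    \<comment> \<open>Both truncations are within \<open>4\<^bsup>-n\<^esup>\<close> of \<open>f\<close>, and squares of sums cost a factor of two.\<close>
    show "L2_sq (\<lambda>x. fourier (u (Suc n)) x - fourier (u n) x) \<le> ennreal (4 / 4 ^ n)" for n
    proof -
      have e2: "2 * ennreal a = ennreal (2 * a)" if "0 \<le> a" for a
        using ennreal_mult[of 2 a] that by simp
      have "(\<lambda>x. fourier (u (Suc n)) x - fourier (u n) x) = fourier (\<lambda>x. u (Suc n) x - u n x)"
        by (intro ext fourier_diff[symmetric] u1)
      then have "L2_sq (\<lambda>x. fourier (u (Suc n)) x - fourier (u n) x) = L2_sq (fourier (\<lambda>x. u (Suc n) x - u n x))"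
        by (rule arg_cong)
      also have "\<dots> \<le> L2_sq (\<lambda>x. u (Suc n) x - u n x)"
        by (intro Bessel_inequality square_integrable_diff u2 Bochner_Integration.integrable_diff u1)
      also have "\<dots> \<le> 2 * L2_sq (\<lambda>x. u (Suc n) x - f x) + 2 * L2_sq (\<lambda>x. f x - u n x)"
        by (rule weighted_sq_triangle) auto
      also have "\<dots> \<le> 2 * ennreal (1 / 4 ^ Suc n) + 2 * ennreal (1 / 4 ^ n)"
        unfolding weighted_sq_diff_commute[of _ f] by (intro add_mono mult_left_mono uf) auto
      also have "\<dots> = ennreal (2 * (1 / 4 ^ Suc n) + 2 * (1 / 4 ^ n))"
        by (subst (1 2) e2, simp, simp, subst ennreal_plus) auto
      also have "\<dots> \<le> ennreal (4 / 4 ^ n)" by (intro ennreal_leI) (simp add: field_simps)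
      finally show ?thesis .
    qed
  qed simp
  then show ?thesis using u1 u2 lim unfolding has_fourier_L2_iff by blast
qed

lemma has_fourier_L2_fourier_L2:
  "square_integrable f \<Longrightarrow> has_fourier_L2 f (fourier_L2 f)"
  unfolding fourier_L2_def using has_fourier_L2_exists by (rule someI_ex)

text \<open>
  Two approximating sequences differ by integrable functions that tend to zero in the mean, and so do
  their transforms by Bessel's inequality. Hence a norm defined through \<^const>\<open>fourier_L2\<close> can be computed
  from any transform at hand.
\<close>

lemma has_fourier_L2_unique:
  fixes f :: "'a::euclidean_space \<Rightarrow> complex"
  assumes f: "square_integrable f" and g: "has_fourier_L2 f g" and g': "has_fourier_L2 f g'"
  shows "AE \<omega> in lborel. g \<omega> = g' \<omega>"
proof -
  obtain u where u: "\<And>n. integrable lborel (u n)" "\<And>n. square_integrable (u n)"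
      "(\<lambda>n. L2_sq (\<lambda>x. u n x - f x)) \<longlonglongrightarrow> 0" "(\<lambda>n. L2_sq (\<lambda>\<omega>. fourier (u n) \<omega> - g \<omega>)) \<longlonglongrightarrow> 0"
    using g unfolding has_fourier_L2_iff by blast
  obtain v where v: "\<And>n. integrable lborel (v n)" "\<And>n. square_integrable (v n)"
      "(\<lambda>n. L2_sq (\<lambda>x. v n x - f x)) \<longlonglongrightarrow> 0" "(\<lambda>n. L2_sq (\<lambda>\<omega>. fourier (v n) \<omega> - g' \<omega>)) \<longlonglongrightarrow> 0"
    using g' unfolding has_fourier_L2_iff by blast
  have [measurable]: "f \<in> borel_measurable borel" "g \<in> borel_measurable borel" "g' \<in> borel_measurable borel"
    "u n \<in> borel_measurable borel" "v n \<in> borel_measurable borel" for n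
    using f g g' u(2) v(2) by (auto simp: has_fourier_L2_iff dest: square_integrableD)
  have le: "L2_sq (\<lambda>\<omega>. g \<omega> - g' \<omega>) \<le> 2 * L2_sq (\<lambda>\<omega>. fourier (u n) \<omega> - g \<omega>) +
     2 * (2 * (2 * L2_sq (\<lambda>x. u n x - f x) + 2 * L2_sq (\<lambda>x. v n x - f x)) + 2 * L2_sq (\<lambda>\<omega>. fourier (v n) \<omega> - g' \<omega>))" for n
  proof -
    have "(\<lambda>\<omega>. fourier (u n) \<omega> - fourier (v n) \<omega>) = fourier (\<lambda>x. u n x - v n x)"
      by (intro ext fourier_diff[symmetric] u v)
    then have "L2_sq (\<lambda>\<omega>. fourier (u n) \<omega> - fourier (v n) \<omega>) = L2_sq (fourier (\<lambda>x. u n x - v n x))"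
      by (rule arg_cong)
    also have "\<dots> \<le> L2_sq (\<lambda>x. u n x - v n x)"
      by (intro Bessel_inequality square_integrable_diff u v Bochner_Integration.integrable_diff)
    also have "\<dots> \<le> 2 * L2_sq (\<lambda>x. u n x - f x) + 2 * L2_sq (\<lambda>x. f x - v n x)"
      by (rule weighted_sq_triangle) auto
    finally have uv: "L2_sq (\<lambda>\<omega>. fourier (u n) \<omega> - fourier (v n) \<omega>) \<le> 2 * L2_sq (\<lambda>x. u n x - f x) + 2 * L2_sq (\<lambda>x. v n x - f x)"
      by (simp add: weighted_sq_diff_commute[of _ f])
    have "L2_sq (\<lambda>\<omega>. fourier (u n) \<omega> - g' \<omega>) \<le> 2 * L2_sq (\<lambda>\<omega>. fourier (u n) \<omega> - fourier (v n) \<omega>) + 2 * L2_sq (\<lambda>\<omega>. fourier (v n) \<omega> - g' \<omega>)"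
      by (rule weighted_sq_triangle) auto
    also have "\<dots> \<le> 2 * (2 * L2_sq (\<lambda>x. u n x - f x) + 2 * L2_sq (\<lambda>x. v n x - f x)) + 2 * L2_sq (\<lambda>\<omega>. fourier (v n) \<omega> - g' \<omega>)"
      by (intro add_mono mult_left_mono uv) auto
    finally have 1: "L2_sq (\<lambda>\<omega>. fourier (u n) \<omega> - g' \<omega>) \<le> 2 * (2 * L2_sq (\<lambda>x. u n x - f x) + 2 * L2_sq (\<lambda>x. v n x - f x)) + 2 * L2_sq (\<lambda>\<omega>. fourier (v n) \<omega> - g' \<omega>)" .
    have "L2_sq (\<lambda>\<omega>. g \<omega> - g' \<omega>) \<le> 2 * L2_sq (\<lambda>\<omega>. g \<omega> - fourier (u n) \<omega>) + 2 * L2_sq (\<lambda>\<omega>. fourier (u n) \<omega> - g' \<omega>)"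
      by (rule weighted_sq_triangle) auto
    also have "\<dots> \<le> 2 * L2_sq (\<lambda>\<omega>. fourier (u n) \<omega> - g \<omega>) + 2 * (2 * (2 * L2_sq (\<lambda>x. u n x - f x) + 2 * L2_sq (\<lambda>x. v n x - f x)) + 2 * L2_sq (\<lambda>\<omega>. fourier (v n) \<omega> - g' \<omega>))"
      unfolding weighted_sq_diff_commute[of _ g] by (intro add_mono mult_left_mono 1) auto
    finally show ?thesis .
  qed
  have "(\<lambda>n. 2 * L2_sq (\<lambda>\<omega>. fourier (u n) \<omega> - g \<omega>) +
     2 * (2 * (2 * L2_sq (\<lambda>x. u n x - f x) + 2 * L2_sq (\<lambda>x. v n x - f x)) + 2 * L2_sq (\<lambda>\<omega>. fourier (v n) \<omega> - g' \<omega>)))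
     \<longlonglongrightarrow> 2 * 0 + 2 * (2 * (2 * 0 + 2 * 0) + 2 * 0)"
    by (intro tendsto_add ennreal_tendsto_cmult u v) auto
  then have "L2_sq (\<lambda>\<omega>. g \<omega> - g' \<omega>) \<le> 2 * 0 + 2 * (2 * (2 * 0 + 2 * 0) + 2 * 0)"
    by (rule LIMSEQ_le_const) (use le in auto)
  then have "AE \<omega> in lborel. ennreal (1 * (cmod (g \<omega> - g' \<omega>))\<^sup>2) = 0"
    using nn_integral_0_iff_AE[of "\<lambda>\<omega>. ennreal (1 * (cmod (g \<omega> - g' \<omega>))\<^sup>2)" lborel] by (simp add: weighted_sq_def)
  then show ?thesis by eventually_elim simp
qed

lemma L2_tendsto_integral:
  fixes f h :: "'a::euclidean_space \<Rightarrow> complex"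
  assumes f: "square_integrable f" and h: "square_integrable h" and u: "\<And>n. square_integrable (u n)"
    and lim: "(\<lambda>n. L2_sq (\<lambda>x. u n x - f x)) \<longlonglongrightarrow> 0"
  shows "(\<lambda>n. LINT x|lborel. u n x * h x) \<longlonglongrightarrow> (LINT x|lborel. f x * h x)"
proof -
  have [measurable]: "f \<in> borel_measurable borel" "h \<in> borel_measurable borel" "u n \<in> borel_measurable borel" for n
    using f h u by auto
  have "(\<lambda>n. L2_sq h * L2_sq (\<lambda>x. u n x - f x)) \<longlonglongrightarrow> L2_sq h * 0"
    using h by (intro ennreal_tendsto_cmult lim) (auto simp: square_integrable_iff)
  then have prod: "(\<lambda>n. L2_sq h * L2_sq (\<lambda>x. u n x - f x)) \<longlonglongrightarrow> 0" by simp
  have "ennreal ((cmod ((LINT x|lborel. u n x * h x) - (LINT x|lborel. f x * h x)))\<^sup>2) \<le> L2_sq h * L2_sq (\<lambda>x. u n x - f x)" for n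
  proof -
    have "(LINT x|lborel. u n x * h x) - (LINT x|lborel. f x * h x) = (LINT x|lborel. (u n x - f x) * h x)"
      unfolding left_diff_distrib
      by (rule Bochner_Integration.integral_diff[symmetric]) (intro integrable_mult_L2 u f h)+
    then show ?thesis using Cauchy_Schwarz_integral[of "\<lambda>x. u n x - f x" h "\<lambda>_. 1"] by (simp add: mult.commute)
  qed
  from ennreal_squeeze_0[OF prod this]
  have "(\<lambda>n. ennreal ((cmod ((LINT x|lborel. u n x * h x) - (LINT x|lborel. f x * h x)))\<^sup>2)) \<longlonglongrightarrow> 0" .
  then have "(\<lambda>n. (cmod ((LINT x|lborel. u n x * h x) - (LINT x|lborel. f x * h x)))\<^sup>2) \<longlonglongrightarrow> 0"
    by (subst (asm) ennreal_0[symmetric], subst (asm) tendsto_ennreal_iff) auto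
  then have "(\<lambda>n. sqrt ((cmod ((LINT x|lborel. u n x * h x) - (LINT x|lborel. f x * h x)))\<^sup>2)) \<longlonglongrightarrow> sqrt 0"
    by (rule tendsto_real_sqrt)
  then show ?thesis by (simp add: tendsto_norm_zero_iff LIM_zero_iff)
qed

text \<open>
  Functions against which every square-integrable function can be paired on either side: they are
  square integrable together with their transforms and obey the inversion formula.
\<close>

definition test_function :: "('a::euclidean_space \<Rightarrow> complex) \<Rightarrow> bool" where
  "test_function \<phi> \<longleftrightarrow> continuous_on UNIV \<phi> \<and> integrable lborel \<phi> \<and> (\<exists>B. \<forall>x. cmod (\<phi> x) \<le> B) \<and>
     integrable lborel (fourier \<phi>)"

lemma test_function_square_integrable: "test_function \<phi> \<Longrightarrow> square_integrable \<phi>"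
  unfolding test_function_def using square_integrable_bounded by blast

lemma test_function_fourier_square_integrable: "test_function \<phi> \<Longrightarrow> square_integrable (fourier \<phi>)"
  unfolding test_function_def using square_integrable_bounded[of "fourier \<phi>", OF _ cmod_fourier_le[of \<phi>]] by blast

text \<open>
  Insert the inversion formula for the test function and exchange the integrals.
\<close>

lemma Parseval_integrable:
  fixes u \<phi> :: "'a::euclidean_space \<Rightarrow> complex"
  assumes u: "integrable lborel u" and \<phi>: "test_function \<phi>"
  shows "(LINT x|lborel. u x * cnj (\<phi> x)) = (LINT \<omega>|lborel. fourier u \<omega> * cnj (fourier \<phi> \<omega>))"
proof -
  from \<phi> obtain B where \<phi>': "continuous_on UNIV \<phi>" "integrable lborel \<phi>" "\<And>x. cmod (\<phi> x) \<le> B" "integrable lborel (fourier \<phi>)"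
    unfolding test_function_def by blast
  let ?\<kappa> = "complex_of_real (fourier_factor TYPE('a))"
  have inv: "cnj (\<phi> x) = ?\<kappa> * (LINT \<omega>|lborel. cnj (fourier \<phi> \<omega>) * cis (- (x \<bullet> \<omega>)))" for x
  proof -
    have "cnj (\<phi> x) = ?\<kappa> * cnj (LINT \<omega>|lborel. fourier \<phi> \<omega> * cis (x \<bullet> \<omega>))"
      using arg_cong[OF fourier_inversion_bounded[OF \<phi>'(2,4,1,3), of x], of cnj] by simp
    also have "cnj (LINT \<omega>|lborel. fourier \<phi> \<omega> * cis (x \<bullet> \<omega>)) = (LINT \<omega>|lborel. cnj (fourier \<phi> \<omega> * cis (x \<bullet> \<omega>)))"
      by (rule Bochner_Integration.integral_cnj[symmetric])
    finally show ?thesis by (simp add: cis_cnj)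
  qed
  have fc: "integrable lborel (\<lambda>\<omega>. cnj (fourier \<phi> \<omega>))" using \<phi>'(4) by simp
  have "(LINT x|lborel. u x * cnj (\<phi> x)) = (LINT x|lborel. ?\<kappa> * (u x * (LINT \<omega>|lborel. cnj (fourier \<phi> \<omega>) * cis (- (x \<bullet> \<omega>)))))"
    unfolding inv by (intro Bochner_Integration.integral_cong refl) (simp only: mult_ac)
  also have "\<dots> = ?\<kappa> * (LINT x|lborel. u x * (LINT \<omega>|lborel. cnj (fourier \<phi> \<omega>) * cis (- (x \<bullet> \<omega>))))"
    by (rule integral_mult_right_zero)
  also have "(LINT x|lborel. u x * (LINT \<omega>|lborel. cnj (fourier \<phi> \<omega>) * cis (- (x \<bullet> \<omega>)))) =
     (LINT \<omega>|lborel. cnj (fourier \<phi> \<omega>) * (LINT x|lborel. u x * cis (- (x \<bullet> \<omega>))))"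
    by (rule Fubini_kernel[OF u fc, where B=1]) auto
  also have "?\<kappa> * \<dots> = (LINT \<omega>|lborel. ?\<kappa> * (cnj (fourier \<phi> \<omega>) * (LINT x|lborel. u x * cis (- (x \<bullet> \<omega>)))))"
    by (rule integral_mult_right_zero[symmetric])
  also have "\<dots> = (LINT \<omega>|lborel. fourier u \<omega> * cnj (fourier \<phi> \<omega>))"
    by (intro Bochner_Integration.integral_cong refl) (simp only: fourier_cis mult_ac)
  finally show ?thesis .
qed

text \<open>
  Both sides are continuous in the mean along an approximating sequence.
\<close>

theorem Parseval_test_function:
  fixes f g \<phi> :: "'a::euclidean_space \<Rightarrow> complex"
  assumes f: "square_integrable f" and g: "has_fourier_L2 f g" and \<phi>: "test_function \<phi>"
  shows "(LINT x|lborel. f x * cnj (\<phi> x)) = (LINT \<omega>|lborel. g \<omega> * cnj (fourier \<phi> \<omega>))"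
proof -
  obtain u where u: "\<And>n. integrable lborel (u n)" "\<And>n. square_integrable (u n)"
      "(\<lambda>n. L2_sq (\<lambda>x. u n x - f x)) \<longlonglongrightarrow> 0" "(\<lambda>n. L2_sq (\<lambda>\<omega>. fourier (u n) \<omega> - g \<omega>)) \<longlonglongrightarrow> 0"
    using g unfolding has_fourier_L2_iff by blast
  have cnj2: "square_integrable (\<lambda>x. cnj (h x))" if "square_integrable h" for h :: "'a \<Rightarrow> complex"
    using that by (auto simp: square_integrable_def)
  have "(\<lambda>n. LINT x|lborel. u n x * cnj (\<phi> x)) \<longlonglongrightarrow> (LINT x|lborel. f x * cnj (\<phi> x))"
    by (intro L2_tendsto_integral f u cnj2 test_function_square_integrable \<phi>)
  moreover have "(\<lambda>n. LINT \<omega>|lborel. fourier (u n) \<omega> * cnj (fourier \<phi> \<omega>)) \<longlonglongrightarrow> (LINT \<omega>|lborel. g \<omega> * cnj (fourier \<phi> \<omega>))"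
    using g by (intro L2_tendsto_integral u cnj2 test_function_fourier_square_integrable \<phi> square_integrable_fourier)
      (auto simp: has_fourier_L2_iff)
  ultimately show ?thesis unfolding Parseval_integrable[OF u(1) \<phi>] by (rule LIMSEQ_unique)
qed

section \<open>Convolutions and multipliers\<close>

definition convolve :: "('a::euclidean_space \<Rightarrow> complex) \<Rightarrow> ('a \<Rightarrow> complex) \<Rightarrow> 'a \<Rightarrow> complex" where
  "convolve Z f x = (LINT y|lborel. Z y * f (x - y))"

lemma borel_measurable_convolve [measurable]:
  fixes Z f :: "'a::euclidean_space \<Rightarrow> complex"
  assumes [measurable]: "Z \<in> borel_measurable borel" "f \<in> borel_measurable borel"
  shows "convolve Z f \<in> borel_measurable borel"
  unfolding convolve_def[abs_def] by measurable

text \<open>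
  If the weight \<open>W\<close> grows at most by the factor \<open>V \<eta>\<close> under translation by \<open>\<eta>\<close>, convolution is
  bounded in the weighted norm: Cauchy-Schwarz with respect to the measure \<open>|Z \<eta>| d\<eta>\<close>, then Fubini.
\<close>

lemma weighted_Young:
  fixes Z g :: "'a::euclidean_space \<Rightarrow> complex"
  assumes [measurable]: "Z \<in> borel_measurable borel" "g \<in> borel_measurable borel"
      "W \<in> borel_measurable borel" "V \<in> borel_measurable borel"
    and W: "\<And>\<omega>. 0 \<le> W \<omega>" and V: "\<And>\<eta>. 0 \<le> V \<eta>" and WV: "\<And>\<omega> \<eta>. W \<omega> \<le> V \<eta> * W (\<omega> - \<eta>)"
  shows "weighted_sq W (convolve Z g) \<le>
    (\<integral>\<^sup>+\<eta>. ennreal (cmod (Z \<eta>)) \<partial>lborel) * (\<integral>\<^sup>+\<eta>. ennreal (V \<eta> * cmod (Z \<eta>)) \<partial>lborel) * weighted_sq W g"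
proof -
  let ?N = "\<integral>\<^sup>+\<eta>. ennreal (cmod (Z \<eta>)) \<partial>lborel"
  have pointwise: "ennreal (W \<omega> * (cmod (convolve Z g \<omega>))\<^sup>2) \<le>
      ?N * (\<integral>\<^sup>+\<eta>. ennreal (V \<eta> * cmod (Z \<eta>)) * ennreal (W (\<omega> - \<eta>) * (cmod (g (\<omega> - \<eta>)))\<^sup>2) \<partial>lborel)" for \<omega>
  proof -
    have "ennreal (cmod (convolve Z g \<omega>)) \<le> (\<integral>\<^sup>+\<eta>. norm (Z \<eta> * g (\<omega> - \<eta>)) \<partial>lborel)"
      unfolding convolve_def by (rule norm_integral_le_nn)
    also have "\<dots> = (\<integral>\<^sup>+\<eta>. ennreal (sqrt (cmod (Z \<eta>))) * ennreal (sqrt (cmod (Z \<eta>)) * cmod (g (\<omega> - \<eta>))) \<partial>lborel)"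
      by (rule nn_integral_cong) (simp add: ennreal_mult[symmetric] norm_mult mult.assoc[symmetric])
    finally have "(ennreal (cmod (convolve Z g \<omega>)))\<^sup>2 \<le> (\<integral>\<^sup>+\<eta>. ennreal (sqrt (cmod (Z \<eta>))) * ennreal (sqrt (cmod (Z \<eta>)) * cmod (g (\<omega> - \<eta>))) \<partial>lborel)\<^sup>2"
      by (rule power_mono) simp
    also have "\<dots> \<le> (\<integral>\<^sup>+\<eta>. (ennreal (sqrt (cmod (Z \<eta>))))\<^sup>2 \<partial>lborel) * (\<integral>\<^sup>+\<eta>. (ennreal (sqrt (cmod (Z \<eta>)) * cmod (g (\<omega> - \<eta>))))\<^sup>2 \<partial>lborel)"
      by (rule Cauchy_Schwarz_nn_integral) measurable
    also have "\<dots> = ?N * (\<integral>\<^sup>+\<eta>. ennreal (cmod (Z \<eta>) * (cmod (g (\<omega> - \<eta>)))\<^sup>2) \<partial>lborel)"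
      by (simp add: ennreal_power power_mult_distrib)
    finally have "ennreal (W \<omega>) * (ennreal (cmod (convolve Z g \<omega>)))\<^sup>2 \<le> ennreal (W \<omega>) * (?N * (\<integral>\<^sup>+\<eta>. ennreal (cmod (Z \<eta>) * (cmod (g (\<omega> - \<eta>)))\<^sup>2) \<partial>lborel))"
      by (rule mult_left_mono) simp
    also have "\<dots> = ?N * (\<integral>\<^sup>+\<eta>. ennreal (W \<omega>) * ennreal (cmod (Z \<eta>) * (cmod (g (\<omega> - \<eta>)))\<^sup>2) \<partial>lborel)"
      by (subst nn_integral_cmult) (auto simp: mult_ac)
    also have "\<dots> \<le> ?N * (\<integral>\<^sup>+\<eta>. ennreal (V \<eta> * cmod (Z \<eta>)) * ennreal (W (\<omega> - \<eta>) * (cmod (g (\<omega> - \<eta>)))\<^sup>2) \<partial>lborel)"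
    proof (intro mult_left_mono nn_integral_mono)
      fix \<eta>
      have "W \<omega> * (cmod (Z \<eta>) * (cmod (g (\<omega> - \<eta>)))\<^sup>2) \<le> (V \<eta> * W (\<omega> - \<eta>)) * (cmod (Z \<eta>) * (cmod (g (\<omega> - \<eta>)))\<^sup>2)"
        by (rule mult_right_mono[OF WV]) simp
      then show "ennreal (W \<omega>) * ennreal (cmod (Z \<eta>) * (cmod (g (\<omega> - \<eta>)))\<^sup>2) \<le> ennreal (V \<eta> * cmod (Z \<eta>)) * ennreal (W (\<omega> - \<eta>) * (cmod (g (\<omega> - \<eta>)))\<^sup>2)"
        by (simp add: ennreal_mult[symmetric] W V mult_ac)
    qed simp
    finally show ?thesis by (simp add: ennreal_mult W ennreal_power)
  qed
  have "weighted_sq W (convolve Z g) \<le> (\<integral>\<^sup>+\<omega>. ?N * (\<integral>\<^sup>+\<eta>. ennreal (V \<eta> * cmod (Z \<eta>)) * ennreal (W (\<omega> - \<eta>) * (cmod (g (\<omega> - \<eta>)))\<^sup>2) \<partial>lborel) \<partial>lborel)"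
    unfolding weighted_sq_def by (intro nn_integral_mono pointwise)
  also have "\<dots> = ?N * (\<integral>\<^sup>+\<omega>. \<integral>\<^sup>+\<eta>. ennreal (V \<eta> * cmod (Z \<eta>)) * ennreal (W (\<omega> - \<eta>) * (cmod (g (\<omega> - \<eta>)))\<^sup>2) \<partial>lborel \<partial>lborel)"
    by (rule nn_integral_cmult) measurable
  also have "(\<integral>\<^sup>+\<omega>. \<integral>\<^sup>+\<eta>. ennreal (V \<eta> * cmod (Z \<eta>)) * ennreal (W (\<omega> - \<eta>) * (cmod (g (\<omega> - \<eta>)))\<^sup>2) \<partial>lborel \<partial>lborel) =
     (\<integral>\<^sup>+\<eta>. \<integral>\<^sup>+\<omega>. ennreal (V \<eta> * cmod (Z \<eta>)) * ennreal (W (\<omega> - \<eta>) * (cmod (g (\<omega> - \<eta>)))\<^sup>2) \<partial>lborel \<partial>lborel)"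
    by (rule lborel_pair.Fubini') measurable
  also have "\<dots> = (\<integral>\<^sup>+\<eta>. ennreal (V \<eta> * cmod (Z \<eta>)) * weighted_sq W g \<partial>lborel)"
  proof (rule nn_integral_cong)
    fix \<eta> :: 'a
    have "(\<integral>\<^sup>+\<omega>. ennreal (W (\<omega> - \<eta>) * (cmod (g (\<omega> - \<eta>)))\<^sup>2) \<partial>lborel) = weighted_sq W g"
      using nn_integral_translate[of "\<lambda>\<omega>. ennreal (W \<omega> * (cmod (g \<omega>))\<^sup>2)" "- \<eta>"] by (simp add: weighted_sq_def)
    then show "(\<integral>\<^sup>+\<omega>. ennreal (V \<eta> * cmod (Z \<eta>)) * ennreal (W (\<omega> - \<eta>) * (cmod (g (\<omega> - \<eta>)))\<^sup>2) \<partial>lborel) = ennreal (V \<eta> * cmod (Z \<eta>)) * weighted_sq W g"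
      by (subst nn_integral_cmult) auto
  qed
  also have "\<dots> = (\<integral>\<^sup>+\<eta>. ennreal (V \<eta> * cmod (Z \<eta>)) \<partial>lborel) * weighted_sq W g"
    by (rule nn_integral_multc) measurable
  finally show ?thesis by (simp add: mult.assoc)
qed

lemma Young_L1_L2:
  fixes Z g :: "'a::euclidean_space \<Rightarrow> complex"
  assumes "Z \<in> borel_measurable borel" "g \<in> borel_measurable borel"
  shows "L2_sq (convolve Z g) \<le> (\<integral>\<^sup>+\<eta>. ennreal (cmod (Z \<eta>)) \<partial>lborel)\<^sup>2 * L2_sq g"
  using weighted_Young[OF assms, of "\<lambda>_. 1" "\<lambda>_. 1"] by (simp add: power2_eq_square)

lemma nn_integral_norm_finite:
  fixes Z :: "_ \<Rightarrow> 'b::{banach, second_countable_topology}"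
  shows "integrable M Z \<Longrightarrow> (\<integral>\<^sup>+\<eta>. ennreal (norm (Z \<eta>)) \<partial>M) < \<infinity>"
  by (simp add: integrable_iff_bounded)

lemma square_integrable_convolve:
  fixes Z g :: "'a::euclidean_space \<Rightarrow> complex"
  assumes Z: "integrable lborel Z" and g: "square_integrable g"
  shows "square_integrable (convolve Z g)"
proof -
  have [measurable]: "Z \<in> borel_measurable borel" "g \<in> borel_measurable borel"
    using Z g by (auto dest: borel_measurable_integrable)
  have "(\<integral>\<^sup>+\<eta>. ennreal (cmod (Z \<eta>)) \<partial>lborel)\<^sup>2 * L2_sq g < \<infinity>"
    using nn_integral_norm_finite[OF Z] g by (simp add: square_integrable_iff ennreal_mult_less_top power2_eq_square)
  with Young_L1_L2[of Z g] show ?thesis by (simp add: square_integrable_iff order_le_less_trans)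
qed

lemma square_integrable_reflect:
  fixes f :: "'a::euclidean_space \<Rightarrow> complex"
  assumes "square_integrable f"
  shows "square_integrable (\<lambda>y. f (x - y))"
proof -
  have [measurable]: "f \<in> borel_measurable borel" using assms by auto
  show ?thesis
    using assms nn_integral_affine[of "\<lambda>y. ennreal ((cmod (f y))\<^sup>2)" "-1" x]
    by (simp add: square_integrable_iff weighted_sq_def)
qed

lemma convolve_diff:
  fixes Z f g :: "'a::euclidean_space \<Rightarrow> complex"
  assumes "square_integrable Z" "square_integrable f" "square_integrable g"
  shows "convolve Z (\<lambda>x. f x - g x) x = convolve Z f x - convolve Z g x"
  unfolding convolve_def right_diff_distrib
  by (rule Bochner_Integration.integral_diff) (intro integrable_mult_L2 square_integrable_reflect assms)+

lemma
  fixes Z f :: "'a::euclidean_space \<Rightarrow> complex"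
  assumes Z: "integrable lborel Z" and f: "integrable lborel f"
  shows integrable_convolve: "integrable lborel (convolve Z f)"
    and fourier_convolve: "fourier (convolve Z f) \<omega> = fourier Z \<omega> * fourier f \<omega> / of_real (fourier_factor TYPE('a))"
proof -
  have [measurable]: "Z \<in> borel_measurable borel" "f \<in> borel_measurable borel"
    using borel_measurable_integrable[OF Z] borel_measurable_integrable[OF f] by auto
  have translate: "integrable lborel (\<lambda>x. f (x - y))" for y
    using integrable_affine[OF f, of 1 "- y"] by simp
  have norm_translate: "(LINT x|lborel. cmod (f (x - y))) = (LINT x|lborel. cmod (f x))" for y
    using integral_affine[OF integrable_norm[OF f], of 1 "- y"] by simp
  have int: "integrable (lborel \<Otimes>\<^sub>M lborel) (\<lambda>(y, x). Z y * (f (x - y) * cis (- (x \<bullet> \<theta>))))" for \<theta>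
  proof (rule lborel_pair.Fubini_integrable)
    show "AE y in lborel. integrable lborel (\<lambda>x. case (y, x) of (y, x) \<Rightarrow> Z y * (f (x - y) * cis (- (x \<bullet> \<theta>))))"
      by (auto intro!: integrable_mult_right integrable_mult_cis translate)
    have "integrable lborel (\<lambda>y. cmod (Z y) * (LINT x|lborel. cmod (f x)))"
      using Z by simp
    then show "integrable lborel (\<lambda>y. LINT x|lborel. cmod (case (y, x) of (y, x) \<Rightarrow> Z y * (f (x - y) * cis (- (x \<bullet> \<theta>)))))"
      by (simp add: norm_mult norm_translate)
  qed measurable
  show "integrable lborel (convolve Z f)"
    using lborel_pair.integrable_snd[OF int[of 0]] by (simp add: convolve_def[abs_def])
  let ?\<kappa> = "complex_of_real (fourier_factor TYPE('a))"
  have "fourier (convolve Z f) \<omega> = ?\<kappa> * (LINT x|lborel. LINT y|lborel. Z y * (f (x - y) * cis (- (x \<bullet> \<omega>))))"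
    unfolding fourier_cis convolve_def integral_mult_left_zero[symmetric] by (simp only: mult.assoc)
  also have "(LINT x|lborel. LINT y|lborel. Z y * (f (x - y) * cis (- (x \<bullet> \<omega>)))) = (LINT y|lborel. LINT x|lborel. Z y * (f (x - y) * cis (- (x \<bullet> \<omega>))))"
    by (rule lborel_pair.Fubini_integral[OF int])
  also have "\<dots> = (LINT y|lborel. (Z y * cis (- (y \<bullet> \<omega>))) * (LINT x|lborel. f x * cis (- (x \<bullet> \<omega>))))"
  proof (rule Bochner_Integration.integral_cong[OF refl])
    fix y
    have "(LINT x|lborel. f (x - y) * cis (- (x \<bullet> \<omega>))) = (LINT x|lborel. f x * cis (- ((x + y) \<bullet> \<omega>)))"
      using integral_affine[OF integrable_mult_cis[OF translate[of y]], of "\<lambda>x. - (x \<bullet> \<omega>)" 1 y] by (simp add: add.commute)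
    also have "\<dots> = (LINT x|lborel. cis (- (y \<bullet> \<omega>)) * (f x * cis (- (x \<bullet> \<omega>))))"
    proof (rule Bochner_Integration.integral_cong[OF refl])
      fix x
      have "cis (- ((x + y) \<bullet> \<omega>)) = cis (- (y \<bullet> \<omega>)) * cis (- (x \<bullet> \<omega>))"
        by (simp add: cis_mult inner_add_left algebra_simps)
      then show "f x * cis (- ((x + y) \<bullet> \<omega>)) = cis (- (y \<bullet> \<omega>)) * (f x * cis (- (x \<bullet> \<omega>)))"
        by (simp only: mult.left_commute)
    qed
    also have "\<dots> = cis (- (y \<bullet> \<omega>)) * (LINT x|lborel. f x * cis (- (x \<bullet> \<omega>)))"
      by (rule integral_mult_right_zero)
    finally show "(LINT x|lborel. Z y * (f (x - y) * cis (- (x \<bullet> \<omega>)))) = (Z y * cis (- (y \<bullet> \<omega>))) * (LINT x|lborel. f x * cis (- (x \<bullet> \<omega>)))"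
      by (simp only: integral_mult_right_zero mult.assoc)
  qed
  also have "\<dots> = (LINT y|lborel. Z y * cis (- (y \<bullet> \<omega>))) * (LINT x|lborel. f x * cis (- (x \<bullet> \<omega>)))"
    by (rule integral_mult_left_zero)
  finally show "fourier (convolve Z f) \<omega> = fourier Z \<omega> * fourier f \<omega> / ?\<kappa>"
    by (simp add: fourier_cis)
qed

lemma L2_sq_mult_bound:
  fixes f :: "'a::euclidean_space \<Rightarrow> complex"
  assumes [measurable]: "f \<in> borel_measurable borel" and B: "\<And>x. cmod (k x) \<le> B"
  shows "L2_sq (\<lambda>x. k x * f x) \<le> ennreal (B\<^sup>2) * L2_sq f"
proof -
  have "L2_sq (\<lambda>x. k x * f x) \<le> weighted_sq (\<lambda>_. B\<^sup>2) f"
  proof (rule weighted_sq_mono)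
    fix x show "1 * (cmod (k x * f x))\<^sup>2 \<le> B\<^sup>2 * (cmod (f x))\<^sup>2"
      using power_mono[OF B[of x] norm_ge_zero, of 2] by (simp add: norm_mult power_mult_distrib mult_right_mono)
  qed
  also have "\<dots> = ennreal (B\<^sup>2) * L2_sq f"
    by (simp add: weighted_sq_def ennreal_mult nn_integral_cmult)
  finally show ?thesis .
qed

lemma ennreal_cmult_tendsto_0: "f \<longlonglongrightarrow> (0::ennreal) \<Longrightarrow> c < \<infinity> \<Longrightarrow> (\<lambda>n. c * f n) \<longlonglongrightarrow> 0"
  using ennreal_tendsto_cmult[of c f 0 sequentially] by simp

text \<open>
  Pass to the limit in \<open>fourier_convolve\<close>, using Young's inequality on the space side and boundedness of the
  multiplier on the Fourier side.
\<close>

lemma has_fourier_L2_convolve: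
  fixes Z f g :: "'a::euclidean_space \<Rightarrow> complex"
  assumes Z: "integrable lborel Z" "square_integrable Z" and f: "square_integrable f" and g: "has_fourier_L2 f g"
  shows "has_fourier_L2 (convolve Z f) (\<lambda>\<omega>. fourier Z \<omega> / of_real (fourier_factor TYPE('a)) * g \<omega>)"
proof -
  obtain u where u: "\<And>n. integrable lborel (u n)" "\<And>n. square_integrable (u n)"
      "(\<lambda>n. L2_sq (\<lambda>x. u n x - f x)) \<longlonglongrightarrow> 0" "(\<lambda>n. L2_sq (\<lambda>\<omega>. fourier (u n) \<omega> - g \<omega>)) \<longlonglongrightarrow> 0"
    and g2: "square_integrable g"
    using g unfolding has_fourier_L2_iff by blast
  have [measurable]: "Z \<in> borel_measurable borel" "f \<in> borel_measurable borel" "g \<in> borel_measurable borel"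
    "u n \<in> borel_measurable borel" for n
    using Z(2) f g2 u(2) by auto
  define B where "B = (LINT x|lborel. cmod (Z x))"
  have B: "cmod (fourier Z \<omega> / of_real (fourier_factor TYPE('a))) \<le> B" for \<omega>
    using cmod_fourier_le[of Z \<omega>] by (simp add: B_def norm_divide divide_simps mult.commute)
  show ?thesis unfolding has_fourier_L2_iff
  proof (intro conjI exI[of _ "\<lambda>n. convolve Z (u n)"] allI)
    show "square_integrable (\<lambda>\<omega>. fourier Z \<omega> / of_real (fourier_factor TYPE('a)) * g \<omega>)"
      by (rule square_integrable_mult_bounded[OF g2 _ B]) measurable
    show "integrable lborel (convolve Z (u n))" for n by (intro integrable_convolve Z u)
    show "square_integrable (convolve Z (u n))" for n by (intro square_integrable_convolve Z u)
    show "(\<lambda>n. L2_sq (\<lambda>x. convolve Z (u n) x - convolve Z f x)) \<longlonglongrightarrow> 0"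
    proof (rule ennreal_squeeze_0)
      show "(\<lambda>n. (\<integral>\<^sup>+\<eta>. ennreal (cmod (Z \<eta>)) \<partial>lborel)\<^sup>2 * L2_sq (\<lambda>x. u n x - f x)) \<longlonglongrightarrow> 0"
        using nn_integral_norm_finite[OF Z(1)]
        by (intro ennreal_cmult_tendsto_0 u) (simp add: power2_eq_square ennreal_mult_less_top)
      show "L2_sq (\<lambda>x. convolve Z (u n) x - convolve Z f x) \<le> (\<integral>\<^sup>+\<eta>. ennreal (cmod (Z \<eta>)) \<partial>lborel)\<^sup>2 * L2_sq (\<lambda>x. u n x - f x)" for n
        using Young_L1_L2[of Z "\<lambda>x. u n x - f x"] unfolding convolve_diff[OF Z(2) u(2) f, abs_def] by simp
    qed
    show "(\<lambda>n. L2_sq (\<lambda>\<omega>. fourier (convolve Z (u n)) \<omega> - fourier Z \<omega> / of_real (fourier_factor TYPE('a)) * g \<omega>)) \<longlonglongrightarrow> 0"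
    proof (rule ennreal_squeeze_0)
      show "(\<lambda>n. ennreal (B\<^sup>2) * L2_sq (\<lambda>\<omega>. fourier (u n) \<omega> - g \<omega>)) \<longlonglongrightarrow> 0"
        by (intro ennreal_cmult_tendsto_0 u) simp
      show "L2_sq (\<lambda>\<omega>. fourier (convolve Z (u n)) \<omega> - fourier Z \<omega> / of_real (fourier_factor TYPE('a)) * g \<omega>) \<le> ennreal (B\<^sup>2) * L2_sq (\<lambda>\<omega>. fourier (u n) \<omega> - g \<omega>)" for n
      proof -
        have "fourier (convolve Z (u n)) \<omega> - fourier Z \<omega> / of_real (fourier_factor TYPE('a)) * g \<omega> = fourier Z \<omega> / of_real (fourier_factor TYPE('a)) * (fourier (u n) \<omega> - g \<omega>)" for \<omega>
          by (simp add: fourier_convolve[OF Z(1) u(1)] right_diff_distrib diff_divide_distrib)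
        then show ?thesis using L2_sq_mult_bound[of "\<lambda>\<omega>. fourier (u n) \<omega> - g \<omega>", OF _ B] by simp
      qed
    qed
  qed
qed

text \<open>
  The normalising factor is omitted, so that the value at the origin is the integral of \<open>Z\<close>: a mollifier has
  an inverse transform bounded by one.
\<close>

definition inverse_transform :: "('a::euclidean_space \<Rightarrow> complex) \<Rightarrow> 'a \<Rightarrow> complex" where
  "inverse_transform Z x = (LINT \<eta>|lborel. Z \<eta> * cis (x \<bullet> \<eta>))"

lemma borel_measurable_inverse_transform [measurable]:
  fixes Z :: "'a::euclidean_space \<Rightarrow> complex"
  assumes [measurable]: "Z \<in> borel_measurable borel"
  shows "inverse_transform Z \<in> borel_measurable borel"
  unfolding inverse_transform_def[abs_def] by measurable

lemma cmod_inverse_transform_le: "cmod (inverse_transform Z x) \<le> (LINT \<eta>|lborel. cmod (Z \<eta>))"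
  unfolding inverse_transform_def using integral_norm_bound[of lborel "\<lambda>\<eta>. Z \<eta> * cis (x \<bullet> \<eta>)"]
  by (simp add: norm_mult)

lemma fourier_inverse_transform_mult:
  fixes Z f :: "'a::euclidean_space \<Rightarrow> complex"
  assumes Z: "integrable lborel Z" and f: "integrable lborel f"
  shows "fourier (\<lambda>x. inverse_transform Z x * f x) \<omega> = convolve Z (fourier f) \<omega>"
proof -
  have [measurable]: "Z \<in> borel_measurable borel" "f \<in> borel_measurable borel"
    using borel_measurable_integrable[OF Z] borel_measurable_integrable[OF f] by auto
  let ?\<kappa> = "complex_of_real (fourier_factor TYPE('a))"
  have fc: "integrable lborel (\<lambda>x. f x * cis (- (x \<bullet> \<omega>)))" by (rule integrable_mult_cis[OF f]) measurable
  have "fourier (\<lambda>x. inverse_transform Z x * f x) \<omega> = ?\<kappa> * (LINT x|lborel. (f x * cis (- (x \<bullet> \<omega>))) * (LINT \<eta>|lborel. Z \<eta> * cis (x \<bullet> \<eta>)))"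
    unfolding fourier_cis inverse_transform_def by (simp only: mult_ac)
  also have "(LINT x|lborel. (f x * cis (- (x \<bullet> \<omega>))) * (LINT \<eta>|lborel. Z \<eta> * cis (x \<bullet> \<eta>))) =
    (LINT \<eta>|lborel. Z \<eta> * (LINT x|lborel. (f x * cis (- (x \<bullet> \<omega>))) * cis (x \<bullet> \<eta>)))"
    by (rule Fubini_kernel[OF fc Z, where B=1]) auto
  also have "?\<kappa> * \<dots> = (LINT \<eta>|lborel. ?\<kappa> * (Z \<eta> * (LINT x|lborel. (f x * cis (- (x \<bullet> \<omega>))) * cis (x \<bullet> \<eta>))))"
    by (rule integral_mult_right_zero[symmetric])
  also have "\<dots> = convolve Z (fourier f) \<omega>"
    unfolding convolve_def fourier_cis
    by (intro Bochner_Integration.integral_cong refl) (simp add: cis_mult mult.assoc inner_diff_right mult.left_commute)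
  finally show ?thesis .
qed

text \<open>
  Multiplication by a function that is given as an inverse transform is convolution on the Fourier side; this
  is how the cut-off functions of the partition act on Sobolev norms.
\<close>

lemma has_fourier_L2_inverse_transform_mult:
  fixes Z f g :: "'a::euclidean_space \<Rightarrow> complex"
  assumes Z: "integrable lborel Z" "square_integrable Z" and f: "square_integrable f" and g: "has_fourier_L2 f g"
  shows "has_fourier_L2 (\<lambda>x. inverse_transform Z x * f x) (convolve Z g)"
proof -
  obtain u where u: "\<And>n. integrable lborel (u n)" "\<And>n. square_integrable (u n)"
      "(\<lambda>n. L2_sq (\<lambda>x. u n x - f x)) \<longlonglongrightarrow> 0" "(\<lambda>n. L2_sq (\<lambda>\<omega>. fourier (u n) \<omega> - g \<omega>)) \<longlonglongrightarrow> 0"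
    and g2: "square_integrable g"
    using g unfolding has_fourier_L2_iff by blast
  have [measurable]: "Z \<in> borel_measurable borel" "f \<in> borel_measurable borel" "g \<in> borel_measurable borel"
    "u n \<in> borel_measurable borel" for n
    using Z(2) f g2 u(2) by auto
  define B where "B = (LINT x|lborel. cmod (Z x))"
  have B: "cmod (inverse_transform Z x) \<le> B" for x
    unfolding B_def by (rule cmod_inverse_transform_le)
  show ?thesis unfolding has_fourier_L2_iff
  proof (intro conjI exI[of _ "\<lambda>n x. inverse_transform Z x * u n x"] allI)
    show "square_integrable (convolve Z g)" by (intro square_integrable_convolve Z g2)
    show "integrable lborel (\<lambda>x. inverse_transform Z x * u n x)" for n
      by (subst mult.commute, rule integrable_mult_bounded[OF u(1) _ B]) measurable
    show "square_integrable (\<lambda>x. inverse_transform Z x * u n x)" for n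
      by (rule square_integrable_mult_bounded[OF u(2) _ B]) measurable
    show "(\<lambda>n. L2_sq (\<lambda>x. inverse_transform Z x * u n x - inverse_transform Z x * f x)) \<longlonglongrightarrow> 0"
    proof (rule ennreal_squeeze_0)
      show "(\<lambda>n. ennreal (B\<^sup>2) * L2_sq (\<lambda>x. u n x - f x)) \<longlonglongrightarrow> 0"
        by (intro ennreal_cmult_tendsto_0 u) simp
      show "L2_sq (\<lambda>x. inverse_transform Z x * u n x - inverse_transform Z x * f x) \<le> ennreal (B\<^sup>2) * L2_sq (\<lambda>x. u n x - f x)" for n
        unfolding right_diff_distrib[symmetric] by (rule L2_sq_mult_bound[OF _ B]) measurable
    qed
    show "(\<lambda>n. L2_sq (\<lambda>\<omega>. fourier (\<lambda>x. inverse_transform Z x * u n x) \<omega> - convolve Z g \<omega>)) \<longlonglongrightarrow> 0"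
    proof (rule ennreal_squeeze_0)
      show "(\<lambda>n. (\<integral>\<^sup>+\<eta>. ennreal (cmod (Z \<eta>)) \<partial>lborel)\<^sup>2 * L2_sq (\<lambda>\<omega>. fourier (u n) \<omega> - g \<omega>)) \<longlonglongrightarrow> 0"
        using nn_integral_norm_finite[OF Z(1)]
        by (intro ennreal_cmult_tendsto_0 u) (simp add: power2_eq_square ennreal_mult_less_top)
      show "L2_sq (\<lambda>\<omega>. fourier (\<lambda>x. inverse_transform Z x * u n x) \<omega> - convolve Z g \<omega>) \<le> (\<integral>\<^sup>+\<eta>. ennreal (cmod (Z \<eta>)) \<partial>lborel)\<^sup>2 * L2_sq (\<lambda>\<omega>. fourier (u n) \<omega> - g \<omega>)" for n
        unfolding fourier_inverse_transform_mult[OF Z(1) u(1)]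
        using Young_L1_L2[of Z "\<lambda>\<omega>. fourier (u n) \<omega> - g \<omega>"]
        unfolding convolve_diff[OF Z(2) square_integrable_fourier[OF u(1,2)] g2, abs_def] by simp
    qed
  qed
qed

lemma has_fourier_L2_add:
  fixes f f' g g' :: "'a::euclidean_space \<Rightarrow> complex"
  assumes f: "square_integrable f" "has_fourier_L2 f g" and f': "square_integrable f'" "has_fourier_L2 f' g'"
  shows "has_fourier_L2 (\<lambda>x. f x + f' x) (\<lambda>\<omega>. g \<omega> + g' \<omega>)"
proof -
  obtain u where u: "\<And>n. integrable lborel (u n)" "\<And>n. square_integrable (u n)"
      "(\<lambda>n. L2_sq (\<lambda>x. u n x - f x)) \<longlonglongrightarrow> 0" "(\<lambda>n. L2_sq (\<lambda>\<omega>. fourier (u n) \<omega> - g \<omega>)) \<longlonglongrightarrow> 0"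
    and g2: "square_integrable g"
    using f(2) unfolding has_fourier_L2_iff by blast
  obtain u' where u': "\<And>n. integrable lborel (u' n)" "\<And>n. square_integrable (u' n)"
      "(\<lambda>n. L2_sq (\<lambda>x. u' n x - f' x)) \<longlonglongrightarrow> 0" "(\<lambda>n. L2_sq (\<lambda>\<omega>. fourier (u' n) \<omega> - g' \<omega>)) \<longlonglongrightarrow> 0"
    and g2': "square_integrable g'"
    using f'(2) unfolding has_fourier_L2_iff by blast
  have [measurable]: "f \<in> borel_measurable borel" "g \<in> borel_measurable borel" "f' \<in> borel_measurable borel" "g' \<in> borel_measurable borel"
    "u n \<in> borel_measurable borel" "u' n \<in> borel_measurable borel" for n
    using f(1) f'(1) g2 g2' u(2) u'(2) by auto
  have lim: "(\<lambda>n. 2 * a n + 2 * b n) \<longlonglongrightarrow> 0" if "a \<longlonglongrightarrow> 0" "b \<longlonglongrightarrow> 0" for a b :: "nat \<Rightarrow> ennreal"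
    using tendsto_add[OF ennreal_cmult_tendsto_0[OF that(1), of 2] ennreal_cmult_tendsto_0[OF that(2), of 2]] by simp
  have split: "L2_sq (\<lambda>x. (p x + p' x) - (q x + q' x)) \<le> 2 * L2_sq (\<lambda>x. p x - q x) + 2 * L2_sq (\<lambda>x. p' x - q' x)"
    if [measurable]: "p \<in> borel_measurable borel" "q \<in> borel_measurable borel" "p' \<in> borel_measurable borel" "q' \<in> borel_measurable borel"
    for p p' q q' :: "'a \<Rightarrow> complex"
    using weighted_sq_add[of "\<lambda>x. p x - q x" "\<lambda>x. p' x - q' x" "\<lambda>_. 1"] by (simp add: algebra_simps)
  show ?thesis unfolding has_fourier_L2_iff
  proof (intro conjI exI[of _ "\<lambda>n x. u n x + u' n x"] allI)
    show "square_integrable (\<lambda>\<omega>. g \<omega> + g' \<omega>)" by (intro square_integrable_add g2 g2')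
    show "integrable lborel (\<lambda>x. u n x + u' n x)" for n by (intro Bochner_Integration.integrable_add u u')
    show "square_integrable (\<lambda>x. u n x + u' n x)" for n by (intro square_integrable_add u u')
    show "(\<lambda>n. L2_sq (\<lambda>x. u n x + u' n x - (f x + f' x))) \<longlonglongrightarrow> 0"
      by (rule ennreal_squeeze_0[OF lim[OF u(3) u'(3)] split]) measurable
    show "(\<lambda>n. L2_sq (\<lambda>\<omega>. fourier (\<lambda>x. u n x + u' n x) \<omega> - (g \<omega> + g' \<omega>))) \<longlonglongrightarrow> 0"
      unfolding fourier_add[OF u(1) u'(1)]
      by (rule ennreal_squeeze_0[OF lim[OF u(4) u'(4)] split]) measurable
  qed
qed

lemma square_integrable_0: "square_integrable (\<lambda>_. 0)"
  by (simp add: square_integrable_def)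

lemma has_fourier_L2_0: "has_fourier_L2 (\<lambda>_. 0) (\<lambda>_. 0)"
  unfolding has_fourier_L2_iff
  by (intro conjI exI[of _ "\<lambda>_ _. 0"]) (auto simp: weighted_sq_def square_integrable_0 fourier_def)

lemma square_integrable_sum:
  "finite I \<Longrightarrow> (\<And>i. i \<in> I \<Longrightarrow> square_integrable (f i)) \<Longrightarrow> square_integrable (\<lambda>x. \<Sum>i\<in>I. f i x)"
  by (induction I rule: finite_induct) (auto simp: square_integrable_0 intro!: square_integrable_add)

lemma has_fourier_L2_sum:
  fixes f g :: "'i \<Rightarrow> 'a::euclidean_space \<Rightarrow> complex"
  assumes "finite I" "\<And>i. i \<in> I \<Longrightarrow> square_integrable (f i)" "\<And>i. i \<in> I \<Longrightarrow> has_fourier_L2 (f i) (g i)"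
  shows "has_fourier_L2 (\<lambda>x. \<Sum>i\<in>I. f i x) (\<lambda>\<omega>. \<Sum>i\<in>I. g i \<omega>)"
  using assms
  by (induction I rule: finite_induct) (auto simp: has_fourier_L2_0 intro!: has_fourier_L2_add square_integrable_sum)

lemma weighted_sq_sum_le:
  fixes g :: "'i \<Rightarrow> 'a::euclidean_space \<Rightarrow> complex"
  assumes "finite I" and m: "\<And>i. i \<in> I \<Longrightarrow> g i \<in> borel_measurable borel" and W[measurable]: "W \<in> borel_measurable borel"
    and W0: "\<And>x. 0 \<le> W x"
  shows "weighted_sq W (\<lambda>x. \<Sum>i\<in>I. g i x) \<le> of_nat (card I) * (\<Sum>i\<in>I. weighted_sq W (g i))"
proof -
  have "W x * (cmod (\<Sum>i\<in>I. g i x))\<^sup>2 \<le> (\<Sum>i\<in>I. real (card I) * (W x * (cmod (g i x))\<^sup>2))" for x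
  proof -
    have "(cmod (\<Sum>i\<in>I. g i x))\<^sup>2 \<le> (\<Sum>i\<in>I. 1 * cmod (g i x))\<^sup>2"
      by (intro power_mono) (auto simp: norm_sum)
    also have "\<dots> \<le> (\<Sum>i\<in>I. 1\<^sup>2) * (\<Sum>i\<in>I. (cmod (g i x))\<^sup>2)" by (rule Cauchy_Schwarz_ineq_sum)
    finally have "(cmod (\<Sum>i\<in>I. g i x))\<^sup>2 \<le> real (card I) * (\<Sum>i\<in>I. (cmod (g i x))\<^sup>2)" by simp
    from mult_left_mono[OF this W0[of x]] show ?thesis by (simp add: sum_distrib_left mult_ac)
  qed
  then have "ennreal (W x * (cmod (\<Sum>i\<in>I. g i x))\<^sup>2) \<le> ennreal (\<Sum>i\<in>I. real (card I) * (W x * (cmod (g i x))\<^sup>2))" for x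
    by (rule ennreal_leI)
  also have "ennreal (\<Sum>i\<in>I. real (card I) * (W x * (cmod (g i x))\<^sup>2)) = (\<Sum>i\<in>I. ennreal (real (card I)) * ennreal (W x * (cmod (g i x))\<^sup>2))" for x
    by (subst sum_ennreal[symmetric]) (auto simp: W0 ennreal_mult simp del: ennreal_of_nat_eq_real_of_nat intro!: sum.cong)
  finally have "weighted_sq W (\<lambda>x. \<Sum>i\<in>I. g i x) \<le> (\<integral>\<^sup>+x. (\<Sum>i\<in>I. ennreal (real (card I)) * ennreal (W x * (cmod (g i x))\<^sup>2)) \<partial>lborel)"
    unfolding weighted_sq_def by (intro nn_integral_mono)
  also have "\<dots> = (\<Sum>i\<in>I. ennreal (real (card I)) * weighted_sq W (g i))"
    unfolding weighted_sq_def using m by (subst nn_integral_sum) (auto simp: nn_integral_cmult)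
  finally show ?thesis by (simp add: sum_distrib_left ennreal_of_nat_eq_real_of_nat)
qed

lemma has_fourier_L2_uminus:
  fixes f g :: "'a::euclidean_space \<Rightarrow> complex"
  assumes "has_fourier_L2 f g"
  shows "has_fourier_L2 (\<lambda>x. - f x) (\<lambda>\<omega>. - g \<omega>)"
proof -
  obtain u where u: "\<And>n. integrable lborel (u n)" "\<And>n. square_integrable (u n)"
      "(\<lambda>n. L2_sq (\<lambda>x. u n x - f x)) \<longlonglongrightarrow> 0" "(\<lambda>n. L2_sq (\<lambda>\<omega>. fourier (u n) \<omega> - g \<omega>)) \<longlonglongrightarrow> 0"
    and g2: "square_integrable g"
    using assms unfolding has_fourier_L2_iff by blast
  have f: "fourier (\<lambda>x. - u n x) \<omega> = - fourier (u n) \<omega>" for n \<omega> by (simp add: fourier_cis)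
  have m: "L2_sq (\<lambda>x. - p x - - q x) = L2_sq (\<lambda>x. p x - q x)" for p q :: "'a \<Rightarrow> complex"
    using weighted_sq_uminus[of "\<lambda>_. 1" "\<lambda>x. p x - q x"] by simp
  show ?thesis unfolding has_fourier_L2_iff
    by (intro conjI exI[of _ "\<lambda>n x. - u n x"] allI)
      (use u g2 in \<open>simp_all only: f m, auto simp: square_integrable_def\<close>)
qed

lemma has_fourier_L2_diff:
  fixes f f' g g' :: "'a::euclidean_space \<Rightarrow> complex"
  assumes f: "square_integrable f" "has_fourier_L2 f g" and f': "square_integrable f'" "has_fourier_L2 f' g'"
  shows "has_fourier_L2 (\<lambda>x. f x - f' x) (\<lambda>\<omega>. g \<omega> - g' \<omega>)"
proof -
  have "square_integrable (\<lambda>x. - f' x)" using f'(1) by (simp add: square_integrable_def)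
  from has_fourier_L2_add[OF f this has_fourier_L2_uminus[OF f'(2)]] show ?thesis by simp
qed

lemma weighted_sq_le_cmult:
  fixes f g :: "'a::euclidean_space \<Rightarrow> complex"
  assumes [measurable]: "g \<in> borel_measurable borel" "W' \<in> borel_measurable borel"
    and W': "\<And>x. 0 \<le> W' x" and c: "0 \<le> c" and le: "\<And>x. W x * (cmod (f x))\<^sup>2 \<le> c * (W' x * (cmod (g x))\<^sup>2)"
  shows "weighted_sq W f \<le> ennreal c * weighted_sq W' g"
proof -
  have "weighted_sq W f \<le> (\<integral>\<^sup>+x. ennreal c * ennreal (W' x * (cmod (g x))\<^sup>2) \<partial>lborel)"
    unfolding weighted_sq_def using le by (intro nn_integral_mono) (simp add: ennreal_mult[symmetric] c W' ennreal_leI)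
  also have "\<dots> = ennreal c * weighted_sq W' g"
    unfolding weighted_sq_def by (rule nn_integral_cmult) measurable
  finally show ?thesis .
qed

section \<open>Sobolev weights\<close>

definition sobolev_weight :: "real \<Rightarrow> real \<Rightarrow> 'a::euclidean_space \<Rightarrow> real" where
  "sobolev_weight \<delta> s \<omega> = (1 + \<delta>\<^sup>2 * (norm \<omega>)\<^sup>2) powr s"

lemma one_plus_sq_pos: "0 < 1 + \<delta>\<^sup>2 * (norm \<omega>)\<^sup>2"
  by (simp add: add_pos_nonneg)

lemma sobolev_weight_pos [simp]: "0 < sobolev_weight \<delta> s \<omega>"
  using one_plus_sq_pos[of \<delta> \<omega>] by (simp add: sobolev_weight_def)

lemma sobolev_weight_nonneg [simp]: "0 \<le> sobolev_weight \<delta> s \<omega>"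
  by (simp add: less_imp_le)

lemma sobolev_weight_neq_0 [simp]: "sobolev_weight \<delta> s \<omega> \<noteq> 0"
  using sobolev_weight_pos[of \<delta> s \<omega>] by linarith

lemma borel_measurable_sobolev_weight [measurable]: "sobolev_weight \<delta> s \<in> borel_measurable borel"
  unfolding sobolev_weight_def[abs_def] by measurable

lemma sobolev_weight_add: "sobolev_weight \<delta> (s + t) \<omega> = sobolev_weight \<delta> s \<omega> * sobolev_weight \<delta> t \<omega>"
  by (simp add: sobolev_weight_def powr_add)

lemma sobolev_weight_minus: "sobolev_weight \<delta> (- s) \<omega> = inverse (sobolev_weight \<delta> s \<omega>)"
  by (simp add: sobolev_weight_def powr_minus)

lemma sobolev_weight_0 [simp]: "sobolev_weight \<delta> 0 \<omega> = 1"
  using one_plus_sq_pos[of \<delta> \<omega>] by (simp add: sobolev_weight_def)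

lemma sobolev_weight_mono: "s \<le> t \<Longrightarrow> sobolev_weight \<delta> s \<omega> \<le> sobolev_weight \<delta> t \<omega>"
  unfolding sobolev_weight_def by (intro powr_mono) auto

text \<open>
  A Sobolev weight changes under translation by at most a polynomial factor, uniformly in \<open>\<delta> \<le> 1\<close>. For
  negative order the roles of the two frequencies are exchanged.
\<close>

lemma Peetre_inequality:
  fixes \<omega> \<eta> :: "'a::euclidean_space"
  assumes "0 \<le> \<delta>" "\<delta> \<le> 1"
  shows "sobolev_weight \<delta> s \<omega> \<le> 2 powr \<bar>s\<bar> * sobolev_weight 1 \<bar>s\<bar> \<eta> * sobolev_weight \<delta> s (\<omega> - \<eta>)"
proof -
  have base: "1 + \<delta>\<^sup>2 * (norm \<omega>)\<^sup>2 \<le> 2 * (1 + 1\<^sup>2 * (norm \<eta>)\<^sup>2) * (1 + \<delta>\<^sup>2 * (norm (\<omega> - \<eta>))\<^sup>2)" for \<omega> \<eta> :: 'a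
  proof -
    have "(norm \<omega>)\<^sup>2 \<le> 2 * (norm \<eta>)\<^sup>2 + 2 * (norm (\<omega> - \<eta>))\<^sup>2"
      using norm_sum_sq_le[of \<eta> "\<omega> - \<eta>"] by simp
    from mult_left_mono[OF this, of "\<delta>\<^sup>2"]
    have "\<delta>\<^sup>2 * (norm \<omega>)\<^sup>2 \<le> 2 * (\<delta>\<^sup>2 * (norm \<eta>)\<^sup>2) + 2 * (\<delta>\<^sup>2 * (norm (\<omega> - \<eta>))\<^sup>2)"
      by (simp add: algebra_simps)
    moreover have "\<delta>\<^sup>2 * (norm \<eta>)\<^sup>2 \<le> 1 * (norm \<eta>)\<^sup>2"
      using assms by (intro mult_right_mono) (auto simp: power_le_one)
    moreover have "0 \<le> (norm \<eta>)\<^sup>2 * (\<delta>\<^sup>2 * (norm (\<omega> - \<eta>))\<^sup>2)" by simp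
    moreover have "2 * (1 + 1\<^sup>2 * N) * (1 + D) = 2 + 2 * D + 2 * N + 2 * (N * D)" for N D :: real
      by (simp add: algebra_simps)
    ultimately show ?thesis by smt
  qed
  have pm: "(2 * a * b) powr r = 2 powr r * a powr r * b powr r" if "0 \<le> a" "0 \<le> b" for a b r :: real
    using that by (simp add: powr_mult)
  show ?thesis
  proof (cases "0 \<le> s")
    case True
    have "(1 + \<delta>\<^sup>2 * (norm \<omega>)\<^sup>2) powr s \<le> (2 * (1 + 1\<^sup>2 * (norm \<eta>)\<^sup>2) * (1 + \<delta>\<^sup>2 * (norm (\<omega> - \<eta>))\<^sup>2)) powr s"
      by (rule powr_mono2[OF True _ base]) (use one_plus_sq_pos[of \<delta> \<omega>] in simp)
    then show ?thesis using True by (subst (asm) pm) (simp_all add: sobolev_weight_def)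
  next
    case False
    have "1 + \<delta>\<^sup>2 * (norm (\<omega> - \<eta>))\<^sup>2 \<le> 2 * (1 + 1\<^sup>2 * (norm \<eta>)\<^sup>2) * (1 + \<delta>\<^sup>2 * (norm \<omega>)\<^sup>2)"
      using base[of "\<omega> - \<eta>" "- \<eta>"] by simp
    then have "(1 + \<delta>\<^sup>2 * (norm (\<omega> - \<eta>))\<^sup>2) powr (- s) \<le> (2 * (1 + 1\<^sup>2 * (norm \<eta>)\<^sup>2) * (1 + \<delta>\<^sup>2 * (norm \<omega>)\<^sup>2)) powr (- s)"
      using False one_plus_sq_pos[of \<delta> "\<omega> - \<eta>"] by (intro powr_mono2) auto
    then have "sobolev_weight \<delta> (- s) (\<omega> - \<eta>) \<le> 2 powr \<bar>s\<bar> * sobolev_weight 1 \<bar>s\<bar> \<eta> * sobolev_weight \<delta> (- s) \<omega>"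
      using False by (subst (asm) pm) (simp_all add: sobolev_weight_def)
    from mult_right_mono[OF this, of "sobolev_weight \<delta> s \<omega> * sobolev_weight \<delta> s (\<omega> - \<eta>)"]
    show ?thesis by (simp add: sobolev_weight_minus field_simps)
  qed
qed

lemma
  fixes w g :: "'a::euclidean_space \<Rightarrow> complex"
  assumes w: "square_integrable w" and g: "has_fourier_L2 w g"
  shows scaled_sobolev_space_iff: "w \<in> scaled_sobolev_space \<delta> s \<longleftrightarrow> weighted_sq (sobolev_weight \<delta> s) g < \<infinity>"
    and scaled_sobolev_norm_sq: "w \<in> scaled_sobolev_space \<delta> s \<Longrightarrow>
      ennreal ((scaled_sobolev_norm \<delta> s w)\<^sup>2) = ennreal (fourier_factor TYPE('a)) * weighted_sq (sobolev_weight \<delta> s) g"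
proof -
  have h: "has_fourier_L2 w (fourier_L2 w)" by (rule has_fourier_L2_fourier_L2[OF w])
  have [measurable]: "fourier_L2 w \<in> borel_measurable borel" using h by (auto simp: has_fourier_L2_def)
  have "AE \<omega> in lborel. fourier_L2 w \<omega> = g \<omega>" by (rule has_fourier_L2_unique[OF w h g])
  then have eq: "weighted_sq (sobolev_weight \<delta> s) g = (\<integral>\<^sup>+\<omega>. ennreal ((1 + \<delta>\<^sup>2 * (norm \<omega>)\<^sup>2) powr s * (cmod (fourier_L2 w \<omega>))\<^sup>2) \<partial>lborel)"
    using weighted_sq_cong_AE[of "fourier_L2 w" g "sobolev_weight \<delta> s"] unfolding weighted_sq_def[of _ "fourier_L2 w"] sobolev_weight_def by simp
  show "w \<in> scaled_sobolev_space \<delta> s \<longleftrightarrow> weighted_sq (sobolev_weight \<delta> s) g < \<infinity>"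
    using w unfolding eq by (auto simp: scaled_sobolev_space_def integrable_iff_bounded abs_mult)
  assume ws: "w \<in> scaled_sobolev_space \<delta> s"
  have "ennreal (LINT \<omega>|lborel. (1 + \<delta>\<^sup>2 * (norm \<omega>)\<^sup>2) powr s * (cmod (fourier_L2 w \<omega>))\<^sup>2) = weighted_sq (sobolev_weight \<delta> s) g"
    unfolding eq using ws by (intro nn_integral_eq_integral[symmetric]) (auto simp: scaled_sobolev_space_def)
  moreover have "0 \<le> (LINT \<omega>|lborel. (1 + \<delta>\<^sup>2 * (norm \<omega>)\<^sup>2) powr s * (cmod (fourier_L2 w \<omega>))\<^sup>2)"
    by (intro Bochner_Integration.integral_nonneg) simp
  ultimately show "ennreal ((scaled_sobolev_norm \<delta> s w)\<^sup>2) = ennreal (fourier_factor TYPE('a)) * weighted_sq (sobolev_weight \<delta> s) g"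
    unfolding scaled_sobolev_norm_def fourier_factor_def
    by (subst real_sqrt_pow2) (auto simp: ennreal_mult)
qed

lemma scaled_sobolev_norm_nonneg: "0 \<le> scaled_sobolev_norm \<delta> s w"
  unfolding scaled_sobolev_norm_def by (intro real_sqrt_ge_zero mult_nonneg_nonneg Bochner_Integration.integral_nonneg) auto

lemma ennreal_le_suminf: "f k \<le> (\<Sum>k. f k)" for f :: "nat \<Rightarrow> ennreal"
  using sum_le_suminf[of f "{k}"] by simp

text \<open>
  Dyadic shells: on the shell of radius \<open>2\<^sup>k\<close> the weight is about \<open>2\<^bsup>-2 k \<sigma>\<^esup>\<close> and the volume about \<open>2\<^bsup>k d\<^esup>\<close>, which gives
  a geometric series of ratio \<open>2\<^bsup>d - 2 \<sigma>\<^esup> < 1\<close>.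
\<close>

lemma nn_integral_sobolev_weight_finite:
  assumes \<sigma>: "real DIM('a::euclidean_space) / 2 < \<sigma>"
  shows "(\<integral>\<^sup>+\<omega>. ennreal (sobolev_weight 1 (- \<sigma>) (\<omega>::'a)) \<partial>lborel) < \<infinity>"
proof -
  let ?d = "real DIM('a)"
  have \<sigma>0: "0 < \<sigma>" using \<sigma> by (rule order.strict_trans1[rotated]) simp
  define r where "r = 2 powr (?d - 2 * \<sigma>)"
  have r: "0 < r" "r < 1"
    using \<sigma> by (auto simp: r_def powr_less_one)
  define A where "A = 4 powr \<sigma>"
  have le: "ennreal (sobolev_weight 1 (- \<sigma>) \<omega>) \<le> (\<Sum>k. ennreal (A * (2 powr (- 2 * \<sigma>)) ^ k) * indicator (cball 0 (2 ^ k)) \<omega>)" (is "_ \<le> (\<Sum>k. ?f k)") for \<omega> :: 'a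
  proof -
    define k where "k = (LEAST k. norm \<omega> \<le> 2 ^ k)"
    have ex: "\<exists>k. norm \<omega> \<le> 2 ^ k"
      using real_arch_pow[of 2 "norm \<omega>"] less_imp_le by auto
    then have k: "norm \<omega> \<le> 2 ^ k" unfolding k_def by (rule LeastI_ex)
    have "sobolev_weight 1 (- \<sigma>) \<omega> \<le> A * (2 powr (- 2 * \<sigma>)) ^ k"
    proof (cases k)
      case 0
      have "sobolev_weight 1 (- \<sigma>) \<omega> \<le> 1"
        using sobolev_weight_mono[of "- \<sigma>" 0 1 \<omega>] \<sigma>0 by simp
      also have "1 \<le> A" unfolding A_def using \<sigma>0 by (intro ge_one_powr_ge_zero) auto
      finally show ?thesis using 0 by simp
    next
      case (Suc j)
      have "\<not> norm \<omega> \<le> 2 ^ j" using not_less_Least[of j "\<lambda>k. norm \<omega> \<le> 2 ^ k"] Suc by (simp add: k_def)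
      then have "(2 ^ j)\<^sup>2 \<le> (norm \<omega>)\<^sup>2" by (intro power_mono) auto
      then have "(4::real) powr j \<le> 1 + 1\<^sup>2 * (norm \<omega>)\<^sup>2"
        by (simp add: powr_realpow power2_eq_square flip: power_mult_distrib)
      then have "sobolev_weight 1 (- \<sigma>) \<omega> \<le> (4 powr j) powr (- \<sigma>)"
        unfolding sobolev_weight_def using \<sigma>0 by (intro powr_mono2') auto
      also have "\<dots> = 4 powr (\<sigma> - \<sigma> * k)" by (simp add: powr_powr Suc algebra_simps)
      also have "\<dots> = A * 4 powr (- \<sigma> * k)" by (simp add: A_def powr_add[symmetric])
      also have "(4::real) powr (- \<sigma> * k) = (2 powr 2) powr (- \<sigma> * k)" by simp
      also have "\<dots> = (2 powr (- 2 * \<sigma>)) ^ k"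
        unfolding powr_powr by (simp add: powr_realpow[symmetric] powr_powr mult_ac)
      finally show ?thesis .
    qed
    then have "ennreal (sobolev_weight 1 (- \<sigma>) \<omega>) \<le> ?f k" using k by (simp add: ennreal_leI)
    also have "\<dots> \<le> (\<Sum>k. ?f k)" by (rule ennreal_le_suminf)
    finally show ?thesis .
  qed
  have "(\<integral>\<^sup>+\<omega>. ennreal (sobolev_weight 1 (- \<sigma>) (\<omega>::'a)) \<partial>lborel) \<le>
      (\<integral>\<^sup>+\<omega>. (\<Sum>k. ennreal (A * (2 powr (- 2 * \<sigma>)) ^ k) * indicator (cball 0 (2 ^ k)) (\<omega>::'a)) \<partial>lborel)"
    by (intro nn_integral_mono le)
  also have "\<dots> = (\<Sum>k. \<integral>\<^sup>+\<omega>. ennreal (A * (2 powr (- 2 * \<sigma>)) ^ k) * indicator (cball 0 (2 ^ k)) (\<omega>::'a) \<partial>lborel)"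
    by (rule nn_integral_suminf) measurable
  also have "\<dots> = (\<Sum>k. ennreal (A * unit_ball_vol ?d * r ^ k))"
  proof (rule suminf_cong)
    fix k
    have "((2::real) ^ k) ^ DIM('a) = (2 powr ?d) ^ k"
      by (simp add: powr_realpow power_mult[symmetric] mult.commute)
    then have *: "(2 powr (- 2 * \<sigma>)) ^ k * (2 ^ k) ^ DIM('a) = r ^ k"
      by (simp add: r_def powr_diff powr_minus power_divide field_simps powr_realpow power_mult[symmetric])
    have "(\<integral>\<^sup>+\<omega>. ennreal (A * (2 powr (- 2 * \<sigma>)) ^ k) * indicator (cball 0 (2 ^ k)) (\<omega>::'a) \<partial>lborel) =
      ennreal (A * (2 powr (- 2 * \<sigma>)) ^ k) * ennreal (unit_ball_vol ?d * (2 ^ k) ^ DIM('a))"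
      by (subst nn_integral_cmult_indicator) (auto simp: emeasure_cball)
    also have "\<dots> = ennreal (A * unit_ball_vol ?d * ((2 powr (- 2 * \<sigma>)) ^ k * (2 ^ k) ^ DIM('a)))"
      by (subst ennreal_mult[symmetric]) (auto simp: A_def mult_ac)
    finally show "(\<integral>\<^sup>+\<omega>. ennreal (A * (2 powr (- 2 * \<sigma>)) ^ k) * indicator (cball 0 (2 ^ k)) (\<omega>::'a) \<partial>lborel) = ennreal (A * unit_ball_vol ?d * r ^ k)"
      unfolding * .
  qed
  also have "\<dots> = ennreal (\<Sum>k. A * unit_ball_vol ?d * r ^ k)"
    by (rule suminf_ennreal2) (use r in \<open>auto simp: A_def intro!: summable_mult summable_geometric\<close>)
  finally show ?thesis by (simp add: order_le_less_trans)
qed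

lemma sobolev_weight_dilate_le:
  assumes "0 \<le> a" "0 \<le> b" "b \<le> K * a" "1 \<le> K" "0 \<le> s"
  shows "sobolev_weight b s \<omega> \<le> K powr (2 * s) * sobolev_weight a s \<omega>"
    and "sobolev_weight a (- s) \<omega> \<le> K powr (2 * s) * sobolev_weight b (- s) \<omega>"
proof -
  have "b\<^sup>2 \<le> (K * a)\<^sup>2" using assms by (intro power_mono) auto
  then have "b\<^sup>2 * (norm \<omega>)\<^sup>2 \<le> K\<^sup>2 * (a\<^sup>2 * (norm \<omega>)\<^sup>2)"
    using mult_right_mono[of "b\<^sup>2" "K\<^sup>2 * a\<^sup>2" "(norm \<omega>)\<^sup>2"] by (simp add: power_mult_distrib mult.assoc)
  moreover have "1 \<le> K\<^sup>2" using assms by simp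
  ultimately have "1 + b\<^sup>2 * (norm \<omega>)\<^sup>2 \<le> K\<^sup>2 * (1 + a\<^sup>2 * (norm \<omega>)\<^sup>2)"
    by (simp add: distrib_left)
  then have "sobolev_weight b s \<omega> \<le> (K\<^sup>2 * (1 + a\<^sup>2 * (norm \<omega>)\<^sup>2)) powr s"
    unfolding sobolev_weight_def using assms one_plus_sq_pos[of b \<omega>] by (intro powr_mono2) auto
  also have "\<dots> = K powr (2 * s) * sobolev_weight a s \<omega>"
    using assms by (simp add: powr_mult sobolev_weight_def powr_powr[symmetric] powr_numeral)
  finally show 1: "sobolev_weight b s \<omega> \<le> K powr (2 * s) * sobolev_weight a s \<omega>" .
  from mult_right_mono[OF 1, of "inverse (sobolev_weight a s \<omega>) * inverse (sobolev_weight b s \<omega>)"]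
  show "sobolev_weight a (- s) \<omega> \<le> K powr (2 * s) * sobolev_weight b (- s) \<omega>"
    by (simp add: sobolev_weight_minus field_simps)
qed

lemma sobolev_weight_scaleR: "sobolev_weight 1 s (h *\<^sub>R \<omega>) = sobolev_weight h s \<omega>"
  by (simp add: sobolev_weight_def power_mult_distrib)

lemma integrable_sobolev_weight:
  assumes "real DIM('a::euclidean_space) / 2 < \<sigma>"
  shows "integrable lborel (sobolev_weight 1 (- \<sigma>) :: 'a \<Rightarrow> real)"
  using nn_integral_sobolev_weight_finite[OF assms] by (simp add: integrable_iff_bounded)

section \<open>A compactly supported mollifier with decaying transform\<close>

text \<open>
  The Fourier integral of \<open>t\<^sup>j (1 - t\<^sup>2)\<^sup>n\<close> over \<open>[-1, 1]\<close>. The powers \<open>t\<^sup>j\<close> are carried along because integration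
  by parts produces them.
\<close>

definition bump_moment :: "nat \<Rightarrow> nat \<Rightarrow> real \<Rightarrow> complex" where
  "bump_moment n j s = (LINT t|lborel. indicator {-1..1} t *\<^sub>R (of_real (t ^ j * (1 - t\<^sup>2) ^ n) * cis (t * s)))"

lemma integrable_bump_moment:
  "integrable lborel (\<lambda>t. indicator {-1..1} t *\<^sub>R (complex_of_real (t ^ j * (1 - t\<^sup>2) ^ n) * cis (t * s)))"
  by (rule borel_integrable_compact) (auto intro!: continuous_intros)

text \<open>
  Integration by parts; the boundary terms vanish because of the factor \<open>(1 - t\<^sup>2)\<^bsup>n + 1\<^esup>\<close>. In the case \<open>j = 0\<close>
  the moment with \<open>j - 1\<close> is multiplied by zero.
\<close>

lemma bump_moment_parts:
  "\<i> * of_real s * bump_moment (Suc n) j s =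
     of_real (2 * (real n + 1)) * bump_moment n (Suc j) s - of_real (real j) * (bump_moment n (j - 1) s - bump_moment n (Suc j) s)"
proof -
  let ?G = "\<lambda>n j t. complex_of_real (t ^ j * (1 - t\<^sup>2) ^ n) * cis (t * s)"
  let ?F = "\<lambda>t. ?G (Suc n) j t"
  let ?f = "\<lambda>t. of_real (real j) * (?G n (j - 1) t - ?G n (Suc j) t) - of_real (2 * (real n + 1)) * ?G n (Suc j) t + \<i> * of_real s * ?G (Suc n) j t"
  have "(LINT t|lborel. indicator {-1..1} t *\<^sub>R ?f t) = ?F 1 - ?F (-1)"
  proof (rule integral_FTC_Icc)
    fix t :: real
    have 1: "((\<lambda>t. t ^ j * (1 - t\<^sup>2) ^ Suc n) has_real_derivative
        (real j * (t ^ (j - 1) * (1 - t\<^sup>2) ^ n - t ^ Suc j * (1 - t\<^sup>2) ^ n) - 2 * (real n + 1) * (t ^ Suc j * (1 - t\<^sup>2) ^ n))) (at t within {-1..1})"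
    proof -
      have "t ^ (j - 1) * (1 - t\<^sup>2) ^ n - t ^ Suc j * (1 - t\<^sup>2) ^ n = t ^ (j - 1) * (1 - t\<^sup>2) ^ Suc n" if "j > 0"
        using that by (cases j) (auto simp: algebra_simps power2_eq_square)
      then have eq: "real j * (t ^ (j - 1) * (1 - t\<^sup>2) ^ n - t ^ Suc j * (1 - t\<^sup>2) ^ n) = real j * (t ^ (j - 1) * (1 - t\<^sup>2) ^ Suc n)"
        by (cases "j > 0") auto
      show ?thesis unfolding eq
        by (rule derivative_eq_intros refl)+ (simp add: algebra_simps power2_eq_square)
    qed
    have 2: "((\<lambda>t. cis (t * s)) has_vector_derivative (\<i> * of_real s * cis (t * s))) (at t within {-1..1})"
    proof -
      have "((\<lambda>t. exp (\<i> * of_real s * t)) has_field_derivative (\<i> * of_real s * exp (\<i> * of_real s * of_real t))) (at (complex_of_real t))"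
        by (auto intro!: derivative_eq_intros)
      from has_vector_derivative_real_field[OF this] show ?thesis
        by (simp add: cis_conv_exp mult_ac)
    qed
    have 3: "((\<lambda>t. complex_of_real (t ^ j * (1 - t\<^sup>2) ^ Suc n)) has_vector_derivative of_real
        (real j * (t ^ (j - 1) * (1 - t\<^sup>2) ^ n - t ^ Suc j * (1 - t\<^sup>2) ^ n) - 2 * (real n + 1) * (t ^ Suc j * (1 - t\<^sup>2) ^ n))) (at t within {-1..1})"
      using 1 by (intro has_vector_derivative_of_real) (simp add: has_real_derivative_iff_has_vector_derivative)
    show "(?F has_vector_derivative ?f t) (at t within {-1..1})"
      using has_vector_derivative_mult[OF 3 2] by (simp add: algebra_simps)
  qed (auto intro!: continuous_intros)
  also have "?F 1 - ?F (-1) = 0" by simp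
  also have "(LINT t|lborel. indicator {-1..1} t *\<^sub>R ?f t) =
    of_real (real j) * (bump_moment n (j - 1) s - bump_moment n (Suc j) s) - of_real (2 * (real n + 1)) * bump_moment n (Suc j) s + \<i> * of_real s * bump_moment (Suc n) j s"
  proof -
    have "(\<lambda>t. indicator {-1..1} t *\<^sub>R ?f t) = (\<lambda>t. of_real (real j) * (indicator {-1..1} t *\<^sub>R ?G n (j - 1) t - indicator {-1..1} t *\<^sub>R ?G n (Suc j) t)
       - of_real (2 * (real n + 1)) * (indicator {-1..1} t *\<^sub>R ?G n (Suc j) t) + \<i> * of_real s * (indicator {-1..1} t *\<^sub>R ?G (Suc n) j t))"
      by (intro ext) (simp split: split_indicator)
    then show ?thesis
      unfolding bump_moment_def
      by (simp only: Bochner_Integration.integral_add Bochner_Integration.integral_diff integral_mult_right_zero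
        integrable_bump_moment Bochner_Integration.integrable_diff Bochner_Integration.integrable_add integrable_mult_right)
  qed
  finally show ?thesis by (simp add: algebra_simps add_eq_0_iff)
qed

text \<open>
  Each integration by parts gains one power of \<open>s\<close> and lowers \<open>n\<close> by one.
\<close>

lemma bump_moment_decay: "\<exists>C\<ge>0. \<forall>s. \<bar>s\<bar> ^ n * cmod (bump_moment n j s) \<le> C"
proof (induction n arbitrary: j)
  case 0
  have "cmod (bump_moment 0 j s) \<le> 2" for s
  proof -
    have "cmod (bump_moment 0 j s) \<le> (LINT t|lborel. indicator {-1..1::real} t)"
      unfolding bump_moment_def
    proof (rule Bochner_Integration.integral_norm_bound_integral[OF integrable_bump_moment])
      show "integrable lborel (indicator {-1..1::real} :: real \<Rightarrow> real)" by simp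
      show "norm (indicator {-1..1} t *\<^sub>R (complex_of_real (t ^ j * (1 - t\<^sup>2) ^ 0) * cis (t * s))) \<le> indicator {-1..1} t" for t :: real
        by (auto split: split_indicator simp: norm_mult norm_power power_le_one)
    qed
    then show ?thesis by simp
  qed
  then show ?case by (intro exI[of _ 2]) auto
next
  case (Suc n)
  obtain C1 where C1: "0 \<le> C1" "\<And>s. \<bar>s\<bar> ^ n * cmod (bump_moment n (j - 1) s) \<le> C1" using Suc.IH by blast
  obtain C2 where C2: "0 \<le> C2" "\<And>s. \<bar>s\<bar> ^ n * cmod (bump_moment n (Suc j) s) \<le> C2" using Suc.IH by blast
  let ?C = "2 * (real n + 1) * C2 + real j * (C1 + C2)"
  have "\<bar>s\<bar> ^ Suc n * cmod (bump_moment (Suc n) j s) \<le> ?C" for s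
  proof -
    have "\<bar>s\<bar> * cmod (bump_moment (Suc n) j s) = cmod (\<i> * of_real s * bump_moment (Suc n) j s)"
      by (simp add: norm_mult)
    also have "\<dots> \<le> cmod (of_real (2 * (real n + 1)) * bump_moment n (Suc j) s) + cmod (of_real (real j) * (bump_moment n (j - 1) s - bump_moment n (Suc j) s))"
      unfolding bump_moment_parts by (rule norm_triangle_ineq4)
    also have "\<dots> \<le> 2 * (real n + 1) * cmod (bump_moment n (Suc j) s) + real j * (cmod (bump_moment n (j - 1) s) + cmod (bump_moment n (Suc j) s))"
      unfolding norm_mult norm_of_real by (intro add_mono mult_mono norm_triangle_ineq4) auto
    finally have "\<bar>s\<bar> ^ n * (\<bar>s\<bar> * cmod (bump_moment (Suc n) j s)) \<le>
        \<bar>s\<bar> ^ n * (2 * (real n + 1) * cmod (bump_moment n (Suc j) s) + real j * (cmod (bump_moment n (j - 1) s) + cmod (bump_moment n (Suc j) s)))"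
      by (rule mult_left_mono) simp
    also have "\<dots> = 2 * (real n + 1) * (\<bar>s\<bar> ^ n * cmod (bump_moment n (Suc j) s)) +
        real j * (\<bar>s\<bar> ^ n * cmod (bump_moment n (j - 1) s) + \<bar>s\<bar> ^ n * cmod (bump_moment n (Suc j) s))"
      by (simp add: algebra_simps)
    also have "\<dots> \<le> ?C" by (intro add_mono mult_left_mono C1 C2) auto
    finally show ?thesis by (simp add: mult_ac)
  qed
  moreover have "0 \<le> ?C" using C1 C2 by auto
  ultimately show ?case by blast
qed

lemma cmod_bump_moment_le: "cmod (bump_moment n j s) \<le> 2"
proof -
  have "cmod (bump_moment n j s) \<le> (LINT t|lborel. indicator {-1..1::real} t)"
    unfolding bump_moment_def
  proof (rule Bochner_Integration.integral_norm_bound_integral[OF integrable_bump_moment])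
    show "integrable lborel (indicator {-1..1::real} :: real \<Rightarrow> real)" by simp
    show "norm (indicator {-1..1} t *\<^sub>R (complex_of_real (t ^ j * (1 - t\<^sup>2) ^ n) * cis (t * s))) \<le> indicator {-1..1} t" for t :: real
    proof (cases "t \<in> {-1..1}")
      case True
      then have "\<bar>t\<bar> \<le> 1" "t\<^sup>2 \<le> 1" by (auto simp: abs_square_le_1)
      then have "\<bar>t\<bar> ^ j * \<bar>1 - t\<^sup>2\<bar> ^ n \<le> 1 * 1" by (intro mult_mono power_le_one) auto
      then show ?thesis using True by (simp only: norm_mult norm_scaleR norm_of_real norm_cis power_abs abs_mult indicator_simps)
    qed simp
  qed
  then show ?thesis by simp
qed

lemma bump_moment_sq_le:
  "\<exists>C\<ge>0. \<forall>s. (cmod (bump_moment n 0 s))\<^sup>2 * (1 + s\<^sup>2) ^ n \<le> C"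
proof -
  obtain C where C: "C \<ge> 0" "\<And>s. \<bar>s\<bar> ^ n * cmod (bump_moment n 0 s) \<le> C"
    using bump_moment_decay[of n 0] by blast
  have "(cmod (bump_moment n 0 s))\<^sup>2 * (1 + s\<^sup>2) ^ n \<le> 2 ^ n * (4 + C\<^sup>2)" for s
  proof -
    have "(1 + s\<^sup>2) ^ n \<le> 2 ^ n * (1 + (\<bar>s\<bar> ^ n)\<^sup>2)"
    proof (cases "s\<^sup>2 \<le> 1")
      case True
      then have "(1 + s\<^sup>2) ^ n \<le> 2 ^ n" by (intro power_mono) auto
      also have "\<dots> \<le> 2 ^ n * (1 + (\<bar>s\<bar> ^ n)\<^sup>2)" by simp
      finally show ?thesis .
    next
      case False
      then have "(1 + s\<^sup>2) ^ n \<le> (2 * s\<^sup>2) ^ n" by (intro power_mono) auto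
      also have "\<dots> = 2 ^ n * (\<bar>s\<bar> ^ n)\<^sup>2" by (simp add: power_mult_distrib power_mult[symmetric] power_even_abs mult.commute)
      also have "\<dots> \<le> 2 ^ n * (1 + (\<bar>s\<bar> ^ n)\<^sup>2)" by simp
      finally show ?thesis .
    qed
    then have "(cmod (bump_moment n 0 s))\<^sup>2 * (1 + s\<^sup>2) ^ n \<le> (cmod (bump_moment n 0 s))\<^sup>2 * (2 ^ n * (1 + (\<bar>s\<bar> ^ n)\<^sup>2))"
      by (rule mult_left_mono) simp
    also have "\<dots> = 2 ^ n * ((cmod (bump_moment n 0 s))\<^sup>2 + (\<bar>s\<bar> ^ n * cmod (bump_moment n 0 s))\<^sup>2)"
      by (simp add: algebra_simps power_mult_distrib)
    also have "\<dots> \<le> 2 ^ n * (2\<^sup>2 + C\<^sup>2)"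
      by (intro mult_left_mono add_mono power_mono cmod_bump_moment_le C) auto
    finally show ?thesis by simp
  qed
  then show ?thesis using C(1) by (intro exI[of _ "2 ^ n * (4 + C\<^sup>2)"]) auto
qed

text \<open>
  A product over the coordinates, so that its transform is a product of moments; it is supported in a cube.
\<close>

definition tensor_bump :: "nat \<Rightarrow> 'a::euclidean_space \<Rightarrow> real" where
  "tensor_bump n x = (\<Prod>b\<in>Basis. (max 0 (1 - (x \<bullet> b)\<^sup>2)) ^ n)"

lemma tensor_bump_nonneg: "0 \<le> tensor_bump n x"
  unfolding tensor_bump_def by (intro prod_nonneg) auto

lemma continuous_on_tensor_bump: "continuous_on A (tensor_bump n)"
  unfolding tensor_bump_def[abs_def] by (intro continuous_intros)

lemma tensor_bump_eq_0:
  fixes x :: "'a::euclidean_space"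
  assumes "0 < n" "real DIM('a) < norm x"
  shows "tensor_bump n x = 0"
proof -
  have "\<exists>b\<in>Basis. 1 < \<bar>x \<bullet> b\<bar>"
  proof (rule ccontr)
    assume "\<not> ?thesis"
    then have "(\<Sum>b\<in>Basis. \<bar>x \<bullet> b\<bar>) \<le> (\<Sum>b\<in>(Basis::'a set). 1)" by (intro sum_mono) force
    with norm_le_l1[of x] assms(2) show False by simp
  qed
  then obtain b where b: "b \<in> Basis" "1 < \<bar>x \<bullet> b\<bar>" by blast
  then have "1 < (x \<bullet> b)\<^sup>2" by (metis abs_square_le_1 not_le)
  then have "(max 0 (1 - (x \<bullet> b)\<^sup>2)) ^ n = 0" using assms(1) by simp
  then show ?thesis unfolding tensor_bump_def using b(1) by (intro prod_zero) auto
qed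

lemma bump_factor:
  assumes "0 < n"
  shows "complex_of_real ((max 0 (1 - t\<^sup>2)) ^ n) * cis (t * s) = indicator {-1..1} t *\<^sub>R (of_real (t ^ 0 * (1 - t\<^sup>2) ^ n) * cis (t * s))"
proof (cases "t \<in> {-1..1}")
  case True
  then have "t\<^sup>2 \<le> 1" by (auto simp: abs_square_le_1)
  then show ?thesis using True by (simp add: max_def)
next
  case False
  then have "\<not> t\<^sup>2 \<le> 1" by (auto simp: abs_square_le_1)
  then show ?thesis using False assms by (simp add: max_def)
qed

lemma tensor_bump_cis:
  "complex_of_real (tensor_bump n x) * cis (x \<bullet> \<omega>) = (\<Prod>b\<in>Basis. complex_of_real ((max 0 (1 - (x \<bullet> b)\<^sup>2)) ^ n) * cis ((x \<bullet> b) * (\<omega> \<bullet> b)))"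
  for x \<omega> :: "'a::euclidean_space"
proof -
  have "cis (x \<bullet> \<omega>) = (\<Prod>b\<in>Basis. cis ((x \<bullet> b) * (\<omega> \<bullet> b)))"
    by (simp add: cis_conv_exp euclidean_inner[of x \<omega>] exp_sum[symmetric] sum_distrib_left)
  then show ?thesis by (simp add: tensor_bump_def prod.distrib)
qed

lemma
  fixes \<omega> :: "'a::euclidean_space"
  assumes n: "0 < n"
  shows integrable_tensor_bump_cis: "integrable lborel (\<lambda>x::'a. complex_of_real (tensor_bump n x) * cis (x \<bullet> \<omega>))"
    and integral_tensor_bump_cis: "(LINT x|lborel. complex_of_real (tensor_bump n x) * cis (x \<bullet> \<omega>)) = (\<Prod>b\<in>Basis. bump_moment n 0 (\<omega> \<bullet> b))"
proof -
  have i: "integrable lborel (\<lambda>t. complex_of_real ((max 0 (1 - t\<^sup>2)) ^ n) * cis (t * s))" for s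
    unfolding bump_factor[OF n] by (rule integrable_bump_moment)
  show "integrable lborel (\<lambda>x::'a. complex_of_real (tensor_bump n x) * cis (x \<bullet> \<omega>))"
    unfolding tensor_bump_cis by (rule integrable_lborel_tensor[OF i])
  show "(LINT x|lborel. complex_of_real (tensor_bump n x) * cis (x \<bullet> \<omega>)) = (\<Prod>b\<in>Basis. bump_moment n 0 (\<omega> \<bullet> b))"
    unfolding tensor_bump_cis integral_lborel_tensor[OF i] bump_moment_def bump_factor[OF n, symmetric] ..
qed

lemma integrable_tensor_bump: "0 < n \<Longrightarrow> integrable lborel (tensor_bump n :: 'a::euclidean_space \<Rightarrow> real)"
  using integrable_Re[OF integrable_tensor_bump_cis[of n "0::'a"]] by simp

lemma bump_moment_0_pos:
  assumes n: "0 < n"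
  shows "\<exists>m>0. bump_moment n 0 0 = of_real m"
proof -
  let ?\<beta> = "\<lambda>t::real. (max 0 (1 - t\<^sup>2)) ^ n"
  have eq: "bump_moment n 0 0 = (LINT t|lborel. complex_of_real (?\<beta> t))"
    unfolding bump_moment_def bump_factor[OF n, symmetric] by simp
  have i: "integrable lborel (\<lambda>t. complex_of_real (?\<beta> t))"
    using integrable_bump_moment[of 0 n 0] unfolding bump_factor[OF n, symmetric] by simp
  from integrable_Re[OF this] have ir: "integrable lborel ?\<beta>" by simp
  have "(LINT t|lborel. (3/4) ^ n * indicator {-1/2..1/2::real} t) \<le> (LINT t|lborel. ?\<beta> t)"
  proof (rule integral_mono[OF _ ir])
    show "integrable lborel (\<lambda>t::real. (3/4) ^ n * indicator {-1/2..1/2} t :: real)" by simp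
    fix t :: real
    show "(3/4) ^ n * indicator {-1/2..1/2} t \<le> ?\<beta> t"
    proof (cases "t \<in> {-1/2..1/2}")
      case True
      then have "\<bar>t\<bar>\<^sup>2 \<le> (1/2)\<^sup>2" by (intro power_mono) auto
      then have "(3/4) ^ n \<le> ?\<beta> t" by (intro power_mono) (auto simp: power2_eq_square)
      then show ?thesis using True by simp
    qed simp
  qed
  moreover have "(LINT t|lborel. (3/4) ^ n * indicator {-1/2..1/2::real} t) = (3/4::real) ^ n" by simp
  moreover have "0 < (3/4::real) ^ n" by simp
  ultimately have "0 < (LINT t|lborel. ?\<beta> t)" by linarith
  then show ?thesis unfolding eq by (intro exI[of _ "LINT t|lborel. ?\<beta> t"] conjI integral_of_real[OF ir])
qed

lemma tensor_bump_mass_pos: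
  assumes "0 < n"
  shows "0 < (LINT x|lborel. tensor_bump n (x::'a::euclidean_space))"
proof -
  obtain m where m: "m > 0" "bump_moment n 0 0 = of_real m" using bump_moment_0_pos[OF assms] by blast
  have "complex_of_real (LINT x|lborel. tensor_bump n (x::'a)) = (LINT x|lborel. complex_of_real (tensor_bump n (x::'a)) * cis (x \<bullet> 0))"
    by (simp add: integral_of_real[OF integrable_tensor_bump[OF assms]])
  also have "\<dots> = of_real (m ^ DIM('a))"
    unfolding integral_tensor_bump_cis[OF assms] by (simp add: m)
  finally have "(LINT x|lborel. tensor_bump n (x::'a)) = m ^ DIM('a)" unfolding of_real_eq_iff .
  then show ?thesis using m by simp
qed

text \<open>
  The largest coordinate of \<open>\<omega>\<close> is comparable to its norm and its factor alone provides the decay; the other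
  factors are bounded by two.
\<close>

lemma tensor_bump_decay:
  assumes n: "0 < n"
  shows "\<exists>C\<ge>0. \<forall>\<omega>::'a::euclidean_space. (cmod (LINT x|lborel. complex_of_real (tensor_bump n x) * cis (x \<bullet> \<omega>)))\<^sup>2 \<le> C * sobolev_weight 1 (- real n) \<omega>"
proof -
  obtain C where C: "C \<ge> 0" "\<And>s. (cmod (bump_moment n 0 s))\<^sup>2 * (1 + s\<^sup>2) ^ n \<le> C"
    using bump_moment_sq_le by blast
  let ?D = "real DIM('a)"
  have "(cmod (LINT x|lborel. complex_of_real (tensor_bump n x) * cis (x \<bullet> \<omega>)))\<^sup>2 \<le> (4 ^ DIM('a) * C * ?D ^ n) * sobolev_weight 1 (- real n) \<omega>" for \<omega> :: 'a
  proof -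
    have "Max ((\<lambda>b. \<bar>\<omega> \<bullet> b\<bar>) ` Basis) \<in> (\<lambda>b. \<bar>\<omega> \<bullet> b\<bar>) ` Basis" by (intro Max_in) auto
    then obtain b where b: "b \<in> Basis" "\<bar>\<omega> \<bullet> b\<bar> = Max ((\<lambda>b. \<bar>\<omega> \<bullet> b\<bar>) ` Basis)" by force
    have max: "\<bar>\<omega> \<bullet> i\<bar> \<le> \<bar>\<omega> \<bullet> b\<bar>" if "i \<in> Basis" for i
      unfolding b(2) using that by (intro Max_ge) auto
    have "(norm \<omega>)\<^sup>2 = (\<Sum>i\<in>Basis. (\<omega> \<bullet> i)\<^sup>2)"
      using euclidean_inner[of \<omega> \<omega>] by (simp add: power2_norm_eq_inner) (simp add: power2_eq_square)
    also have "\<dots> \<le> (\<Sum>i\<in>(Basis::'a set). (\<omega> \<bullet> b)\<^sup>2)"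
      by (intro sum_mono) (use max in \<open>simp add: abs_le_square_iff\<close>)
    finally have "(norm \<omega>)\<^sup>2 \<le> ?D * (\<omega> \<bullet> b)\<^sup>2" by simp
    moreover have "1 \<le> ?D" by (simp add: Suc_leI)
    ultimately have le: "1 + (norm \<omega>)\<^sup>2 \<le> ?D * (1 + (\<omega> \<bullet> b)\<^sup>2)"
      unfolding distrib_left by linarith
    have "(cmod (LINT x|lborel. complex_of_real (tensor_bump n x) * cis (x \<bullet> \<omega>)))\<^sup>2 = (\<Prod>i\<in>Basis. (cmod (bump_moment n 0 (\<omega> \<bullet> i)))\<^sup>2)"
      unfolding integral_tensor_bump_cis[OF n] by (simp add: prod_norm[symmetric] prod_power_distrib)
    also have "\<dots> = (cmod (bump_moment n 0 (\<omega> \<bullet> b)))\<^sup>2 * (\<Prod>i\<in>Basis - {b}. (cmod (bump_moment n 0 (\<omega> \<bullet> i)))\<^sup>2)"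
      by (rule prod.remove) (use b in auto)
    also have "\<dots> \<le> (cmod (bump_moment n 0 (\<omega> \<bullet> b)))\<^sup>2 * (\<Prod>i\<in>Basis - {b}. 4)"
    proof (intro mult_left_mono prod_mono)
      fix i show "0 \<le> (cmod (bump_moment n 0 (\<omega> \<bullet> i)))\<^sup>2 \<and> (cmod (bump_moment n 0 (\<omega> \<bullet> i)))\<^sup>2 \<le> 4"
        using power_mono[OF cmod_bump_moment_le[of n 0 "\<omega> \<bullet> i"], of 2] by simp
    qed simp
    also have "(\<Prod>i\<in>Basis - {b}. 4::real) \<le> 4 ^ DIM('a)"
      using b by (simp add: power_increasing card_Diff_subset)
    finally have "(cmod (LINT x|lborel. complex_of_real (tensor_bump n x) * cis (x \<bullet> \<omega>)))\<^sup>2 \<le> (cmod (bump_moment n 0 (\<omega> \<bullet> b)))\<^sup>2 * 4 ^ DIM('a)"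
      by (simp add: mult_left_mono)
    then have "(cmod (LINT x|lborel. complex_of_real (tensor_bump n x) * cis (x \<bullet> \<omega>)))\<^sup>2 * (1 + (norm \<omega>)\<^sup>2) ^ n
       \<le> ((cmod (bump_moment n 0 (\<omega> \<bullet> b)))\<^sup>2 * 4 ^ DIM('a)) * (?D * (1 + (\<omega> \<bullet> b)\<^sup>2)) ^ n"
      by (intro mult_mono power_mono le) auto
    also have "\<dots> = 4 ^ DIM('a) * ?D ^ n * ((cmod (bump_moment n 0 (\<omega> \<bullet> b)))\<^sup>2 * (1 + (\<omega> \<bullet> b)\<^sup>2) ^ n)"
      by (simp add: power_mult_distrib)
    also have "\<dots> \<le> 4 ^ DIM('a) * ?D ^ n * C" by (intro mult_left_mono C) auto
    finally show ?thesis
      by (simp add: sobolev_weight_def powr_minus powr_realpow add_pos_nonneg field_simps)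
  qed
  then show ?thesis using C(1) by (intro exI[of _ "4 ^ DIM('a) * C * ?D ^ n"]) auto
qed

text \<open>
  The rescaled product bump, with its support moved into the unit ball. Smoothness of the order
  \<open>\<kappa>\<close> is expressed by the decay of the transform.
\<close>

lemma mollifier_exists:
  fixes \<kappa> :: real
  assumes \<kappa>: "0 \<le> \<kappa>"
  shows "\<exists>(\<rho> :: 'a::euclidean_space \<Rightarrow> real) C. continuous_on UNIV \<rho> \<and> (\<forall>x. 0 \<le> \<rho> x) \<and> (\<forall>x. 1 \<le> norm x \<longrightarrow> \<rho> x = 0) \<and> (\<forall>x. \<rho> (- x) = \<rho> x) \<and>
     integrable lborel \<rho> \<and> (LINT x|lborel. \<rho> x) = 1 \<and> 0 \<le> C \<and>
     (\<forall>\<omega>. (cmod (inverse_transform (\<lambda>x. of_real (\<rho> x)) \<omega>))\<^sup>2 \<le> C * sobolev_weight 1 (- \<kappa>) \<omega>)"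
proof -
  define n where "n = max 1 (nat \<lceil>\<kappa>\<rceil>)"
  have n: "0 < n" "\<kappa> \<le> real n" by (auto simp: n_def) linarith
  \<comment> \<open>The cube that supports the product bump lies in the open ball of this radius.\<close>
  define R where "R = real DIM('a) + 1"
  have R: "R > 1" by (simp add: R_def)
  define I where "I = (LINT x|lborel. tensor_bump n (x::'a))"
  have I: "I > 0" unfolding I_def by (rule tensor_bump_mass_pos[OF n(1)])
  define \<rho> :: "'a \<Rightarrow> real" where "\<rho> x = R ^ DIM('a) / I * tensor_bump n (0 + R *\<^sub>R x)" for x
  obtain C where C: "C \<ge> 0" "\<And>\<omega>::'a. (cmod (LINT x|lborel. complex_of_real (tensor_bump n x) * cis (x \<bullet> \<omega>)))\<^sup>2 \<le> C * sobolev_weight 1 (- real n) \<omega>"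
    using tensor_bump_decay[OF n(1), where 'a='a] by blast
  have ft: "inverse_transform (\<lambda>x. of_real (\<rho> x)) \<omega> = (1 / of_real I) * (LINT x|lborel. complex_of_real (tensor_bump n x) * cis (x \<bullet> (\<omega> /\<^sub>R R)))" for \<omega>
  proof -
    have "inverse_transform (\<lambda>x. of_real (\<rho> x)) \<omega> = (LINT x|lborel. of_real (R ^ DIM('a) / I) * (\<lambda>x. complex_of_real (tensor_bump n x) * cis (x \<bullet> (\<omega> /\<^sub>R R))) (0 + R *\<^sub>R x))"
      unfolding inverse_transform_def \<rho>_def using R
      by (intro Bochner_Integration.integral_cong refl) (simp add: inner_commute mult.assoc[symmetric])
    also have "\<dots> = of_real (R ^ DIM('a) / I) * (LINT x|lborel. (\<lambda>x. complex_of_real (tensor_bump n x) * cis (x \<bullet> (\<omega> /\<^sub>R R))) (0 + R *\<^sub>R x))"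
      by (rule integral_mult_right_zero)
    also have "(LINT x|lborel. (\<lambda>x. complex_of_real (tensor_bump n x) * cis (x \<bullet> (\<omega> /\<^sub>R R))) (0 + R *\<^sub>R x)) =
        (1 / \<bar>R\<bar> ^ DIM('a)) *\<^sub>R (LINT x|lborel. complex_of_real (tensor_bump n x) * cis (x \<bullet> (\<omega> /\<^sub>R R)))"
      by (rule integral_affine') (use R in auto)
    finally show ?thesis using R by (simp add: scaleR_conv_of_real)
  qed
  show ?thesis
  proof (intro exI[of _ \<rho>] exI[of _ "C / I\<^sup>2 * R powr (2 * real n)"] conjI allI impI)
    show "continuous_on UNIV \<rho>"
      unfolding \<rho>_def by (intro continuous_intros continuous_on_compose2[OF continuous_on_tensor_bump[of UNIV]]) auto
    show "0 \<le> \<rho> x" for x unfolding \<rho>_def using R I by (intro mult_nonneg_nonneg tensor_bump_nonneg) auto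
    show "\<rho> x = 0" if "1 \<le> norm x" for x
    proof -
      have "real DIM('a) < R * 1" by (simp add: R_def)
      also have "R * 1 \<le> norm (0 + R *\<^sub>R x)" using that R by simp
      finally show ?thesis unfolding \<rho>_def by (simp only: tensor_bump_eq_0[OF n(1)] mult_zero_right)
    qed
    show "\<rho> (- x) = \<rho> x" for x
      by (simp add: \<rho>_def tensor_bump_def)
    show "integrable lborel \<rho>"
      unfolding \<rho>_def using R by (intro integrable_mult_right integrable_affine[OF integrable_tensor_bump[OF n(1)]]) auto
    have "(LINT x|lborel. \<rho> x) = R ^ DIM('a) / I * (LINT x|lborel. tensor_bump n (0 + R *\<^sub>R (x::'a)))"
      unfolding \<rho>_def by (rule integral_mult_right_zero)
    also have "\<dots> = R ^ DIM('a) / I * ((1 / \<bar>R\<bar> ^ DIM('a)) *\<^sub>R I)"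
      unfolding I_def using R by (subst integral_affine') auto
    finally show "(LINT x|lborel. \<rho> x) = 1" using R I by simp
    show "0 \<le> C / I\<^sup>2 * R powr (2 * real n)" using C(1) by simp
    fix \<omega> :: 'a
    have "(cmod (inverse_transform (\<lambda>x. of_real (\<rho> x)) \<omega>))\<^sup>2 = (cmod (LINT x|lborel. complex_of_real (tensor_bump n x) * cis (x \<bullet> (\<omega> /\<^sub>R R))))\<^sup>2 / I\<^sup>2"
      unfolding ft norm_mult using I by (simp add: norm_divide power_mult_distrib power_divide)
    also have "\<dots> \<le> C * sobolev_weight 1 (- real n) (\<omega> /\<^sub>R R) / I\<^sup>2"
      by (intro divide_right_mono C) simp
    also have "sobolev_weight 1 (- real n) (\<omega> /\<^sub>R R) = sobolev_weight (1 / R) (- real n) \<omega>"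
      using R by (simp add: sobolev_weight_def power_mult_distrib divide_inverse)
    also have "C * sobolev_weight (1 / R) (- real n) \<omega> / I\<^sup>2 \<le> C * (R powr (2 * real n) * sobolev_weight 1 (- real n) \<omega>) / I\<^sup>2"
      using R C(1) by (intro divide_right_mono mult_left_mono sobolev_weight_dilate_le) auto
    also have "\<dots> \<le> C * (R powr (2 * real n) * sobolev_weight 1 (- \<kappa>) \<omega>) / I\<^sup>2"
      using R C(1) n(2) by (intro divide_right_mono mult_left_mono sobolev_weight_mono) auto
    finally show "(cmod (inverse_transform (\<lambda>x. of_real (\<rho> x)) \<omega>))\<^sup>2 \<le> C / I\<^sup>2 * R powr (2 * real n) * sobolev_weight 1 (- \<kappa>) \<omega>"
      by (simp add: mult_ac)
  qed
qed

section \<open>Exponential sums over separated points\<close>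

lemma test_function_sum:
  fixes \<phi> :: "'i \<Rightarrow> 'a::euclidean_space \<Rightarrow> complex"
  assumes "finite I" and \<phi>: "\<And>i. i \<in> I \<Longrightarrow> test_function (\<phi> i)"
  shows "test_function (\<lambda>x. \<Sum>i\<in>I. a i * \<phi> i x)"
proof -
  have \<phi>': "continuous_on UNIV (\<phi> i)" "integrable lborel (\<phi> i)" "integrable lborel (fourier (\<phi> i))" if "i \<in> I" for i
    using \<phi>[OF that] by (auto simp: test_function_def)
  have "\<exists>B. \<forall>x. cmod (\<Sum>i\<in>I. a i * \<phi> i x) \<le> B"
  proof -
    have "\<forall>i\<in>I. \<exists>B. \<forall>x. cmod (\<phi> i x) \<le> B" using \<phi> by (auto simp: test_function_def)
    then obtain B where B: "\<And>i x. i \<in> I \<Longrightarrow> cmod (\<phi> i x) \<le> B i" by metis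
    have "cmod (\<Sum>i\<in>I. a i * \<phi> i x) \<le> (\<Sum>i\<in>I. cmod (a i) * B i)" for x
      by (rule order_trans[OF norm_sum]) (auto simp: norm_mult intro!: sum_mono mult_left_mono B)
    then show ?thesis by blast
  qed
  moreover have "fourier (\<lambda>x. \<Sum>i\<in>I. a i * \<phi> i x) = (\<lambda>\<omega>. \<Sum>i\<in>I. a i * fourier (\<phi> i) \<omega>)"
    by (rule ext, rule fourier_sum_cmult) (rule \<phi>')
  ultimately show ?thesis unfolding test_function_def
    by (auto intro!: continuous_intros \<phi>')
qed

text \<open>
  Pair the function with itself in \<open>Parseval_integrable\<close>.
\<close>

lemma Plancherel_test_function:
  assumes "test_function \<phi>"
  shows "L2_sq (fourier \<phi>) = L2_sq \<phi>"
proof -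
  have \<phi>: "integrable lborel \<phi>" "square_integrable \<phi>"
    using assms test_function_square_integrable by (auto simp: test_function_def)
  have sq: "L2_sq f = ennreal (Re (LINT x|lborel. f x * cnj (f x)))" if "square_integrable f" for f :: "'a \<Rightarrow> complex"
  proof -
    have i: "integrable lborel (\<lambda>x. (cmod (f x))\<^sup>2)" using that by (simp add: square_integrable_def)
    have "(LINT x|lborel. f x * cnj (f x)) = (LINT x|lborel. complex_of_real ((cmod (f x))\<^sup>2))"
      by (simp only: complex_norm_square)
    also have "\<dots> = of_real (LINT x|lborel. (cmod (f x))\<^sup>2)" by (rule integral_of_real[OF i])
    finally show ?thesis using nn_integral_eq_integral[OF i] by (simp add: weighted_sq_def)
  qed
  show ?thesis
    unfolding sq[OF \<phi>(2)] sq[OF test_function_fourier_square_integrable[OF assms]]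
    using Parseval_test_function[OF \<phi>(2) has_fourier_L2_fourier[OF \<phi>] assms] by simp
qed

definition exp_sum :: "('a::euclidean_space \<Rightarrow> complex) \<Rightarrow> 'a set \<Rightarrow> 'a \<Rightarrow> complex" where
  "exp_sum b X \<omega> = (\<Sum>y\<in>X. b y * cis (- (y \<bullet> \<omega>)))"

lemma borel_measurable_exp_sum [measurable]: "exp_sum b X \<in> borel_measurable borel"
  unfolding exp_sum_def[abs_def] by measurable

lemma exp_sum_translate: "exp_sum b X (\<omega> + \<xi>) = exp_sum (\<lambda>y. b y * cis (- (y \<bullet> \<xi>))) X \<omega>"
  by (simp add: exp_sum_def inner_add_right cis_mult mult.assoc add.commute)

text \<open>
  Balls of radius \<open>h\<close> around the points are disjoint.
\<close>

definition separated :: "'a::euclidean_space set \<Rightarrow> real \<Rightarrow> bool" where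
  "separated X h \<longleftrightarrow> (\<forall>x\<in>X. \<forall>y\<in>X. x \<noteq> y \<longrightarrow> 2 * h \<le> norm (x - y))"

text \<open>
  The exponent \<open>4 \<sigma>\<close> bounds the transform itself by the weight of order \<open>- 2 \<sigma>\<close>. After a factor of
  order \<open>\<sigma>\<close> from Peetre's inequality is paid, an integrable weight of order \<open>- \<sigma>\<close> remains.
\<close>

locale mollifier =
  fixes \<rho> :: "'a::euclidean_space \<Rightarrow> real" and \<sigma> C\<^sub>\<rho> :: real
  assumes half_dim_less: "real DIM('a) / 2 < \<sigma>"
    and continuous: "continuous_on UNIV \<rho>"
    and nonneg: "0 \<le> \<rho> x"
    and vanishes: "1 \<le> norm x \<Longrightarrow> \<rho> x = 0"
    and even: "\<rho> (- x) = \<rho> x"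
    and integrable: "integrable lborel \<rho>"
    and mass: "(LINT x|lborel. \<rho> x) = 1"
    and C\<^sub>\<rho>: "0 \<le> C\<^sub>\<rho>"
    and decay: "(cmod (inverse_transform (\<lambda>x. of_real (\<rho> x)) \<omega>))\<^sup>2 \<le> C\<^sub>\<rho> * sobolev_weight 1 (- (4 * \<sigma>)) \<omega>"
begin

lemma \<sigma>_pos: "0 < \<sigma>"
  using half_dim_less by (rule order.strict_trans1[rotated]) simp

abbreviation "\<rho>hat \<equiv> inverse_transform (\<lambda>x. complex_of_real (\<rho> x))"

text \<open>
  The mollifier dilated to the ball of radius \<open>r\<close> around \<open>p\<close>, with mass one.
\<close>

definition bump :: "real \<Rightarrow> 'a \<Rightarrow> 'a \<Rightarrow> real" where
  "bump r p x = \<rho> ((x - p) /\<^sub>R r) / r ^ DIM('a)"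

lemma borel_measurable_\<rho> [measurable]: "\<rho> \<in> borel_measurable borel"
  using borel_measurable_continuous_onI[OF continuous] .

lemma integrable_complex: "integrable lborel (\<lambda>x. complex_of_real (\<rho> x))"
  by (intro integrable_of_real integrable)

lemma cmod_\<rho>hat_le_1: "cmod (\<rho>hat \<omega>) \<le> 1"
  using cmod_inverse_transform_le[of "\<lambda>x. complex_of_real (\<rho> x)" \<omega>] mass by (simp add: nonneg)

lemma cmod_\<rho>hat_le: "cmod (\<rho>hat \<omega>) \<le> sqrt C\<^sub>\<rho> * sobolev_weight 1 (- (2 * \<sigma>)) \<omega>"
proof -
  have "sobolev_weight 1 (- (4 * \<sigma>)) \<omega> = (sobolev_weight 1 (- (2 * \<sigma>)) \<omega>)\<^sup>2"
    unfolding power2_eq_square sobolev_weight_add[symmetric] by simp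
  then have "(cmod (\<rho>hat \<omega>))\<^sup>2 \<le> (sqrt C\<^sub>\<rho> * sobolev_weight 1 (- (2 * \<sigma>)) \<omega>)\<^sup>2"
    using decay[of \<omega>] C\<^sub>\<rho> by (simp add: power_mult_distrib)
  then show ?thesis by (rule power2_le_imp_le) (simp add: C\<^sub>\<rho>)
qed

lemma integrable_\<rho>hat: "integrable lborel \<rho>hat"
proof (rule Bochner_Integration.integrable_bound)
  show "integrable lborel (\<lambda>\<omega>::'a. sqrt C\<^sub>\<rho> * sobolev_weight 1 (- \<sigma>) \<omega>)"
    by (intro integrable_mult_right integrable_sobolev_weight half_dim_less)
  have "cmod (\<rho>hat \<omega>) \<le> norm (sqrt C\<^sub>\<rho> * sobolev_weight 1 (- \<sigma>) \<omega>)" for \<omega>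
  proof -
    have "sobolev_weight 1 (- (2 * \<sigma>)) \<omega> \<le> sobolev_weight 1 (- \<sigma>) \<omega>"
      using \<sigma>_pos by (intro sobolev_weight_mono) simp
    from order_trans[OF cmod_\<rho>hat_le mult_left_mono[OF this, of "sqrt C\<^sub>\<rho>"]] show ?thesis
      using C\<^sub>\<rho> by (simp add: abs_mult)
  qed
  then show "AE \<omega> in lborel. cmod (\<rho>hat \<omega>) \<le> norm (sqrt C\<^sub>\<rho> * sobolev_weight 1 (- \<sigma>) \<omega>)" by simp
qed measurable

lemma \<rho>_bounded: "\<exists>B. \<forall>x. \<rho> x \<le> B"
proof -
  have "compact (\<rho> ` cball 0 1)" by (intro compact_continuous_image continuous_on_subset[OF continuous]) auto
  then obtain B where "\<forall>y\<in>\<rho> ` cball 0 1. norm y \<le> B" unfolding compact_eq_bounded_closed bounded_iff by blast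
  then have B: "\<bar>\<rho> x\<bar> \<le> B" if "norm x \<le> 1" for x using that by auto
  have "\<rho> x \<le> B" for x
  proof (cases "norm x \<le> 1")
    case True then show ?thesis using B[of x] by simp
  next
    case False then show ?thesis using B[of 0] vanishes[of x] by simp
  qed
  then show ?thesis by blast
qed

lemma continuous_on_bump [continuous_intros]: "r \<noteq> 0 \<Longrightarrow> continuous_on A (bump r p)"
  unfolding bump_def[abs_def]
  by (intro continuous_intros continuous_on_compose2[OF continuous]) auto

lemma borel_measurable_bump [measurable]: "bump r p \<in> borel_measurable borel"
  unfolding bump_def[abs_def] by measurable

lemma bump_nonneg: "0 < r \<Longrightarrow> 0 \<le> bump r p x"
  unfolding bump_def by (intro divide_nonneg_nonneg nonneg) simp

lemma bump_eq_0: "0 < r \<Longrightarrow> r \<le> norm (x - p) \<Longrightarrow> bump r p x = 0"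
proof -
  assume r: "0 < r" "r \<le> norm (x - p)"
  then have "norm ((x - p) /\<^sub>R r) = norm (x - p) / r" by (simp only: norm_scaleR) (simp add: field_simps)
  then show ?thesis unfolding bump_def using r by (subst vanishes) simp_all
qed

lemma integral_bump_mult:
  fixes g :: "'a \<Rightarrow> complex"
  assumes "0 < r"
  shows "(LINT x|lborel. of_real (bump r p x) * g x) = (LINT z|lborel. of_real (\<rho> z) * g (p + r *\<^sub>R z))"
proof -
  have "(LINT z|lborel. of_real (\<rho> z) * g (p + r *\<^sub>R z)) = (LINT z|lborel. of_real (r ^ DIM('a)) * (of_real (bump r p (p + r *\<^sub>R z)) * g (p + r *\<^sub>R z)))"
    using assms by (intro Bochner_Integration.integral_cong refl) (simp add: bump_def)
  also have "\<dots> = of_real (r ^ DIM('a)) * (LINT z|lborel. of_real (bump r p (p + r *\<^sub>R z)) * g (p + r *\<^sub>R z))"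
    by (rule integral_mult_right_zero)
  also have "(LINT z|lborel. of_real (bump r p (p + r *\<^sub>R z)) * g (p + r *\<^sub>R z)) = (1 / \<bar>r\<bar> ^ DIM('a)) *\<^sub>R (LINT x|lborel. of_real (bump r p x) * g x)"
    by (rule integral_affine'[of r "\<lambda>x. of_real (bump r p x) * g x" p]) (use assms in simp)
  finally show ?thesis using assms by (simp add: scaleR_conv_of_real)
qed

lemma integrable_bump: "0 < r \<Longrightarrow> integrable lborel (\<lambda>x. complex_of_real (bump r p x))"
  using integrable_affine[OF integrable, of "1 / r" "- p /\<^sub>R r"]
  unfolding bump_def by (intro integrable_of_real integrable_divide) (simp add: scaleR_diff_right divide_inverse)

lemma inverse_transform_bump:
  assumes "0 < r"
  shows "inverse_transform (\<lambda>x. of_real (bump r p x)) \<omega> = cis (p \<bullet> \<omega>) * \<rho>hat (r *\<^sub>R \<omega>)"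
proof -
  have "inverse_transform (\<lambda>x. of_real (bump r p x)) \<omega> = (LINT z|lborel. of_real (\<rho> z) * cis (\<omega> \<bullet> (p + r *\<^sub>R z)))"
    unfolding inverse_transform_def by (rule integral_bump_mult[OF assms])
  also have "\<dots> = (LINT z|lborel. cis (p \<bullet> \<omega>) * (of_real (\<rho> z) * cis ((r *\<^sub>R \<omega>) \<bullet> z)))"
    by (intro Bochner_Integration.integral_cong refl)
      (simp add: inner_add_right inner_commute[of \<omega> p] mult.left_commute[of "cis (p \<bullet> \<omega>)"] cis_mult)
  also have "\<dots> = cis (p \<bullet> \<omega>) * \<rho>hat (r *\<^sub>R \<omega>)"
    unfolding inverse_transform_def by (rule integral_mult_right_zero)
  finally show ?thesis .
qed

lemma fourier_eq_inverse_transform: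
  "fourier f \<omega> = of_real (fourier_factor TYPE('a)) * inverse_transform f (- \<omega>)" for f :: "'a \<Rightarrow> complex"
  by (simp add: fourier_cis inverse_transform_def inner_commute)

lemma fourier_bump:
  assumes "0 < r"
  shows "fourier (\<lambda>x. of_real (bump r p x)) \<omega> = of_real (fourier_factor TYPE('a)) * (cis (- (p \<bullet> \<omega>)) * \<rho>hat (- (r *\<^sub>R \<omega>)))"
  unfolding fourier_eq_inverse_transform inverse_transform_bump[OF assms] by simp

lemma test_function_bump:
  assumes r: "0 < r"
  shows "test_function (\<lambda>x. of_real (bump r p x))"
  unfolding test_function_def
proof (intro conjI)
  show "continuous_on UNIV (\<lambda>x. complex_of_real (bump r p x))" using r by (intro continuous_intros) auto
  show "integrable lborel (\<lambda>x. complex_of_real (bump r p x))" by (rule integrable_bump[OF r])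
  obtain B where B: "\<And>x. \<rho> x \<le> B" using \<rho>_bounded by blast
  have "cmod (complex_of_real (bump r p x)) \<le> B / r ^ DIM('a)" for x
    unfolding norm_of_real abs_of_nonneg[OF bump_nonneg[OF r]] unfolding bump_def
    using r by (intro divide_right_mono B) simp
  then show "\<exists>B. \<forall>x. cmod (complex_of_real (bump r p x)) \<le> B" by blast
  have "integrable lborel (\<lambda>\<omega>. \<rho>hat (0 + (- r) *\<^sub>R \<omega>))"
    using r by (intro integrable_affine integrable_\<rho>hat) auto
  then have "integrable lborel (\<lambda>\<omega>. of_real (fourier_factor TYPE('a)) * (\<rho>hat (0 + (- r) *\<^sub>R \<omega>) * cis (- (p \<bullet> \<omega>))))"
    by (intro integrable_mult_right integrable_mult_cis) auto
  then show "integrable lborel (fourier (\<lambda>x. of_real (bump r p x)))"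
    unfolding fourier_bump[OF r, abs_def] by (simp add: mult.commute[of "cis _"])
qed

definition \<rho>_energy :: ennreal where "\<rho>_energy = L2_sq (\<lambda>x. complex_of_real (\<rho> x))"

lemma \<rho>_energy_finite: "\<rho>_energy < \<infinity>"
  using test_function_square_integrable[OF test_function_bump[of 1 0]]
  by (simp add: \<rho>_energy_def bump_def square_integrable_iff)

lemma \<rho>_energy_pos: "0 < \<rho>_energy"
proof (rule ccontr)
  assume "\<not> 0 < \<rho>_energy"
  then have "L2_sq (\<lambda>x. complex_of_real (\<rho> x)) = 0" by (simp add: \<rho>_energy_def)
  then have "AE x in lborel. ennreal ((\<rho> x)\<^sup>2) = 0"
    unfolding weighted_sq_def by (subst (asm) nn_integral_0_iff_AE) auto
  then have "AE x in lborel. \<rho> x = 0" by eventually_elim simp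
  then have "(LINT x|lborel. \<rho> x) = 0" by (rule integral_eq_zero_AE)
  then show False using mass by simp
qed

text \<open>
  The bumps around separated points have disjoint supports, so no mixed terms occur.
\<close>

lemma L2_sq_separated_bumps:
  assumes X: "finite X" "separated X h" and h: "0 < h"
  shows "L2_sq (\<lambda>x. \<Sum>y\<in>X. b y * of_real (bump h y x)) = ennreal ((\<Sum>y\<in>X. (cmod (b y))\<^sup>2) / h ^ DIM('a)) * \<rho>_energy"
proof -
  have sq: "(cmod (\<Sum>y\<in>X. b y * of_real (bump h y x)))\<^sup>2 = (\<Sum>y\<in>X. (cmod (b y))\<^sup>2 * (bump h y x)\<^sup>2)" for x
  proof (cases "\<exists>y\<in>X. norm (x - y) < h")
    case True
    then obtain y where y: "y \<in> X" "norm (x - y) < h" by blast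
    have 0: "bump h z x = 0" if "z \<in> X - {y}" for z
    proof (rule bump_eq_0[OF h])
      have "2 * h \<le> norm (y - z)" using X(2) that y(1) unfolding separated_def by auto
      also have "\<dots> \<le> norm (x - y) + norm (x - z)" using norm_triangle_ineq4[of "x - z" "x - y"] by (simp add: add.commute)
      finally show "h \<le> norm (x - z)" using y(2) by linarith
    qed
    have "(\<Sum>z\<in>X. b z * of_real (bump h z x)) = b y * of_real (bump h y x)"
      using 0 by (subst sum.remove[OF X(1) y(1)]) simp
    moreover have "(\<Sum>z\<in>X. (cmod (b z))\<^sup>2 * (bump h z x)\<^sup>2) = (cmod (b y))\<^sup>2 * (bump h y x)\<^sup>2"
      using 0 by (subst sum.remove[OF X(1) y(1)]) simp
    ultimately show ?thesis by (simp add: norm_mult power_mult_distrib)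
  next
    case False
    then have "bump h y x = 0" if "y \<in> X" for y using that by (intro bump_eq_0 h) (auto simp: not_less)
    then show ?thesis by simp
  qed
  have "L2_sq (\<lambda>x. \<Sum>y\<in>X. b y * of_real (bump h y x)) = (\<integral>\<^sup>+x. (\<Sum>y\<in>X. ennreal ((cmod (b y))\<^sup>2) * ennreal ((bump h y x)\<^sup>2)) \<partial>lborel)"
    unfolding weighted_sq_def sq by (simp add: ennreal_mult flip: sum_ennreal)
  also have "\<dots> = (\<Sum>y\<in>X. ennreal ((cmod (b y))\<^sup>2) * (\<integral>\<^sup>+x. ennreal ((bump h y x)\<^sup>2) \<partial>lborel))"
    by (subst nn_integral_sum) (auto simp: nn_integral_cmult)
  also have "\<dots> = (\<Sum>y\<in>X. ennreal ((cmod (b y))\<^sup>2) * (ennreal (1 / h ^ DIM('a)) * \<rho>_energy))"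
  proof (intro sum.cong refl arg_cong2[where f="(*)"])
    fix y
    have "(\<integral>\<^sup>+x. ennreal ((bump h y x)\<^sup>2) \<partial>lborel) = ennreal (h ^ DIM('a)) * (\<integral>\<^sup>+x. ennreal ((bump h y (y + h *\<^sub>R x))\<^sup>2) \<partial>lborel)"
      using nn_integral_affine[of "\<lambda>x. ennreal ((bump h y x)\<^sup>2)" h y] h by simp
    also have "\<dots> = ennreal (h ^ DIM('a)) * (\<integral>\<^sup>+x. ennreal (1 / (h ^ DIM('a))\<^sup>2) * ennreal (1 * (cmod (complex_of_real (\<rho> x)))\<^sup>2) \<partial>lborel)"
      using h by (simp add: bump_def power_divide ennreal_mult[symmetric] divide_inverse mult.commute power_mult_distrib power_inverse)
    also have "\<dots> = ennreal (h ^ DIM('a)) * (ennreal (1 / (h ^ DIM('a))\<^sup>2) * \<rho>_energy)"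
      unfolding \<rho>_energy_def weighted_sq_def by (subst nn_integral_cmult) auto
    also have "\<dots> = ennreal (1 / h ^ DIM('a)) * \<rho>_energy"
      using h by (simp add: mult.assoc[symmetric] ennreal_mult[symmetric] power2_eq_square)
    finally show "(\<integral>\<^sup>+x. ennreal ((bump h y x)\<^sup>2) \<partial>lborel) = ennreal (1 / h ^ DIM('a)) * \<rho>_energy" .
  qed
  also have "\<dots> = ennreal (\<Sum>y\<in>X. (cmod (b y))\<^sup>2) * (ennreal (1 / h ^ DIM('a)) * \<rho>_energy)"
    by (simp add: sum_distrib_right[symmetric])
  also have "\<dots> = ennreal ((\<Sum>y\<in>X. (cmod (b y))\<^sup>2) / h ^ DIM('a)) * \<rho>_energy"
    using h by (simp add: mult.assoc[symmetric] ennreal_mult[symmetric] sum_nonneg)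
  finally show ?thesis .
qed

lemma fourier_bump_sum:
  assumes "0 < h"
  shows "fourier (\<lambda>x. \<Sum>y\<in>X. b y * of_real (bump h y x)) \<omega> = of_real (fourier_factor TYPE('a)) * \<rho>hat (- (h *\<^sub>R \<omega>)) * exp_sum b X \<omega>"
  unfolding exp_sum_def by (subst fourier_sum_cmult[OF integrable_bump[OF assms]])
    (simp add: fourier_bump[OF assms] sum_distrib_left mult_ac)

text \<open>
  The transform of a sum of bumps is the transform of one bump times the exponential sum. By Plancherel, the
  exponential sum has in one particular weight exactly the norm of its coefficients.
\<close>

lemma separated_identity:
  assumes X: "finite X" "separated X h" and h: "0 < h"
  shows "weighted_sq (\<lambda>\<omega>. (fourier_factor TYPE('a))\<^sup>2 * (cmod (\<rho>hat (- (h *\<^sub>R \<omega>))))\<^sup>2) (exp_sum b X)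
     = ennreal ((\<Sum>y\<in>X. (cmod (b y))\<^sup>2) / h ^ DIM('a)) * \<rho>_energy"
proof -
  have "weighted_sq (\<lambda>\<omega>. (fourier_factor TYPE('a))\<^sup>2 * (cmod (\<rho>hat (- (h *\<^sub>R \<omega>))))\<^sup>2) (exp_sum b X) = L2_sq (fourier (\<lambda>x. \<Sum>y\<in>X. b y * of_real (bump h y x)))"
    unfolding weighted_sq_def fourier_bump_sum[OF h] by (simp add: norm_mult power_mult_distrib)
  also have "\<dots> = L2_sq (\<lambda>x. \<Sum>y\<in>X. b y * of_real (bump h y x))"
    by (intro Plancherel_test_function test_function_sum X test_function_bump h)
  finally show ?thesis unfolding L2_sq_separated_bumps[OF assms] .
qed

text \<open>
  The weight in \<open>separated_identity\<close> decays faster than the Sobolev weight of order \<open>- \<sigma>\<close>.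
\<close>

lemma exp_sum_lower:
  "\<exists>A\<ge>0. \<forall>h b. \<forall>X::'a set. 0 < h \<and> finite X \<and> separated X h \<longrightarrow>
     ennreal (\<Sum>y\<in>X. (cmod (b y))\<^sup>2) \<le> ennreal (A * h ^ DIM('a)) * weighted_sq (sobolev_weight h (- \<sigma>)) (exp_sum b X)"
proof -
  obtain N where N: "\<rho>_energy = ennreal N" "0 < N"
    using \<rho>_energy_finite \<rho>_energy_pos by (cases \<rho>_energy) auto
  let ?\<kappa> = "fourier_factor TYPE('a)"
  define A where "A = ?\<kappa>\<^sup>2 * C\<^sub>\<rho> / N"
  have main: "ennreal (\<Sum>y\<in>X. (cmod (b y))\<^sup>2) \<le> ennreal (A * h ^ DIM('a)) * weighted_sq (sobolev_weight h (- \<sigma>)) (exp_sum b X)"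
    if h: "0 < h" and X: "finite X" "separated X h" for h b and X :: "'a set"
  proof -
    let ?S = "\<Sum>y\<in>X. (cmod (b y))\<^sup>2"
    have S: "0 \<le> ?S" by (intro sum_nonneg) simp
    have "ennreal ?S = ennreal (h ^ DIM('a) / N) * (ennreal (?S / h ^ DIM('a)) * \<rho>_energy)"
      using h N S by (simp add: ennreal_mult[symmetric])
    also have "ennreal (?S / h ^ DIM('a)) * \<rho>_energy = weighted_sq (\<lambda>\<omega>. ?\<kappa>\<^sup>2 * (cmod (\<rho>hat (- (h *\<^sub>R \<omega>))))\<^sup>2) (exp_sum b X)"
      by (rule separated_identity[OF X h, symmetric])
    also have "\<dots> \<le> weighted_sq (\<lambda>\<omega>. (?\<kappa>\<^sup>2 * C\<^sub>\<rho>) * sobolev_weight h (- \<sigma>) \<omega>) (exp_sum b X)"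
    proof (rule weighted_sq_mono, rule mult_right_mono)
      fix \<omega>
      have "(cmod (\<rho>hat (- (h *\<^sub>R \<omega>))))\<^sup>2 \<le> C\<^sub>\<rho> * sobolev_weight 1 (- (4 * \<sigma>)) (h *\<^sub>R \<omega>)"
        using decay[of "- (h *\<^sub>R \<omega>)"] by (simp add: sobolev_weight_def)
      also have "\<dots> \<le> C\<^sub>\<rho> * sobolev_weight h (- \<sigma>) \<omega>"
        unfolding sobolev_weight_scaleR using \<sigma>_pos by (intro mult_left_mono C\<^sub>\<rho> sobolev_weight_mono) simp
      finally show "?\<kappa>\<^sup>2 * (cmod (\<rho>hat (- (h *\<^sub>R \<omega>))))\<^sup>2 \<le> (?\<kappa>\<^sup>2 * C\<^sub>\<rho>) * sobolev_weight h (- \<sigma>) \<omega>"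
        by (simp add: mult.assoc mult_left_mono)
    qed simp
    also have "\<dots> = ennreal (?\<kappa>\<^sup>2 * C\<^sub>\<rho>) * weighted_sq (sobolev_weight h (- \<sigma>)) (exp_sum b X)"
      unfolding weighted_sq_def using C\<^sub>\<rho> by (simp add: mult.assoc[of "_ * _"] ennreal_mult nn_integral_cmult)
    finally have "ennreal ?S \<le> ennreal (h ^ DIM('a) / N) * (ennreal (?\<kappa>\<^sup>2 * C\<^sub>\<rho>) * weighted_sq (sobolev_weight h (- \<sigma>)) (exp_sum b X))"
      by (simp add: mult_left_mono)
    also have "\<dots> = ennreal (A * h ^ DIM('a)) * weighted_sq (sobolev_weight h (- \<sigma>)) (exp_sum b X)"
    proof -
      have "ennreal (h ^ DIM('a) / N) * ennreal (?\<kappa>\<^sup>2 * C\<^sub>\<rho>) = ennreal (A * h ^ DIM('a))"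
        using h N C\<^sub>\<rho> by (simp add: ennreal_mult[symmetric] A_def field_simps)
      then show ?thesis by (simp only: mult.assoc[symmetric])
    qed
    finally show ?thesis .
  qed
  show ?thesis
  proof (intro exI[of _ A] conjI allI impI)
    show "0 \<le> A" using N C\<^sub>\<rho> by (simp add: A_def)
  qed (elim conjE, rule main, assumption+)
qed

text \<open>
  The weight \<open>|\<rho>hat|\<^sup>2\<close> of \<open>separated_identity\<close> may have zeros, so it does not dominate the Sobolev weight
  pointwise. Its translates do on average: a shift of the frequency multiplies the coefficients by factors of
  modulus one, hence the identity holds with every translate of the weight, and integrating it over all shifts
  against the Sobolev weight gives the bound by Peetre's inequality.
\<close>

lemma exp_sum_upper:
  "\<exists>A\<ge>0. \<forall>h b. \<forall>X::'a set. 0 < h \<and> finite X \<and> separated X h \<longrightarrow>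
     weighted_sq (sobolev_weight h (- \<sigma>)) (exp_sum b X) \<le> ennreal (A / h ^ DIM('a) * (\<Sum>y\<in>X. (cmod (b y))\<^sup>2))"
proof -
  obtain N where N: "\<rho>_energy = ennreal N" "0 < N"
    using \<rho>_energy_finite \<rho>_energy_pos by (cases \<rho>_energy) auto
  let ?\<kappa> = "fourier_factor TYPE('a)"
  let ?G = "\<lambda>\<omega>::'a. ?\<kappa>\<^sup>2 * (cmod (\<rho>hat (- \<omega>)))\<^sup>2"
  have [measurable]: "(\<lambda>\<omega>. \<rho>hat (- \<omega>)) \<in> borel_measurable borel" "(\<lambda>\<omega>. \<rho>hat (- (h *\<^sub>R \<omega>))) \<in> borel_measurable borel" for h :: real
    by measurable
  \<comment> \<open>The mass that survives Peetre's inequality; it is positive since \<open>\<rho>hat\<close> does not vanish almost everywhere.\<close>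
  define c where "c = (\<integral>\<^sup>+\<omega>. ennreal (?G \<omega> * (2 powr (- \<sigma>) * sobolev_weight 1 (- \<sigma>) \<omega>)) \<partial>lborel)"
  define I where "I = (\<integral>\<^sup>+\<omega>. ennreal (sobolev_weight 1 (- \<sigma>) (\<omega>::'a)) \<partial>lborel)"
  have I: "I < \<infinity>" unfolding I_def by (rule nn_integral_sobolev_weight_finite[OF half_dim_less])
  have "c \<noteq> 0"
  proof
    assume "c = 0"
    then have "AE \<omega> in lborel. ennreal (?G \<omega> * (2 powr (- \<sigma>) * sobolev_weight 1 (- \<sigma>) \<omega>)) = 0"
      unfolding c_def by (subst (asm) nn_integral_0_iff_AE) auto
    then have "AE \<omega> in lborel. ennreal (?G \<omega> * (cmod (exp_sum (\<lambda>_. 1) {0} \<omega>))\<^sup>2) = 0"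
    proof eventually_elim
      fix \<omega> :: 'a assume "ennreal (?G \<omega> * (2 powr (- \<sigma>) * sobolev_weight 1 (- \<sigma>) \<omega>)) = 0"
      then have "?G \<omega> * (2 powr (- \<sigma>) * sobolev_weight 1 (- \<sigma>) \<omega>) \<le> 0" by (simp only: ennreal_eq_0_iff)
      moreover have "0 < 2 powr (- \<sigma>) * sobolev_weight 1 (- \<sigma>) \<omega>" by simp
      ultimately have "\<not> 0 < ?G \<omega>" using mult_pos_pos[of "?G \<omega>" "2 powr (- \<sigma>) * sobolev_weight 1 (- \<sigma>) \<omega>"] by linarith
      then have "?G \<omega> \<le> 0" by linarith
      then have "?G \<omega> = 0" by (meson antisym mult_nonneg_nonneg zero_le_power2)
      then show "ennreal (?G \<omega> * (cmod (exp_sum (\<lambda>_. 1) {0} \<omega>))\<^sup>2) = 0" by simp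
    qed
    then have "weighted_sq ?G (exp_sum (\<lambda>_. 1) {0}) = 0"
      unfolding weighted_sq_def by (subst nn_integral_0_iff_AE) auto
    \<comment> \<open>For the single point \<open>0\<close> the exponential sum is constant, and the identity shows that \<open>\<rho>hat\<close> has positive norm.\<close>
    with separated_identity[of "{0}" 1 "\<lambda>_. 1"] N show False by (simp add: separated_def)
  qed
  moreover have "c < \<infinity>"
  proof -
    have "c \<le> (\<integral>\<^sup>+\<omega>. ennreal (?\<kappa>\<^sup>2 * sobolev_weight 1 (- \<sigma>) (\<omega>::'a)) \<partial>lborel)"
      unfolding c_def
    proof (intro nn_integral_mono ennreal_leI)
      fix \<omega> :: 'a
      have "(cmod (\<rho>hat (- \<omega>)))\<^sup>2 \<le> 1" using cmod_\<rho>hat_le_1 by (simp add: power_le_one)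
      moreover have "2 powr (- \<sigma>) \<le> (1::real)" using \<sigma>_pos powr_mono[of "- \<sigma>" 0 2] by simp
      ultimately have "(cmod (\<rho>hat (- \<omega>)))\<^sup>2 * 2 powr (- \<sigma>) \<le> 1 * 1" by (intro mult_mono) auto
      then have "?\<kappa>\<^sup>2 * ((cmod (\<rho>hat (- \<omega>)))\<^sup>2 * 2 powr (- \<sigma>)) * sobolev_weight 1 (- \<sigma>) \<omega> \<le> ?\<kappa>\<^sup>2 * (1 * 1) * sobolev_weight 1 (- \<sigma>) \<omega>"
        by (intro mult_right_mono mult_left_mono) auto
      then show "?G \<omega> * (2 powr (- \<sigma>) * sobolev_weight 1 (- \<sigma>) \<omega>) \<le> ?\<kappa>\<^sup>2 * sobolev_weight 1 (- \<sigma>) \<omega>" by (simp add: mult_ac)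
    qed
    also have "\<dots> = ennreal (?\<kappa>\<^sup>2) * I" unfolding I_def by (simp add: ennreal_mult nn_integral_cmult)
    also have "\<dots> < \<infinity>" using I by (simp add: ennreal_mult_less_top)
    finally show ?thesis .
  qed
  ultimately obtain c' where c': "c = ennreal c'" "0 < c'" by (cases c) auto
  obtain I' where I': "I = ennreal I'" "0 \<le> I'" using I by (cases I) auto
  define A where "A = N * I' / c'"
  have main: "weighted_sq (sobolev_weight h (- \<sigma>)) (exp_sum b X) \<le> ennreal (A / h ^ DIM('a) * (\<Sum>y\<in>X. (cmod (b y))\<^sup>2))"
    if h: "0 < h" and X: "finite X" "separated X h" for h b and X :: "'a set"
  proof -
    let ?P = "exp_sum b X"
    let ?S = "\<Sum>y\<in>X. (cmod (b y))\<^sup>2"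
    let ?W = "sobolev_weight h (- \<sigma>) :: 'a \<Rightarrow> real"
    have S: "0 \<le> ?S" by (intro sum_nonneg) simp
    define ch where "ch = (\<integral>\<^sup>+\<omega>. ennreal (?G (h *\<^sub>R \<omega>) * (2 powr (- \<sigma>) * ?W \<omega>)) \<partial>lborel)"
    define Ih where "Ih = (\<integral>\<^sup>+\<omega>. ennreal (?W \<omega>) \<partial>lborel)"
    have ch: "ennreal (h ^ DIM('a)) * ch = c"
      using nn_integral_affine[of "\<lambda>\<omega>. ennreal (?G \<omega> * (2 powr (- \<sigma>) * sobolev_weight 1 (- \<sigma>) \<omega>))" h 0] h
      by (simp add: ch_def c_def sobolev_weight_scaleR)
    have Ih: "ennreal (h ^ DIM('a)) * Ih = I"
      using nn_integral_affine[of "\<lambda>\<omega>::'a. ennreal (sobolev_weight 1 (- \<sigma>) \<omega>)" h 0] h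
      by (simp add: Ih_def I_def sobolev_weight_scaleR)
    have shifted: "(\<integral>\<^sup>+\<omega>. ennreal (?G (h *\<^sub>R \<omega>) * (cmod (?P (\<omega> + \<xi>)))\<^sup>2) \<partial>lborel) = ennreal (?S / h ^ DIM('a)) * \<rho>_energy" for \<xi>
      using separated_identity[OF X h, of "\<lambda>y. b y * cis (- (y \<bullet> \<xi>))"]
      by (simp add: weighted_sq_def exp_sum_translate norm_mult)
    have "ch * weighted_sq ?W ?P = (\<integral>\<^sup>+\<omega>. ennreal (?G (h *\<^sub>R \<omega>) * (2 powr (- \<sigma>) * ?W \<omega>)) * weighted_sq ?W ?P \<partial>lborel)"
      unfolding ch_def by (rule nn_integral_multc[symmetric]) measurable
    also have "\<dots> \<le> (\<integral>\<^sup>+\<omega>. \<integral>\<^sup>+\<xi>. ennreal (?G (h *\<^sub>R \<omega>) * (cmod (?P (\<omega> + \<xi>)))\<^sup>2) * ennreal (?W \<xi>) \<partial>lborel \<partial>lborel)"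
    proof (rule nn_integral_mono)
      fix \<omega> :: 'a
      have "ennreal (?G (h *\<^sub>R \<omega>) * (2 powr (- \<sigma>) * ?W \<omega>)) * weighted_sq ?W ?P = (\<integral>\<^sup>+\<mu>. ennreal (?G (h *\<^sub>R \<omega>) * (2 powr (- \<sigma>) * ?W \<omega>)) * ennreal (?W \<mu> * (cmod (?P \<mu>))\<^sup>2) \<partial>lborel)"
        unfolding weighted_sq_def by (rule nn_integral_cmult[symmetric]) measurable
      also have "\<dots> \<le> (\<integral>\<^sup>+\<mu>. ennreal (?G (h *\<^sub>R \<omega>) * (cmod (?P \<mu>))\<^sup>2) * ennreal (?W (\<mu> - \<omega>)) \<partial>lborel)"
      proof (rule nn_integral_mono)
        fix \<mu>
        have "?W \<mu> \<le> 2 powr \<sigma> * sobolev_weight h \<sigma> \<omega> * ?W (\<mu> - \<omega>)"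
          using Peetre_inequality[of 1 "- \<sigma>" "h *\<^sub>R \<mu>" "h *\<^sub>R \<omega>"] \<sigma>_pos
          by (simp add: sobolev_weight_scaleR scaleR_diff_right[symmetric])
        from mult_left_mono[OF this, of "2 powr (- \<sigma>) * ?W \<omega>"]
        have "2 powr (- \<sigma>) * ?W \<omega> * ?W \<mu> \<le> ?W (\<mu> - \<omega>)"
          by (simp add: sobolev_weight_minus powr_minus field_simps)
        from mult_left_mono[OF this, of "?G (h *\<^sub>R \<omega>) * (cmod (?P \<mu>))\<^sup>2"]
        show "ennreal (?G (h *\<^sub>R \<omega>) * (2 powr (- \<sigma>) * ?W \<omega>)) * ennreal (?W \<mu> * (cmod (?P \<mu>))\<^sup>2) \<le> ennreal (?G (h *\<^sub>R \<omega>) * (cmod (?P \<mu>))\<^sup>2) * ennreal (?W (\<mu> - \<omega>))"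
          by (simp add: ennreal_mult[symmetric] mult_ac)
      qed
      also have "\<dots> = (\<integral>\<^sup>+\<xi>. ennreal (?G (h *\<^sub>R \<omega>) * (cmod (?P (\<omega> + \<xi>)))\<^sup>2) * ennreal (?W \<xi>) \<partial>lborel)"
        using nn_integral_translate[of "\<lambda>\<mu>. ennreal (?G (h *\<^sub>R \<omega>) * (cmod (?P \<mu>))\<^sup>2) * ennreal (?W (\<mu> - \<omega>))" \<omega>] by (simp add: add.commute)
      finally show "ennreal (?G (h *\<^sub>R \<omega>) * (2 powr (- \<sigma>) * ?W \<omega>)) * weighted_sq ?W ?P \<le> (\<integral>\<^sup>+\<xi>. ennreal (?G (h *\<^sub>R \<omega>) * (cmod (?P (\<omega> + \<xi>)))\<^sup>2) * ennreal (?W \<xi>) \<partial>lborel)" .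
    qed
    also have "\<dots> = (\<integral>\<^sup>+\<xi>. \<integral>\<^sup>+\<omega>. ennreal (?G (h *\<^sub>R \<omega>) * (cmod (?P (\<omega> + \<xi>)))\<^sup>2) * ennreal (?W \<xi>) \<partial>lborel \<partial>lborel)"
      by (rule lborel_pair.Fubini') measurable
    also have "\<dots> = (\<integral>\<^sup>+\<xi>. (ennreal (?S / h ^ DIM('a)) * \<rho>_energy) * ennreal (?W \<xi>) \<partial>lborel)"
    proof (rule nn_integral_cong)
      fix \<xi>
      show "(\<integral>\<^sup>+\<omega>. ennreal (?G (h *\<^sub>R \<omega>) * (cmod (?P (\<omega> + \<xi>)))\<^sup>2) * ennreal (?W \<xi>) \<partial>lborel) = (ennreal (?S / h ^ DIM('a)) * \<rho>_energy) * ennreal (?W \<xi>)"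
        unfolding shifted[of \<xi>, symmetric] by (rule nn_integral_multc) measurable
    qed
    also have "\<dots> = (ennreal (?S / h ^ DIM('a)) * \<rho>_energy) * Ih"
      unfolding Ih_def by (rule nn_integral_cmult) measurable
    finally have "ennreal (h ^ DIM('a)) * (ch * weighted_sq ?W ?P) \<le> ennreal (h ^ DIM('a)) * ((ennreal (?S / h ^ DIM('a)) * \<rho>_energy) * Ih)"
      by (rule mult_left_mono) simp
    then have "c * weighted_sq ?W ?P \<le> (ennreal (?S / h ^ DIM('a)) * \<rho>_energy) * I"
      unfolding ch[symmetric] Ih[symmetric] by (simp only: mult_ac)
    then have "ennreal (1 / c') * (c * weighted_sq ?W ?P) \<le> ennreal (1 / c') * ((ennreal (?S / h ^ DIM('a)) * \<rho>_energy) * I)"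
      by (rule mult_left_mono) simp
    moreover have "ennreal (1 / c') * (c * weighted_sq ?W ?P) = weighted_sq ?W ?P"
      using c' by (simp add: mult.assoc[symmetric] ennreal_mult[symmetric])
    moreover have "ennreal (1 / c') * ((ennreal (?S / h ^ DIM('a)) * \<rho>_energy) * I) = ennreal (A / h ^ DIM('a) * ?S)"
      using c' I' N h S by (simp add: ennreal_mult[symmetric] A_def mult_ac)
    ultimately show ?thesis by simp
  qed
  show ?thesis
  proof (intro exI[of _ A] conjI allI impI)
    show "0 \<le> A" using N I' c' by (simp add: A_def)
  qed (elim conjE, rule main, assumption+)
qed

text \<open>
  Averages against the compactly supported mollifier see only a neighbourhood of \<open>x\<close>, where continuity
  bounds the function. So the lemma can establish that the kernel \<open>\<Phi>\<close> is bounded, which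
  inversion through Gaussian averages presupposes.
\<close>

lemma cmod_le_integral_fourier:
  fixes f :: "'a \<Rightarrow> complex"
  assumes f: "integrable lborel f" and F: "integrable lborel (fourier f)" and cont: "continuous_on UNIV f"
  shows "cmod (f x) \<le> fourier_factor TYPE('a) * (LINT \<omega>|lborel. cmod (fourier f \<omega>))"
proof -
  let ?\<kappa> = "fourier_factor TYPE('a)"
  define e where "e n = inverse (real (Suc n))" for n
  have e: "e \<longlonglongrightarrow> 0" "0 < e n" "e n \<le> 1" for n
    unfolding e_def using LIMSEQ_inverse_real_of_nat by (auto simp: inverse_le_1_iff)
  have [measurable]: "f \<in> borel_measurable borel" using borel_measurable_integrable[OF f] by simp
  have "compact (f ` cball x 1)" by (intro compact_continuous_image continuous_on_subset[OF cont]) auto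
  then obtain B where "\<forall>y\<in>f ` cball x 1. norm y \<le> B" unfolding compact_eq_bounded_closed bounded_iff by blast
  then have B: "cmod (f y) \<le> B" if "dist x y \<le> 1" for y using that by auto
  have bound: "cmod (LINT z|lborel. of_real (\<rho> z) * f (x + e n *\<^sub>R z)) \<le> ?\<kappa> * (LINT \<omega>|lborel. cmod (fourier f \<omega>))" for n
  proof -
    have "(LINT z|lborel. of_real (\<rho> z) * f (x + e n *\<^sub>R z)) = (LINT y|lborel. f y * cnj (complex_of_real (bump (e n) x y)))"
      using integral_bump_mult[OF e(2), of n x f] by (simp add: mult.commute)
    also have "\<dots> = (LINT \<omega>|lborel. fourier f \<omega> * cnj (fourier (\<lambda>y. of_real (bump (e n) x y)) \<omega>))"
      by (rule Parseval_integrable[OF f test_function_bump[OF e(2)]])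
    also have "cmod \<dots> \<le> (LINT \<omega>|lborel. ?\<kappa> * cmod (fourier f \<omega>))"
    proof (rule Bochner_Integration.integral_norm_bound_integral)
      have le: "cmod (fourier (\<lambda>y. complex_of_real (bump (e n) x y)) \<omega>) \<le> ?\<kappa>" for \<omega>
        unfolding fourier_bump[OF e(2)] using cmod_\<rho>hat_le_1 by (simp add: norm_mult mult_left_le)
      show "integrable lborel (\<lambda>\<omega>. fourier f \<omega> * cnj (fourier (\<lambda>y. of_real (bump (e n) x y)) \<omega>))"
        by (rule integrable_mult_bounded[OF F, where B="?\<kappa>"]) (use le in auto)
      show "integrable lborel (\<lambda>\<omega>. ?\<kappa> * cmod (fourier f \<omega>))" using F by simp
      show "norm (fourier f \<omega> * cnj (fourier (\<lambda>y. of_real (bump (e n) x y)) \<omega>)) \<le> ?\<kappa> * cmod (fourier f \<omega>)" for \<omega>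
        using mult_left_mono[OF le[of \<omega>], of "cmod (fourier f \<omega>)"] by (simp add: norm_mult mult.commute)
    qed
    finally show ?thesis by simp
  qed
  have "(\<lambda>n. LINT z|lborel. of_real (\<rho> z) * f (x + e n *\<^sub>R z)) \<longlonglongrightarrow> (LINT z|lborel. of_real (\<rho> z) * f x)"
  proof (rule integral_dominated_convergence[where w="\<lambda>z. \<rho> z * B"])
    have "(\<lambda>n. x + e n *\<^sub>R z) \<longlonglongrightarrow> x + 0 *\<^sub>R z" for z
      by (intro tendsto_intros e)
    then have "(\<lambda>n. f (x + e n *\<^sub>R z)) \<longlonglongrightarrow> f (x + 0 *\<^sub>R z)" for z
      by (rule continuous_on_tendsto_compose[OF cont]) auto
    then show "AE z in lborel. (\<lambda>n. of_real (\<rho> z) * f (x + e n *\<^sub>R z)) \<longlonglongrightarrow> of_real (\<rho> z) * f x"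
      by (intro always_eventually allI tendsto_intros) simp
    have "cmod (of_real (\<rho> z) * f (x + e n *\<^sub>R z)) \<le> \<rho> z * B" for n z
    proof (cases "norm z < 1")
      case True
      then have "e n * norm z \<le> 1 * 1" using e(2)[of n] e(3)[of n] by (intro mult_mono) auto
      then have "cmod (f (x + e n *\<^sub>R z)) \<le> B" using e(2)[of n] by (intro B) (simp add: dist_norm)
      then show ?thesis by (simp add: norm_mult nonneg mult_left_mono)
    qed (simp add: vanishes)
    then show "AE z in lborel. cmod (of_real (\<rho> z) * f (x + e n *\<^sub>R z)) \<le> \<rho> z * B" for n by simp
    show "integrable lborel (\<lambda>z. \<rho> z * B)" using integrable by simp
  qed measurable
  also have "(LINT z|lborel. of_real (\<rho> z) * f x) = f x"
    using integrable_complex mass by (simp add: integral_of_real[OF integrable])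
  finally have "(\<lambda>n. cmod (LINT z|lborel. of_real (\<rho> z) * f (x + e n *\<^sub>R z))) \<longlonglongrightarrow> cmod (f x)"
    by (rule tendsto_norm)
  then show ?thesis by (rule LIMSEQ_le_const2) (use bound in auto)
qed

end

section \<open>Mollifiers along a cone\<close>

lemma AE_lborel_reflect:
  fixes x :: "'a::euclidean_space"
  assumes "AE y in lborel. P y"
  shows "AE y in lborel. P (x - y)"
proof -
  have eq: "lborel = distr lborel borel (\<lambda>y. x + (-1) *\<^sub>R y)"
    using lborel_affine[of "-1" x] by (simp add: density_1)
  have "AE y in distr lborel borel (\<lambda>y. x + (-1) *\<^sub>R y). P y"
    using assms by (simp only: eq[symmetric])
  then have "AE y in lborel. P (x + (-1) *\<^sub>R y)" by (rule AE_distrD[rotated]) measurable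
  then show ?thesis by simp
qed

lemma cmod_one_minus_cis_le: "cmod (1 - cis t) \<le> 2" "cmod (1 - cis t) \<le> \<bar>t\<bar>"
proof -
  show "cmod (1 - cis t) \<le> 2" using norm_triangle_ineq4[of 1 "cis t"] by simp
  have "(cmod (1 - cis t))\<^sup>2 = (1 - cos t)\<^sup>2 + (sin t)\<^sup>2" by (simp add: cmod_power2)
  also have "\<dots> = 2 - 2 * cos (2 * (t / 2))" using sin_cos_squared_add[of t] by (simp add: power2_diff)
  also have "\<dots> = 4 * (sin (t / 2))\<^sup>2" unfolding cos_double_sin by simp
  also have "\<dots> \<le> 4 * (t / 2)\<^sup>2"
    by (intro mult_left_mono abs_le_square_iff[THEN iffD1] abs_sin_x_le_abs_x) simp
  also have "\<dots> = \<bar>t\<bar>\<^sup>2" by (simp add: power_divide)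
  finally show "cmod (1 - cis t) \<le> \<bar>t\<bar>" by (rule power2_le_imp_le) simp
qed

text \<open>
  The coefficient of \<open>w\<^sup>l\<close> in \<open>1 - (1 - w)\<^sup>k\<close>.
\<close>

definition cone_coeff :: "nat \<Rightarrow> nat \<Rightarrow> real" where
  "cone_coeff k l = - ((-1) ^ l * real (k choose l))"

lemma binomial_cone_coeff: "(1 - w) ^ k = 1 - (\<Sum>l=1..k. complex_of_real (cone_coeff k l) * w ^ l)"
proof -
  have "(1 - w) ^ k = (- w + 1) ^ k" by simp
  also have "\<dots> = (\<Sum>l\<le>k. of_nat (k choose l) * (- w) ^ l * 1 ^ (k - l))" by (rule binomial_ring)
  also have "\<dots> = (\<Sum>l\<in>insert 0 {1..k}. of_nat (k choose l) * (- w) ^ l)"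
    by (intro sum.cong) auto
  also have "\<dots> = 1 + (\<Sum>l=1..k. of_nat (k choose l) * (- w) ^ l)" by simp
  also have "(\<Sum>l=1..k. of_nat (k choose l) * (- w) ^ l) = (\<Sum>l=1..k. - (complex_of_real (cone_coeff k l) * w ^ l))"
  proof (rule sum.cong[OF refl])
    fix l show "of_nat (k choose l) * (- w) ^ l = - (complex_of_real (cone_coeff k l) * w ^ l)"
      using power_minus[of w l] by (simp add: cone_coeff_def)
  qed
  finally show ?thesis by (simp add: sum_negf)
qed

context mollifier
begin

lemma \<rho>hat_minus: "\<rho>hat (- \<omega>) = \<rho>hat \<omega>"
proof -
  have "\<rho>hat \<omega> = (LINT x|lborel. (\<lambda>x. of_real (\<rho> x) * cis (\<omega> \<bullet> x)) (0 + (-1) *\<^sub>R x))"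
    unfolding inverse_transform_def by (subst integral_affine') auto
  then show ?thesis by (simp add: inverse_transform_def even)
qed

lemma cnj_\<rho>hat: "cnj (\<rho>hat \<omega>) = \<rho>hat \<omega>"
proof -
  have "cnj (\<rho>hat \<omega>) = (LINT x|lborel. cnj (of_real (\<rho> x) * cis (\<omega> \<bullet> x)))"
    unfolding inverse_transform_def by (rule Bochner_Integration.integral_cnj[symmetric])
  also have "\<dots> = \<rho>hat (- \<omega>)" by (simp add: inverse_transform_def cis_cnj)
  finally show ?thesis by (simp add: \<rho>hat_minus)
qed

text \<open>
  Convolution with this kernel evaluates a function near the points \<open>x + h l (e + s z)\<close>, \<open>|z| < 1\<close>: the ray
  in the direction \<open>e\<close> is thickened to a cone of opening \<open>s\<close>. The combination of \<open>k\<close> points reproduces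
  polynomials of degree less than \<open>k\<close>.
\<close>

definition cone_kernel :: "nat \<Rightarrow> real \<Rightarrow> 'a \<Rightarrow> real \<Rightarrow> 'a \<Rightarrow> real" where
  "cone_kernel k s e h y = (\<Sum>l=1..k. cone_coeff k l * bump (h * real l * s) (- ((h * real l) *\<^sub>R e)) y)"

text \<open>
  The multiplier of the convolution with \<open>cone_kernel\<close> for \<open>h = 1\<close>.
\<close>

definition cone_multiplier :: "nat \<Rightarrow> real \<Rightarrow> 'a \<Rightarrow> 'a \<Rightarrow> complex" where
  "cone_multiplier k s e \<omega> = (\<Sum>l=1..k. of_real (cone_coeff k l) * (cis (real l * (e \<bullet> \<omega>)) * \<rho>hat ((real l * s) *\<^sub>R \<omega>)))"

lemma borel_measurable_cone_multiplier [measurable]: "cone_multiplier k s e \<in> borel_measurable borel"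
  unfolding cone_multiplier_def[abs_def] by measurable

lemma cone_kernel_complex:
  "complex_of_real (cone_kernel k s e h y) = (\<Sum>l=1..k. of_real (cone_coeff k l) * of_real (bump (h * real l * s) (- ((h * real l) *\<^sub>R e)) y))"
  by (simp add: cone_kernel_def)

lemma test_function_cone_kernel:
  assumes "0 < s" "0 < h"
  shows "test_function (\<lambda>y. complex_of_real (cone_kernel k s e h y))"
  unfolding cone_kernel_complex using assms by (intro test_function_sum test_function_bump) auto

lemma fourier_cone_kernel:
  assumes "0 < s" "0 < h"
  shows "fourier (\<lambda>y. complex_of_real (cone_kernel k s e h y)) \<omega> = of_real (fourier_factor TYPE('a)) * cone_multiplier k s e (h *\<^sub>R \<omega>)"
proof -
  have "fourier (\<lambda>y. complex_of_real (cone_kernel k s e h y)) \<omega> = (\<Sum>l=1..k. of_real (cone_coeff k l) * fourier (\<lambda>y. of_real (bump (h * real l * s) (- ((h * real l) *\<^sub>R e)) y)) \<omega>)"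
    unfolding cone_kernel_complex using assms by (intro fourier_sum_cmult integrable_bump) auto
  also have "\<dots> = of_real (fourier_factor TYPE('a)) * cone_multiplier k s e (h *\<^sub>R \<omega>)"
    unfolding cone_multiplier_def sum_distrib_left
  proof (rule sum.cong[OF refl])
    fix l assume "l \<in> {1..k}"
    then have r: "0 < h * real l * s" using assms by auto
    show "of_real (cone_coeff k l) * fourier (\<lambda>y. of_real (bump (h * real l * s) (- ((h * real l) *\<^sub>R e)) y)) \<omega> =
       of_real (fourier_factor TYPE('a)) * (of_real (cone_coeff k l) * (cis (real l * (e \<bullet> (h *\<^sub>R \<omega>))) * \<rho>hat ((real l * s) *\<^sub>R h *\<^sub>R \<omega>)))"
      unfolding fourier_bump[OF r] \<rho>hat_minus by (simp add: mult_ac)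
  qed
  finally show ?thesis .
qed

lemma cone_kernel_support:
  assumes "0 < s" "0 < h" "cone_kernel k s e h y \<noteq> 0"
  obtains l z where "l \<in> {1..k}" "norm z < 1" "- y = (h * real l) *\<^sub>R (e + s *\<^sub>R z)"
proof -
  from assms(3) obtain l where l: "l \<in> {1..k}" "bump (h * real l * s) (- ((h * real l) *\<^sub>R e)) y \<noteq> 0"
    unfolding cone_kernel_def by (elim sum.not_neutral_contains_not_neutral) auto
  have r: "0 < h * real l * s" "0 < h * real l" using l assms by auto
  define z where "z = - (y + (h * real l) *\<^sub>R e) /\<^sub>R (h * real l * s)"
  have "norm (y + (h * real l) *\<^sub>R e) < h * real l * s"
    using bump_eq_0[OF r(1), of y "- ((h * real l) *\<^sub>R e)"] l(2) by (auto simp: not_le[symmetric])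
  moreover have "norm z = norm (y + (h * real l) *\<^sub>R e) / (h * real l * s)"
    unfolding z_def norm_scaleR norm_minus_cancel abs_of_pos[OF positive_imp_inverse_positive[OF r(1)]]
    by (simp only: divide_inverse mult.commute)
  ultimately have "norm z < 1" using r by simp
  moreover have "- y = (h * real l) *\<^sub>R (e + s *\<^sub>R z)"
  proof -
    have "(h * real l) *\<^sub>R (s *\<^sub>R z) = - (y + (h * real l) *\<^sub>R e)"
      unfolding z_def scaleR_scaleR mult.assoc[symmetric] by (subst right_inverse) (use r l in auto)
    then show ?thesis by (simp add: scaleR_add_right)
  qed
  ultimately show thesis using that l(1) by blast
qed

text \<open>
  The kernel sees only the cone with apex \<open>x\<close>, which is contained in \<open>\<Omega>\<close>.
\<close>

lemma convolve_cone_kernel_local: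
  assumes "0 < s" "0 < h" and ae: "AE x in lborel. x \<in> \<Omega> \<longrightarrow> f x = f' x"
    and [measurable]: "f \<in> borel_measurable borel" "f' \<in> borel_measurable borel"
    and cone: "\<And>l z. l \<in> {1..k} \<Longrightarrow> norm z < 1 \<Longrightarrow> x + (h * real l) *\<^sub>R (e + s *\<^sub>R z) \<in> \<Omega>"
  shows "convolve (\<lambda>y. complex_of_real (cone_kernel k s e h y)) f x = convolve (\<lambda>y. complex_of_real (cone_kernel k s e h y)) f' x"
  unfolding convolve_def
proof (rule integral_cong_AE)
  have [measurable]: "(\<lambda>y. complex_of_real (cone_kernel k s e h y)) \<in> borel_measurable borel"
    unfolding cone_kernel_def[abs_def] by measurable
  show "(\<lambda>y. complex_of_real (cone_kernel k s e h y) * f (x - y)) \<in> borel_measurable lborel"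
    "(\<lambda>y. complex_of_real (cone_kernel k s e h y) * f' (x - y)) \<in> borel_measurable lborel" by measurable
  show "AE y in lborel. complex_of_real (cone_kernel k s e h y) * f (x - y) = complex_of_real (cone_kernel k s e h y) * f' (x - y)"
    using AE_lborel_reflect[OF ae, of x]
  proof eventually_elim
    fix y assume eq: "x - y \<in> \<Omega> \<longrightarrow> f (x - y) = f' (x - y)"
    show "complex_of_real (cone_kernel k s e h y) * f (x - y) = complex_of_real (cone_kernel k s e h y) * f' (x - y)"
    proof (cases "cone_kernel k s e h y = 0")
      case False
      from cone_kernel_support[OF assms(1,2) this] obtain l z where
        "l \<in> {1..k}" "norm z < 1" "- y = (h * real l) *\<^sub>R (e + s *\<^sub>R z)" by blast
      with cone[of l z] have "x + - y \<in> \<Omega>" by (simp only:)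
      then have "x - y \<in> \<Omega>" by simp
      with eq show ?thesis by simp
    qed simp
  qed
qed

text \<open>
  The adjoint of the convolution, applied to point masses at \<open>X\<close>. Its support lies in the cones with apexes
  in \<open>X\<close>.
\<close>

definition cone_test :: "nat \<Rightarrow> real \<Rightarrow> 'a \<Rightarrow> real \<Rightarrow> ('a \<Rightarrow> complex) \<Rightarrow> 'a set \<Rightarrow> 'a \<Rightarrow> complex" where
  "cone_test k s e h b X x = (\<Sum>y\<in>X. b y * of_real (cone_kernel k s e h (y - x)))"

lemma bump_reflect: "bump r p (y - x) = bump r (y - p) x"
  using even[of "(y - x - p) /\<^sub>R r"] by (simp add: bump_def algebra_simps flip: scaleR_minus_right)

lemma cone_kernel_reflect:
  "complex_of_real (cone_kernel k s e h (y - x)) = (\<Sum>l=1..k. of_real (cone_coeff k l) * of_real (bump (h * real l * s) (y + (h * real l) *\<^sub>R e) x))"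
  unfolding cone_kernel_complex bump_reflect by simp

lemma test_function_cone_test:
  assumes "0 < s" "0 < h" "finite X"
  shows "test_function (cone_test k s e h b X)"
  unfolding cone_test_def[abs_def] cone_kernel_reflect
  using assms by (intro test_function_sum test_function_bump) auto

lemma fourier_cone_test:
  assumes "0 < s" "0 < h"
  shows "fourier (cone_test k s e h b X) \<omega> = of_real (fourier_factor TYPE('a)) * (exp_sum b X \<omega> * cnj (cone_multiplier k s e (h *\<^sub>R \<omega>)))"
proof -
  let ?\<kappa> = "complex_of_real (fourier_factor TYPE('a))"
  have b: "integrable lborel (\<lambda>x. complex_of_real (bump (h * real l * s) (y + (h * real l) *\<^sub>R e) x))" if "l \<in> {1..k}" for l y
    using that assms by (intro integrable_bump) auto
  have single: "fourier (\<lambda>x. complex_of_real (cone_kernel k s e h (y - x))) \<omega> = ?\<kappa> * cis (- (y \<bullet> \<omega>)) * cnj (cone_multiplier k s e (h *\<^sub>R \<omega>))" for y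
  proof -
    have "fourier (\<lambda>x. complex_of_real (cone_kernel k s e h (y - x))) \<omega> =
      (\<Sum>l=1..k. of_real (cone_coeff k l) * fourier (\<lambda>x. of_real (bump (h * real l * s) (y + (h * real l) *\<^sub>R e) x)) \<omega>)"
      unfolding cone_kernel_reflect by (rule fourier_sum_cmult[OF b])
    also have "\<dots> = (\<Sum>l=1..k. ?\<kappa> * cis (- (y \<bullet> \<omega>)) * cnj (of_real (cone_coeff k l) * (cis (real l * (e \<bullet> (h *\<^sub>R \<omega>))) * \<rho>hat ((real l * s) *\<^sub>R h *\<^sub>R \<omega>))))"
    proof (rule sum.cong[OF refl])
      fix l assume "l \<in> {1..k}"
      then have r: "0 < h * real l * s" using assms by auto
      have "cis (- ((y + (h * real l) *\<^sub>R e) \<bullet> \<omega>)) = cis (- (y \<bullet> \<omega>)) * cnj (cis (real l * (e \<bullet> (h *\<^sub>R \<omega>))))"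
        by (simp add: cis_cnj cis_mult inner_add_left algebra_simps)
      then show "of_real (cone_coeff k l) * fourier (\<lambda>x. of_real (bump (h * real l * s) (y + (h * real l) *\<^sub>R e) x)) \<omega> =
        ?\<kappa> * cis (- (y \<bullet> \<omega>)) * cnj (of_real (cone_coeff k l) * (cis (real l * (e \<bullet> (h *\<^sub>R \<omega>))) * \<rho>hat ((real l * s) *\<^sub>R h *\<^sub>R \<omega>)))"
        unfolding fourier_bump[OF r] \<rho>hat_minus complex_cnj_mult cnj_\<rho>hat complex_cnj_complex_of_real by (simp add: mult_ac)
    qed
    finally show ?thesis unfolding cone_multiplier_def by (simp add: sum_distrib_left)
  qed
  have "integrable lborel (\<lambda>x. complex_of_real (cone_kernel k s e h (y - x)))" for y
    unfolding cone_kernel_reflect by (intro Bochner_Integration.integrable_sum integrable_mult_right b)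
  then have "fourier (cone_test k s e h b X) \<omega> = (\<Sum>y\<in>X. b y * fourier (\<lambda>x. complex_of_real (cone_kernel k s e h (y - x))) \<omega>)"
    unfolding cone_test_def[abs_def] by (rule fourier_sum_cmult)
  also have "\<dots> = ?\<kappa> * (exp_sum b X \<omega> * cnj (cone_multiplier k s e (h *\<^sub>R \<omega>)))"
    unfolding single exp_sum_def sum_distrib_left sum_distrib_right by (intro sum.cong refl) (simp only: mult_ac)
  finally show ?thesis .
qed

text \<open>
  Both sides are pairings with \<open>cone_test\<close>, which is supported in \<open>\<Omega>\<close>. The transform \<open>g\<close> of a function may therefore
  be replaced by the transform of any other function with the same values on \<open>\<Omega>\<close>.
\<close>

lemma cone_pairing_local:
  assumes sh: "0 < s" "0 < h" and X: "finite X"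
    and ae: "AE x in lborel. x \<in> \<Omega> \<longrightarrow> f x = f' x"
    and f: "square_integrable f" "has_fourier_L2 f g" and f': "square_integrable f'" "has_fourier_L2 f' g'"
    and cone: "\<And>y l z. y \<in> X \<Longrightarrow> b y \<noteq> 0 \<Longrightarrow> l \<in> {1..k} \<Longrightarrow> norm z < 1 \<Longrightarrow> y + (h * real l) *\<^sub>R (e + s *\<^sub>R z) \<in> \<Omega>"
  shows "(LINT \<omega>|lborel. g \<omega> * (cone_multiplier k s e (h *\<^sub>R \<omega>) * cnj (exp_sum b X \<omega>))) =
    (LINT \<omega>|lborel. g' \<omega> * (cone_multiplier k s e (h *\<^sub>R \<omega>) * cnj (exp_sum b X \<omega>)))"
proof -
  let ?\<chi> = "cone_test k s e h b X"
  let ?\<kappa> = "complex_of_real (fourier_factor TYPE('a))"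
  have t: "test_function ?\<chi>" by (rule test_function_cone_test[OF sh X])
  have [measurable]: "f \<in> borel_measurable borel" "f' \<in> borel_measurable borel" "?\<chi> \<in> borel_measurable borel"
    using f f' test_function_square_integrable[OF t] by auto
  have F: "?\<kappa> * (LINT \<omega>|lborel. G \<omega> * (cone_multiplier k s e (h *\<^sub>R \<omega>) * cnj (exp_sum b X \<omega>))) = (LINT \<omega>|lborel. G \<omega> * cnj (fourier ?\<chi> \<omega>))" for G
    unfolding fourier_cone_test[OF sh] integral_mult_right_zero[symmetric]
    by (intro Bochner_Integration.integral_cong refl) (simp add: mult_ac)
  have "(LINT x|lborel. f x * cnj (?\<chi> x)) = (LINT x|lborel. f' x * cnj (?\<chi> x))"
  proof (rule integral_cong_AE)
    show "AE x in lborel. f x * cnj (?\<chi> x) = f' x * cnj (?\<chi> x)"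
      using ae
    proof eventually_elim
      fix x assume eq: "x \<in> \<Omega> \<longrightarrow> f x = f' x"
      show "f x * cnj (?\<chi> x) = f' x * cnj (?\<chi> x)"
      proof (cases "?\<chi> x = 0")
        case False
        then obtain y where y: "y \<in> X" "b y * of_real (cone_kernel k s e h (y - x)) \<noteq> 0"
          unfolding cone_test_def by (elim sum.not_neutral_contains_not_neutral)
        then have "cone_kernel k s e h (y - x) \<noteq> 0" by auto
        from cone_kernel_support[OF sh this] obtain l z where
          lz: "l \<in> {1..k}" "norm z < 1" "- (y - x) = (h * real l) *\<^sub>R (e + s *\<^sub>R z)" by blast
        have "y + (h * real l) *\<^sub>R (e + s *\<^sub>R z) \<in> \<Omega>" using cone[OF y(1) _ lz(1,2)] y(2) by auto
        then have "x \<in> \<Omega>" unfolding lz(3)[symmetric] by simp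
        with eq show ?thesis by simp
      qed simp
    qed
  qed measurable
  then have "?\<kappa> * (LINT \<omega>|lborel. g \<omega> * (cone_multiplier k s e (h *\<^sub>R \<omega>) * cnj (exp_sum b X \<omega>))) =
    ?\<kappa> * (LINT \<omega>|lborel. g' \<omega> * (cone_multiplier k s e (h *\<^sub>R \<omega>) * cnj (exp_sum b X \<omega>)))"
    unfolding F Parseval_test_function[OF f t] Parseval_test_function[OF f' t] .
  then show ?thesis by simp
qed

text \<open>
  The transform of \<open>\<rho>\<close> decays; the smallest of the dilations \<open>l s\<close>, the one for \<open>l = 1\<close>, is the worst.
\<close>

lemma cone_multiplier_le:
  assumes s: "0 < s"
  shows "\<exists>C\<ge>0. \<forall>\<omega>. (cmod (cone_multiplier k s e \<omega>))\<^sup>2 \<le> C * sobolev_weight 1 (- \<sigma>) \<omega>"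
proof -
  define K where "K = max 1 (1 / s)"
  have K: "1 \<le> K" "1 \<le> K * s" using s by (auto simp: K_def max_def field_simps)
  define A where "A = (\<Sum>l=1..k. \<bar>cone_coeff k l\<bar> * (sqrt C\<^sub>\<rho> * K powr (2 * (2 * \<sigma>))))"
  have A: "0 \<le> A" unfolding A_def using C\<^sub>\<rho> by (intro sum_nonneg mult_nonneg_nonneg) auto
  have "(cmod (cone_multiplier k s e \<omega>))\<^sup>2 \<le> A\<^sup>2 * sobolev_weight 1 (- \<sigma>) \<omega>" for \<omega>
  proof -
    have "cmod (cone_multiplier k s e \<omega>) \<le> (\<Sum>l=1..k. cmod (of_real (cone_coeff k l) * (cis (real l * (e \<bullet> \<omega>)) * \<rho>hat ((real l * s) *\<^sub>R \<omega>))))"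
      unfolding cone_multiplier_def by (rule norm_sum)
    also have "\<dots> \<le> (\<Sum>l=1..k. \<bar>cone_coeff k l\<bar> * (sqrt C\<^sub>\<rho> * K powr (2 * (2 * \<sigma>))) * sobolev_weight 1 (- (2 * \<sigma>)) \<omega>)"
    proof (rule sum_mono)
      fix l assume l: "l \<in> {1..k}"
      have "cmod (\<rho>hat ((real l * s) *\<^sub>R \<omega>)) \<le> sqrt C\<^sub>\<rho> * sobolev_weight (real l * s) (- (2 * \<sigma>)) \<omega>"
        using cmod_\<rho>hat_le[of "(real l * s) *\<^sub>R \<omega>"] unfolding sobolev_weight_scaleR .
      also have "\<dots> \<le> sqrt C\<^sub>\<rho> * (K powr (2 * (2 * \<sigma>)) * sobolev_weight 1 (- (2 * \<sigma>)) \<omega>)"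
      proof (intro mult_left_mono sobolev_weight_dilate_le)
        have "1 * 1 \<le> real l * (K * s)" using l K by (intro mult_mono) auto
        then show "1 \<le> K * (real l * s)" by (simp add: mult_ac)
      qed (use l s K \<sigma>_pos C\<^sub>\<rho> in auto)
      finally show "cmod (of_real (cone_coeff k l) * (cis (real l * (e \<bullet> \<omega>)) * \<rho>hat ((real l * s) *\<^sub>R \<omega>))) \<le>
        \<bar>cone_coeff k l\<bar> * (sqrt C\<^sub>\<rho> * K powr (2 * (2 * \<sigma>))) * sobolev_weight 1 (- (2 * \<sigma>)) \<omega>"
        by (simp add: norm_mult mult.assoc mult_left_mono)
    qed
    also have "\<dots> = A * sobolev_weight 1 (- (2 * \<sigma>)) \<omega>" by (simp only: A_def sum_distrib_right)
    finally have "(cmod (cone_multiplier k s e \<omega>))\<^sup>2 \<le> (A * sobolev_weight 1 (- (2 * \<sigma>)) \<omega>)\<^sup>2"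
      by (rule power_mono) simp
    also have "\<dots> = A\<^sup>2 * sobolev_weight 1 (- (2 * \<sigma>) + - (2 * \<sigma>)) \<omega>"
      by (simp only: sobolev_weight_add power_mult_distrib) (simp only: power2_eq_square)
    also have "\<dots> \<le> A\<^sup>2 * sobolev_weight 1 (- \<sigma>) \<omega>"
      using \<sigma>_pos by (intro mult_left_mono sobolev_weight_mono) auto
    finally show ?thesis .
  qed
  then show ?thesis by (intro exI[of _ "A\<^sup>2"]) simp
qed

text \<open>
  The binomial theorem under the integral; this is the reason for the choice of the coefficients.
\<close>

lemma one_minus_cone_multiplier:
  "1 - cone_multiplier k s e \<omega> = (LINT z|lborel. of_real (\<rho> z) * (1 - cis ((e + s *\<^sub>R z) \<bullet> \<omega>)) ^ k)"
proof -
  have i: "integrable lborel (\<lambda>z. complex_of_real (\<rho> z) * (cis (\<omega> \<bullet> ((real l * s) *\<^sub>R z))))" for l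
    by (rule integrable_mult_cis[OF integrable_complex]) measurable
  have "(LINT z|lborel. of_real (\<rho> z) * (1 - cis ((e + s *\<^sub>R z) \<bullet> \<omega>)) ^ k) =
     (LINT z|lborel. of_real (\<rho> z) - (\<Sum>l=1..k. (of_real (cone_coeff k l) * cis (real l * (e \<bullet> \<omega>))) * (of_real (\<rho> z) * cis (\<omega> \<bullet> ((real l * s) *\<^sub>R z)))))"
  proof (rule Bochner_Integration.integral_cong[OF refl])
    fix z
    have "cis ((e + s *\<^sub>R z) \<bullet> \<omega>) ^ l = cis (real l * (e \<bullet> \<omega>)) * cis (\<omega> \<bullet> ((real l * s) *\<^sub>R z))" for l
      unfolding Complex.DeMoivre cis_mult
      by (rule arg_cong[where f=cis]) (simp add: inner_add_left inner_commute[of z] algebra_simps)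
    then show "of_real (\<rho> z) * (1 - cis ((e + s *\<^sub>R z) \<bullet> \<omega>)) ^ k = of_real (\<rho> z) - (\<Sum>l=1..k. (of_real (cone_coeff k l) * cis (real l * (e \<bullet> \<omega>))) * (of_real (\<rho> z) * cis (\<omega> \<bullet> ((real l * s) *\<^sub>R z))))"
      unfolding binomial_cone_coeff right_diff_distrib sum_distrib_left by (simp only: mult_ac mult_1)
  qed
  also have "\<dots> = (LINT z|lborel. of_real (\<rho> z)) - (\<Sum>l=1..k. (of_real (cone_coeff k l) * cis (real l * (e \<bullet> \<omega>))) * (LINT z|lborel. of_real (\<rho> z) * cis (\<omega> \<bullet> ((real l * s) *\<^sub>R z))))"
    by (subst Bochner_Integration.integral_diff, rule integrable_complex, intro Bochner_Integration.integrable_sum integrable_mult_right i,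
        subst Bochner_Integration.integral_sum, intro integrable_mult_right i, simp only: integral_mult_right_zero)
  also have "(LINT z|lborel. complex_of_real (\<rho> z)) = 1" using mass by (simp add: integral_of_real[OF integrable])
  finally show ?thesis
    by (simp add: cone_multiplier_def inverse_transform_def mult.assoc)
qed

text \<open>
  Each of the \<open>k\<close> factors \<open>1 - cis (\<dots>)\<close> is at most a multiple of \<open>|\<omega>|\<close> and at most two, so its square is
  at most a multiple of \<open>|\<omega>|\<^sup>2 / (1 + |\<omega>|\<^sup>2)\<close>.
\<close>

lemma one_minus_cone_multiplier_le:
  assumes s: "0 < s" and k: "\<sigma> \<le> real k"
  shows "\<exists>C\<ge>0. \<forall>\<omega>. (cmod (1 - cone_multiplier k s e \<omega>))\<^sup>2 \<le> C * ((norm \<omega>)\<^sup>2 / (1 + (norm \<omega>)\<^sup>2)) powr \<sigma>"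
proof -
  define R where "R = norm e + s"
  have R: "0 \<le> R" using s by (simp add: R_def)
  have k0: "0 < k" using k \<sigma>_pos by (cases k) auto
  have "(cmod (1 - cone_multiplier k s e \<omega>))\<^sup>2 \<le> (4 + R\<^sup>2) ^ k * ((norm \<omega>)\<^sup>2 / (1 + (norm \<omega>)\<^sup>2)) powr \<sigma>" for \<omega>
  proof -
    define y where "y = (norm \<omega>)\<^sup>2 / (1 + (norm \<omega>)\<^sup>2)"
    have pos: "0 < 1 + (norm \<omega>)\<^sup>2" by (simp add: add_pos_nonneg)
    have y: "0 \<le> y" "y \<le> 1" using pos by (auto simp: y_def)
    define a where "a = sqrt ((4 + R\<^sup>2) * y)"
    have a: "0 \<le> a" using y by (simp add: a_def)
    have le_a: "cmod (1 - cis ((e + s *\<^sub>R z) \<bullet> \<omega>)) \<le> a" if "norm z < 1" for z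
    proof -
      let ?c = "cmod (1 - cis ((e + s *\<^sub>R z) \<bullet> \<omega>))"
      have "\<bar>(e + s *\<^sub>R z) \<bullet> \<omega>\<bar> \<le> norm (e + s *\<^sub>R z) * norm \<omega>" by (rule Cauchy_Schwarz_ineq2)
      also have "norm (e + s *\<^sub>R z) \<le> R"
      proof -
        have "s * norm z \<le> s" using that s by (intro mult_left_le) auto
        moreover have "norm (e + s *\<^sub>R z) \<le> norm e + s * norm z" using norm_triangle_ineq[of e "s *\<^sub>R z"] s by simp
        ultimately show ?thesis unfolding R_def by linarith
      qed
      finally have "\<bar>(e + s *\<^sub>R z) \<bullet> \<omega>\<bar> \<le> R * norm \<omega>" by (simp add: mult_right_mono)
      then have "?c \<le> R * norm \<omega>" using cmod_one_minus_cis_le(2) order_trans by blast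
      then have "?c\<^sup>2 \<le> (R * norm \<omega>)\<^sup>2" by (intro power_mono) auto
      then have 1: "?c\<^sup>2 \<le> R\<^sup>2 * (norm \<omega>)\<^sup>2" by (simp add: power_mult_distrib)
      have "?c\<^sup>2 \<le> 2\<^sup>2" by (intro power_mono cmod_one_minus_cis_le) auto
      then have 2: "?c\<^sup>2 * (norm \<omega>)\<^sup>2 \<le> 4 * (norm \<omega>)\<^sup>2" by (intro mult_right_mono) auto
      have "?c\<^sup>2 * (1 + (norm \<omega>)\<^sup>2) \<le> (4 + R\<^sup>2) * (norm \<omega>)\<^sup>2"
        using 1 2 by (simp add: algebra_simps)
      then have "?c\<^sup>2 \<le> (4 + R\<^sup>2) * y" using pos by (simp add: y_def pos_le_divide_eq)
      then show ?thesis unfolding a_def by (rule real_le_rsqrt)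
    qed
    have "cmod (1 - cone_multiplier k s e \<omega>) \<le> (LINT z|lborel. \<rho> z * a ^ k)"
      unfolding one_minus_cone_multiplier
    proof (rule Bochner_Integration.integral_norm_bound_integral)
      have "cmod ((1 - cis ((e + s *\<^sub>R z) \<bullet> \<omega>)) ^ k) \<le> 2 ^ k" for z
        unfolding norm_power by (intro power_mono cmod_one_minus_cis_le) auto
      then show "Bochner_Integration.integrable lborel (\<lambda>z. of_real (\<rho> z) * (1 - cis ((e + s *\<^sub>R z) \<bullet> \<omega>)) ^ k)"
        by (intro integrable_mult_bounded[OF integrable_complex]) auto
      show "Bochner_Integration.integrable lborel (\<lambda>z. \<rho> z * a ^ k)" using integrable by simp
      show "norm (of_real (\<rho> z) * (1 - cis ((e + s *\<^sub>R z) \<bullet> \<omega>)) ^ k) \<le> \<rho> z * a ^ k" for z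
      proof (cases "norm z < 1")
        case True
        then show ?thesis unfolding norm_mult norm_power norm_of_real abs_of_nonneg[OF nonneg]
          by (intro mult_left_mono power_mono le_a nonneg) auto
      qed (simp add: vanishes)
    qed
    also have "\<dots> = a ^ k" using mass integrable by simp
    finally have "(cmod (1 - cone_multiplier k s e \<omega>))\<^sup>2 \<le> (a ^ k)\<^sup>2" by (intro power_mono) auto
    also have "\<dots> = (a\<^sup>2) ^ k" by (simp add: power_mult[symmetric] mult.commute)
    also have "\<dots> = (4 + R\<^sup>2) ^ k * y ^ k" using y by (simp add: a_def power_mult_distrib)
    also have "y ^ k \<le> y powr \<sigma>"
    proof (cases "y = 0")
      case False
      then have "y ^ k = y powr k" using y by (simp add: powr_realpow)
      also have "\<dots> \<le> y powr \<sigma>" using k y by (intro powr_mono') auto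
      finally show ?thesis .
    qed (use k0 in \<open>simp add: power_0_left\<close>)
    finally show ?thesis by (simp add: mult_left_mono y_def)
  qed
  then show ?thesis by (intro exI[of _ "(4 + R\<^sup>2) ^ k"]) simp
qed

text \<open>
  Smoothing at the scale \<open>h\<close>, measured in norms of the coarser scale \<open>\<delta>\<close>. The last bound keeps the
  decay at the scale \<open>h\<close>, as the estimate of exponential sums requires.
\<close>

lemma cone_multiplier_bounds:
  assumes s: "0 < s" and k: "\<sigma> \<le> real k"
  shows "\<exists>C\<ge>0. \<forall>h \<delta> \<omega>. 0 < h \<and> h \<le> \<delta> \<longrightarrow>
     (\<forall>r. 0 \<le> r \<and> r \<le> \<sigma> \<longrightarrow>
       (cmod (cone_multiplier k s e (h *\<^sub>R \<omega>)))\<^sup>2 * sobolev_weight \<delta> r \<omega> \<le> C * (\<delta> / h) powr (2 * r) \<and>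
       (cmod (1 - cone_multiplier k s e (h *\<^sub>R \<omega>)))\<^sup>2 * sobolev_weight \<delta> (- r) \<omega> \<le> C * (h / \<delta>) powr (2 * r)) \<and>
     (cmod (1 - cone_multiplier k s e (h *\<^sub>R \<omega>)))\<^sup>2 * sobolev_weight \<delta> (- \<sigma>) \<omega> \<le> C * (h / \<delta>) powr (2 * \<sigma>) * sobolev_weight h (- \<sigma>) \<omega>"
proof -
  obtain C1 where C1: "0 \<le> C1" "\<And>\<omega>. (cmod (cone_multiplier k s e \<omega>))\<^sup>2 \<le> C1 * sobolev_weight 1 (- \<sigma>) \<omega>"
    using cone_multiplier_le[OF s, of k e] by blast
  obtain C2 where C2: "0 \<le> C2" "\<And>\<omega>. (cmod (1 - cone_multiplier k s e \<omega>))\<^sup>2 \<le> C2 * ((norm \<omega>)\<^sup>2 / (1 + (norm \<omega>)\<^sup>2)) powr \<sigma>"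
    using one_minus_cone_multiplier_le[OF s k, of e] by blast
  define C where "C = max C1 C2"
  have C: "0 \<le> C" "C1 \<le> C" "C2 \<le> C" using C1 by (auto simp: C_def)
  have bound: "(cmod (cone_multiplier k s e (h *\<^sub>R \<omega>)))\<^sup>2 * sobolev_weight \<delta> r \<omega> \<le> C * (\<delta> / h) powr (2 * r)"
    if h: "0 < h" "h \<le> \<delta>" and r: "0 \<le> r" "r \<le> \<sigma>" for h \<delta> r \<omega>
  proof -
    have "(cmod (cone_multiplier k s e (h *\<^sub>R \<omega>)))\<^sup>2 \<le> C1 * sobolev_weight h (- \<sigma>) \<omega>"
      using C1(2)[of "h *\<^sub>R \<omega>"] unfolding sobolev_weight_scaleR .
    also have "\<dots> \<le> C * sobolev_weight h (- r) \<omega>" using r C C1 by (intro mult_mono sobolev_weight_mono) auto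
    finally have "(cmod (cone_multiplier k s e (h *\<^sub>R \<omega>)))\<^sup>2 * sobolev_weight \<delta> r \<omega> \<le> C * sobolev_weight h (- r) \<omega> * ((\<delta> / h) powr (2 * r) * sobolev_weight h r \<omega>)"
      using h r C by (intro mult_mono sobolev_weight_dilate_le) auto
    also have "\<dots> = C * (\<delta> / h) powr (2 * r)" by (simp add: sobolev_weight_minus)
    finally show ?thesis .
  qed
  have quot: "((norm (h *\<^sub>R \<omega>))\<^sup>2 / (1 + (norm (h *\<^sub>R \<omega>))\<^sup>2)) powr r = ((h * norm \<omega>)\<^sup>2) powr r * sobolev_weight h (- r) \<omega>"
    if "0 < h" for h r and \<omega> :: 'a
    using that one_plus_sq_pos[of h \<omega>] by (simp add: sobolev_weight_def powr_divide powr_minus_divide power_mult_distrib)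
  have num: "((h * norm \<omega>)\<^sup>2) powr r \<le> (h / \<delta>) powr (2 * r) * sobolev_weight \<delta> r \<omega>" if h: "0 < h" "h \<le> \<delta>" and r: "0 \<le> r" for h \<delta> r and \<omega> :: 'a
  proof -
    have "(h * norm \<omega>)\<^sup>2 = (h / \<delta>)\<^sup>2 * (\<delta>\<^sup>2 * (norm \<omega>)\<^sup>2)" using h by (simp add: power_mult_distrib power_divide)
    also have "\<dots> \<le> (h / \<delta>)\<^sup>2 * (1 + \<delta>\<^sup>2 * (norm \<omega>)\<^sup>2)" by (intro mult_left_mono) auto
    finally have "((h * norm \<omega>)\<^sup>2) powr r \<le> ((h / \<delta>)\<^sup>2 * (1 + \<delta>\<^sup>2 * (norm \<omega>)\<^sup>2)) powr r" using r by (intro powr_mono2) auto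
    also have "\<dots> = (h / \<delta>) powr (2 * r) * sobolev_weight \<delta> r \<omega>"
      using h by (simp add: powr_mult sobolev_weight_def powr_powr[symmetric] powr_numeral)
    finally show ?thesis .
  qed
  have bound': "(cmod (1 - cone_multiplier k s e (h *\<^sub>R \<omega>)))\<^sup>2 * sobolev_weight \<delta> (- r) \<omega> \<le> C * (h / \<delta>) powr (2 * r) * sobolev_weight h (- r) \<omega>"
    if h: "0 < h" "h \<le> \<delta>" and r: "0 \<le> r" "r \<le> \<sigma>" for h \<delta> r \<omega>
  proof -
    have q: "0 \<le> (norm (h *\<^sub>R \<omega>))\<^sup>2 / (1 + (norm (h *\<^sub>R \<omega>))\<^sup>2)" "(norm (h *\<^sub>R \<omega>))\<^sup>2 / (1 + (norm (h *\<^sub>R \<omega>))\<^sup>2) \<le> 1"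
      by (auto simp: divide_le_eq_1 add_pos_nonneg)
    have "(cmod (1 - cone_multiplier k s e (h *\<^sub>R \<omega>)))\<^sup>2 \<le> C2 * ((norm (h *\<^sub>R \<omega>))\<^sup>2 / (1 + (norm (h *\<^sub>R \<omega>))\<^sup>2)) powr \<sigma>"
      by (rule C2)
    also have "\<dots> \<le> C * ((norm (h *\<^sub>R \<omega>))\<^sup>2 / (1 + (norm (h *\<^sub>R \<omega>))\<^sup>2)) powr r"
      using C C2(1) r q by (intro mult_mono powr_mono') auto
    also have "\<dots> \<le> C * ((h / \<delta>) powr (2 * r) * sobolev_weight \<delta> r \<omega> * sobolev_weight h (- r) \<omega>)"
      unfolding quot[OF h(1)] using C r h by (intro mult_left_mono mult_right_mono num) auto
    finally have "(cmod (1 - cone_multiplier k s e (h *\<^sub>R \<omega>)))\<^sup>2 * sobolev_weight \<delta> (- r) \<omega> \<le> C * ((h / \<delta>) powr (2 * r) * sobolev_weight \<delta> r \<omega> * sobolev_weight h (- r) \<omega>) * sobolev_weight \<delta> (- r) \<omega>"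
      by (rule mult_right_mono) simp
    also have "\<dots> = C * (h / \<delta>) powr (2 * r) * sobolev_weight h (- r) \<omega>"
      by (simp add: sobolev_weight_minus)
    finally show ?thesis .
  qed
  show ?thesis
  proof (intro exI[of _ C] conjI allI impI; (elim conjE)?)
    show "0 \<le> C" by (rule C)
    fix h \<delta> r :: real and \<omega> :: 'a assume h: "0 < h" "h \<le> \<delta>"
    show "(cmod (1 - cone_multiplier k s e (h *\<^sub>R \<omega>)))\<^sup>2 * sobolev_weight \<delta> (- \<sigma>) \<omega> \<le> C * (h / \<delta>) powr (2 * \<sigma>) * sobolev_weight h (- \<sigma>) \<omega>"
      using bound'[OF h, of \<sigma> \<omega>] \<sigma>_pos by simp
    assume r: "0 \<le> r" "r \<le> \<sigma>"
    show "(cmod (cone_multiplier k s e (h *\<^sub>R \<omega>)))\<^sup>2 * sobolev_weight \<delta> r \<omega> \<le> C * (\<delta> / h) powr (2 * r)"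
      by (rule bound[OF h r])
    have "C * (h / \<delta>) powr (2 * r) * sobolev_weight h (- r) \<omega> \<le> C * (h / \<delta>) powr (2 * r) * 1"
      using C r sobolev_weight_mono[of "- r" 0 h \<omega>] by (intro mult_left_mono) auto
    then show "(cmod (1 - cone_multiplier k s e (h *\<^sub>R \<omega>)))\<^sup>2 * sobolev_weight \<delta> (- r) \<omega> \<le> C * (h / \<delta>) powr (2 * r)"
      using bound'[OF h r, of \<omega>] by simp
  qed
qed

end

section \<open>Lipschitz domains and smooth partitions\<close>

text \<open>
  At a boundary point the axis is the direction \<open>e\<close> of the graph representation. Along the vector
  \<open>e + s z\<close> the height grows at the rate at least \<open>1 - s\<close>, the graph of the \<open>L\<close>-Lipschitz function at most at the rate \<open>L s\<close>, and
  \<open>s = 1 / (L + 2)\<close> makes the first rate larger. At an interior point a ball serves as a cone with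
  axis zero.
\<close>

lemma local_cone:
  fixes \<Omega> :: "'a::euclidean_space set"
  assumes \<Omega>: "bounded_lipschitz_domain \<Omega>" and p: "p \<in> closure \<Omega>"
  shows "\<exists>r e s. 0 < r \<and> 0 < s \<and> (\<forall>x \<tau> z. x \<in> closure \<Omega> \<and> dist x p < r \<and> 0 < \<tau> \<and> \<tau> < r \<and> norm z \<le> 1 \<longrightarrow> x + \<tau> *\<^sub>R (e + s *\<^sub>R z) \<in> \<Omega>)"
proof (cases "p \<in> \<Omega>")
  case True
  have "open \<Omega>" using \<Omega> by (simp add: bounded_lipschitz_domain_def)
  then obtain R where R: "0 < R" "ball p R \<subseteq> \<Omega>" using True by (auto simp: open_contains_ball)
  have "x + \<tau> *\<^sub>R (0 + 1 *\<^sub>R z) \<in> \<Omega>" if "dist x p < R / 2" "0 < \<tau>" "\<tau> < R / 2" "norm z \<le> 1" for x z :: 'a and \<tau>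
  proof -
    have "norm (x + \<tau> *\<^sub>R z - p) \<le> norm (x - p) + norm (\<tau> *\<^sub>R z)"
      using norm_triangle_ineq[of "x - p" "\<tau> *\<^sub>R z"] by (simp add: algebra_simps)
    also have "norm (\<tau> *\<^sub>R z) \<le> \<tau>" using that by (simp add: mult_left_le)
    finally have "x + \<tau> *\<^sub>R z \<in> ball p R" using that by (simp add: dist_norm norm_minus_commute)
    then show ?thesis using R by auto
  qed
  then show ?thesis using R(1) by (intro exI[of _ "R / 2"] exI[of _ 0] exI[of _ 1]) auto
next
  case False
  have op: "open \<Omega>" using \<Omega> by (simp add: bounded_lipschitz_domain_def)
  have "p \<in> frontier \<Omega>" using p False op by (simp add: frontier_def interior_open)
  then obtain R e \<gamma> L where R: "0 < R" and e: "norm e = 1" and lip: "L-lipschitz_on {y. y \<bullet> e = 0} \<gamma>"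
    and graph: "\<Omega> \<inter> ball p R = {x \<in> ball p R. \<gamma> (x - (x \<bullet> e) *\<^sub>R e) < x \<bullet> e}"
    using \<Omega> unfolding bounded_lipschitz_domain_def by blast
  define \<pi> where "\<pi> x = x - (x \<bullet> e) *\<^sub>R e" for x
  have ee: "e \<bullet> e = 1" using e by (simp add: dot_square_norm)
  have \<pi>0: "\<pi> x \<bullet> e = 0" for x by (simp add: \<pi>_def inner_diff_left ee)
  have \<pi>_norm: "norm (\<pi> x) \<le> norm x" for x
  proof -
    have "(norm (\<pi> x))\<^sup>2 = (norm x)\<^sup>2 - (x \<bullet> e)\<^sup>2"
      unfolding \<pi>_def power2_norm_eq_inner
      by (simp add: inner_diff_left inner_diff_right ee inner_commute[of e x]) (simp add: power2_eq_square)
    then have "(norm (\<pi> x))\<^sup>2 \<le> (norm x)\<^sup>2" by simp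
    then show ?thesis by (rule power2_le_imp_le) simp
  qed
  have \<pi>_diff: "\<pi> x - \<pi> y = \<pi> (x - y)" for x y by (simp add: \<pi>_def inner_diff_left algebra_simps)
  have L: "0 \<le> L" using lip by (rule lipschitz_on_nonneg)
  have lip': "\<gamma> (\<pi> x) \<le> \<gamma> (\<pi> y) + L * norm (\<pi> (x - y))" for x y
  proof -
    have "dist (\<gamma> (\<pi> x)) (\<gamma> (\<pi> y)) \<le> L * dist (\<pi> x) (\<pi> y)"
      using lip by (rule lipschitz_onD) (auto simp: \<pi>0)
    then show ?thesis by (simp add: dist_norm \<pi>_diff abs_le_iff)
  qed
  define s where "s = 1 / (L + 2)"
  have s: "0 < s" "s \<le> 1" "L * s < 1 - s" using L by (auto simp: s_def divide_simps)
  have "x + \<tau> *\<^sub>R (e + s *\<^sub>R z) \<in> \<Omega>" if x: "x \<in> closure \<Omega>" "dist x p < R / 4" and \<tau>: "0 < \<tau>" "\<tau> < R / 4" and z: "norm z \<le> 1" for x z \<tau>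
  proof -
    \<comment> \<open>Points of the closure lie on or above the graph, by approximation from inside.\<close>
    have above: "\<gamma> (\<pi> x) \<le> x \<bullet> e"
    proof (rule field_le_epsilon)
      fix \<epsilon> :: real assume \<epsilon>: "0 < \<epsilon>"
      define d where "d = min (\<epsilon> / (1 + L)) (R / 4)"
      have d: "0 < d" using \<epsilon> R L by (simp add: d_def)
      obtain y where y: "y \<in> \<Omega>" "dist y x < d" using x(1) d unfolding closure_approachable by blast
      have "dist y p \<le> dist y x + dist x p" by (rule dist_triangle)
      then have "y \<in> ball p R" using y(2) x(2) R by (simp add: d_def dist_commute)
      with y(1) graph have "\<gamma> (\<pi> y) < y \<bullet> e" unfolding \<pi>_def by blast
      moreover have "\<gamma> (\<pi> x) \<le> \<gamma> (\<pi> y) + L * norm (x - y)"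
        using lip'[of x y] mult_left_mono[OF \<pi>_norm[of "x - y"] L] by linarith
      moreover have "y \<bullet> e \<le> x \<bullet> e + norm (x - y)"
        using Cauchy_Schwarz_ineq2[of "y - x" e] e by (simp add: inner_diff_left norm_minus_commute)
      moreover have "(1 + L) * norm (x - y) \<le> \<epsilon>"
      proof -
        have "norm (x - y) \<le> \<epsilon> / (1 + L)" using y(2) by (simp add: d_def dist_norm norm_minus_commute)
        then show ?thesis using L by (simp add: field_simps)
      qed
      ultimately show "\<gamma> (\<pi> x) \<le> x \<bullet> e + \<epsilon>" by (simp add: distrib_right)
    qed
    define w where "w = x + \<tau> *\<^sub>R (e + s *\<^sub>R z)"
    have "norm (w - p) < R"
    proof -
      have "norm (w - p) \<le> norm (x - p) + norm (\<tau> *\<^sub>R (e + s *\<^sub>R z))"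
        using norm_triangle_ineq[of "x - p" "\<tau> *\<^sub>R (e + s *\<^sub>R z)"] by (simp add: w_def algebra_simps)
      also have "norm (\<tau> *\<^sub>R (e + s *\<^sub>R z)) \<le> \<tau> * 2"
      proof -
        have "s * norm z \<le> 1 * 1" using s z by (intro mult_mono) auto
        then have "norm (e + s *\<^sub>R z) \<le> 2" using norm_triangle_ineq[of e "s *\<^sub>R z"] e s by simp
        then show ?thesis using \<tau> by (simp add: mult_left_mono)
      qed
      finally show ?thesis using x(2) \<tau> by (simp add: dist_norm)
    qed
    moreover have "\<gamma> (\<pi> w) < w \<bullet> e"
    proof -
      have "\<pi> (w - x) = (\<tau> * s) *\<^sub>R \<pi> z"
        by (simp add: w_def \<pi>_def inner_add_left ee algebra_simps)
      then have "norm (\<pi> (w - x)) \<le> \<tau> * s"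
        using \<pi>_norm[of z] z \<tau> s by (simp add: mult_left_le)
      then have 1: "\<gamma> (\<pi> w) \<le> x \<bullet> e + L * (\<tau> * s)"
        using lip'[of w x] mult_left_mono[of "norm (\<pi> (w - x))" "\<tau> * s" L] L above by linarith
      have "\<bar>z \<bullet> e\<bar> \<le> 1" using Cauchy_Schwarz_ineq2[of z e] e z by simp
      then have "\<bar>s * (z \<bullet> e)\<bar> \<le> s" using s by (simp add: abs_mult mult_left_le)
      then have "L * s < 1 + s * (z \<bullet> e)" using s(3) by linarith
      then have "\<tau> * (L * s) < \<tau> * (1 + s * (z \<bullet> e))" using \<tau> by (intro mult_strict_left_mono) auto
      moreover have "w \<bullet> e = x \<bullet> e + \<tau> * (1 + s * (z \<bullet> e))" by (simp add: w_def inner_add_left ee)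
      ultimately show ?thesis using 1 by (simp add: mult_ac)
    qed
    ultimately have "w \<in> {x \<in> ball p R. \<gamma> (x - (x \<bullet> e) *\<^sub>R e) < x \<bullet> e}"
      by (simp add: \<pi>_def dist_norm norm_minus_commute)
    then show ?thesis unfolding w_def[symmetric] using graph by blast
  qed
  then show ?thesis using R s(1) by (intro exI[of _ "R / 4"] exI[of _ e] exI[of _ s]) auto
qed

text \<open>
  Compactness of the closure gives finitely many balls from \<open>local_cone\<close>; removing the earlier balls from each makes
  them disjoint. The margin \<open>t\<close> is a quarter of the smallest radius: the balls \<open>B i\<close> have three quarters of their
  radius \<open>r\<close> and half of it already covers the closure.
\<close>

lemma cone_cover:
  fixes \<Omega> :: "'a::euclidean_space set"
  assumes \<Omega>: "bounded_lipschitz_domain \<Omega>"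
  shows "\<exists>(M::nat) e s A t. 0 < t \<and> (\<forall>i<M. 0 < s i \<and> A i \<in> sets borel \<and> bounded (A i)) \<and> disjoint_family_on A {..<M} \<and>
    (\<forall>x\<in>closure \<Omega>. ball x t \<subseteq> (\<Union>i<M. A i)) \<and>
    (\<forall>i<M. \<forall>x\<in>closure \<Omega>. \<forall>a\<in>A i. dist x a < t \<longrightarrow>
       (\<forall>\<tau> z. 0 < \<tau> \<and> \<tau> < t \<and> norm z \<le> 1 \<longrightarrow> x + \<tau> *\<^sub>R (e i + s i *\<^sub>R z) \<in> \<Omega>))"
proof -
  from local_cone[OF \<Omega>] obtain r e s where
    rs: "\<And>p. p \<in> closure \<Omega> \<Longrightarrow> 0 < r p" "\<And>p. p \<in> closure \<Omega> \<Longrightarrow> 0 < s p"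
    and cone: "\<And>p x \<tau> z. \<lbrakk>p \<in> closure \<Omega>; x \<in> closure \<Omega>; dist x p < r p; 0 < \<tau>; \<tau> < r p; norm z \<le> 1\<rbrakk> \<Longrightarrow> x + \<tau> *\<^sub>R (e p + s p *\<^sub>R z) \<in> \<Omega>"
    by metis
  have cpt: "compact (closure \<Omega>)" using \<Omega> by (simp add: bounded_lipschitz_domain_def compact_closure)
  have sub: "closure \<Omega> \<subseteq> (\<Union>p\<in>closure \<Omega>. ball p (r p / 2))" using rs(1) by force
  obtain C where C: "C \<subseteq> closure \<Omega>" "finite C" "closure \<Omega> \<subseteq> (\<Union>p\<in>C. ball p (r p / 2))"
    by (rule compactE_image[OF cpt _ sub]) auto
  have "closure \<Omega> \<noteq> {}" using \<Omega> by (simp add: bounded_lipschitz_domain_def closure_eq_empty)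
  then have Cne: "C \<noteq> {}" using C(3) by auto
  define M where "M = card C"
  obtain f where f: "bij_betw f {0..<M} C" using ex_bij_betw_nat_finite[OF C(2)] unfolding M_def by blast
  have fC: "f i \<in> C" if "i < M" for i using f that by (auto simp: bij_betw_def)
  have Cf: "\<exists>i<M. f i = p" if "p \<in> C" for p using f that unfolding bij_betw_def by force
  define t where "t = Min (r ` C) / 4"
  have t: "t \<le> r p / 4" if "p \<in> C" for p unfolding t_def using that C(2) by (intro divide_right_mono Min_le) auto
  have "Min (r ` C) \<in> r ` C" using C(2) Cne by (intro Min_in) auto
  then have t0: "0 < t" unfolding t_def using C(1) rs(1) by auto
  define B where "B i = ball (f i) (3 / 4 * r (f i))" for i
  define A where "A i = B i - (\<Union>j<i. B j)" for i
  have cover: "y \<in> (\<Union>i<M. A i)" if "y \<in> B j" "j < M" for y j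
  proof -
    define i where "i = (LEAST i. y \<in> B i)"
    have "y \<in> B i" unfolding i_def using that(1) by (rule LeastI)
    moreover have "i \<le> j" unfolding i_def using that(1) by (rule Least_le)
    moreover have "y \<notin> B l" if "l < i" for l using not_less_Least[OF that[unfolded i_def]] .
    ultimately show ?thesis using that(2) by (auto simp: A_def intro!: bexI[of _ i])
  qed
  show ?thesis
  proof (intro exI[of _ t] exI[of _ M] exI[of _ "\<lambda>i. e (f i)"] exI[of _ "\<lambda>i. s (f i)"] exI[of _ A] conjI allI impI ballI)
    show "0 < t" by (rule t0)
    fix i assume i: "i < M"
    show "0 < s (f i)" using rs(2) C(1) fC[OF i] by auto
    show "A i \<in> sets borel" unfolding A_def B_def by (intro sets.Diff sets.finite_UN) auto
    show "bounded (A i)" unfolding A_def B_def by (rule bounded_subset[OF bounded_ball]) auto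
    fix x a z :: 'a and \<tau> assume x: "x \<in> closure \<Omega>" "a \<in> A i" "dist x a < t" and lz: "0 < \<tau> \<and> \<tau> < t \<and> norm z \<le> 1"
    have p: "f i \<in> closure \<Omega>" using C(1) fC[OF i] by auto
    have "dist x (f i) \<le> dist x a + dist a (f i)" by (rule dist_triangle)
    also have "\<dots> < r (f i)" using x(2,3) t[OF fC[OF i]] by (auto simp: A_def B_def dist_commute)
    finally show "x + \<tau> *\<^sub>R (e (f i) + s (f i) *\<^sub>R z) \<in> \<Omega>"
      using cone[OF p x(1)] lz t[OF fC[OF i]] rs(1)[OF p] by auto
  next
    show "disjoint_family_on A {..<M}"
      unfolding disjoint_family_on_def A_def by (auto simp: neq_iff)
    fix x assume "x \<in> closure \<Omega>"
    with C(3) obtain p where p: "p \<in> C" "dist p x < r p / 2" by auto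
    obtain j where j: "j < M" "f j = p" using Cf[OF p(1)] by blast
    show "ball x t \<subseteq> (\<Union>i<M. A i)"
    proof
      fix y assume "y \<in> ball x t"
      then have "dist p y < r p / 2 + r p / 4" using p(2) t[OF p(1)] dist_triangle[of p y x] by simp
      then have "y \<in> B j" using j by (simp add: B_def)
      then show "y \<in> (\<Union>i<M. A i)" using j(1) by (rule cover)
    qed
  qed
qed

context mollifier
begin

text \<open>
  The convolution of the indicator function with \<open>bump t 0\<close>, which is even.
\<close>

definition smooth_indicator :: "'a set \<Rightarrow> real \<Rightarrow> 'a \<Rightarrow> real" where
  "smooth_indicator A t x = (LINT y|lborel. indicator A y * bump t x y)"

text \<open>
  The function whose \<open>inverse_transform\<close> is \<open>smooth_indicator A t\<close>.
\<close>

definition smooth_indicator_spectrum :: "'a set \<Rightarrow> real \<Rightarrow> 'a \<Rightarrow> complex" where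
  "smooth_indicator_spectrum A t \<eta> = of_real (fourier_factor TYPE('a)) * (\<rho>hat (t *\<^sub>R \<eta>) * fourier (indicator A) \<eta>)"

lemma integrable_bump_real: "0 < t \<Longrightarrow> Bochner_Integration.integrable lborel (bump t x)"
  using integrable_Re[OF integrable_bump[of t x]] by simp

lemma integral_bump: "0 < t \<Longrightarrow> (LINT y|lborel. bump t x y) = 1"
proof -
  assume t: "0 < t"
  have "complex_of_real (LINT y|lborel. bump t x y) = (LINT y|lborel. of_real (bump t x y) * 1)"
    by (simp add: integral_of_real[OF integrable_bump_real[OF t]])
  also have "\<dots> = 1" unfolding integral_bump_mult[OF t] using mass by (simp add: integral_of_real[OF integrable])
  finally show ?thesis unfolding of_real_eq_1_iff .
qed

lemma integrable_indicator_bump: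
  "0 < t \<Longrightarrow> A \<in> sets borel \<Longrightarrow> Bochner_Integration.integrable lborel (\<lambda>y. indicator A y * bump t x y)"
  using integrable_real_mult_indicator[OF _ integrable_bump_real[of t x], of A] by (simp add: mult.commute)

lemma smooth_indicator_nonneg: "0 < t \<Longrightarrow> 0 \<le> smooth_indicator A t x"
  unfolding smooth_indicator_def by (intro Bochner_Integration.integral_nonneg mult_nonneg_nonneg bump_nonneg) auto

lemma smooth_indicator_eq_0:
  assumes "0 < t" "\<And>a. a \<in> A \<Longrightarrow> t \<le> dist x a"
  shows "smooth_indicator A t x = 0"
proof -
  have "indicator A y * bump t x y = 0" for y
  proof (cases "y \<in> A")
    case True
    then have "t \<le> norm (y - x)" using assms(2) by (metis dist_commute dist_norm)
    then show ?thesis using bump_eq_0[OF assms(1)] by simp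
  qed simp
  then have "(\<lambda>y. indicator A y * bump t x y) = (\<lambda>_. 0)" by (rule ext)
  then show ?thesis unfolding smooth_indicator_def by (simp only: Bochner_Integration.integral_zero)
qed

text \<open>
  The indicator functions of the pieces add up to one on the support of the bump around \<open>x\<close>.
\<close>

lemma sum_smooth_indicator:
  fixes A :: "nat \<Rightarrow> 'a set"
  assumes t: "0 < t" and A: "\<And>i. i < M \<Longrightarrow> A i \<in> sets borel" "disjoint_family_on A {..<M}" and x: "ball x t \<subseteq> (\<Union>i<M. A i)"
  shows "(\<Sum>i<M. smooth_indicator (A i) t x) = 1"
proof -
  have "(\<Sum>i<M. smooth_indicator (A i) t x) = (LINT y|lborel. (\<Sum>i<M. indicator (A i) y * bump t x y))"
    unfolding smooth_indicator_def
    by (rule Bochner_Integration.integral_sum[symmetric]) (use t A in \<open>auto intro: integrable_indicator_bump\<close>)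
  also have "\<dots> = (LINT y|lborel. bump t x y)"
  proof (rule Bochner_Integration.integral_cong[OF refl])
    fix y
    show "(\<Sum>i<M. indicator (A i) y * bump t x y) = bump t x y"
    proof (cases "y \<in> ball x t")
      case True
      then have "y \<in> (\<Union>i<M. A i)" using x by auto
      moreover have "(\<Sum>i<M. indicator (A i) y) = (indicator (\<Union>i<M. A i) y :: real)"
        by (rule indicator_UN_disjoint[symmetric]) (use A in auto)
      ultimately show ?thesis by (simp add: sum_distrib_right[symmetric])
    next
      case False
      then have "bump t x y = 0" using t by (intro bump_eq_0) (auto simp: dist_norm norm_minus_commute)
      then show ?thesis by simp
    qed
  qed
  finally show ?thesis using integral_bump[OF t] by simp
qed

lemma integrable_indicator_bounded:
  "A \<in> sets borel \<Longrightarrow> bounded A \<Longrightarrow> Bochner_Integration.integrable lborel (indicator A :: 'a \<Rightarrow> complex)"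
proof -
  assume A: "A \<in> sets borel" "bounded A"
  have "Bochner_Integration.integrable lborel (\<lambda>x. complex_of_real (indicator A x))"
    using A by (intro integrable_of_real integrable_real_indicator emeasure_bounded_finite) auto
  also have "(\<lambda>x. complex_of_real (indicator A x)) = indicator A"
    by (auto split: split_indicator)
  finally show ?thesis .
qed

text \<open>
  The transform of the indicator function is merely bounded; the decay comes from the mollifier.
\<close>

lemma smooth_indicator_spectrum_le:
  assumes t: "0 < t" and A: "A \<in> sets borel" "bounded A"
  shows "\<exists>B\<ge>0. \<forall>\<eta>. cmod (smooth_indicator_spectrum A t \<eta>) \<le> B * sobolev_weight 1 (- (2 * \<sigma>)) \<eta>"
proof -
  define K where "K = max 1 (1 / t)"
  have K: "1 \<le> K" "1 \<le> K * t" using t by (auto simp: K_def max_def field_simps)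
  define D where "D = fourier_factor TYPE('a) * (LINT x|lborel. cmod (indicator A (x::'a)))"
  have D: "0 \<le> D" unfolding D_def by (intro mult_nonneg_nonneg Bochner_Integration.integral_nonneg) auto
  let ?B = "fourier_factor TYPE('a) * (sqrt C\<^sub>\<rho> * K powr (2 * (2 * \<sigma>)) * D)"
  have "cmod (smooth_indicator_spectrum A t \<eta>) \<le> ?B * sobolev_weight 1 (- (2 * \<sigma>)) \<eta>" for \<eta>
  proof -
    have "cmod (\<rho>hat (t *\<^sub>R \<eta>)) \<le> sqrt C\<^sub>\<rho> * sobolev_weight t (- (2 * \<sigma>)) \<eta>"
      using cmod_\<rho>hat_le[of "t *\<^sub>R \<eta>"] unfolding sobolev_weight_scaleR .
    also have "\<dots> \<le> sqrt C\<^sub>\<rho> * (K powr (2 * (2 * \<sigma>)) * sobolev_weight 1 (- (2 * \<sigma>)) \<eta>)"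
      using K t \<sigma>_pos C\<^sub>\<rho> by (intro mult_left_mono sobolev_weight_dilate_le) auto
    finally have "cmod (\<rho>hat (t *\<^sub>R \<eta>)) * cmod (fourier (indicator A) \<eta>) \<le> (sqrt C\<^sub>\<rho> * (K powr (2 * (2 * \<sigma>)) * sobolev_weight 1 (- (2 * \<sigma>)) \<eta>)) * D"
      unfolding D_def using C\<^sub>\<rho> by (intro mult_mono cmod_fourier_le) auto
    from mult_left_mono[OF this, of "fourier_factor TYPE('a)"] show ?thesis
      by (simp add: smooth_indicator_spectrum_def norm_mult mult_ac)
  qed
  moreover have "0 \<le> ?B" using D C\<^sub>\<rho> by (intro mult_nonneg_nonneg) auto
  ultimately show ?thesis by blast
qed

lemma borel_measurable_smooth_indicator_spectrum [measurable]:
  assumes [measurable]: "A \<in> sets borel"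
  shows "smooth_indicator_spectrum A t \<in> borel_measurable borel"
  unfolding smooth_indicator_spectrum_def[abs_def] by measurable

lemma
  assumes t: "0 < t" and A: "A \<in> sets borel" "bounded A"
  shows integrable_smooth_indicator_spectrum: "Bochner_Integration.integrable lborel (smooth_indicator_spectrum A t)" (is ?i)
    and square_integrable_smooth_indicator_spectrum: "square_integrable (smooth_indicator_spectrum A t)" (is ?s)
    and weighted_smooth_indicator_spectrum: "(\<integral>\<^sup>+\<eta>. ennreal (sobolev_weight 1 \<sigma> \<eta> * cmod (smooth_indicator_spectrum A t \<eta>)) \<partial>lborel) < \<infinity>"
proof -
  note [measurable] = borel_measurable_smooth_indicator_spectrum[OF A(1)]
  obtain B where B: "0 \<le> B" "\<And>\<eta>. cmod (smooth_indicator_spectrum A t \<eta>) \<le> B * sobolev_weight 1 (- (2 * \<sigma>)) \<eta>"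
    using smooth_indicator_spectrum_le[OF assms] by blast
  have B1: "cmod (smooth_indicator_spectrum A t \<eta>) \<le> B * sobolev_weight 1 (- \<sigma>) \<eta>" for \<eta>
    using \<sigma>_pos by (intro order_trans[OF B(2)] mult_left_mono sobolev_weight_mono B(1)) auto
  have B2: "cmod (smooth_indicator_spectrum A t \<eta>) \<le> B" for \<eta>
    using mult_left_mono[OF sobolev_weight_mono[of "- \<sigma>" 0 1 \<eta>] B(1)] \<sigma>_pos B1[of \<eta>] by simp
  have W: "Bochner_Integration.integrable lborel (\<lambda>\<eta>::'a. B * sobolev_weight 1 (- \<sigma>) \<eta>)"
    by (intro integrable_mult_right integrable_sobolev_weight half_dim_less)
  show i: ?i
    by (rule Bochner_Integration.integrable_bound[OF W]) (use B1 B(1) in \<open>auto simp: abs_mult\<close>)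
  show ?s by (rule square_integrable_bounded[OF i B2])
  have "(\<integral>\<^sup>+\<eta>. ennreal (sobolev_weight 1 \<sigma> \<eta> * cmod (smooth_indicator_spectrum A t \<eta>)) \<partial>lborel) \<le> (\<integral>\<^sup>+\<eta>. ennreal (B * sobolev_weight 1 (- \<sigma>) (\<eta>::'a)) \<partial>lborel)"
  proof (intro nn_integral_mono ennreal_leI)
    fix \<eta> :: 'a
    have "sobolev_weight 1 \<sigma> \<eta> * cmod (smooth_indicator_spectrum A t \<eta>) \<le> sobolev_weight 1 \<sigma> \<eta> * (B * sobolev_weight 1 (- (2 * \<sigma>)) \<eta>)"
      by (intro mult_left_mono B) simp
    also have "\<dots> = B * sobolev_weight 1 (\<sigma> + - (2 * \<sigma>)) \<eta>" unfolding sobolev_weight_add by simp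
    finally show "sobolev_weight 1 \<sigma> \<eta> * cmod (smooth_indicator_spectrum A t \<eta>) \<le> B * sobolev_weight 1 (- \<sigma>) \<eta>" by simp
  qed
  also have "\<dots> < \<infinity>"
    using nn_integral_sobolev_weight_finite[OF half_dim_less] B(1) by (simp add: ennreal_mult nn_integral_cmult ennreal_mult_less_top)
  finally show "(\<integral>\<^sup>+\<eta>. ennreal (sobolev_weight 1 \<sigma> \<eta> * cmod (smooth_indicator_spectrum A t \<eta>)) \<partial>lborel) < \<infinity>" .
qed

text \<open>
  Invert the transform of the bump and exchange the integrals.
\<close>

lemma inverse_transform_smooth_indicator_spectrum:
  assumes t: "0 < t" and A: "A \<in> sets borel" "bounded A"
  shows "inverse_transform (smooth_indicator_spectrum A t) x = of_real (smooth_indicator A t x)"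
proof -
  let ?\<kappa> = "complex_of_real (fourier_factor TYPE('a))"
  have iA: "Bochner_Integration.integrable lborel (indicator A :: 'a \<Rightarrow> complex)" by (rule integrable_indicator_bounded[OF A])
  have i\<rho>: "Bochner_Integration.integrable lborel (\<lambda>\<eta>. \<rho>hat (t *\<^sub>R \<eta>) * cis (x \<bullet> \<eta>))"
    using integrable_affine[OF integrable_\<rho>hat, of t 0] t by (intro integrable_mult_cis) auto
  obtain B where B: "\<And>x. cmod (complex_of_real (bump t 0 x)) \<le> B"
    using test_function_bump[OF t, of 0] unfolding test_function_def by blast
  have inv: "complex_of_real (bump t x y) = ?\<kappa> * (?\<kappa> * (LINT \<eta>|lborel. (\<rho>hat (t *\<^sub>R \<eta>) * cis (x \<bullet> \<eta>)) * cis (- (y \<bullet> \<eta>))))" for y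
  proof -
    have "complex_of_real (bump t x y) = complex_of_real (bump t 0 (x - y))" by (simp add: bump_reflect)
    also have "\<dots> = ?\<kappa> * (LINT \<eta>|lborel. fourier (\<lambda>x. of_real (bump t 0 x)) \<eta> * cis ((x - y) \<bullet> \<eta>))"
      using test_function_bump[OF t, of 0] unfolding test_function_def
      by (intro fourier_inversion_bounded[OF _ _ _ B]) auto
    also have "(LINT \<eta>|lborel. fourier (\<lambda>x. of_real (bump t 0 x)) \<eta> * cis ((x - y) \<bullet> \<eta>)) = (LINT \<eta>|lborel. ?\<kappa> * ((\<rho>hat (t *\<^sub>R \<eta>) * cis (x \<bullet> \<eta>)) * cis (- (y \<bullet> \<eta>))))"
      unfolding fourier_bump[OF t] \<rho>hat_minus
      by (intro Bochner_Integration.integral_cong refl) (simp add: mult.assoc cis_mult inner_diff_left)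
    finally show ?thesis by (simp only: integral_mult_right_zero)
  qed
  have "complex_of_real (smooth_indicator A t x) = (LINT y|lborel. of_real (indicator A y * bump t x y))"
    unfolding smooth_indicator_def by (rule integral_of_real[OF integrable_indicator_bump[OF t A(1)], symmetric])
  also have "\<dots> = (LINT y|lborel. (?\<kappa> * ?\<kappa>) * (indicator A y * (LINT \<eta>|lborel. (\<rho>hat (t *\<^sub>R \<eta>) * cis (x \<bullet> \<eta>)) * cis (- (y \<bullet> \<eta>)))))"
  proof (rule Bochner_Integration.integral_cong[OF refl])
    fix y
    show "complex_of_real (indicator A y * bump t x y) = (?\<kappa> * ?\<kappa>) * (indicator A y * (LINT \<eta>|lborel. (\<rho>hat (t *\<^sub>R \<eta>) * cis (x \<bullet> \<eta>)) * cis (- (y \<bullet> \<eta>))))"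
      unfolding of_real_mult inv by (cases "y \<in> A") (simp_all add: mult_ac)
  qed
  also have "\<dots> = (?\<kappa> * ?\<kappa>) * (LINT y|lborel. indicator A y * (LINT \<eta>|lborel. (\<rho>hat (t *\<^sub>R \<eta>) * cis (x \<bullet> \<eta>)) * cis (- (y \<bullet> \<eta>))))"
    by (rule integral_mult_right_zero)
  also have "(LINT y|lborel. indicator A y * (LINT \<eta>|lborel. (\<rho>hat (t *\<^sub>R \<eta>) * cis (x \<bullet> \<eta>)) * cis (- (y \<bullet> \<eta>)))) =
      (LINT \<eta>|lborel. (\<rho>hat (t *\<^sub>R \<eta>) * cis (x \<bullet> \<eta>)) * (LINT y|lborel. indicator A y * cis (- (y \<bullet> \<eta>))))"
    by (rule Fubini_kernel[OF iA i\<rho>, where B=1]) auto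
  also have "(?\<kappa> * ?\<kappa>) * \<dots> = (LINT \<eta>|lborel. (?\<kappa> * ?\<kappa>) * ((\<rho>hat (t *\<^sub>R \<eta>) * cis (x \<bullet> \<eta>)) * (LINT y|lborel. indicator A y * cis (- (y \<bullet> \<eta>)))))"
    by (rule integral_mult_right_zero[symmetric])
  also have "\<dots> = inverse_transform (smooth_indicator_spectrum A t) x"
    unfolding inverse_transform_def[of "smooth_indicator_spectrum A t"] smooth_indicator_spectrum_def fourier_cis
    by (intro Bochner_Integration.integral_cong refl) (simp only: mult_ac)
  finally show ?thesis by simp
qed

lemma smooth_indicator_le_1:
  assumes t: "0 < t" and A: "A \<in> sets borel"
  shows "smooth_indicator A t x \<le> 1"
proof -
  have "smooth_indicator A t x \<le> (LINT y|lborel. bump t x y)"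
    unfolding smooth_indicator_def
    by (intro integral_mono integrable_indicator_bump integrable_bump_real t A)
      (auto split: split_indicator intro: bump_nonneg t)
  then show ?thesis by (simp add: integral_bump[OF t])
qed

end

section \<open>Translates of a kernel\<close>

text \<open>
  The cones and pieces of \<open>cone_cover\<close> and the kernel with its bounds are fixed here, so that the constants below
  depend on nothing else; \<open>\<delta>\<close>, the points and the coefficients stay free. The radius \<open>t\<close> serves both as the
  height of the cones and as the width of the partition of unity.
\<close>

locale bernstein_setting = mollifier \<rho> \<sigma> C\<^sub>\<rho>
  for \<rho> :: "'a::euclidean_space \<Rightarrow> real" and \<sigma> C\<^sub>\<rho> :: real +
  fixes \<Omega> :: "'a set" and M :: nat and e :: "nat \<Rightarrow> 'a" and s :: "nat \<Rightarrow> real" and A :: "nat \<Rightarrow> 'a set" and t :: real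
    and k :: nat and \<Phi> :: "'a \<Rightarrow> real" and c C :: real
  assumes t_pos: "0 < t"
    and s_pos: "i < M \<Longrightarrow> 0 < s i"
    and A_borel: "i < M \<Longrightarrow> A i \<in> sets borel"
    and A_bounded: "i < M \<Longrightarrow> bounded (A i)"
    and A_disjoint: "disjoint_family_on A {..<M}"
    and A_cover: "x \<in> closure \<Omega> \<Longrightarrow> ball x t \<subseteq> (\<Union>i<M. A i)"
    and cone: "\<lbrakk>i < M; x \<in> closure \<Omega>; a \<in> A i; dist x a < t; 0 < \<tau>; \<tau> < t; norm z \<le> 1\<rbrakk> \<Longrightarrow> x + \<tau> *\<^sub>R (e i + s i *\<^sub>R z) \<in> \<Omega>"
    and k_ge: "\<sigma> \<le> real k"
    and \<Phi>_continuous: "continuous_on UNIV \<Phi>"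
    and \<Phi>_integrable: "Bochner_Integration.integrable lborel \<Phi>"
    and \<Phi>_real: "fourier (\<lambda>x. of_real (\<Phi> x)) \<omega> \<in> \<real>"
    and c_pos: "0 < c"
    and \<Phi>_lower: "c * sobolev_weight 1 (- \<sigma>) \<omega> \<le> Re (fourier (\<lambda>x. of_real (\<Phi> x)) \<omega>)"
    and \<Phi>_upper: "Re (fourier (\<lambda>x. of_real (\<Phi> x)) \<omega>) \<le> C * sobolev_weight 1 (- \<sigma>) \<omega>"
begin

definition \<Phi>hat :: "'a \<Rightarrow> real" where "\<Phi>hat \<omega> = Re (fourier (\<lambda>x. of_real (\<Phi> x)) \<omega>)"

lemma fourier_\<Phi>: "fourier (\<lambda>x. of_real (\<Phi> x)) \<omega> = of_real (\<Phi>hat \<omega>)"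
  using \<Phi>_real[of \<omega>] by (simp add: \<Phi>hat_def)

lemma \<Phi>hat_bounds: "c * sobolev_weight \<delta> (- \<sigma>) \<omega> \<le> \<Phi>hat (\<delta> *\<^sub>R \<omega>)" "\<Phi>hat (\<delta> *\<^sub>R \<omega>) \<le> C * sobolev_weight \<delta> (- \<sigma>) \<omega>"
  using \<Phi>_lower[of "\<delta> *\<^sub>R \<omega>"] \<Phi>_upper[of "\<delta> *\<^sub>R \<omega>"] by (simp_all add: \<Phi>hat_def sobolev_weight_scaleR)

lemma \<Phi>hat_nonneg: "0 \<le> \<Phi>hat \<omega>"
proof -
  have "0 \<le> c * sobolev_weight 1 (- \<sigma>) \<omega>" using c_pos by (intro mult_nonneg_nonneg) auto
  also have "\<dots> \<le> \<Phi>hat \<omega>" using \<Phi>hat_bounds(1)[of 1 \<omega>] by simp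
  finally show ?thesis .
qed

lemma C_pos: "0 < C"
proof -
  have "c * sobolev_weight 1 (- \<sigma>) (0::'a) \<le> C * sobolev_weight 1 (- \<sigma>) (0::'a)"
    using \<Phi>_lower[of 0] \<Phi>_upper[of 0] by linarith
  then have "c \<le> C" by simp
  then show ?thesis using c_pos by simp
qed

lemma borel_measurable_\<Phi> [measurable]: "\<Phi> \<in> borel_measurable borel"
  using borel_measurable_continuous_onI[OF \<Phi>_continuous] .

text \<open>
  The upper bound on the transform of \<open>\<Phi>\<close> is integrable since \<open>\<sigma>\<close> exceeds half the dimension.
\<close>

lemma \<Phi>_bounded: "\<exists>B. \<forall>x. \<bar>\<Phi> x\<bar> \<le> B"
proof -
  let ?\<Phi> = "\<lambda>x. complex_of_real (\<Phi> x)"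
  have i: "Bochner_Integration.integrable lborel ?\<Phi>" by (intro integrable_of_real \<Phi>_integrable)
  have F: "Bochner_Integration.integrable lborel (fourier ?\<Phi>)"
  proof (rule Bochner_Integration.integrable_bound)
    show "Bochner_Integration.integrable lborel (\<lambda>\<omega>::'a. C * sobolev_weight 1 (- \<sigma>) \<omega>)"
      by (intro integrable_mult_right integrable_sobolev_weight half_dim_less)
    show "fourier ?\<Phi> \<in> borel_measurable lborel" by measurable
    show "AE \<omega> in lborel. cmod (fourier ?\<Phi> \<omega>) \<le> norm (C * sobolev_weight 1 (- \<sigma>) \<omega>)"
      using \<Phi>hat_bounds(2)[of 1] \<Phi>hat_nonneg C_pos by (simp add: fourier_\<Phi> abs_mult)
  qed
  have "continuous_on UNIV ?\<Phi>" by (intro continuous_intros \<Phi>_continuous)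
  from cmod_le_integral_fourier[OF i F this] show ?thesis by (auto simp: norm_of_real)
qed

definition combination :: "real \<Rightarrow> ('a \<Rightarrow> complex) \<Rightarrow> 'a set \<Rightarrow> 'a \<Rightarrow> complex" where
  "combination \<delta> a X x = (\<Sum>y\<in>X. a y * of_real (scaled_kernel \<Phi> \<delta> (x - y)))"

lemma scaled_kernel_translate: "scaled_kernel \<Phi> \<delta> (x - y) = \<Phi> (- y /\<^sub>R \<delta> + (1 / \<delta>) *\<^sub>R x) / \<delta> ^ DIM('a)"
  by (simp add: scaled_kernel_def algebra_simps divide_inverse)

lemma integrable_scaled_kernel:
  "0 < \<delta> \<Longrightarrow> Bochner_Integration.integrable lborel (\<lambda>x. complex_of_real (scaled_kernel \<Phi> \<delta> (x - y)))"
  unfolding scaled_kernel_translate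
  by (intro integrable_of_real integrable_divide integrable_affine[OF \<Phi>_integrable]) simp

lemma fourier_scaled_kernel:
  assumes \<delta>: "0 < \<delta>"
  shows "fourier (\<lambda>x. of_real (scaled_kernel \<Phi> \<delta> (x - y))) \<omega> = cis (- (y \<bullet> \<omega>)) * of_real (\<Phi>hat (\<delta> *\<^sub>R \<omega>))"
proof -
  let ?\<kappa> = "complex_of_real (fourier_factor TYPE('a))"
  let ?g = "\<lambda>x. complex_of_real (scaled_kernel \<Phi> \<delta> (x - y)) * cis (- (x \<bullet> \<omega>))"
  have "Bochner_Integration.integrable lborel ?g" by (rule integrable_mult_cis[OF integrable_scaled_kernel[OF \<delta>]]) measurable
  from integral_affine[OF this, of \<delta> y] \<delta>
  have "(LINT x|lborel. ?g x) = \<delta> ^ DIM('a) *\<^sub>R (LINT z|lborel. ?g (y + \<delta> *\<^sub>R z))" by simp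
  also have "\<dots> = (LINT z|lborel. \<delta> ^ DIM('a) *\<^sub>R ?g (y + \<delta> *\<^sub>R z))" by (rule integral_scaleR_right[symmetric])
  also have "\<dots> = (LINT z|lborel. cis (- (y \<bullet> \<omega>)) * (of_real (\<Phi> z) * cis (- (z \<bullet> (\<delta> *\<^sub>R \<omega>)))))"
  proof (rule Bochner_Integration.integral_cong[OF refl])
    fix z
    have "cis (- ((y + \<delta> *\<^sub>R z) \<bullet> \<omega>)) = cis (- (y \<bullet> \<omega>)) * cis (- (z \<bullet> (\<delta> *\<^sub>R \<omega>)))"
      unfolding cis_mult by (rule arg_cong[where f=cis]) (simp add: inner_add_left)
    then show "\<delta> ^ DIM('a) *\<^sub>R ?g (y + \<delta> *\<^sub>R z) = cis (- (y \<bullet> \<omega>)) * (of_real (\<Phi> z) * cis (- (z \<bullet> (\<delta> *\<^sub>R \<omega>))))"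
      using \<delta> by (simp add: scaled_kernel_def scaleR_conv_of_real)
  qed
  also have "\<dots> = cis (- (y \<bullet> \<omega>)) * (LINT z|lborel. of_real (\<Phi> z) * cis (- (z \<bullet> (\<delta> *\<^sub>R \<omega>))))"
    by (rule integral_mult_right_zero)
  finally have "fourier (\<lambda>x. of_real (scaled_kernel \<Phi> \<delta> (x - y))) \<omega> = cis (- (y \<bullet> \<omega>)) * fourier (\<lambda>x. of_real (\<Phi> x)) (\<delta> *\<^sub>R \<omega>)"
    by (simp add: fourier_cis mult.left_commute)
  then show ?thesis unfolding fourier_\<Phi> .
qed

lemma integrable_combination: "0 < \<delta> \<Longrightarrow> Bochner_Integration.integrable lborel (combination \<delta> a X)"
  unfolding combination_def[abs_def]
  by (intro Bochner_Integration.integrable_sum integrable_mult_right integrable_scaled_kernel)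

lemma fourier_combination:
  "0 < \<delta> \<Longrightarrow> fourier (combination \<delta> a X) \<omega> = exp_sum a X \<omega> * of_real (\<Phi>hat (\<delta> *\<^sub>R \<omega>))"
  unfolding combination_def[abs_def]
  by (subst fourier_sum_cmult[OF integrable_scaled_kernel]) (simp_all add: fourier_scaled_kernel exp_sum_def sum_distrib_right mult.assoc)

lemma square_integrable_combination:
  assumes \<delta>: "0 < \<delta>"
  shows "square_integrable (combination \<delta> a X)"
proof -
  obtain B where B: "\<And>x. \<bar>\<Phi> x\<bar> \<le> B" using \<Phi>_bounded by blast
  have "cmod (combination \<delta> a X x) \<le> (\<Sum>y\<in>X. cmod (a y) * (B / \<delta> ^ DIM('a)))" for x
    unfolding combination_def
  proof (rule order_trans[OF norm_sum], rule sum_mono)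
    fix y
    have "\<bar>scaled_kernel \<Phi> \<delta> (x - y)\<bar> \<le> B / \<delta> ^ DIM('a)"
      using \<delta> B by (simp add: scaled_kernel_def abs_divide divide_right_mono)
    then show "cmod (a y * of_real (scaled_kernel \<Phi> \<delta> (x - y))) \<le> cmod (a y) * (B / \<delta> ^ DIM('a))"
      unfolding norm_mult norm_of_real by (intro mult_left_mono) auto
  qed
  then show ?thesis by (rule square_integrable_bounded[OF integrable_combination[OF \<delta>]])
qed

lemma has_fourier_L2_combination: "0 < \<delta> \<Longrightarrow> has_fourier_L2 (combination \<delta> a X) (fourier (combination \<delta> a X))"
  by (intro has_fourier_L2_fourier integrable_combination square_integrable_combination)

text \<open>
  Comparable to the square of the norm of order \<open>\<sigma>\<close> of \<open>combination \<delta> a X\<close>, as the transform of that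
  function is the exponential sum times a factor comparable to the weight of order \<open>- \<sigma>\<close>.
\<close>

definition energy :: "real \<Rightarrow> ('a \<Rightarrow> complex) \<Rightarrow> 'a set \<Rightarrow> ennreal" where
  "energy \<delta> a X = weighted_sq (sobolev_weight \<delta> (- \<sigma>)) (exp_sum a X)"

lemma cmod_exp_sum_le: "cmod (exp_sum a X \<omega>) \<le> (\<Sum>y\<in>X. cmod (a y))"
  unfolding exp_sum_def by (rule order_trans[OF norm_sum]) (simp add: norm_mult)

lemma energy_finite:
  assumes \<delta>: "0 < \<delta>"
  shows "energy \<delta> a X < \<infinity>"
proof -
  let ?S = "\<Sum>y\<in>X. cmod (a y)"
  have "energy \<delta> a X \<le> (\<integral>\<^sup>+\<omega>. ennreal (?S\<^sup>2) * ennreal (sobolev_weight 1 (- \<sigma>) (\<delta> *\<^sub>R (\<omega>::'a))) \<partial>lborel)"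
    unfolding energy_def weighted_sq_def
  proof (rule nn_integral_mono)
    fix \<omega> :: 'a
    have "(cmod (exp_sum a X \<omega>))\<^sup>2 \<le> ?S\<^sup>2" by (intro power_mono cmod_exp_sum_le) auto
    then have "sobolev_weight \<delta> (- \<sigma>) \<omega> * (cmod (exp_sum a X \<omega>))\<^sup>2 \<le> sobolev_weight \<delta> (- \<sigma>) \<omega> * ?S\<^sup>2" by (intro mult_left_mono) auto
    then show "ennreal (sobolev_weight \<delta> (- \<sigma>) \<omega> * (cmod (exp_sum a X \<omega>))\<^sup>2) \<le> ennreal (?S\<^sup>2) * ennreal (sobolev_weight 1 (- \<sigma>) (\<delta> *\<^sub>R \<omega>))"
      by (simp add: sobolev_weight_scaleR ennreal_mult[symmetric] ennreal_leI mult.commute)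
  qed
  also have "\<dots> = ennreal (?S\<^sup>2) * (\<integral>\<^sup>+\<omega>. ennreal (sobolev_weight 1 (- \<sigma>) (\<delta> *\<^sub>R (\<omega>::'a))) \<partial>lborel)"
    by (rule nn_integral_cmult) measurable
  also have "\<dots> < \<infinity>"
  proof -
    have "ennreal (\<bar>\<delta>\<bar> ^ DIM('a)) * (\<integral>\<^sup>+\<omega>. ennreal (sobolev_weight 1 (- \<sigma>) (0 + \<delta> *\<^sub>R (\<omega>::'a))) \<partial>lborel) < \<infinity>"
      using nn_integral_affine[of "\<lambda>\<omega>::'a. ennreal (sobolev_weight 1 (- \<sigma>) \<omega>)" \<delta> 0] \<delta> nn_integral_sobolev_weight_finite[OF half_dim_less]
      by simp
    then have "(\<integral>\<^sup>+\<omega>. ennreal (sobolev_weight 1 (- \<sigma>) (\<delta> *\<^sub>R (\<omega>::'a))) \<partial>lborel) < \<infinity>"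
      using \<delta> by (auto simp: ennreal_mult_less_top)
    then show ?thesis by (simp add: ennreal_mult_less_top)
  qed
  finally show ?thesis .
qed

lemma combination_weight_le:
  assumes \<delta>: "0 < \<delta>"
  shows "(cmod (fourier (combination \<delta> a X) \<omega>))\<^sup>2 \<le> C\<^sup>2 * (sobolev_weight \<delta> (- (2 * \<sigma>)) \<omega> * (cmod (exp_sum a X \<omega>))\<^sup>2)"
proof -
  have "(\<Phi>hat (\<delta> *\<^sub>R \<omega>))\<^sup>2 \<le> (C * sobolev_weight \<delta> (- \<sigma>) \<omega>)\<^sup>2"
    by (intro power_mono \<Phi>hat_bounds \<Phi>hat_nonneg)
  also have "\<dots> = C\<^sup>2 * sobolev_weight \<delta> (- \<sigma> + - \<sigma>) \<omega>"
    by (simp only: sobolev_weight_add power2_eq_square mult_ac)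
  finally have "(\<Phi>hat (\<delta> *\<^sub>R \<omega>))\<^sup>2 \<le> C\<^sup>2 * sobolev_weight \<delta> (- (2 * \<sigma>)) \<omega>" by simp
  from mult_right_mono[OF this, of "(cmod (exp_sum a X \<omega>))\<^sup>2"] show ?thesis
    by (simp add: fourier_combination[OF \<delta>] norm_mult power_mult_distrib mult_ac)
qed

abbreviation \<zeta> :: "nat \<Rightarrow> 'a \<Rightarrow> real" where "\<zeta> i \<equiv> smooth_indicator (A i) t"
abbreviation \<zeta>hat :: "nat \<Rightarrow> 'a \<Rightarrow> complex" where "\<zeta>hat i \<equiv> smooth_indicator_spectrum (A i) t"
abbreviation \<mu> :: "nat \<Rightarrow> 'a \<Rightarrow> complex" where "\<mu> i \<equiv> cone_multiplier k (s i) (e i)"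

text \<open>
  Multiplying the coefficients by a smooth function of the points convolves the exponential sum with the
  spectrum of that function, without loss in weighted norms.
\<close>

lemma exp_sum_part:
  assumes "i < M"
  shows "exp_sum (\<lambda>y. of_real (\<zeta> i y) * a y) X \<omega> = convolve (\<zeta>hat i) (exp_sum a X) \<omega>"
proof -
  have i: "Bochner_Integration.integrable lborel (\<lambda>\<eta>. \<zeta>hat i \<eta> * cis (y \<bullet> \<eta>))" for y
    by (rule integrable_mult_cis[OF integrable_smooth_indicator_spectrum[OF t_pos A_borel[OF assms] A_bounded[OF assms]]]) measurable
  have "convolve (\<zeta>hat i) (exp_sum a X) \<omega> = (LINT \<eta>|lborel. (\<Sum>y\<in>X. (a y * cis (- (y \<bullet> \<omega>))) * (\<zeta>hat i \<eta> * cis (y \<bullet> \<eta>))))"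
    unfolding convolve_def exp_sum_def
  proof (rule Bochner_Integration.integral_cong[OF refl])
    fix \<eta>
    have "cis (- (y \<bullet> (\<omega> - \<eta>))) = cis (- (y \<bullet> \<omega>)) * cis (y \<bullet> \<eta>)" for y :: 'a
      by (simp add: cis_mult inner_diff_right)
    then show "\<zeta>hat i \<eta> * (\<Sum>y\<in>X. a y * cis (- (y \<bullet> (\<omega> - \<eta>)))) = (\<Sum>y\<in>X. (a y * cis (- (y \<bullet> \<omega>))) * (\<zeta>hat i \<eta> * cis (y \<bullet> \<eta>)))"
      unfolding sum_distrib_left by (simp only: mult_ac)
  qed
  also have "\<dots> = (\<Sum>y\<in>X. (a y * cis (- (y \<bullet> \<omega>))) * (LINT \<eta>|lborel. \<zeta>hat i \<eta> * cis (y \<bullet> \<eta>)))"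
    by (subst Bochner_Integration.integral_sum) (simp_all only: integral_mult_right_zero integrable_mult_right i)
  also have "\<dots> = exp_sum (\<lambda>y. of_real (\<zeta> i y) * a y) X \<omega>"
    using inverse_transform_smooth_indicator_spectrum[OF t_pos A_borel[OF assms] A_bounded[OF assms]]
    unfolding exp_sum_def inverse_transform_def by (simp add: mult_ac)
  finally show ?thesis ..
qed

lemma sum_exp_sum_part:
  assumes "X \<subseteq> closure \<Omega>"
  shows "(\<Sum>i<M. exp_sum (\<lambda>y. of_real (\<zeta> i y) * a y) X \<omega>) = exp_sum a X \<omega>"
proof -
  have "(\<Sum>i<M. exp_sum (\<lambda>y. of_real (\<zeta> i y) * a y) X \<omega>) = (\<Sum>y\<in>X. of_real (\<Sum>i<M. \<zeta> i y) * (a y * cis (- (y \<bullet> \<omega>))))"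
    unfolding exp_sum_def by (subst sum.swap) (simp add: sum_distrib_right mult.assoc)
  also have "\<dots> = (\<Sum>y\<in>X. a y * cis (- (y \<bullet> \<omega>)))"
    using assms by (intro sum.cong refl) (subst sum_smooth_indicator[OF t_pos A_borel A_disjoint A_cover], auto)
  finally show ?thesis by (simp add: exp_sum_def)
qed

text \<open>
  Where \<open>\<zeta> i\<close> does not vanish, the cone of the \<open>i\<close>-th piece is available up to height \<open>t\<close>.
\<close>

lemma part_cone:
  assumes i: "i < M" and x: "x \<in> closure \<Omega>" "\<zeta> i x \<noteq> 0" and h: "0 < h" "h * real k < t"
    and l: "l \<in> {1..k}" and z: "norm z < 1"
  shows "x + (h * real l) *\<^sub>R (e i + s i *\<^sub>R z) \<in> \<Omega>"
proof -
  obtain a where a: "a \<in> A i" "dist x a < t" using smooth_indicator_eq_0[OF t_pos, of "A i" x] x(2) by force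
  have "h * real l \<le> h * real k" using h l by (intro mult_left_mono) auto
  then have "h * real l < t" using h(2) by linarith
  then show ?thesis using h l z by (intro cone[OF i x(1) a]) auto
qed

text \<open>
  Multiplication by \<open>\<zeta> i\<close> is bounded on all Sobolev spaces that occur, uniformly in \<open>\<delta> \<le> 1\<close>.
\<close>

lemma spectrum_Young:
  "\<exists>D\<ge>0. \<forall>i<M. \<forall>\<delta> r g. 0 \<le> \<delta> \<and> \<delta> \<le> 1 \<and> \<bar>r\<bar> \<le> \<sigma> \<and> g \<in> borel_measurable borel \<longrightarrow>
     weighted_sq (sobolev_weight \<delta> r) (convolve (\<zeta>hat i) g) \<le> ennreal D * weighted_sq (sobolev_weight \<delta> r) g"
proof -
  define N where "N i = (\<integral>\<^sup>+\<eta>. ennreal (cmod (\<zeta>hat i \<eta>)) \<partial>lborel) * (\<integral>\<^sup>+\<eta>. ennreal (2 powr \<sigma> * sobolev_weight 1 \<sigma> \<eta> * cmod (\<zeta>hat i \<eta>)) \<partial>lborel)" for i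
  have N: "N i < \<infinity>" if i: "i < M" for i
  proof -
    note [measurable] = borel_measurable_smooth_indicator_spectrum[OF A_borel[OF i]]
    have "(\<integral>\<^sup>+\<eta>. ennreal (2 powr \<sigma> * sobolev_weight 1 \<sigma> \<eta> * cmod (\<zeta>hat i \<eta>)) \<partial>lborel) = ennreal (2 powr \<sigma>) * (\<integral>\<^sup>+\<eta>. ennreal (sobolev_weight 1 \<sigma> \<eta> * cmod (\<zeta>hat i \<eta>)) \<partial>lborel)"
      by (subst nn_integral_cmult[symmetric]) (auto simp: ennreal_mult[symmetric] mult.assoc)
    then show ?thesis
      using weighted_smooth_indicator_spectrum[OF t_pos A_borel[OF i] A_bounded[OF i]]
        nn_integral_norm_finite[OF integrable_smooth_indicator_spectrum[OF t_pos A_borel[OF i] A_bounded[OF i]]]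
      by (simp add: N_def ennreal_mult_less_top)
  qed
  define D where "D = (\<Sum>i<M. enn2real (N i))"
  have ND: "N i \<le> ennreal D" if i: "i < M" for i
  proof -
    have "enn2real (N i) \<le> D" unfolding D_def by (rule member_le_sum) (use i in auto)
    then have "ennreal (enn2real (N i)) \<le> ennreal D" by (rule ennreal_leI)
    then show ?thesis using N[OF i] by simp
  qed
  have main: "weighted_sq (sobolev_weight \<delta> r) (convolve (\<zeta>hat i) g) \<le> ennreal D * weighted_sq (sobolev_weight \<delta> r) g"
    if i: "i < M" and \<delta>: "0 \<le> \<delta>" "\<delta> \<le> 1" and r: "\<bar>r\<bar> \<le> \<sigma>" and g[measurable]: "g \<in> borel_measurable borel" for i \<delta> r g
  proof -
    note [measurable] = borel_measurable_smooth_indicator_spectrum[OF A_borel[OF i]]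
    have "weighted_sq (sobolev_weight \<delta> r) (convolve (\<zeta>hat i) g) \<le> N i * weighted_sq (sobolev_weight \<delta> r) g"
      unfolding N_def
    proof (rule weighted_Young)
      fix \<omega> \<eta> :: 'a
      have "sobolev_weight \<delta> r \<omega> \<le> 2 powr \<bar>r\<bar> * sobolev_weight 1 \<bar>r\<bar> \<eta> * sobolev_weight \<delta> r (\<omega> - \<eta>)"
        by (rule Peetre_inequality[OF \<delta>])
      also have "\<dots> \<le> 2 powr \<sigma> * sobolev_weight 1 \<sigma> \<eta> * sobolev_weight \<delta> r (\<omega> - \<eta>)"
        using r by (intro mult_right_mono mult_mono powr_mono sobolev_weight_mono) auto
      finally show "sobolev_weight \<delta> r \<omega> \<le> 2 powr \<sigma> * sobolev_weight 1 \<sigma> \<eta> * sobolev_weight \<delta> r (\<omega> - \<eta>)" .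
    qed auto
    also have "\<dots> \<le> ennreal D * weighted_sq (sobolev_weight \<delta> r) g" by (intro mult_right_mono ND i) simp
    finally show ?thesis .
  qed
  show ?thesis
  proof (intro exI[of _ D] conjI allI impI)
    show "0 \<le> D" unfolding D_def by (intro sum_nonneg) simp
  qed (elim conjE, rule main, assumption+)
qed

lemma multiplier_bounds:
  "\<exists>D\<ge>0. \<forall>i<M. \<forall>h \<delta> \<omega>. 0 < h \<and> h \<le> \<delta> \<longrightarrow>
     (\<forall>r. 0 \<le> r \<and> r \<le> \<sigma> \<longrightarrow>
       (cmod (\<mu> i (h *\<^sub>R \<omega>)))\<^sup>2 * sobolev_weight \<delta> r \<omega> \<le> D * (\<delta> / h) powr (2 * r) \<and>
       (cmod (1 - \<mu> i (h *\<^sub>R \<omega>)))\<^sup>2 * sobolev_weight \<delta> (- r) \<omega> \<le> D * (h / \<delta>) powr (2 * r)) \<and>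
     (cmod (1 - \<mu> i (h *\<^sub>R \<omega>)))\<^sup>2 * sobolev_weight \<delta> (- \<sigma>) \<omega> \<le> D * (h / \<delta>) powr (2 * \<sigma>) * sobolev_weight h (- \<sigma>) \<omega>"
  (is "\<exists>D\<ge>0. \<forall>i<M. ?P i D")
proof -
  have "\<forall>i\<in>{..<M}. \<exists>D\<ge>0. ?P i D"
  proof
    fix i assume "i \<in> {..<M}"
    then show "\<exists>D\<ge>0. ?P i D" using cone_multiplier_bounds[OF s_pos k_ge, of i "e i"] by simp
  qed
  from bchoice[OF this] obtain D where D': "\<forall>i\<in>{..<M}. 0 \<le> D i \<and> ?P i (D i)" ..
  have both: "0 \<le> D i \<and> ?P i (D i)" if "i < M" for i
    by (rule bspec[OF D']) (use that in simp)
  note D = both[THEN conjunct1] both[THEN conjunct2]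
  define D' where "D' = (\<Sum>i<M. D i)"
  have le: "D i \<le> D'" if "i < M" for i unfolding D'_def by (rule member_le_sum) (use D that in auto)
  show ?thesis
  proof (intro exI[of _ D'] conjI allI impI; (elim conjE)?)
    show "0 \<le> D'" unfolding D'_def by (intro sum_nonneg D) auto
    fix i and h \<delta> :: real and \<omega> :: 'a assume i: "i < M" and h: "0 < h" "h \<le> \<delta>"
    then have hh: "0 < h \<and> h \<le> \<delta>" by simp
    note P = D(2)[OF i, THEN spec[of _ h], THEN spec[of _ \<delta>], THEN spec[of _ \<omega>], THEN mp, OF hh]
    have "D i * (h / \<delta>) powr (2 * \<sigma>) * sobolev_weight h (- \<sigma>) \<omega> \<le> D' * (h / \<delta>) powr (2 * \<sigma>) * sobolev_weight h (- \<sigma>) \<omega>"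
      by (intro mult_right_mono le i) auto
    with P[THEN conjunct2]
    show "(cmod (1 - \<mu> i (h *\<^sub>R \<omega>)))\<^sup>2 * sobolev_weight \<delta> (- \<sigma>) \<omega> \<le> D' * (h / \<delta>) powr (2 * \<sigma>) * sobolev_weight h (- \<sigma>) \<omega>"
      by (rule order_trans)
    fix r :: real assume r: "0 \<le> r" "r \<le> \<sigma>"
    have "D i * (\<delta> / h) powr (2 * r) \<le> D' * (\<delta> / h) powr (2 * r)" by (intro mult_right_mono le i) auto
    then show "(cmod (\<mu> i (h *\<^sub>R \<omega>)))\<^sup>2 * sobolev_weight \<delta> r \<omega> \<le> D' * (\<delta> / h) powr (2 * r)"
      using P[THEN conjunct1] r by (meson order_trans)
    have "D i * (h / \<delta>) powr (2 * r) \<le> D' * (h / \<delta>) powr (2 * r)" by (intro mult_right_mono le i) auto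
    then show "(cmod (1 - \<mu> i (h *\<^sub>R \<omega>)))\<^sup>2 * sobolev_weight \<delta> (- r) \<omega> \<le> D' * (h / \<delta>) powr (2 * r)"
      using P[THEN conjunct1] r by (meson order_trans)
  qed
qed

end

section \<open>The energy estimate\<close>

lemma cmod_mult_cnj: "cmod (x * cnj y) = cmod x * cmod y"
  by (simp add: norm_mult)

context bernstein_setting
begin

lemma integrable_fourier_combination:
  assumes \<delta>: "0 < \<delta>"
  shows "Bochner_Integration.integrable lborel (fourier (combination \<delta> a X))"
proof (rule Bochner_Integration.integrable_bound)
  let ?S = "\<Sum>y\<in>X. cmod (a y)"
  have S: "0 \<le> ?S" by (intro sum_nonneg) simp
  have "Bochner_Integration.integrable lborel (\<lambda>\<omega>::'a. sobolev_weight 1 (- \<sigma>) (0 + \<delta> *\<^sub>R \<omega>))"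
    using \<delta> by (intro integrable_affine integrable_sobolev_weight half_dim_less) simp
  then show "Bochner_Integration.integrable lborel (\<lambda>\<omega>::'a. ?S * (C * sobolev_weight 1 (- \<sigma>) (0 + \<delta> *\<^sub>R \<omega>)))"
    by (intro integrable_mult_right)
  show "fourier (combination \<delta> a X) \<in> borel_measurable lborel"
    using square_integrableD[OF square_integrable_combination[OF \<delta>]] by measurable
  have "cmod (fourier (combination \<delta> a X) \<omega>) \<le> ?S * (C * sobolev_weight 1 (- \<sigma>) (0 + \<delta> *\<^sub>R \<omega>))" for \<omega>
    unfolding fourier_combination[OF \<delta>] norm_mult norm_of_real abs_of_nonneg[OF \<Phi>hat_nonneg]
    using \<Phi>hat_bounds(2)[of \<delta> \<omega>] by (intro mult_mono cmod_exp_sum_le S \<Phi>hat_nonneg) (simp add: sobolev_weight_scaleR)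
  then show "AE \<omega> in lborel. cmod (fourier (combination \<delta> a X) \<omega>) \<le> norm (?S * (C * sobolev_weight 1 (- \<sigma>) (0 + \<delta> *\<^sub>R \<omega>)))"
    by (auto intro: order_trans[OF _ abs_ge_self])
qed

text \<open>
  The lower bound for exponential sums lives at the scale \<open>q\<close>; passing to the scale \<open>\<delta>\<close> costs \<open>(\<delta>/q)\<^bsup>2 \<sigma>\<^esup>\<close>.
\<close>

lemma coefficients_le_energy:
  assumes "0 < c\<^sub>0"
  shows "\<exists>D\<ge>0. \<forall>\<delta> q a. \<forall>X::'a set. 0 < q \<and> q \<le> c\<^sub>0 * \<delta> \<and> 0 < \<delta> \<and> finite X \<and> separated X q \<longrightarrow>
     ennreal (\<Sum>y\<in>X. (cmod (a y))\<^sup>2) \<le> ennreal (D * (q ^ DIM('a) * (\<delta> / q) powr (2 * \<sigma>))) * energy \<delta> a X"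
proof -
  obtain B where B: "0 \<le> B" and lower: "\<And>h b X. 0 < h \<and> finite X \<and> separated X h \<Longrightarrow>
     ennreal (\<Sum>y\<in>X. (cmod (b y))\<^sup>2) \<le> ennreal (B * h ^ DIM('a)) * weighted_sq (sobolev_weight h (- \<sigma>)) (exp_sum b (X::'a set))"
    using exp_sum_lower by blast
  define K where "K = max 1 c\<^sub>0"
  have K: "1 \<le> K" "c\<^sub>0 \<le> K" by (auto simp: K_def)
  have main: "ennreal (\<Sum>y\<in>X. (cmod (a y))\<^sup>2) \<le> ennreal (B * K powr (2 * \<sigma>) * (q ^ DIM('a) * (\<delta> / q) powr (2 * \<sigma>))) * energy \<delta> a X"
    if q: "0 < q" "q \<le> c\<^sub>0 * \<delta>" and \<delta>: "0 < \<delta>" and X: "finite X" "separated X q" for \<delta> q a and X :: "'a set"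
  proof -
    have "c\<^sub>0 * \<delta> \<le> K * \<delta>" using K \<delta> by (intro mult_right_mono) auto
    then have Kq: "1 \<le> K * (\<delta> / q)" using q by (simp add: field_simps)
    have "\<delta> = 1 * \<delta>" by simp
    also have "1 * \<delta> \<le> K * \<delta>" using K \<delta> by (intro mult_right_mono) auto
    also have "K * \<delta> = (K * (\<delta> / q)) * q" using q by simp
    finally have \<delta>q: "\<delta> \<le> (K * (\<delta> / q)) * q" .
    have "weighted_sq (sobolev_weight q (- \<sigma>)) (exp_sum a X) \<le> ennreal ((K * (\<delta> / q)) powr (2 * \<sigma>)) * energy \<delta> a X"
      unfolding energy_def
    proof (rule weighted_sq_le_cmult)
      fix \<omega> :: 'a
      have "sobolev_weight q (- \<sigma>) \<omega> \<le> (K * (\<delta> / q)) powr (2 * \<sigma>) * sobolev_weight \<delta> (- \<sigma>) \<omega>"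
        using q \<delta> \<sigma>_pos by (intro sobolev_weight_dilate_le \<delta>q Kq) auto
      then show "sobolev_weight q (- \<sigma>) \<omega> * (cmod (exp_sum a X \<omega>))\<^sup>2 \<le> (K * (\<delta> / q)) powr (2 * \<sigma>) * (sobolev_weight \<delta> (- \<sigma>) \<omega> * (cmod (exp_sum a X \<omega>))\<^sup>2)"
        unfolding mult.assoc[symmetric] by (intro mult_right_mono) auto
    qed auto
    then have "ennreal (B * q ^ DIM('a)) * weighted_sq (sobolev_weight q (- \<sigma>)) (exp_sum a X) \<le> ennreal (B * q ^ DIM('a)) * (ennreal ((K * (\<delta> / q)) powr (2 * \<sigma>)) * energy \<delta> a X)"
      by (rule mult_left_mono) simp
    with lower[of q X a] q X have "ennreal (\<Sum>y\<in>X. (cmod (a y))\<^sup>2) \<le> ennreal (B * q ^ DIM('a)) * (ennreal ((K * (\<delta> / q)) powr (2 * \<sigma>)) * energy \<delta> a X)"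
      by (meson order_trans)
    also have "\<dots> = ennreal (B * K powr (2 * \<sigma>) * (q ^ DIM('a) * (\<delta> / q) powr (2 * \<sigma>))) * energy \<delta> a X"
    proof -
      have "ennreal (B * q ^ DIM('a)) * ennreal ((K * (\<delta> / q)) powr (2 * \<sigma>)) = ennreal (B * K powr (2 * \<sigma>) * (q ^ DIM('a) * (\<delta> / q) powr (2 * \<sigma>)))"
        using B q \<delta> K powr_mult[of K "\<delta> / q" "2 * \<sigma>"] by (subst ennreal_mult[symmetric]) (auto simp: mult_ac)
      then show ?thesis by (simp only: mult.assoc[symmetric])
    qed
    finally show ?thesis .
  qed
  show ?thesis
  proof (intro exI[of _ "B * K powr (2 * \<sigma>)"] conjI allI impI)
    show "0 \<le> B * K powr (2 * \<sigma>)" using B by simp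
  qed (elim conjE, rule main, assumption+)
qed

abbreviation part_sum :: "nat \<Rightarrow> ('a \<Rightarrow> complex) \<Rightarrow> 'a set \<Rightarrow> 'a \<Rightarrow> complex" where
  "part_sum i a X \<equiv> exp_sum (\<lambda>y. of_real (\<zeta> i y) * a y) X"

text \<open>
  The multiplier gains \<open>(h/\<delta>)\<^bsup>2 \<sigma>\<^esup>\<close> and leaves the exponential sum in the weight of the scale \<open>h\<close>. There
  \<open>exp_sum_upper\<close> returns to the coefficients with a factor \<open>h\<^bsup>-d\<^esup>\<close>, and \<open>coefficients_le_energy\<close> to the energy with
  \<open>q\<^sup>d (\<delta>/q)\<^bsup>2 \<sigma>\<^esup>\<close>. All powers of \<open>\<delta>\<close> cancel; the power \<open>2 \<sigma> - d\<close> of \<open>h/q\<close> that remains is positive.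
\<close>

lemma smoothing_error_term:
  assumes "0 < c\<^sub>0"
  shows "\<exists>D\<ge>0. \<forall>i<M. \<forall>h \<delta> q a. \<forall>X::'a set. 0 < h \<and> h \<le> q \<and> h \<le> \<delta> \<and> q \<le> c\<^sub>0 * \<delta> \<and> finite X \<and> separated X q \<longrightarrow>
     ennreal ((cmod (LINT \<omega>|lborel. fourier (combination \<delta> a X) \<omega> * ((1 - \<mu> i (h *\<^sub>R \<omega>)) * cnj (part_sum i a X \<omega>))))\<^sup>2)
       \<le> ennreal (D * (h / q) powr (2 * \<sigma> - real DIM('a))) * (energy \<delta> a X * energy \<delta> a X)"
proof -
  obtain D1 where D1: "0 \<le> D1" and mult: "\<And>i h \<delta> \<omega>. i < M \<Longrightarrow> 0 < h \<and> h \<le> \<delta> \<Longrightarrow>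
     (cmod (1 - \<mu> i (h *\<^sub>R \<omega>)))\<^sup>2 * sobolev_weight \<delta> (- \<sigma>) \<omega> \<le> D1 * (h / \<delta>) powr (2 * \<sigma>) * sobolev_weight h (- \<sigma>) \<omega>"
    using multiplier_bounds by meson
  obtain D2 where D2: "0 \<le> D2" and upper: "\<And>h b X. 0 < h \<and> finite X \<and> separated X h \<Longrightarrow>
     weighted_sq (sobolev_weight h (- \<sigma>)) (exp_sum b (X::'a set)) \<le> ennreal (D2 / h ^ DIM('a) * (\<Sum>y\<in>X. (cmod (b y))\<^sup>2))"
    using exp_sum_upper by blast
  obtain D3 where D3: "0 \<le> D3" and coeff: "\<And>\<delta> q a X. 0 < q \<and> q \<le> c\<^sub>0 * \<delta> \<and> 0 < \<delta> \<and> finite X \<and> separated X q \<Longrightarrow>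
     ennreal (\<Sum>y\<in>X. (cmod (a y))\<^sup>2) \<le> ennreal (D3 * (q ^ DIM('a) * (\<delta> / q) powr (2 * \<sigma>))) * energy \<delta> a (X::'a set)"
    using coefficients_le_energy[OF assms] by blast
  define D where "D = C\<^sup>2 * (D1 * (D2 * D3))"
  have D: "0 \<le> D" using D1 D2 D3 by (simp add: D_def)
  have main: "ennreal ((cmod (LINT \<omega>|lborel. fourier (combination \<delta> a X) \<omega> * ((1 - \<mu> i (h *\<^sub>R \<omega>)) * cnj (part_sum i a X \<omega>))))\<^sup>2)
       \<le> ennreal (D * (h / q) powr (2 * \<sigma> - real DIM('a))) * (energy \<delta> a X * energy \<delta> a X)"
    if i: "i < M" and h: "0 < h" "h \<le> q" "h \<le> \<delta>" and q: "q \<le> c\<^sub>0 * \<delta>" and X: "finite X" "separated X q" for i h \<delta> q a and X :: "'a set"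
  proof -
    have \<delta>: "0 < \<delta>" and q0: "0 < q" using h by auto
    let ?V = "fourier (combination \<delta> a X)"
    let ?g = "\<lambda>\<omega>. (1 - \<mu> i (h *\<^sub>R \<omega>)) * cnj (part_sum i a X \<omega>)"
    have [measurable]: "?V \<in> borel_measurable borel"
      using square_integrableD[OF square_integrable_combination[OF \<delta>]] by measurable
    have Xh: "separated X h" using X(2) h unfolding separated_def by (meson mult_left_mono order_trans zero_le_numeral)
    have V: "weighted_sq (sobolev_weight \<delta> \<sigma>) ?V \<le> ennreal (C\<^sup>2) * energy \<delta> a X"
      unfolding energy_def
    proof (rule weighted_sq_le_cmult)
      fix \<omega>
      have "sobolev_weight \<delta> \<sigma> \<omega> * (cmod (?V \<omega>))\<^sup>2 \<le> sobolev_weight \<delta> \<sigma> \<omega> * (C\<^sup>2 * (sobolev_weight \<delta> (- (2 * \<sigma>)) \<omega> * (cmod (exp_sum a X \<omega>))\<^sup>2))"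
        by (intro mult_left_mono combination_weight_le \<delta>) simp
      also have "\<dots> = C\<^sup>2 * (sobolev_weight \<delta> (\<sigma> + - (2 * \<sigma>)) \<omega> * (cmod (exp_sum a X \<omega>))\<^sup>2)"
        unfolding sobolev_weight_add by simp
      finally show "sobolev_weight \<delta> \<sigma> \<omega> * (cmod (?V \<omega>))\<^sup>2 \<le> C\<^sup>2 * (sobolev_weight \<delta> (- \<sigma>) \<omega> * (cmod (exp_sum a X \<omega>))\<^sup>2)" by simp
    qed auto
    have "weighted_sq (sobolev_weight \<delta> (- \<sigma>)) ?g \<le> ennreal (D1 * (h / \<delta>) powr (2 * \<sigma>)) * weighted_sq (sobolev_weight h (- \<sigma>)) (part_sum i a X)"
    proof (rule weighted_sq_le_cmult)
      fix \<omega>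
      have "(cmod (1 - \<mu> i (h *\<^sub>R \<omega>)))\<^sup>2 * sobolev_weight \<delta> (- \<sigma>) \<omega> * (cmod (part_sum i a X \<omega>))\<^sup>2
          \<le> D1 * (h / \<delta>) powr (2 * \<sigma>) * sobolev_weight h (- \<sigma>) \<omega> * (cmod (part_sum i a X \<omega>))\<^sup>2"
        by (intro mult_right_mono mult i) (use h in auto)
      then show "sobolev_weight \<delta> (- \<sigma>) \<omega> * (cmod (?g \<omega>))\<^sup>2 \<le> D1 * (h / \<delta>) powr (2 * \<sigma>) * (sobolev_weight h (- \<sigma>) \<omega> * (cmod (part_sum i a X \<omega>))\<^sup>2)"
        by (simp add: norm_mult power_mult_distrib mult_ac)
    qed (use D1 in auto)
    also have "\<dots> \<le> ennreal (D1 * (h / \<delta>) powr (2 * \<sigma>)) * (ennreal (D2 / h ^ DIM('a)) * (ennreal (D3 * (q ^ DIM('a) * (\<delta> / q) powr (2 * \<sigma>))) * energy \<delta> a X))"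
    proof (rule mult_left_mono)
      have "weighted_sq (sobolev_weight h (- \<sigma>)) (part_sum i a X) \<le> ennreal (D2 / h ^ DIM('a) * (\<Sum>y\<in>X. (cmod (of_real (\<zeta> i y) * a y))\<^sup>2))"
        using h X Xh by (intro upper) auto
      also have "\<dots> \<le> ennreal (D2 / h ^ DIM('a) * (\<Sum>y\<in>X. (cmod (a y))\<^sup>2))"
      proof (intro ennreal_leI mult_left_mono sum_mono power_mono)
        fix y
        have "0 \<le> \<zeta> i y" "\<zeta> i y \<le> 1"
          using smooth_indicator_nonneg[OF t_pos] smooth_indicator_le_1[OF t_pos A_borel[OF i]] by auto
        then show "cmod (of_real (\<zeta> i y) * a y) \<le> cmod (a y)" by (simp add: norm_mult mult_right_le_one_le mult.commute)
      qed (use D2 h in auto)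
      also have "\<dots> = ennreal (D2 / h ^ DIM('a)) * ennreal (\<Sum>y\<in>X. (cmod (a y))\<^sup>2)"
        using D2 h by (intro ennreal_mult sum_nonneg) auto
      also have "\<dots> \<le> ennreal (D2 / h ^ DIM('a)) * (ennreal (D3 * (q ^ DIM('a) * (\<delta> / q) powr (2 * \<sigma>))) * energy \<delta> a X)"
        using q q0 \<delta> X by (intro mult_left_mono coeff) auto
      finally show "weighted_sq (sobolev_weight h (- \<sigma>)) (part_sum i a X) \<le> ennreal (D2 / h ^ DIM('a)) * (ennreal (D3 * (q ^ DIM('a) * (\<delta> / q) powr (2 * \<sigma>))) * energy \<delta> a X)" .
    qed simp
    finally have g: "weighted_sq (sobolev_weight \<delta> (- \<sigma>)) ?g \<le> ennreal (D1 * (h / \<delta>) powr (2 * \<sigma>)) * (ennreal (D2 / h ^ DIM('a)) * (ennreal (D3 * (q ^ DIM('a) * (\<delta> / q) powr (2 * \<sigma>))) * energy \<delta> a X))" .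
    have "ennreal ((cmod (LINT \<omega>|lborel. ?V \<omega> * ?g \<omega>))\<^sup>2) \<le> weighted_sq (sobolev_weight \<delta> \<sigma>) ?V * weighted_sq (\<lambda>x. inverse (sobolev_weight \<delta> \<sigma> x)) ?g"
      by (rule Cauchy_Schwarz_integral) auto
    also have "(\<lambda>x::'a. inverse (sobolev_weight \<delta> \<sigma> x)) = sobolev_weight \<delta> (- \<sigma>)" by (simp add: sobolev_weight_minus fun_eq_iff)
    also have "weighted_sq (sobolev_weight \<delta> \<sigma>) ?V * weighted_sq (sobolev_weight \<delta> (- \<sigma>)) ?g
      \<le> (ennreal (C\<^sup>2) * energy \<delta> a X) * (ennreal (D1 * (h / \<delta>) powr (2 * \<sigma>)) * (ennreal (D2 / h ^ DIM('a)) * (ennreal (D3 * (q ^ DIM('a) * (\<delta> / q) powr (2 * \<sigma>))) * energy \<delta> a X)))"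
      by (intro mult_mono V g) auto
    also have "\<dots> = (ennreal (C\<^sup>2) * (ennreal (D1 * (h / \<delta>) powr (2 * \<sigma>)) * (ennreal (D2 / h ^ DIM('a)) * ennreal (D3 * (q ^ DIM('a) * (\<delta> / q) powr (2 * \<sigma>)))))) * (energy \<delta> a X * energy \<delta> a X)"
      by (simp only: mult_ac)
    also have "ennreal (C\<^sup>2) * (ennreal (D1 * (h / \<delta>) powr (2 * \<sigma>)) * (ennreal (D2 / h ^ DIM('a)) * ennreal (D3 * (q ^ DIM('a) * (\<delta> / q) powr (2 * \<sigma>))))) =
       ennreal (C\<^sup>2 * (D1 * (h / \<delta>) powr (2 * \<sigma>) * (D2 / h ^ DIM('a) * (D3 * (q ^ DIM('a) * (\<delta> / q) powr (2 * \<sigma>))))))"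
      using D1 D2 D3 h q0 by (simp add: ennreal_mult[symmetric])
    also have "C\<^sup>2 * (D1 * (h / \<delta>) powr (2 * \<sigma>) * (D2 / h ^ DIM('a) * (D3 * (q ^ DIM('a) * (\<delta> / q) powr (2 * \<sigma>))))) = D * (h / q) powr (2 * \<sigma> - real DIM('a))"
    proof -
      have "(h / \<delta>) powr (2 * \<sigma>) * (\<delta> / q) powr (2 * \<sigma>) = (h / q) powr (2 * \<sigma>)"
        using \<delta> q0 h by (simp add: powr_mult[symmetric])
      moreover have "q ^ DIM('a) / h ^ DIM('a) = (h / q) powr (- real DIM('a))"
        using q0 h by (simp add: powr_minus powr_realpow power_divide)
      ultimately have eq: "((h / \<delta>) powr (2 * \<sigma>) * (\<delta> / q) powr (2 * \<sigma>)) * (q ^ DIM('a) / h ^ DIM('a)) = (h / q) powr (2 * \<sigma> - real DIM('a))"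
        by (simp add: powr_add[symmetric])
      have "C\<^sup>2 * (D1 * (h / \<delta>) powr (2 * \<sigma>) * (D2 / h ^ DIM('a) * (D3 * (q ^ DIM('a) * (\<delta> / q) powr (2 * \<sigma>)))))
          = D * (((h / \<delta>) powr (2 * \<sigma>) * (\<delta> / q) powr (2 * \<sigma>)) * (q ^ DIM('a) / h ^ DIM('a)))"
        by (simp add: D_def)
      then show ?thesis unfolding eq .
    qed
    finally show ?thesis .
  qed
  show ?thesis
  proof (intro exI[of _ D] conjI allI impI)
    show "0 \<le> D" by (rule D)
  qed (elim conjE, rule main, assumption+)
qed

text \<open>
  Cauchy-Schwarz between the orders \<open>\<alpha>\<close> and \<open>- \<alpha>\<close>; the multiplier raises the order of the
  exponential sum from \<open>- \<sigma>\<close> to \<open>- \<alpha>\<close>.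
\<close>

lemma smoothed_term:
  "\<exists>D\<ge>0. \<forall>i<M. \<forall>h \<delta> \<alpha> a U. \<forall>X::'a set. 0 < h \<and> h \<le> \<delta> \<and> \<delta> \<le> 1 \<and> 0 \<le> \<alpha> \<and> \<alpha> \<le> \<sigma> \<and> U \<in> borel_measurable borel \<longrightarrow>
     ennreal ((cmod (LINT \<omega>|lborel. U \<omega> * (\<mu> i (h *\<^sub>R \<omega>) * cnj (part_sum i a X \<omega>))))\<^sup>2)
       \<le> ennreal (D * (\<delta> / h) powr (2 * (\<sigma> - \<alpha>))) * (weighted_sq (sobolev_weight \<delta> \<alpha>) U * energy \<delta> a X)"
proof -
  obtain D1 where D1: "0 \<le> D1" and mult: "\<And>i h \<delta> \<omega> r. i < M \<Longrightarrow> 0 < h \<and> h \<le> \<delta> \<Longrightarrow> 0 \<le> r \<and> r \<le> \<sigma> \<Longrightarrow>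
     (cmod (\<mu> i (h *\<^sub>R \<omega>)))\<^sup>2 * sobolev_weight \<delta> r \<omega> \<le> D1 * (\<delta> / h) powr (2 * r)"
    using multiplier_bounds by meson
  obtain D2 where D2: "0 \<le> D2" and Young: "\<And>i \<delta> r g. i < M \<Longrightarrow> 0 \<le> \<delta> \<and> \<delta> \<le> 1 \<and> \<bar>r\<bar> \<le> \<sigma> \<and> g \<in> borel_measurable borel \<Longrightarrow>
     weighted_sq (sobolev_weight \<delta> r) (convolve (\<zeta>hat i) g) \<le> ennreal D2 * weighted_sq (sobolev_weight \<delta> r) g"
    using spectrum_Young by blast
  have main: "ennreal ((cmod (LINT \<omega>|lborel. U \<omega> * (\<mu> i (h *\<^sub>R \<omega>) * cnj (part_sum i a X \<omega>))))\<^sup>2)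
       \<le> ennreal (D1 * D2 * (\<delta> / h) powr (2 * (\<sigma> - \<alpha>))) * (weighted_sq (sobolev_weight \<delta> \<alpha>) U * energy \<delta> a X)"
    if i: "i < M" and h: "0 < h" "h \<le> \<delta>" "\<delta> \<le> 1" and \<alpha>: "0 \<le> \<alpha>" "\<alpha> \<le> \<sigma>" and U[measurable]: "U \<in> borel_measurable borel"
    for i h \<delta> \<alpha> a U and X :: "'a set"
  proof -
    let ?g = "\<lambda>\<omega>. \<mu> i (h *\<^sub>R \<omega>) * cnj (part_sum i a X \<omega>)"
    have "weighted_sq (sobolev_weight \<delta> (- \<alpha>)) ?g \<le> ennreal (D1 * (\<delta> / h) powr (2 * (\<sigma> - \<alpha>))) * weighted_sq (sobolev_weight \<delta> (- \<sigma>)) (part_sum i a X)"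
    proof (rule weighted_sq_le_cmult)
      fix \<omega> :: 'a
      have "(cmod (\<mu> i (h *\<^sub>R \<omega>)))\<^sup>2 * sobolev_weight \<delta> (\<sigma> - \<alpha>) \<omega> * (sobolev_weight \<delta> (- \<sigma>) \<omega> * (cmod (part_sum i a X \<omega>))\<^sup>2)
          \<le> D1 * (\<delta> / h) powr (2 * (\<sigma> - \<alpha>)) * (sobolev_weight \<delta> (- \<sigma>) \<omega> * (cmod (part_sum i a X \<omega>))\<^sup>2)"
        by (intro mult_right_mono mult i) (use h \<alpha> in auto)
      moreover have "sobolev_weight \<delta> (- \<alpha>) \<omega> = sobolev_weight \<delta> (\<sigma> - \<alpha>) \<omega> * sobolev_weight \<delta> (- \<sigma>) \<omega>"
        unfolding sobolev_weight_add[symmetric] by simp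
      ultimately show "sobolev_weight \<delta> (- \<alpha>) \<omega> * (cmod (?g \<omega>))\<^sup>2 \<le> D1 * (\<delta> / h) powr (2 * (\<sigma> - \<alpha>)) * (sobolev_weight \<delta> (- \<sigma>) \<omega> * (cmod (part_sum i a X \<omega>))\<^sup>2)"
        by (simp add: norm_mult power_mult_distrib mult_ac)
    qed (use D1 in auto)
    also have "\<dots> \<le> ennreal (D1 * (\<delta> / h) powr (2 * (\<sigma> - \<alpha>))) * (ennreal D2 * energy \<delta> a X)"
    proof (rule mult_left_mono)
      have "part_sum i a X = convolve (\<zeta>hat i) (exp_sum a X)" by (rule ext, rule exp_sum_part[OF i])
      then show "weighted_sq (sobolev_weight \<delta> (- \<sigma>)) (part_sum i a X) \<le> ennreal D2 * energy \<delta> a X"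
        unfolding energy_def using Young[OF i, of \<delta> "- \<sigma>" "exp_sum a X"] h \<sigma>_pos by simp
    qed simp
    finally have g: "weighted_sq (sobolev_weight \<delta> (- \<alpha>)) ?g \<le> ennreal (D1 * (\<delta> / h) powr (2 * (\<sigma> - \<alpha>))) * (ennreal D2 * energy \<delta> a X)" .
    have "ennreal ((cmod (LINT \<omega>|lborel. U \<omega> * ?g \<omega>))\<^sup>2) \<le> weighted_sq (sobolev_weight \<delta> \<alpha>) U * weighted_sq (\<lambda>x. inverse (sobolev_weight \<delta> \<alpha> x)) ?g"
      by (rule Cauchy_Schwarz_integral) auto
    also have "(\<lambda>x::'a. inverse (sobolev_weight \<delta> \<alpha> x)) = sobolev_weight \<delta> (- \<alpha>)" by (simp add: sobolev_weight_minus fun_eq_iff)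
    also have "weighted_sq (sobolev_weight \<delta> \<alpha>) U * weighted_sq (sobolev_weight \<delta> (- \<alpha>)) ?g \<le> weighted_sq (sobolev_weight \<delta> \<alpha>) U * (ennreal (D1 * (\<delta> / h) powr (2 * (\<sigma> - \<alpha>))) * (ennreal D2 * energy \<delta> a X))"
      by (intro mult_left_mono g) auto
    also have "\<dots> = (ennreal (D1 * (\<delta> / h) powr (2 * (\<sigma> - \<alpha>))) * ennreal D2) * (weighted_sq (sobolev_weight \<delta> \<alpha>) U * energy \<delta> a X)"
      by (simp only: mult_ac)
    also have "ennreal (D1 * (\<delta> / h) powr (2 * (\<sigma> - \<alpha>))) * ennreal D2 = ennreal (D1 * D2 * (\<delta> / h) powr (2 * (\<sigma> - \<alpha>)))"
      using D1 D2 by (simp add: ennreal_mult[symmetric] mult_ac)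
    finally show ?thesis .
  qed
  show ?thesis
  proof (intro exI[of _ "D1 * D2"] conjI allI impI)
    show "0 \<le> D1 * D2" using D1 D2 by simp
  qed (elim conjE, rule main, assumption+)
qed

text \<open>
  By the lower bound on the transform of \<open>\<Phi>\<close>, the energy is at most \<open>1/c\<close> times the pairing of the transform of
  the combination with the exponential sum, which the partition and the identity \<open>1 = (1 - \<mu> i) + \<mu> i\<close> split.
\<close>

lemma energy_le_sum:
  assumes \<delta>: "0 < \<delta>" and X: "X \<subseteq> closure \<Omega>" and e0: "energy \<delta> a X = ennreal e0" "0 \<le> e0"
  shows "c * e0 \<le> (\<Sum>i<M. cmod (LINT \<omega>|lborel. fourier (combination \<delta> a X) \<omega> * ((1 - \<mu> i (h *\<^sub>R \<omega>)) * cnj (part_sum i a X \<omega>))) +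
       cmod (LINT \<omega>|lborel. fourier (combination \<delta> a X) \<omega> * (\<mu> i (h *\<^sub>R \<omega>) * cnj (part_sum i a X \<omega>))))"
proof -
  let ?V = "fourier (combination \<delta> a X)"
  let ?P = "exp_sum a X"
  let ?f = "\<lambda>i \<omega>. ?V \<omega> * ((1 - \<mu> i (h *\<^sub>R \<omega>)) * cnj (part_sum i a X \<omega>))"
  let ?g = "\<lambda>i \<omega>. ?V \<omega> * (\<mu> i (h *\<^sub>R \<omega>) * cnj (part_sum i a X \<omega>))"
  have V: "Bochner_Integration.integrable lborel ?V" by (rule integrable_fourier_combination[OF \<delta>])
  have \<mu>_bounded: "\<exists>B. \<forall>\<omega>. cmod (\<mu> i \<omega>) \<le> B" for i
  proof -
    have "cmod (\<mu> i \<omega>) \<le> (\<Sum>l=1..k. \<bar>cone_coeff k l\<bar>)" for \<omega>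
      unfolding cone_multiplier_def
      by (rule order_trans[OF norm_sum], rule sum_mono) (simp add: norm_mult mult_left_le cmod_\<rho>hat_le_1)
    then show ?thesis by blast
  qed
  have int: "Bochner_Integration.integrable lborel (?f i)" "Bochner_Integration.integrable lborel (?g i)" for i
  proof -
    obtain B where B: "\<And>\<omega>. cmod (\<mu> i \<omega>) \<le> B" using \<mu>_bounded by blast
    have B0: "0 \<le> B" using B[of 0] norm_ge_zero order_trans by blast
    let ?S = "\<Sum>y\<in>X. cmod (of_real (\<zeta> i y) * a y)"
    have "cmod ((1 - \<mu> i (h *\<^sub>R \<omega>)) * cnj (part_sum i a X \<omega>)) \<le> (1 + B) * ?S" for \<omega>
    proof -
      have "cmod (1 - \<mu> i (h *\<^sub>R \<omega>)) \<le> 1 + B" using norm_triangle_ineq4[of 1 "\<mu> i (h *\<^sub>R \<omega>)"] B[of "h *\<^sub>R \<omega>"] by simp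
      then show ?thesis unfolding cmod_mult_cnj using B0 by (intro mult_mono cmod_exp_sum_le) auto
    qed
    then show "Bochner_Integration.integrable lborel (?f i)"
      by (intro integrable_mult_bounded[OF V, where B="(1 + B) * ?S"]) measurable
    have "cmod (\<mu> i (h *\<^sub>R \<omega>) * cnj (part_sum i a X \<omega>)) \<le> B * ?S" for \<omega>
      unfolding cmod_mult_cnj using B0 B by (intro mult_mono cmod_exp_sum_le) auto
    then show "Bochner_Integration.integrable lborel (?g i)"
      by (intro integrable_mult_bounded[OF V, where B="B * ?S"]) measurable
  qed
  have split: "?V \<omega> * cnj (?P \<omega>) = (\<Sum>i<M. ?f i \<omega> + ?g i \<omega>)" for \<omega>
  proof -
    have "?V \<omega> * cnj (?P \<omega>) = ?V \<omega> * cnj (\<Sum>i<M. part_sum i a X \<omega>)" by (simp only: sum_exp_sum_part[OF X])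
    also have "\<dots> = (\<Sum>i<M. ?V \<omega> * cnj (part_sum i a X \<omega>))" by (simp add: sum_distrib_left)
    also have "\<dots> = (\<Sum>i<M. ?f i \<omega> + ?g i \<omega>)" by (intro sum.cong refl) (simp add: algebra_simps)
    finally show ?thesis .
  qed
  have VP: "Bochner_Integration.integrable lborel (\<lambda>\<omega>. ?V \<omega> * cnj (?P \<omega>))"
    by (rule integrable_mult_bounded[OF V, where B="\<Sum>y\<in>X. cmod (a y)"]) (auto simp: cmod_exp_sum_le)
  have real: "?V \<omega> * cnj (?P \<omega>) = of_real (\<Phi>hat (\<delta> *\<^sub>R \<omega>) * (cmod (?P \<omega>))\<^sup>2)" for \<omega>
    unfolding fourier_combination[OF \<delta>] of_real_mult complex_norm_square by (simp only: mult_ac)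
  from integrable_Re[OF VP] have VPr: "Bochner_Integration.integrable lborel (\<lambda>\<omega>. \<Phi>hat (\<delta> *\<^sub>R \<omega>) * (cmod (?P \<omega>))\<^sup>2)"
    by (simp only: real Re_complex_of_real)
  let ?I = "LINT \<omega>|lborel. \<Phi>hat (\<delta> *\<^sub>R \<omega>) * (cmod (?P \<omega>))\<^sup>2"
  have I0: "0 \<le> ?I" by (intro Bochner_Integration.integral_nonneg mult_nonneg_nonneg \<Phi>hat_nonneg) auto
  have "ennreal (c * e0) = ennreal c * energy \<delta> a X" using c_pos e0 by (simp add: ennreal_mult)
  also have "\<dots> = (\<integral>\<^sup>+\<omega>. ennreal c * ennreal (sobolev_weight \<delta> (- \<sigma>) \<omega> * (cmod (?P \<omega>))\<^sup>2) \<partial>lborel)"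
    unfolding energy_def weighted_sq_def by (rule nn_integral_cmult[symmetric]) measurable
  also have "\<dots> \<le> (\<integral>\<^sup>+\<omega>. ennreal (\<Phi>hat (\<delta> *\<^sub>R \<omega>) * (cmod (?P \<omega>))\<^sup>2) \<partial>lborel)"
  proof (rule nn_integral_mono)
    fix \<omega> :: 'a
    have "c * sobolev_weight \<delta> (- \<sigma>) \<omega> * (cmod (?P \<omega>))\<^sup>2 \<le> \<Phi>hat (\<delta> *\<^sub>R \<omega>) * (cmod (?P \<omega>))\<^sup>2"
      by (intro mult_right_mono \<Phi>hat_bounds) auto
    then show "ennreal c * ennreal (sobolev_weight \<delta> (- \<sigma>) \<omega> * (cmod (?P \<omega>))\<^sup>2) \<le> ennreal (\<Phi>hat (\<delta> *\<^sub>R \<omega>) * (cmod (?P \<omega>))\<^sup>2)"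
      using c_pos by (simp add: ennreal_mult[symmetric] mult.assoc ennreal_leI)
  qed
  also have "\<dots> = ennreal ?I"
    by (rule nn_integral_eq_integral[OF VPr]) (auto intro!: mult_nonneg_nonneg \<Phi>hat_nonneg)
  finally have "c * e0 \<le> ?I" using I0 by (simp add: ennreal_le_iff)
  also have "?I = cmod (of_real ?I)" using I0 by simp
  also have "complex_of_real ?I = (LINT \<omega>|lborel. ?V \<omega> * cnj (?P \<omega>))"
    unfolding real by (rule integral_of_real[OF VPr, symmetric])
  also have "\<dots> = (\<Sum>i<M. (LINT \<omega>|lborel. ?f i \<omega>) + (LINT \<omega>|lborel. ?g i \<omega>))"
    unfolding split
    by (subst Bochner_Integration.integral_sum, intro Bochner_Integration.integrable_add int,
        subst Bochner_Integration.integral_add, rule int, rule int, rule refl)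
  also have "cmod \<dots> \<le> (\<Sum>i<M. cmod ((LINT \<omega>|lborel. ?f i \<omega>) + (LINT \<omega>|lborel. ?g i \<omega>)))" by (rule norm_sum)
  also have "\<dots> \<le> (\<Sum>i<M. cmod (LINT \<omega>|lborel. ?f i \<omega>) + cmod (LINT \<omega>|lborel. ?g i \<omega>))"
    by (intro sum_mono norm_triangle_ineq)
  finally show ?thesis .
qed

text \<open>
  With \<open>h = \<epsilon> q\<close> the smoothing errors are at most \<open>c/2\<close> times the energy and move to the left. In the
  smoothed terms \<open>cone_pairing_local\<close> replaces the combination by \<open>u\<close>. The number \<open>\<epsilon>\<close> is part of the statement because the
  extension is built at the same scale.
\<close>

lemma energy_estimate:
  assumes c\<^sub>0: "0 < c\<^sub>0"
  shows "\<exists>\<epsilon> K. 0 < \<epsilon> \<and> \<epsilon> \<le> 1 \<and> \<epsilon> * c\<^sub>0 \<le> 1 \<and> \<epsilon> * c\<^sub>0 * real k < t \<and> 0 \<le> K \<and>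
    (\<forall>\<delta> q \<alpha> a u U. \<forall>X::'a set. 0 < \<delta> \<and> \<delta> \<le> 1 \<and> 0 < q \<and> q \<le> c\<^sub>0 * \<delta> \<and> finite X \<and> X \<subseteq> closure \<Omega> \<and> separated X q \<and>
       0 \<le> \<alpha> \<and> \<alpha> \<le> \<sigma> \<and> square_integrable u \<and> has_fourier_L2 u U \<and>
       (AE x in lborel. x \<in> \<Omega> \<longrightarrow> u x = combination \<delta> a X x) \<and> weighted_sq (sobolev_weight \<delta> \<alpha>) U < \<infinity> \<longrightarrow>
       energy \<delta> a X \<le> ennreal (K * (\<delta> / q) powr (2 * (\<sigma> - \<alpha>))) * weighted_sq (sobolev_weight \<delta> \<alpha>) U)"
proof -
  obtain D1 where D1: "0 \<le> D1" and error: "\<And>i h \<delta> q a X. i < M \<Longrightarrow> 0 < h \<and> h \<le> q \<and> h \<le> \<delta> \<and> q \<le> c\<^sub>0 * \<delta> \<and> finite X \<and> separated X q \<Longrightarrow>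
     ennreal ((cmod (LINT \<omega>|lborel. fourier (combination \<delta> a X) \<omega> * ((1 - \<mu> i (h *\<^sub>R \<omega>)) * cnj (part_sum i a X \<omega>))))\<^sup>2)
       \<le> ennreal (D1 * (h / q) powr (2 * \<sigma> - real DIM('a))) * (energy \<delta> a X * energy \<delta> a X)"
    using smoothing_error_term[OF c\<^sub>0] by blast
  obtain D2 where D2: "0 \<le> D2" and smooth: "\<And>i h \<delta> \<alpha> a U X. i < M \<Longrightarrow> 0 < h \<and> h \<le> \<delta> \<and> \<delta> \<le> 1 \<and> 0 \<le> \<alpha> \<and> \<alpha> \<le> \<sigma> \<and> U \<in> borel_measurable borel \<Longrightarrow>
     ennreal ((cmod (LINT \<omega>|lborel. U \<omega> * (\<mu> i (h *\<^sub>R \<omega>) * cnj (part_sum i a X \<omega>))))\<^sup>2)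
       \<le> ennreal (D2 * (\<delta> / h) powr (2 * (\<sigma> - \<alpha>))) * (weighted_sq (sobolev_weight \<delta> \<alpha>) U * energy \<delta> a X)"
    using smoothed_term by blast
  define N where "N = real M"
  define p where "p = \<sigma> - real DIM('a) / 2"
  have p: "0 < p" using half_dim_less by (simp add: p_def)
  define \<eta> where "\<eta> = c / (2 * (N + 1) * (sqrt D1 + 1))"
  have \<eta>: "0 < \<eta>" unfolding \<eta>_def N_def using c_pos D1 by (intro divide_pos_pos mult_pos_pos) (auto simp: add_nonneg_pos)
  \<comment> \<open>The four bounds give, in this order, \<open>h \<le> q\<close>, \<open>h \<le> \<delta>\<close>, cones of height \<open>h k < t\<close>, and errors of at most half of the energy.\<close>
  define \<epsilon> where "\<epsilon> = min (min 1 (1 / c\<^sub>0)) (min (t / (2 * c\<^sub>0 * (real k + 1))) (\<eta> powr (1 / p)))"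
  have \<epsilon>: "0 < \<epsilon>" "\<epsilon> \<le> 1" "\<epsilon> \<le> 1 / c\<^sub>0" "\<epsilon> \<le> t / (2 * c\<^sub>0 * (real k + 1))" "\<epsilon> \<le> \<eta> powr (1 / p)"
    unfolding \<epsilon>_def using c\<^sub>0 t_pos \<eta> by (auto simp: add_nonneg_pos)
  have \<epsilon>1: "\<epsilon> * c\<^sub>0 \<le> 1" using \<epsilon>(3) c\<^sub>0 by (simp add: field_simps)
  have \<epsilon>2: "\<epsilon> * c\<^sub>0 * real k < t"
  proof -
    have "\<epsilon> * (2 * c\<^sub>0 * (real k + 1)) \<le> t" using \<epsilon>(4) c\<^sub>0 by (subst (asm) pos_le_divide_eq) (auto simp: add_nonneg_pos)
    moreover have "\<epsilon> * (2 * c\<^sub>0 * (real k + 1)) = 2 * (\<epsilon> * c\<^sub>0 * real k) + 2 * (\<epsilon> * c\<^sub>0)" by (simp add: algebra_simps)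
    moreover have "0 < \<epsilon> * c\<^sub>0" "0 \<le> \<epsilon> * c\<^sub>0 * real k" using \<epsilon>(1) c\<^sub>0 by auto
    ultimately show ?thesis by linarith
  qed
  have \<epsilon>3: "N * (sqrt D1 * \<epsilon> powr p) \<le> c / 2"
  proof -
    have "\<epsilon> powr p \<le> (\<eta> powr (1 / p)) powr p" using \<epsilon> p by (intro powr_mono2) auto
    also have "\<dots> = \<eta>" using p \<eta> by (simp add: powr_powr)
    finally have "N * (sqrt D1 * \<epsilon> powr p) \<le> (N + 1) * ((sqrt D1 + 1) * \<eta>)"
      using D1 \<eta> by (intro mult_mono) (auto simp: N_def)
    also have "\<dots> = c / 2"
    proof -
      have "x * (y * (c / (2 * x * y))) = c / 2" if "0 < x" "0 < y" for x y :: real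
        using that by (simp add: field_simps)
      moreover have "0 < N + 1" "0 < sqrt D1 + 1" using D1 by (auto simp: N_def add_nonneg_pos)
      ultimately show ?thesis unfolding \<eta>_def by blast
    qed
    finally show ?thesis .
  qed
  define K where "K = 4 * N\<^sup>2 / c\<^sup>2 * D2 * (1 / \<epsilon>) powr (2 * \<sigma>)"
  have K: "0 \<le> K" using D2 by (simp add: K_def)
  have main: "energy \<delta> a X \<le> ennreal (K * (\<delta> / q) powr (2 * (\<sigma> - \<alpha>))) * weighted_sq (sobolev_weight \<delta> \<alpha>) U"
    if \<delta>: "0 < \<delta>" "\<delta> \<le> 1" and q: "0 < q" "q \<le> c\<^sub>0 * \<delta>" and X: "finite X" "X \<subseteq> closure \<Omega>" "separated X q"
      and \<alpha>: "0 \<le> \<alpha>" "\<alpha> \<le> \<sigma>" and u: "square_integrable u" "has_fourier_L2 u U"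
      and ae: "AE x in lborel. x \<in> \<Omega> \<longrightarrow> u x = combination \<delta> a X x" and fin: "weighted_sq (sobolev_weight \<delta> \<alpha>) U < \<infinity>"
    for \<delta> q \<alpha> a u U and X :: "'a set"
  proof -
    define h where "h = \<epsilon> * q"
    have h: "0 < h" "h \<le> q" using \<epsilon> q by (auto simp: h_def mult_left_le_one_le)
    have "\<epsilon> * q \<le> \<epsilon> * (c\<^sub>0 * \<delta>)" using \<epsilon> q by (intro mult_left_mono) auto
    also have le: "\<epsilon> * (c\<^sub>0 * \<delta>) = (\<epsilon> * c\<^sub>0) * \<delta>" by simp
    also have "(\<epsilon> * c\<^sub>0) * \<delta> \<le> 1 * \<delta>" using \<epsilon>1 \<delta> by (intro mult_right_mono) auto
    finally have h\<delta>: "h \<le> \<delta>" by (simp add: h_def)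
    have "h \<le> \<epsilon> * c\<^sub>0"
    proof -
      have "h \<le> (\<epsilon> * c\<^sub>0) * \<delta>" using \<open>\<epsilon> * q \<le> \<epsilon> * (c\<^sub>0 * \<delta>)\<close> by (simp add: h_def)
      also have "\<dots> \<le> (\<epsilon> * c\<^sub>0) * 1" using \<delta> \<epsilon> c\<^sub>0 by (intro mult_left_mono) auto
      finally show ?thesis by simp
    qed
    then have "h * real k \<le> \<epsilon> * c\<^sub>0 * real k" by (intro mult_right_mono) auto
    then have hk: "h * real k < t" using \<epsilon>2 by linarith
    obtain e0 where e0: "energy \<delta> a X = ennreal e0" "0 \<le> e0"
      using energy_finite[OF \<delta>(1), of a X] by (cases "energy \<delta> a X") auto
    obtain b where b: "weighted_sq (sobolev_weight \<delta> \<alpha>) U = ennreal b" "0 \<le> b"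
      using fin by (cases "weighted_sq (sobolev_weight \<delta> \<alpha>) U") auto
    define Y where "Y = D2 * (\<delta> / h) powr (2 * (\<sigma> - \<alpha>)) * (b * e0)"
    have Y: "0 \<le> Y" using D2 b e0 by (simp add: Y_def)
    have U: "U \<in> borel_measurable borel" using u(2) by (auto simp: has_fourier_L2_def)
    have I1: "cmod (LINT \<omega>|lborel. fourier (combination \<delta> a X) \<omega> * ((1 - \<mu> i (h *\<^sub>R \<omega>)) * cnj (part_sum i a X \<omega>))) \<le> sqrt D1 * \<epsilon> powr p * e0"
      (is "cmod ?I \<le> _") if i: "i < M" for i
    proof -
      have "ennreal ((cmod ?I)\<^sup>2) \<le> ennreal (D1 * (h / q) powr (2 * \<sigma> - real DIM('a))) * (energy \<delta> a X * energy \<delta> a X)"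
        using h h\<delta> q X by (intro error i) auto
      also have "\<dots> = ennreal (D1 * \<epsilon> powr (2 * p) * (e0 * e0))"
        using D1 e0 q by (simp add: ennreal_mult h_def p_def algebra_simps)
      finally have "(cmod ?I)\<^sup>2 \<le> D1 * \<epsilon> powr (2 * p) * (e0 * e0)"
        using D1 e0 by (simp add: ennreal_le_iff)
      also have "\<epsilon> powr (2 * p) = (\<epsilon> powr p)\<^sup>2" by (simp add: power2_eq_square powr_add[symmetric])
      also have "D1 * (\<epsilon> powr p)\<^sup>2 * (e0 * e0) = (sqrt D1 * \<epsilon> powr p * e0)\<^sup>2"
        using D1 by (simp add: power_mult_distrib power2_eq_square[of e0])
      finally show ?thesis by (rule power2_le_imp_le) (use D1 e0 in auto)
    qed
    have I2: "cmod (LINT \<omega>|lborel. fourier (combination \<delta> a X) \<omega> * (\<mu> i (h *\<^sub>R \<omega>) * cnj (part_sum i a X \<omega>))) \<le> sqrt Y"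
      (is "cmod ?I \<le> _") if i: "i < M" for i
    proof -
      have "?I = (LINT \<omega>|lborel. U \<omega> * (\<mu> i (h *\<^sub>R \<omega>) * cnj (part_sum i a X \<omega>)))"
      proof (rule cone_pairing_local[OF s_pos[OF i] h(1) X(1)])
        show "AE x in lborel. x \<in> \<Omega> \<longrightarrow> combination \<delta> a X x = u x" using ae by eventually_elim auto
        show "y + (h * real l) *\<^sub>R (e i + s i *\<^sub>R z) \<in> \<Omega>"
          if "y \<in> X" "complex_of_real (\<zeta> i y) * a y \<noteq> 0" "l \<in> {1..k}" "norm z < 1" for y l z
          using that X(2) by (intro part_cone[OF i _ _ h(1) hk]) auto
      qed (use u square_integrable_combination[OF \<delta>(1)] has_fourier_L2_combination[OF \<delta>(1)] in auto)
      then have "ennreal ((cmod ?I)\<^sup>2) \<le> ennreal (D2 * (\<delta> / h) powr (2 * (\<sigma> - \<alpha>))) * (weighted_sq (sobolev_weight \<delta> \<alpha>) U * energy \<delta> a X)"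
        using smooth[OF i, of h \<delta> \<alpha> U a X] h h\<delta> \<delta> \<alpha> U by simp
      also have "\<dots> = ennreal Y" unfolding Y_def b e0 using D2 b e0 by (simp add: ennreal_mult[symmetric])
      finally have "(cmod ?I)\<^sup>2 \<le> Y" using Y by (simp add: ennreal_le_iff)
      then show ?thesis by (rule real_le_rsqrt)
    qed
    have "c * e0 \<le> (\<Sum>i<M. sqrt D1 * \<epsilon> powr p * e0 + sqrt Y)"
      using energy_le_sum[OF \<delta>(1) X(2) e0, of h] by (rule order_trans) (intro sum_mono add_mono I1 I2, auto)
    also have "\<dots> = N * (sqrt D1 * \<epsilon> powr p) * e0 + N * sqrt Y" by (simp add: N_def algebra_simps)
    also have "\<dots> \<le> c / 2 * e0 + N * sqrt Y" by (intro add_right_mono mult_right_mono \<epsilon>3 e0)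
    finally have "c / 2 * e0 \<le> N * sqrt Y" by simp
    then have "(c / 2 * e0)\<^sup>2 \<le> (N * sqrt Y)\<^sup>2" using c_pos e0 by (intro power_mono) auto
    \<comment> \<open>Dividing by one power of the finite energy \<open>e0\<close> is the absorption step.\<close>
    then have sq: "c\<^sup>2 / 4 * (e0 * e0) \<le> N\<^sup>2 * (D2 * (\<delta> / h) powr (2 * (\<sigma> - \<alpha>)) * b) * e0"
      using Y by (simp add: power_mult_distrib power_divide Y_def power2_eq_square mult_ac)
    have e0_le: "e0 \<le> 4 * N\<^sup>2 / c\<^sup>2 * D2 * (\<delta> / h) powr (2 * (\<sigma> - \<alpha>)) * b"
    proof (cases "e0 = 0")
      case True
      then show ?thesis using D2 b by simp
    next
      case False
      then have "0 < e0" using e0 by simp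
      moreover have "(c\<^sup>2 / 4 * e0) * e0 \<le> (N\<^sup>2 * (D2 * (\<delta> / h) powr (2 * (\<sigma> - \<alpha>)) * b)) * e0"
        using sq by (simp only: mult.assoc)
      ultimately have "c\<^sup>2 / 4 * e0 \<le> N\<^sup>2 * (D2 * (\<delta> / h) powr (2 * (\<sigma> - \<alpha>)) * b)" by (rule mult_right_le_imp_le[rotated])
      from mult_left_mono[OF this, of "4 / c\<^sup>2"] c_pos show ?thesis by (simp add: mult_ac)
    qed
    have "(\<delta> / h) powr (2 * (\<sigma> - \<alpha>)) = (1 / \<epsilon>) powr (2 * (\<sigma> - \<alpha>)) * (\<delta> / q) powr (2 * (\<sigma> - \<alpha>))"
      using \<epsilon> q \<delta> by (simp add: h_def powr_mult[symmetric])
    also have "\<dots> \<le> (1 / \<epsilon>) powr (2 * \<sigma>) * (\<delta> / q) powr (2 * (\<sigma> - \<alpha>))"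
      using \<epsilon> \<alpha> by (intro mult_right_mono powr_mono) auto
    finally have "4 * N\<^sup>2 / c\<^sup>2 * D2 * (\<delta> / h) powr (2 * (\<sigma> - \<alpha>)) * b \<le> 4 * N\<^sup>2 / c\<^sup>2 * D2 * ((1 / \<epsilon>) powr (2 * \<sigma>) * (\<delta> / q) powr (2 * (\<sigma> - \<alpha>))) * b"
      using D2 b by (intro mult_right_mono mult_left_mono) auto
    with e0_le have "e0 \<le> K * (\<delta> / q) powr (2 * (\<sigma> - \<alpha>)) * b" by (simp add: K_def mult.assoc)
    then show ?thesis unfolding e0 b using K b by (simp add: ennreal_mult[symmetric] ennreal_leI)
  qed
  show ?thesis
  proof (rule exI[of _ \<epsilon>], rule exI[of _ K], intro conjI allI impI)
    show "0 < \<epsilon>" "\<epsilon> \<le> 1" "\<epsilon> * c\<^sub>0 \<le> 1" "\<epsilon> * c\<^sub>0 * real k < t" "0 \<le> K" by (fact \<epsilon> \<epsilon>1 \<epsilon>2 K)+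
  qed (elim conjE, rule main, assumption+)
qed

section \<open>Extension of an element of the span\<close>

text \<open>
  The extension is \<open>w = \<Sum>i<M. \<zeta> i * (T i u + v - T i v)\<close> with \<open>T i\<close> the convolution with the \<open>i\<close>-th cone
  kernel at the scale \<open>h = \<epsilon> q\<close>. On \<open>\<Omega>\<close> the terms \<open>T i u\<close> and \<open>T i v\<close> cancel by locality. The rough part of
  \<open>u\<close> is smoothed, and \<open>v - T i v\<close> is small at low frequencies, so that its norm of order \<open>\<tau>\<close> is controlled
  by the energy.
\<close>

lemma extension_exists:
  assumes c\<^sub>0: "0 < c\<^sub>0"
  shows "\<exists>K\<ge>0. \<forall>\<delta> q \<alpha> \<tau> a u U. \<forall>X::'a set. 0 < \<delta> \<and> \<delta> \<le> 1 \<and> 0 < q \<and> q \<le> c\<^sub>0 * \<delta> \<and> finite X \<and> X \<subseteq> closure \<Omega> \<and> separated X q \<and>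
       0 \<le> \<alpha> \<and> \<alpha> \<le> \<tau> \<and> \<tau> \<le> \<sigma> \<and> square_integrable u \<and> has_fourier_L2 u U \<and>
       (AE x in lborel. x \<in> \<Omega> \<longrightarrow> u x = combination \<delta> a X x) \<and> weighted_sq (sobolev_weight \<delta> \<alpha>) U < \<infinity> \<longrightarrow>
       (\<exists>w G. square_integrable w \<and> has_fourier_L2 w G \<and> (\<forall>x\<in>\<Omega>. w x = combination \<delta> a X x) \<and>
          weighted_sq (sobolev_weight \<delta> \<tau>) G \<le> ennreal (K * (\<delta> / q) powr (2 * (\<tau> - \<alpha>))) * weighted_sq (sobolev_weight \<delta> \<alpha>) U)"
proof -
  obtain \<epsilon> K where \<epsilon>: "0 < \<epsilon>" "\<epsilon> \<le> 1" "\<epsilon> * c\<^sub>0 \<le> 1" "\<epsilon> * c\<^sub>0 * real k < t" and K: "0 \<le> K"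
    and energy: "\<And>\<delta> q \<alpha> a u U X. 0 < \<delta> \<and> \<delta> \<le> 1 \<and> 0 < q \<and> q \<le> c\<^sub>0 * \<delta> \<and> finite X \<and> X \<subseteq> closure \<Omega> \<and> separated X q \<and>
       0 \<le> \<alpha> \<and> \<alpha> \<le> \<sigma> \<and> square_integrable u \<and> has_fourier_L2 u U \<and>
       (AE x in lborel. x \<in> \<Omega> \<longrightarrow> u x = combination \<delta> a X x) \<and> weighted_sq (sobolev_weight \<delta> \<alpha>) U < \<infinity> \<Longrightarrow>
       energy \<delta> a X \<le> ennreal (K * (\<delta> / q) powr (2 * (\<sigma> - \<alpha>))) * weighted_sq (sobolev_weight \<delta> \<alpha>) U"
    using energy_estimate[OF c\<^sub>0] by (elim exE conjE) (rule that, assumption+, blast)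
  obtain D1 where D1: "0 \<le> D1" and mult: "\<And>i h \<delta> \<omega> r. i < M \<Longrightarrow> 0 < h \<and> h \<le> \<delta> \<Longrightarrow> 0 \<le> r \<and> r \<le> \<sigma> \<Longrightarrow>
       (cmod (\<mu> i (h *\<^sub>R \<omega>)))\<^sup>2 * sobolev_weight \<delta> r \<omega> \<le> D1 * (\<delta> / h) powr (2 * r) \<and>
       (cmod (1 - \<mu> i (h *\<^sub>R \<omega>)))\<^sup>2 * sobolev_weight \<delta> (- r) \<omega> \<le> D1 * (h / \<delta>) powr (2 * r)"
    using multiplier_bounds by meson
  obtain D2 where D2: "0 \<le> D2" and Young: "\<And>i \<delta> r g. i < M \<Longrightarrow> 0 \<le> \<delta> \<and> \<delta> \<le> 1 \<and> \<bar>r\<bar> \<le> \<sigma> \<and> g \<in> borel_measurable borel \<Longrightarrow>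
     weighted_sq (sobolev_weight \<delta> r) (convolve (\<zeta>hat i) g) \<le> ennreal D2 * weighted_sq (sobolev_weight \<delta> r) g"
    using spectrum_Young by blast
  define R1 where "R1 = D1 * (1 / \<epsilon>) powr (2 * \<sigma>)"
  define R2 where "R2 = C\<^sup>2 * D1 * K"
  have R: "0 \<le> R1" "0 \<le> R2" using D1 K by (auto simp: R1_def R2_def)
  define K' where "K' = real M * (real M * (D2 * (2 * R1 + 2 * R2)))"
  have K': "0 \<le> K'" using R D2 by (simp add: K'_def)
  have main: "\<exists>w G. square_integrable w \<and> has_fourier_L2 w G \<and> (\<forall>x\<in>\<Omega>. w x = combination \<delta> a X x) \<and>
          weighted_sq (sobolev_weight \<delta> \<tau>) G \<le> ennreal (K' * (\<delta> / q) powr (2 * (\<tau> - \<alpha>))) * weighted_sq (sobolev_weight \<delta> \<alpha>) U"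
    if \<delta>: "0 < \<delta>" "\<delta> \<le> 1" and q: "0 < q" "q \<le> c\<^sub>0 * \<delta>" and X: "finite X" "X \<subseteq> closure \<Omega>" "separated X q"
      and \<alpha>: "0 \<le> \<alpha>" "\<alpha> \<le> \<tau>" "\<tau> \<le> \<sigma>" and u: "square_integrable u" "has_fourier_L2 u U"
      and ae: "AE x in lborel. x \<in> \<Omega> \<longrightarrow> u x = combination \<delta> a X x" and fin: "weighted_sq (sobolev_weight \<delta> \<alpha>) U < \<infinity>"
    for \<delta> q \<alpha> \<tau> a u U and X :: "'a set"
  proof -
    define h where "h = \<epsilon> * q"
    have h: "0 < h" "h \<le> q" using \<epsilon> q by (auto simp: h_def mult_left_le_one_le)
    have le: "h \<le> (\<epsilon> * c\<^sub>0) * \<delta>" using mult_left_mono[OF q(2), of \<epsilon>] \<epsilon> by (simp add: h_def)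
    also have "(\<epsilon> * c\<^sub>0) * \<delta> \<le> 1 * \<delta>" using \<epsilon> \<delta> by (intro mult_right_mono) auto
    finally have h\<delta>: "h \<le> \<delta>" by simp
    have "(\<epsilon> * c\<^sub>0) * \<delta> \<le> (\<epsilon> * c\<^sub>0) * 1" using \<delta> \<epsilon> c\<^sub>0 by (intro mult_left_mono) auto
    with le have "h \<le> \<epsilon> * c\<^sub>0" by simp
    then have "h * real k \<le> \<epsilon> * c\<^sub>0 * real k" by (intro mult_right_mono) auto
    then have hk: "h * real k < t" using \<epsilon>(4) by linarith
    define v where "v = combination \<delta> a X"
    define V where "V = fourier v"
    have v: "square_integrable v" "has_fourier_L2 v V"
      unfolding v_def V_def using \<delta>(1) by (intro square_integrable_combination has_fourier_L2_combination; simp)+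
    have [measurable]: "U \<in> borel_measurable borel" "V \<in> borel_measurable borel" "u \<in> borel_measurable borel" "v \<in> borel_measurable borel"
      using u v by (auto simp: has_fourier_L2_def)
    define Z where "Z i y = complex_of_real (cone_kernel k (s i) (e i) h y)" for i y
    \<comment> \<open>The \<open>i\<close>-th summand of the extension before the cut-off, and its transform.\<close>
    define f where "f i x = convolve (Z i) u x + (v x - convolve (Z i) v x)" for i x
    define g where "g i \<omega> = \<mu> i (h *\<^sub>R \<omega>) * U \<omega> + (V \<omega> - \<mu> i (h *\<^sub>R \<omega>) * V \<omega>)" for i \<omega>
    have [measurable]: "g i \<in> borel_measurable borel" for i unfolding g_def[abs_def] by measurable
    have fg: "square_integrable (f i)" "has_fourier_L2 (f i) (g i)" if i: "i < M" for i
    proof -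
      have t: "test_function (Z i)" unfolding Z_def[abs_def] by (rule test_function_cone_kernel[OF s_pos[OF i] h(1)])
      have Z: "Bochner_Integration.integrable lborel (Z i)" "square_integrable (Z i)"
        using t test_function_square_integrable[OF t] by (auto simp: test_function_def)
      have hat: "fourier (Z i) \<omega> / of_real (fourier_factor TYPE('a)) = \<mu> i (h *\<^sub>R \<omega>)" for \<omega>
        unfolding Z_def fourier_cone_kernel[OF s_pos[OF i] h(1)] by simp
      have conv: "square_integrable (convolve (Z i) u)" "square_integrable (convolve (Z i) v)"
        "has_fourier_L2 (convolve (Z i) u) (\<lambda>\<omega>. \<mu> i (h *\<^sub>R \<omega>) * U \<omega>)" "has_fourier_L2 (convolve (Z i) v) (\<lambda>\<omega>. \<mu> i (h *\<^sub>R \<omega>) * V \<omega>)"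
        using square_integrable_convolve[OF Z(1)] has_fourier_L2_convolve[OF Z] u v by (simp_all add: hat)
      show "square_integrable (f i)" unfolding f_def[abs_def] by (intro square_integrable_add square_integrable_diff conv v)
      show "has_fourier_L2 (f i) (g i)" unfolding f_def[abs_def] g_def[abs_def]
        by (intro has_fourier_L2_add has_fourier_L2_diff square_integrable_diff conv v)
    qed
    define w where "w x = (\<Sum>i<M. inverse_transform (\<zeta>hat i) x * f i x)" for x
    define G where "G \<omega> = (\<Sum>i<M. convolve (\<zeta>hat i) (g i) \<omega>)" for \<omega>
    have \<zeta>hat: "Bochner_Integration.integrable lborel (\<zeta>hat i)" "square_integrable (\<zeta>hat i)" "\<zeta>hat i \<in> borel_measurable borel" if "i < M" for i
      using that A_borel A_bounded t_pos
      by (auto intro: integrable_smooth_indicator_spectrum square_integrable_smooth_indicator_spectrum borel_measurable_smooth_indicator_spectrum)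
    have summand: "square_integrable (\<lambda>x. inverse_transform (\<zeta>hat i) x * f i x)" "has_fourier_L2 (\<lambda>x. inverse_transform (\<zeta>hat i) x * f i x) (convolve (\<zeta>hat i) (g i))"
      if i: "i < M" for i
    proof -
      show "square_integrable (\<lambda>x. inverse_transform (\<zeta>hat i) x * f i x)"
        by (rule square_integrable_mult_bounded[OF fg(1)[OF i] borel_measurable_inverse_transform[OF \<zeta>hat(3)[OF i]] cmod_inverse_transform_le])
      show "has_fourier_L2 (\<lambda>x. inverse_transform (\<zeta>hat i) x * f i x) (convolve (\<zeta>hat i) (g i))"
        by (intro has_fourier_L2_inverse_transform_mult \<zeta>hat fg i)
    qed
    have w: "square_integrable w" "has_fourier_L2 w G"
      unfolding w_def[abs_def] G_def[abs_def] by (intro square_integrable_sum has_fourier_L2_sum summand; simp)+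
    have agree: "w x = combination \<delta> a X x" if x: "x \<in> \<Omega>" for x
    proof -
      have xc: "x \<in> closure \<Omega>" using x closure_subset by auto
      have "inverse_transform (\<zeta>hat i) x * f i x = of_real (\<zeta> i x) * v x" if i: "i < M" for i
      proof (cases "\<zeta> i x = 0")
        case True
        then show ?thesis by (simp add: inverse_transform_smooth_indicator_spectrum[OF t_pos A_borel[OF i] A_bounded[OF i]])
      next
        case False
        have "convolve (Z i) u x = convolve (Z i) v x"
          unfolding Z_def[abs_def]
        proof (rule convolve_cone_kernel_local[OF s_pos[OF i] h(1)])
          show "AE x in lborel. x \<in> \<Omega> \<longrightarrow> u x = v x" using ae by (simp add: v_def)
        qed (auto intro: part_cone[OF i xc False h(1) hk])
        then show ?thesis
          by (simp add: f_def inverse_transform_smooth_indicator_spectrum[OF t_pos A_borel[OF i] A_bounded[OF i]])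
      qed
      then have "w x = (\<Sum>i<M. of_real (\<zeta> i x) * v x)" unfolding w_def by (intro sum.cong refl) auto
      also have "\<dots> = of_real (\<Sum>i<M. \<zeta> i x) * v x" by (simp add: sum_distrib_right)
      also have "(\<Sum>i<M. \<zeta> i x) = 1" by (rule sum_smooth_indicator[OF t_pos A_borel A_disjoint A_cover[OF xc]])
      finally show ?thesis by (simp add: v_def)
    qed
    let ?r = "(\<delta> / q) powr (2 * (\<tau> - \<alpha>))"
    let ?B = "weighted_sq (sobolev_weight \<delta> \<alpha>) U"
    have g_bound: "weighted_sq (sobolev_weight \<delta> \<tau>) (g i) \<le> ennreal ((2 * R1 + 2 * R2) * ?r) * ?B" if i: "i < M" for i
    proof -
      have 1: "weighted_sq (sobolev_weight \<delta> \<tau>) (\<lambda>\<omega>. \<mu> i (h *\<^sub>R \<omega>) * U \<omega>) \<le> ennreal (R1 * ?r) * ?B"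
      proof (rule weighted_sq_le_cmult)
        fix \<omega> :: 'a
        have "(cmod (\<mu> i (h *\<^sub>R \<omega>)))\<^sup>2 * sobolev_weight \<delta> (\<tau> - \<alpha>) \<omega> \<le> D1 * (\<delta> / h) powr (2 * (\<tau> - \<alpha>))"
          using mult[OF i, of h \<delta> "\<tau> - \<alpha>" \<omega>] h h\<delta> \<alpha> by simp
        also have "(\<delta> / h) powr (2 * (\<tau> - \<alpha>)) = (1 / \<epsilon>) powr (2 * (\<tau> - \<alpha>)) * ?r"
          using \<epsilon> q \<delta> by (simp add: h_def powr_mult[symmetric])
        also have "D1 * ((1 / \<epsilon>) powr (2 * (\<tau> - \<alpha>)) * ?r) \<le> D1 * ((1 / \<epsilon>) powr (2 * \<sigma>) * ?r)"
          using \<epsilon> \<alpha> D1 by (intro mult_left_mono mult_right_mono powr_mono) auto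
        finally have "(cmod (\<mu> i (h *\<^sub>R \<omega>)))\<^sup>2 * sobolev_weight \<delta> (\<tau> - \<alpha>) \<omega> \<le> R1 * ?r" by (simp add: R1_def mult.assoc)
        from mult_right_mono[OF this, of "sobolev_weight \<delta> \<alpha> \<omega> * (cmod (U \<omega>))\<^sup>2"]
        have "(cmod (\<mu> i (h *\<^sub>R \<omega>)))\<^sup>2 * (sobolev_weight \<delta> (\<tau> - \<alpha>) \<omega> * sobolev_weight \<delta> \<alpha> \<omega>) * (cmod (U \<omega>))\<^sup>2 \<le> R1 * ?r * (sobolev_weight \<delta> \<alpha> \<omega> * (cmod (U \<omega>))\<^sup>2)"
          by (simp add: mult.assoc)
        then show "sobolev_weight \<delta> \<tau> \<omega> * (cmod (\<mu> i (h *\<^sub>R \<omega>) * U \<omega>))\<^sup>2 \<le> R1 * ?r * (sobolev_weight \<delta> \<alpha> \<omega> * (cmod (U \<omega>))\<^sup>2)"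
          unfolding sobolev_weight_add[symmetric] by (simp add: norm_mult power_mult_distrib mult_ac)
      qed (use R in auto)
      have "weighted_sq (sobolev_weight \<delta> \<tau>) (\<lambda>\<omega>. (1 - \<mu> i (h *\<^sub>R \<omega>)) * V \<omega>) \<le> ennreal (C\<^sup>2 * D1 * (q / \<delta>) powr (2 * (\<sigma> - \<tau>))) * energy \<delta> a X"
        unfolding energy_def
      proof (rule weighted_sq_le_cmult)
        fix \<omega> :: 'a
        let ?m = "(cmod (1 - \<mu> i (h *\<^sub>R \<omega>)))\<^sup>2"
        have "?m * sobolev_weight \<delta> (- (\<sigma> - \<tau>)) \<omega> \<le> D1 * (h / \<delta>) powr (2 * (\<sigma> - \<tau>))"
          using mult[OF i, of h \<delta> "\<sigma> - \<tau>" \<omega>] h h\<delta> \<alpha> by simp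
        also have "\<dots> \<le> D1 * (q / \<delta>) powr (2 * (\<sigma> - \<tau>))"
          using h \<delta> \<alpha> D1 by (intro mult_left_mono powr_mono2 divide_right_mono) auto
        finally have m: "?m * sobolev_weight \<delta> (- (\<sigma> - \<tau>)) \<omega> \<le> D1 * (q / \<delta>) powr (2 * (\<sigma> - \<tau>))" .
        have "sobolev_weight \<delta> \<tau> \<omega> * (?m * (cmod (V \<omega>))\<^sup>2) \<le> sobolev_weight \<delta> \<tau> \<omega> * (?m * (C\<^sup>2 * (sobolev_weight \<delta> (- (2 * \<sigma>)) \<omega> * (cmod (exp_sum a X \<omega>))\<^sup>2)))"
          unfolding V_def v_def by (intro mult_left_mono combination_weight_le \<delta>) auto
        also have "\<dots> = C\<^sup>2 * (?m * (sobolev_weight \<delta> \<tau> \<omega> * sobolev_weight \<delta> (- (2 * \<sigma>)) \<omega>) * (cmod (exp_sum a X \<omega>))\<^sup>2)"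
          by (simp only: mult_ac)
        also have "sobolev_weight \<delta> \<tau> \<omega> * sobolev_weight \<delta> (- (2 * \<sigma>)) \<omega> = sobolev_weight \<delta> (- (\<sigma> - \<tau>)) \<omega> * sobolev_weight \<delta> (- \<sigma>) \<omega>"
          unfolding sobolev_weight_add[symmetric] by simp
        also have "C\<^sup>2 * (?m * (sobolev_weight \<delta> (- (\<sigma> - \<tau>)) \<omega> * sobolev_weight \<delta> (- \<sigma>) \<omega>) * (cmod (exp_sum a X \<omega>))\<^sup>2)
           = C\<^sup>2 * ((?m * sobolev_weight \<delta> (- (\<sigma> - \<tau>)) \<omega>) * (sobolev_weight \<delta> (- \<sigma>) \<omega> * (cmod (exp_sum a X \<omega>))\<^sup>2))"
          by (simp only: mult_ac)
        also have "\<dots> \<le> C\<^sup>2 * ((D1 * (q / \<delta>) powr (2 * (\<sigma> - \<tau>))) * (sobolev_weight \<delta> (- \<sigma>) \<omega> * (cmod (exp_sum a X \<omega>))\<^sup>2))"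
          by (intro mult_left_mono mult_right_mono m) auto
        finally show "sobolev_weight \<delta> \<tau> \<omega> * (cmod ((1 - \<mu> i (h *\<^sub>R \<omega>)) * V \<omega>))\<^sup>2 \<le> C\<^sup>2 * D1 * (q / \<delta>) powr (2 * (\<sigma> - \<tau>)) * (sobolev_weight \<delta> (- \<sigma>) \<omega> * (cmod (exp_sum a X \<omega>))\<^sup>2)"
          unfolding norm_mult power_mult_distrib by (simp only: mult.assoc)
      qed (use D1 in auto)
      also have "\<dots> \<le> ennreal (C\<^sup>2 * D1 * (q / \<delta>) powr (2 * (\<sigma> - \<tau>))) * (ennreal (K * (\<delta> / q) powr (2 * (\<sigma> - \<alpha>))) * ?B)"
        by (rule mult_left_mono[OF energy[of \<delta> q X \<alpha> u U a]]) (use \<delta> q X u ae fin \<alpha> in auto)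
      also have "\<dots> = ennreal (C\<^sup>2 * D1 * (q / \<delta>) powr (2 * (\<sigma> - \<tau>)) * (K * (\<delta> / q) powr (2 * (\<sigma> - \<alpha>)))) * ?B"
        using D1 K by (subst ennreal_mult) (auto simp: mult.assoc)
      also have "C\<^sup>2 * D1 * (q / \<delta>) powr (2 * (\<sigma> - \<tau>)) * (K * (\<delta> / q) powr (2 * (\<sigma> - \<alpha>))) = R2 * ?r"
      proof -
        have "(q / \<delta>) powr x = (\<delta> / q) powr (- x)" for x
          using q \<delta> by (simp add: powr_minus powr_divide)
        from this[of "2 * (\<sigma> - \<tau>)"] have "(q / \<delta>) powr (2 * (\<sigma> - \<tau>)) * (\<delta> / q) powr (2 * (\<sigma> - \<alpha>)) = ?r"
          by (simp add: powr_add[symmetric] algebra_simps)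
        then show ?thesis unfolding R2_def by (metis (no_types, lifting) mult.assoc mult.left_commute)
      qed
      finally have 2: "weighted_sq (sobolev_weight \<delta> \<tau>) (\<lambda>\<omega>. (1 - \<mu> i (h *\<^sub>R \<omega>)) * V \<omega>) \<le> ennreal (R2 * ?r) * ?B" .
      have "g i = (\<lambda>\<omega>. \<mu> i (h *\<^sub>R \<omega>) * U \<omega> + (1 - \<mu> i (h *\<^sub>R \<omega>)) * V \<omega>)" by (simp add: g_def fun_eq_iff algebra_simps)
      then have "weighted_sq (sobolev_weight \<delta> \<tau>) (g i) \<le> 2 * weighted_sq (sobolev_weight \<delta> \<tau>) (\<lambda>\<omega>. \<mu> i (h *\<^sub>R \<omega>) * U \<omega>) + 2 * weighted_sq (sobolev_weight \<delta> \<tau>) (\<lambda>\<omega>. (1 - \<mu> i (h *\<^sub>R \<omega>)) * V \<omega>)"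
        by (simp only:) (rule weighted_sq_add, auto)
      also have "\<dots> \<le> 2 * (ennreal (R1 * ?r) * ?B) + 2 * (ennreal (R2 * ?r) * ?B)"
        by (intro add_mono mult_left_mono 1 2) auto
      also have "\<dots> = (ennreal 2 * ennreal (R1 * ?r) + ennreal 2 * ennreal (R2 * ?r)) * ?B"
        by (simp add: distrib_right mult.assoc)
      also have "ennreal 2 * ennreal (R1 * ?r) + ennreal 2 * ennreal (R2 * ?r) = ennreal ((2 * R1 + 2 * R2) * ?r)"
      proof -
        have "(2 * R1 + 2 * R2) * ?r = 2 * (R1 * ?r) + 2 * (R2 * ?r)" by (simp add: distrib_right)
        then show ?thesis using R by (simp add: ennreal_mult)
      qed
      finally show ?thesis .
    qed
    have "weighted_sq (sobolev_weight \<delta> \<tau>) G \<le> of_nat (card {..<M}) * (\<Sum>i<M. weighted_sq (sobolev_weight \<delta> \<tau>) (convolve (\<zeta>hat i) (g i)))"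
      unfolding G_def[abs_def]
    proof (rule weighted_sq_sum_le)
      fix i assume "i \<in> {..<M}"
      then show "convolve (\<zeta>hat i) (g i) \<in> borel_measurable borel" by (intro borel_measurable_convolve \<zeta>hat) auto
    qed auto
    also have "\<dots> \<le> of_nat (card {..<M}) * (\<Sum>i<M. ennreal D2 * (ennreal ((2 * R1 + 2 * R2) * ?r) * ?B))"
    proof (intro mult_left_mono sum_mono)
      fix i assume "i \<in> {..<M}"
      then have i: "i < M" by simp
      have "weighted_sq (sobolev_weight \<delta> \<tau>) (convolve (\<zeta>hat i) (g i)) \<le> ennreal D2 * weighted_sq (sobolev_weight \<delta> \<tau>) (g i)"
        using Young[OF i, of \<delta> \<tau> "g i"] \<delta> \<alpha> by simp
      also have "\<dots> \<le> ennreal D2 * (ennreal ((2 * R1 + 2 * R2) * ?r) * ?B)" by (intro mult_left_mono g_bound i) simp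
      finally show "weighted_sq (sobolev_weight \<delta> \<tau>) (convolve (\<zeta>hat i) (g i)) \<le> ennreal D2 * (ennreal ((2 * R1 + 2 * R2) * ?r) * ?B)" .
    qed simp
    also have "\<dots> = (ennreal (real M) * (ennreal (real M) * (ennreal D2 * ennreal ((2 * R1 + 2 * R2) * ?r)))) * ?B"
      by (simp add: ennreal_of_nat_eq_real_of_nat mult.assoc)
    also have "ennreal (real M) * (ennreal (real M) * (ennreal D2 * ennreal ((2 * R1 + 2 * R2) * ?r))) = ennreal (K' * ?r)"
      using D2 R unfolding K'_def by (subst ennreal_mult[symmetric], simp, simp)+ (simp add: mult_ac)
    finally have "weighted_sq (sobolev_weight \<delta> \<tau>) G \<le> ennreal (K' * ?r) * ?B" .
    with w agree show ?thesis by blast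
  qed
  show ?thesis
  proof (intro exI[of _ K'] conjI allI impI)
    show "0 \<le> K'" by (rule K')
  qed (elim conjE, rule main, assumption+)
qed

end

section \<open>The inverse inequality\<close>

lemma separation_distance_props:
  fixes X :: "'a::euclidean_space set"
  assumes X: "finite X" "2 \<le> card X"
  shows separation_distance_pos: "0 < separation_distance X"
    and separated_separation_distance: "separated X (separation_distance X)"
proof -
  let ?D = "{norm (x - y) | x y. x \<in> X \<and> y \<in> X \<and> x \<noteq> y}"
  have "?D \<subseteq> (\<lambda>(x, y). norm (x - y)) ` (X \<times> X)" by auto
  then have fin: "finite ?D" by (rule finite_subset) (use X in auto)
  obtain x y where "x \<in> X" "y \<in> X" "x \<noteq> y"
    using X card_le_Suc0_iff_eq[OF X(1)] by auto
  then have "?D \<noteq> {}" by auto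
  then have "Min ?D \<in> ?D" using fin by (rule Min_in[rotated])
  then show "0 < separation_distance X" by (auto simp: separation_distance_def)
  show "separated X (separation_distance X)"
    unfolding separated_def
  proof (intro ballI impI)
    fix x y assume "x \<in> X" "y \<in> X" "x \<noteq> y"
    then have "Min ?D \<le> norm (x - y)" by (intro Min_le fin) auto
    then show "2 * separation_distance X \<le> norm (x - y)" by (simp add: separation_distance_def)
  qed
qed

context bernstein_setting
begin

text \<open>
  The combination is its own extension, so the infimum that defines the norm over \<open>\<Omega>\<close> is taken over a
  nonempty set.
\<close>

lemma combination_in_scaled_sobolev_space:
  assumes \<delta>: "0 < \<delta>" and \<alpha>: "\<alpha> \<le> \<sigma>"
  shows "combination \<delta> a X \<in> scaled_sobolev_space \<delta> \<alpha>"
proof -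
  have "weighted_sq (sobolev_weight \<delta> \<alpha>) (fourier (combination \<delta> a X)) \<le> ennreal (C\<^sup>2) * energy \<delta> a X"
    unfolding energy_def
  proof (rule weighted_sq_le_cmult)
    fix \<omega> :: 'a
    have "sobolev_weight \<delta> \<alpha> \<omega> * (cmod (fourier (combination \<delta> a X) \<omega>))\<^sup>2
       \<le> sobolev_weight \<delta> \<sigma> \<omega> * (C\<^sup>2 * (sobolev_weight \<delta> (- (2 * \<sigma>)) \<omega> * (cmod (exp_sum a X \<omega>))\<^sup>2))"
      by (intro mult_mono sobolev_weight_mono \<alpha> combination_weight_le \<delta>) auto
    also have "\<dots> = C\<^sup>2 * ((sobolev_weight \<delta> \<sigma> \<omega> * sobolev_weight \<delta> (- (2 * \<sigma>)) \<omega>) * (cmod (exp_sum a X \<omega>))\<^sup>2)"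
      by (simp only: mult_ac)
    also have "sobolev_weight \<delta> \<sigma> \<omega> * sobolev_weight \<delta> (- (2 * \<sigma>)) \<omega> = sobolev_weight \<delta> (- \<sigma>) \<omega>"
      unfolding sobolev_weight_add[symmetric] by simp
    finally show "sobolev_weight \<delta> \<alpha> \<omega> * (cmod (fourier (combination \<delta> a X) \<omega>))\<^sup>2
       \<le> C\<^sup>2 * (sobolev_weight \<delta> (- \<sigma>) \<omega> * (cmod (exp_sum a X \<omega>))\<^sup>2)" .
  qed auto
  also have "\<dots> < \<infinity>" using energy_finite[OF \<delta>, of a X] by (auto simp: ennreal_mult_less_top)
  finally show ?thesis
    using scaled_sobolev_space_iff[OF square_integrable_combination[OF \<delta>] has_fourier_L2_combination[OF \<delta>]] by simp
qed

text \<open>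
  Every extension \<open>u\<close> of order \<open>\<alpha>\<close> yields one of order \<open>\<tau>\<close>. Adding one to the square root of \<open>K\<close>
  keeps the constant positive.
\<close>

lemma inverse_inequality:
  assumes c\<^sub>0: "0 < c\<^sub>0" and \<alpha>: "0 \<le> \<alpha>" "\<alpha> \<le> \<tau>" "\<tau> \<le> \<sigma>"
  shows "\<exists>B>0. \<forall>\<delta> X v. 0 < \<delta> \<and> \<delta> \<le> 1 \<and> finite X \<and> 2 \<le> card X \<and> X \<subseteq> closure \<Omega> \<and>
           separation_distance X \<le> c\<^sub>0 * \<delta> \<and> v \<in> translate_span (scaled_kernel \<Phi> \<delta>) X \<longrightarrow>
             scaled_sobolev_norm_on \<Omega> \<delta> \<tau> v
               \<le> B * (\<delta> / separation_distance X) powr (\<tau> - \<alpha>) * scaled_sobolev_norm_on \<Omega> \<delta> \<alpha> v"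
proof -
  obtain K where K: "0 \<le> K" and extension: "\<And>\<delta> q \<alpha> \<tau> a u U. \<And>X::'a set. 0 < \<delta> \<and> \<delta> \<le> 1 \<and> 0 < q \<and> q \<le> c\<^sub>0 * \<delta> \<and> finite X \<and> X \<subseteq> closure \<Omega> \<and> separated X q \<and>
       0 \<le> \<alpha> \<and> \<alpha> \<le> \<tau> \<and> \<tau> \<le> \<sigma> \<and> square_integrable u \<and> has_fourier_L2 u U \<and>
       (AE x in lborel. x \<in> \<Omega> \<longrightarrow> u x = combination \<delta> a X x) \<and> weighted_sq (sobolev_weight \<delta> \<alpha>) U < \<infinity> \<Longrightarrow>
       (\<exists>w G. square_integrable w \<and> has_fourier_L2 w G \<and> (\<forall>x\<in>\<Omega>. w x = combination \<delta> a X x) \<and>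
          weighted_sq (sobolev_weight \<delta> \<tau>) G \<le> ennreal (K * (\<delta> / q) powr (2 * (\<tau> - \<alpha>))) * weighted_sq (sobolev_weight \<delta> \<alpha>) U)"
    using extension_exists[OF c\<^sub>0] by (elim exE conjE) (rule that, assumption, blast)
  have main: "scaled_sobolev_norm_on \<Omega> \<delta> \<tau> v
      \<le> (sqrt K + 1) * (\<delta> / separation_distance X) powr (\<tau> - \<alpha>) * scaled_sobolev_norm_on \<Omega> \<delta> \<alpha> v"
    if \<delta>: "0 < \<delta>" "\<delta> \<le> 1" and X: "finite X" "2 \<le> card X" "X \<subseteq> closure \<Omega>" "separation_distance X \<le> c\<^sub>0 * \<delta>"
      and v_span: "v \<in> translate_span (scaled_kernel \<Phi> \<delta>) X" for \<delta> X v
  proof -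
    define q where "q = separation_distance X"
    have q: "0 < q" "q \<le> c\<^sub>0 * \<delta>" "separated X q"
      using separation_distance_props[OF X(1,2)] X(4) by (auto simp: q_def)
    obtain a where v: "v = combination \<delta> a X"
      using v_span by (auto simp: translate_span_def combination_def[abs_def])
    let ?r = "(\<delta> / q) powr (\<tau> - \<alpha>)"
    have r: "0 < ?r" using \<delta> q by simp
    let ?S = "\<lambda>s. {scaled_sobolev_norm \<delta> s w | w. w \<in> scaled_sobolev_space \<delta> s \<and> (AE x in lborel. x \<in> \<Omega> \<longrightarrow> w x = v x)}"
    have S: "scaled_sobolev_norm_on \<Omega> \<delta> s v = Inf (?S s)" for s by (simp add: scaled_sobolev_norm_on_def)
    have bdd: "bdd_below (?S s)" for s
      by (rule bdd_belowI[of _ 0]) (auto simp: scaled_sobolev_norm_nonneg)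
    have each: "scaled_sobolev_norm_on \<Omega> \<delta> \<tau> v \<le> (sqrt K + 1) * ?r * scaled_sobolev_norm \<delta> \<alpha> u"
      if u: "u \<in> scaled_sobolev_space \<delta> \<alpha>" and ae: "AE x in lborel. x \<in> \<Omega> \<longrightarrow> u x = v x" for u
    proof -
      have su: "square_integrable u" using u by (simp add: scaled_sobolev_space_def)
      define U where "U = fourier_L2 u"
      have U: "has_fourier_L2 u U" unfolding U_def by (rule has_fourier_L2_fourier_L2[OF su])
      have fin: "weighted_sq (sobolev_weight \<delta> \<alpha>) U < \<infinity>" using u scaled_sobolev_space_iff[OF su U] by simp
      obtain w G where w: "square_integrable w" "has_fourier_L2 w G" and agree: "\<And>x. x \<in> \<Omega> \<Longrightarrow> w x = v x"
        and bound: "weighted_sq (sobolev_weight \<delta> \<tau>) G \<le> ennreal (K * (\<delta> / q) powr (2 * (\<tau> - \<alpha>))) * weighted_sq (sobolev_weight \<delta> \<alpha>) U"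
        using extension[of \<delta> q X \<alpha> \<tau> u U a] \<delta> q X \<alpha> su U ae fin unfolding v by auto
      have "\<dots> < \<infinity>" using fin by (simp add: ennreal_mult_less_top)
      with bound have "weighted_sq (sobolev_weight \<delta> \<tau>) G < \<infinity>" by (rule le_less_trans)
      then have ws: "w \<in> scaled_sobolev_space \<delta> \<tau>" using scaled_sobolev_space_iff[OF w] by simp
      have "ennreal ((scaled_sobolev_norm \<delta> \<tau> w)\<^sup>2) = ennreal (fourier_factor TYPE('a)) * weighted_sq (sobolev_weight \<delta> \<tau>) G"
        by (rule scaled_sobolev_norm_sq[OF w ws])
      also have "\<dots> \<le> ennreal (fourier_factor TYPE('a)) * (ennreal (K * (\<delta> / q) powr (2 * (\<tau> - \<alpha>))) * weighted_sq (sobolev_weight \<delta> \<alpha>) U)"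
        by (rule mult_left_mono[OF bound]) simp
      also have "\<dots> = ennreal (K * (\<delta> / q) powr (2 * (\<tau> - \<alpha>))) * ennreal ((scaled_sobolev_norm \<delta> \<alpha> u)\<^sup>2)"
        unfolding scaled_sobolev_norm_sq[OF su U u] by (simp only: mult.left_commute)
      also have "\<dots> = ennreal (K * (\<delta> / q) powr (2 * (\<tau> - \<alpha>)) * (scaled_sobolev_norm \<delta> \<alpha> u)\<^sup>2)"
        using K by (simp add: ennreal_mult)
      finally have "(scaled_sobolev_norm \<delta> \<tau> w)\<^sup>2 \<le> K * (\<delta> / q) powr (2 * (\<tau> - \<alpha>)) * (scaled_sobolev_norm \<delta> \<alpha> u)\<^sup>2"
        using K by (subst (asm) ennreal_le_iff) auto
      also have "(\<delta> / q) powr (2 * (\<tau> - \<alpha>)) = ?r\<^sup>2" by (simp add: power2_eq_square powr_add[symmetric])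
      also have "K * ?r\<^sup>2 * (scaled_sobolev_norm \<delta> \<alpha> u)\<^sup>2 = (sqrt K * ?r * scaled_sobolev_norm \<delta> \<alpha> u)\<^sup>2"
        using K by (simp add: power_mult_distrib)
      finally have "scaled_sobolev_norm \<delta> \<tau> w \<le> sqrt K * ?r * scaled_sobolev_norm \<delta> \<alpha> u"
        by (rule power2_le_imp_le) (use K in \<open>auto simp: scaled_sobolev_norm_nonneg\<close>)
      also have "\<dots> \<le> (sqrt K + 1) * ?r * scaled_sobolev_norm \<delta> \<alpha> u"
        by (intro mult_right_mono scaled_sobolev_norm_nonneg) auto
      finally have le: "scaled_sobolev_norm \<delta> \<tau> w \<le> (sqrt K + 1) * ?r * scaled_sobolev_norm \<delta> \<alpha> u" .
      have "scaled_sobolev_norm \<delta> \<tau> w \<in> ?S \<tau>" using ws agree by auto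
      then have "scaled_sobolev_norm_on \<Omega> \<delta> \<tau> v \<le> scaled_sobolev_norm \<delta> \<tau> w" unfolding S by (rule cInf_lower[OF _ bdd])
      then show ?thesis using le by (rule order_trans)
    qed
    have pos: "0 < (sqrt K + 1) * ?r" using K r by (intro mult_pos_pos) (auto simp: add_nonneg_pos)
    have "scaled_sobolev_norm \<delta> \<alpha> v \<in> ?S \<alpha>"
      using combination_in_scaled_sobolev_space[OF \<delta>(1), of \<alpha> a X] \<alpha> unfolding v by auto
    then have "?S \<alpha> \<noteq> {}" by blast
    then have "scaled_sobolev_norm_on \<Omega> \<delta> \<tau> v / ((sqrt K + 1) * ?r) \<le> scaled_sobolev_norm_on \<Omega> \<delta> \<alpha> v"
      unfolding S[of \<alpha>]
    proof (rule cInf_greatest)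
      fix y assume "y \<in> ?S \<alpha>"
      then obtain u where "y = scaled_sobolev_norm \<delta> \<alpha> u" "u \<in> scaled_sobolev_space \<delta> \<alpha>" "AE x in lborel. x \<in> \<Omega> \<longrightarrow> u x = v x" by blast
      then show "scaled_sobolev_norm_on \<Omega> \<delta> \<tau> v / ((sqrt K + 1) * ?r) \<le> y"
        using each[of u] by (simp add: pos_divide_le_eq[OF pos] mult.commute)
    qed
    then show ?thesis unfolding q_def[symmetric] by (simp add: pos_divide_le_eq[OF pos] mult.commute)
  qed
  show ?thesis
  proof (intro exI[of _ "sqrt K + 1"] conjI allI impI)
    show "0 < sqrt K + 1" using K by (simp add: add_nonneg_pos)
  qed (elim conjE, rule main, assumption+)
qed

end

theorem theorem2p4:
  fixes \<Omega> :: "'a::euclidean_space set"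
    and \<Phi> :: "'a \<Rightarrow> real"
    and \<sigma> \<alpha> \<tau> c\<^sub>0 c\<^sub>\<Phi> C\<^sub>\<Phi> :: real
  assumes "bounded_lipschitz_domain \<Omega>"
    and "continuous_on UNIV \<Phi>"
    and "integrable lborel \<Phi>"
    and "strictly_positive_definite \<Phi>"
    and "real DIM('a) / 2 < \<sigma>"
    and "0 < c\<^sub>\<Phi>" and "c\<^sub>\<Phi> \<le> C\<^sub>\<Phi>"
    and "\<And>\<omega>. fourier (\<lambda>x. of_real (\<Phi> x)) \<omega> \<in> \<real>"
    and "\<And>\<omega>. c\<^sub>\<Phi> * (1 + (norm \<omega>)\<^sup>2) powr (- \<sigma>) \<le> Re (fourier (\<lambda>x. of_real (\<Phi> x)) \<omega>)"
    and "\<And>\<omega>. Re (fourier (\<lambda>x. of_real (\<Phi> x)) \<omega>) \<le> C\<^sub>\<Phi> * (1 + (norm \<omega>)\<^sup>2) powr (- \<sigma>)"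
    and "0 \<le> \<alpha>" and "\<alpha> \<le> \<tau>" and "\<tau> \<le> \<sigma>"
    and "0 < c\<^sub>0"
  shows "\<exists>C > 0. \<forall>\<delta> X v.
           0 < \<delta> \<and> \<delta> \<le> 1 \<and>
           finite X \<and> 2 \<le> card X \<and> X \<subseteq> closure \<Omega> \<and>
           separation_distance X \<le> c\<^sub>0 * \<delta> \<and>
           v \<in> translate_span (scaled_kernel \<Phi> \<delta>) X \<longrightarrow>
             scaled_sobolev_norm_on \<Omega> \<delta> \<tau> v
               \<le> C * (\<delta> / separation_distance X) powr (\<tau> - \<alpha>) * scaled_sobolev_norm_on \<Omega> \<delta> \<alpha> v"
proof -
  have "0 \<le> 4 * \<sigma>" using assms(5) by (simp add: order_less_imp_le[OF le_less_trans[of 0 "real DIM('a) / 2"]])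
  then obtain \<rho> :: "'a \<Rightarrow> real" and C\<^sub>\<rho> where \<rho>: "continuous_on UNIV \<rho>" "\<forall>x. 0 \<le> \<rho> x" "\<forall>x. 1 \<le> norm x \<longrightarrow> \<rho> x = 0" "\<forall>x. \<rho> (- x) = \<rho> x"
     "integrable lborel \<rho>" "(LINT x|lborel. \<rho> x) = 1" "0 \<le> C\<^sub>\<rho>"
     "\<forall>\<omega>. (cmod (inverse_transform (\<lambda>x. of_real (\<rho> x)) \<omega>))\<^sup>2 \<le> C\<^sub>\<rho> * sobolev_weight 1 (- (4 * \<sigma>)) \<omega>"
    using mollifier_exists[of "4 * \<sigma>", where 'a = 'a] by blast
  from cone_cover[OF assms(1)] obtain M :: nat and e s A t where
    cover: "0 < t" "\<forall>i<M. 0 < s i \<and> A i \<in> sets borel \<and> bounded (A i)" "disjoint_family_on A {..<M}"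
      "\<forall>x\<in>closure \<Omega>. ball x t \<subseteq> (\<Union>i<M. A i)"
      "\<forall>i<M. \<forall>x\<in>closure \<Omega>. \<forall>a\<in>A i. dist x a < t \<longrightarrow>
        (\<forall>\<tau> z. 0 < \<tau> \<and> \<tau> < t \<and> norm z \<le> 1 \<longrightarrow> x + \<tau> *\<^sub>R (e i + s i *\<^sub>R z) \<in> \<Omega>)"
    by (elim exE conjE) (rule that)
  interpret bernstein_setting \<rho> \<sigma> C\<^sub>\<rho> \<Omega> M e s A t "nat \<lceil>\<sigma>\<rceil>" \<Phi> c\<^sub>\<Phi> C\<^sub>\<Phi>
  proof unfold_locales
    show "\<sigma> \<le> real (nat \<lceil>\<sigma>\<rceil>)" by linarith
    show "x + r *\<^sub>R (e i + s i *\<^sub>R z) \<in> \<Omega>"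
      if "i < M" "x \<in> closure \<Omega>" "a \<in> A i" "dist x a < t" "0 < r" "r < t" "norm z \<le> 1" for i x a r z
      using cover(5) that by blast
    show "c\<^sub>\<Phi> * sobolev_weight 1 (- \<sigma>) \<omega> \<le> Re (fourier (\<lambda>x. of_real (\<Phi> x)) \<omega>)" for \<omega> :: 'a
      using assms(9)[of \<omega>] by (simp add: sobolev_weight_def)
    show "Re (fourier (\<lambda>x. of_real (\<Phi> x)) \<omega>) \<le> C\<^sub>\<Phi> * sobolev_weight 1 (- \<sigma>) \<omega>" for \<omega> :: 'a
      using assms(10)[of \<omega>] by (simp add: sobolev_weight_def)
  qed (use assms \<rho> cover in \<open>simp_all\<close>)
  show ?thesis by (rule inverse_inequality) fact+
qed

end
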